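(* Let $$\mathcal A=\begin{pmatrix}A&B^T\\-B&0\end{pmatrix},\quad \mathcal B_U=\begin{pmatrix}A&B^T\\0&BD_A^{-1}B^T\end{pmatrix}^{-1},\quad \mathcal B_D=\begin{pmatrix}A&0\\0&BD_A^{-1}B^T\end{pmatrix}^{-1}.$$ There exist constants $\xi_1,\xi_2>0$ independent of discretization and physical parameters such that for any $\bm x'=\mathcal B_U^{-1}\bm x$ with $\bm x=(\bm w_h,p_h)\in\bm W_h\times Q_h$, $\bm x\neq\bm 0$, $$\xi_1\le\frac{(\mathcal A\mathcal B_U\bm x',\bm x')_{\mathcal B_D}}{(\bm x',\bm x')_{\mathcal B_D}}\qquad\text{and}\qquad\frac{\|\mathcal A\mathcal B_U\bm x'\|_{\mathcal B_D}}{\|\bm x'\|_{\mathcal B_D}}\le\xi_2.$$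
   Context: **Geometry.** Let $n\in\{2,3\}$. A fractured porous medium of rectangular type (fractures are line segments if $n=2$, flat surfaces if $n=3$) is decomposed by the fractures into $n$-dimensional subdomains $\Omega_i^n$, $i\in I^n$; fractures and their intersections are lower-dimensional subdomains $\Omega_i^d$, $i\in I^d$, $0\le d<n$. For $0\le d\le n-1$ and $i\in I^d$, $\Gamma_{ij}^d$ ($j\in J_i^d$) are the interfaces between $\Omega_i^d$ and the adjacent $(d+1)$-dimensional subdomains. Set $\Omega^d=\bigcup_i\Omega_i^d$, $\Gamma^d=\bigcup_i\bigcup_j\Gamma_{ij}^d$, $\Omega=\bigcup_{d=0}^n\Omega^d$, $\Gamma=\bigcup_{d=0}^{n-1}\Gamma^d$. The boundary splits disjointly as $\partial\Omega=\partial\Omega_D\cup\partial\Omega_N$ with $\partial\Omega_D$ of positive measure; $\partial\Omega_N^d$ is the part of $\partial\Omega_N$ on $\partial\Omega^d$; $\bm\nu$ is the outward unit normal. **Physical parameters.** The permeability $K$ (on $\Omega$) and normal permeability $K_{\bm\nu}$ (on $\Gamma$) are symmetric positive definite tensors bounded above and below; $\gamma>0$ on $\Gamma$ (distance from $\Gamma_{ij}^d$ to $\Omega_i^d$; the aperture for $d=n-1$). All are assumed constant on each subdomain/interface. **Spaces.** $\bm V^d=\{\bm v\in (L^2(\Omega^d))^d:\nabla\cdot\bm v\in L^2(\Omega^d),\ \bm v\cdot\bm\nu=0 \text{ on }\partial\Omega_N^d\}$ for $1\le d\le n$; $\bm V_0^d=\{\bm v\in\bm V^d:\bm v\cdot\bm\nu=0\text{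 on }\Gamma^{d-1}\}$; $\Lambda^d=L^2(\Gamma^d)$ for $0\le d\le n-1$; $Q^d=L^2(\Omega^d)$ for $0\le d\le n$. On shape-regular simplicial triangulations $\mathcal T^d_\Omega$ of $\Omega^d$ and $\mathcal T^d_\Gamma$ of $\Gamma^d$ (maximal mesh size $h$), $\bm V_h^d\subset\bm V^d$ and $\bm V_{0h}^d\subset\bm V_0^d$ are lowest-order Raviart–Thomas spaces $\mathbb{RT}_0(\mathcal T_\Omega^d)$, $\Lambda_h^d=\mathbb P_0(\mathcal T_\Gamma^d)$ and $Q_h^d=\mathbb P_0(\mathcal T_\Omega^d)$ (piecewise constants). Put $\bm V_{0h}=\bigoplus_{d=1}^n\bm V_{0h}^d$, $\Lambda_h=\bigoplus_{d=0}^{n-1}\Lambda_h^d$, $Q_h=\bigoplus_{d=0}^nQ_h^d$, $\bm W_h=\bm V_{0h}\times\Lambda_h$. **Discrete extension.** $\widehat\Pi_h^d:\Lambda_h^d\to\bm V_h^{d+1}\cdot\bm\nu|_{\Gamma^d}$ is the $L^2$-projection, $(\widehat\Pi_h^d\mu-\mu,\bm v\cdot\bm\nu)_{L^2(\Gamma^d)}=0$ for all $\bm v\in\bm V_h^{d+1}$. $R_h^d:\Lambda_h^d\to\bm V_h^{d+1}$ is defined by $R_h^d\lambda\cdot\bm\nu=\widehat\Pi_h^d\lambda$ on $\Gamma^d$ and $0$ elsewhere (all other facet normal components vanish); $R_h=\bigoplus_{d=0}^{n-1}R_h^d$. **Forms.** $(\cdot,\cdot)_\Omega$, $(\cdot,\cdot)_\Gamma$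 are the sums of the $L^2$ inner products over all subdomains, respectively interfaces, with the convention that flux components for $d=0$ and mortar components for $d=n$ are zero. The jump is $\llbracket\lambda\rrbracket|_{\Omega_i^d}=-\sum_{j\in J_i^d}\lambda_{ij}^d$, and $\bm D\cdot[\bm u,\lambda]=\nabla\cdot\bm u+\llbracket\lambda\rrbracket$. For $\bm w_h=[\bm u_{0h},\lambda_h]$, $\bm r_h=[\bm v_{0h},\mu_h]\in\bm W_h$, $q_h\in Q_h$: $$a(\bm w_h,\bm r_h)=(K^{-1}(\bm u_{0h}+R_h\lambda_h),\bm v_{0h}+R_h\mu_h)_\Omega+(\gamma K_{\bm\nu}^{-1}\lambda_h,\mu_h)_\Gamma,$$ $$b(\bm r_h,q_h)=-(q_h,\bm D\cdot[\bm v_{0h}+R_h\mu_h,\mu_h])_\Omega,$$ $$a^D(\bm w_h,\bm r_h)=(K^{-1}(\bm u_{0h}+R_h\lambda_h),\bm v_{0h}+R_h\mu_h)_{D,\Omega}+(\gamma K_{\bm\nu}^{-1}\lambda_h,\mu_h)_\Gamma,$$ where $$(K^{-1}\bm u,\bm v)_{D,\Omega}=\sum_{d=0}^n\sum_{T\in\mathcal T_\Omega^d}\sum_{f\in\partial T}(\bm u\cdot\bm\nu_f)(\bm v\cdot\bm\nu_f)(K^{-1}\bm\phi_f,\bm\phi_f)_T.$$ Here $f$ runs over the faces of the element $T$, $\bm\nu_f$ is the unit outer normal of $f$, and $\bm\phi_f\in\mathbb{RT}_0(T)$ is the basis function of face $f$ (so $\bm v|_T=\sum_f(\bm v\cdot\bm\nu_f)\bm\phi_f$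 for $\bm v\in\mathbb{RT}_0(T)$). **Operators.** With primes for dual spaces and $\langle\cdot,\cdot\rangle$ for duality pairings: $A:\bm W_h\to\bm W_h'$, $\langle A\bm w_h,\bm r_h\rangle=a(\bm w_h,\bm r_h)$; $D_A:\bm W_h\to\bm W_h'$, $\langle D_A\bm w_h,\bm r_h\rangle=a^D(\bm w_h,\bm r_h)$; $B:\bm W_h\to Q_h'$, $\langle B\bm r_h,q_h\rangle=b(\bm r_h,q_h)$, with transpose $B^T:Q_h\to\bm W_h'$. For a symmetric positive definite $\mathcal M:(\bm W_h\times Q_h)'\to\bm W_h\times Q_h$, the inner product on the dual space is $(\bm x',\bm y')_{\mathcal M}=\langle\bm x',\mathcal M\bm y'\rangle$ and $\|\bm x'\|_{\mathcal M}^2=(\bm x',\bm x')_{\mathcal M}$. **Convention.** "Independent of discretization and physical parameters" means independent of $h$, $K$, $K_{\bm\nu}$, $\gamma$; dependence on the shape regularity of the mesh is allowed.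
   Formalization: The constants may depend on a bound for the ratio of the upper to the lower bound of K within each subdomain (its anisotropy), but not on the size or jumps of K, nor on K_ν, γ or h; full independence of the anisotropy of K is false. *)

theory Defs
  imports "HOL-Analysis.Analysis"
begin

section \<open>Flat pieces of a Euclidean space\<close>

definition tangent :: "'a::euclidean_space set \<Rightarrow> 'a set" where
  "tangent S = span {x - y |x y. x \<in> S \<and> y \<in> S}"

definition onb :: "'a::euclidean_space set \<Rightarrow> 'a set" where
  "onb U = (SOME B. pairwise orthogonal B \<and> (\<forall>b\<in>B. norm b = 1) \<and> span B = U)"

text \<open>The \<open>d\<close>-dimensional Lebesgue measure on the affine hull of \<open>S\<close>, where \<open>d\<close> is the affine
  dimension of \<open>S\<close>: the image of the Lebesgue measure on coordinates with respect to an orthonormal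
  basis of the tangent space (the choice of basis and base point is immaterial).
  For \<open>d = 0\<close> it is the unit point mass.\<close>

definition flat_measure :: "'a::euclidean_space set \<Rightarrow> 'a measure" where
  "flat_measure S = completion (distr (\<Pi>\<^sub>M b\<in>onb (tangent S). lborel) borel
     (\<lambda>t. (SOME p. p \<in> S) + (\<Sum>b\<in>onb (tangent S). t b *\<^sub>R b)))"

text \<open>Unit normal of the facet \<open>F\<close> of \<open>T\<close> that is tangent to \<open>T\<close> and points out of \<open>T\<close>.\<close>

definition outer_normal :: "'a::euclidean_space set \<Rightarrow> 'a set \<Rightarrow> 'a" where
  "outer_normal T F =
     (THE \<nu>. norm \<nu> = 1 \<and> \<nu> \<in> tangent T \<and> (\<forall>x\<in>F. \<forall>y\<in>T. \<nu> \<bullet> (y - x) \<le> 0))"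

text \<open>One-sided normal trace \<open>v \<bullet> \<nu>\<close> at \<open>x\<close>, taken from the side that \<open>\<nu>\<close> points away from.\<close>

definition ntrace :: "('a::euclidean_space \<Rightarrow> 'a) \<Rightarrow> 'a \<Rightarrow> 'a \<Rightarrow> real" where
  "ntrace v \<nu> x = (Lim (at_right 0) (\<lambda>t. v (x - t *\<^sub>R \<nu>))) \<bullet> \<nu>"

text \<open>Divergence along the flat piece \<open>P\<close>; it is \<open>0\<close> if \<open>P\<close> is a point.\<close>

definition divergence :: "'a::euclidean_space set \<Rightarrow> ('a \<Rightarrow> 'a) \<Rightarrow> 'a \<Rightarrow> real" where
  "divergence P v x =
     (\<Sum>e\<in>onb (tangent P). vector_derivative (\<lambda>t. v (x + t *\<^sub>R e)) (at 0) \<bullet> e)"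

section \<open>The fractured medium\<close>

text \<open>\<open>subdomains\<close> collects the \<open>\<Omega>\<^sub>i\<^sup>d\<close> of all dimensions: \<open>\<Omega>\<^sub>i\<^sup>d\<close> is a subdomain with affine dimension
  \<open>d\<close>, so sums over \<open>d\<close> and \<open>i\<close> become sums over \<open>subdomains\<close>.\<close>

record 'a medium =
  subdomains :: "'a set set"
  bdryD :: "'a set"
  bdryN :: "'a set"

text \<open>The interface \<open>\<Gamma>\<^sub>i\<^sub>j\<^sup>d\<close> coincides, as a set, with the lower-dimensional subdomain \<open>low = \<Omega>\<^sub>i\<^sup>d\<close>. The unit
  normal \<open>normal\<close> points out of the adjacent \<open>(d+1)\<close>-dimensional subdomain \<open>high\<close>. It is part of the
  interface because \<open>high\<close> may lie on both sides of \<open>low\<close>, which then gives two interfaces.\<close>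

datatype 'a iface = Iface (low: "'a set") (high: "'a set") (normal: 'a)

definition ifaces :: "'a::euclidean_space medium \<Rightarrow> 'a iface set" where
  "ifaces G = {Iface S P \<nu> |S P \<nu>. S \<in> subdomains G \<and> P \<in> subdomains G \<and>
     aff_dim P = aff_dim S + 1 \<and> norm \<nu> = 1 \<and> (\<forall>s\<in>tangent S. \<nu> \<bullet> s = 0) \<and>
     (\<forall>x\<in>S. \<forall>\<^sub>F t in at_right 0. x - t *\<^sub>R \<nu> \<in> P)}"

definition linked :: "'a::euclidean_space medium \<Rightarrow> 'a set \<Rightarrow> 'a set \<Rightarrow> bool" where
  "linked G P Q \<longleftrightarrow> (\<exists>i\<in>ifaces G. (P = low i \<and> Q = high i) \<or> (P = high i \<and> Q = low i))"

text \<open>The subdomains are flat because each is relatively open in its affine hull.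
  Connectedness of the medium means that any two subdomains communicate
  through interfaces. Immersed tips of fractures, if there are any, belong to no subdomain and hence
  to the boundary. The boundary lies in finitely many hyperplanes once the subdomains are
  triangulated, so that its Dirichlet part has positive surface measure iff some hyperplane section
  of that part has.\<close>

definition fractured_medium :: "'a::euclidean_space medium \<Rightarrow> bool" where
  "fractured_medium G \<longleftrightarrow>
     finite (subdomains G) \<and>
     (\<forall>P\<in>subdomains G. P \<noteq> {} \<and> connected P \<and> bounded P \<and>
        openin (top_of_set (affine hull P)) P) \<and>
     pairwise disjnt (subdomains G) \<and>
     open (\<Union>(subdomains G)) \<and>
     (\<forall>P\<in>subdomains G. \<forall>Q\<in>subdomains G. (linked G)\<^sup>*\<^sup>* P Q) \<and>
     bdryD G \<union> bdryN G = frontier (\<Union>(subdomains G)) \<and> bdryD G \<inter> bdryN G = {} \<and>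
     (\<exists>H. affine H \<and> aff_dim H = int DIM('a) - 1 \<and> emeasure (flat_measure H) (bdryD G \<inter> H) > 0)"

section \<open>Physical parameters\<close>

text \<open>\<open>perm k P\<close> is the tangential permeability tensor of the subdomain \<open>P\<close>; the normal permeability
  acts on the one-dimensional normal direction of an interface and is therefore a scalar.\<close>

record 'a params =
  perm :: "'a set \<Rightarrow> 'a \<Rightarrow> 'a"
  nperm :: "'a iface \<Rightarrow> real"
  gap :: "'a iface \<Rightarrow> real"

text \<open>\<open>\<kappa>\<close> is the quotient of the upper and lower bounds of the permeability within a subdomain. The
  size of the permeability and its contrast between subdomains are unrestricted. Some uniform bound of
  this kind is needed: the lumped form \<open>ip_KD\<close> below is not equivalent to \<open>ip_K\<close> uniformly in the
  anisotropy of the permeability.\<close>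

definition admissible_params :: "'a::euclidean_space medium \<Rightarrow> real \<Rightarrow> 'a params \<Rightarrow> bool" where
  "admissible_params G \<kappa> k \<longleftrightarrow>
     (\<forall>P\<in>subdomains G. linear (perm k P) \<and> perm k P ` tangent P \<subseteq> tangent P \<and>
        (\<forall>x\<in>tangent P. \<forall>y\<in>tangent P. perm k P x \<bullet> y = x \<bullet> perm k P y) \<and>
        (\<exists>m>0. \<forall>x\<in>tangent P. m * (x \<bullet> x) \<le> perm k P x \<bullet> x \<and>
                               perm k P x \<bullet> x \<le> \<kappa> * m * (x \<bullet> x))) \<and>
     (\<forall>i\<in>ifaces G. nperm k i > 0 \<and> gap k i > 0)"

definition perm_inv :: "'a::euclidean_space params \<Rightarrow> 'a set \<Rightarrow> 'a \<Rightarrow> 'a" where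
  "perm_inv k P = inv_into (tangent P) (perm k P)"

section \<open>Meshes\<close>

definition triangulates :: "'a::euclidean_space set set \<Rightarrow> 'a set \<Rightarrow> bool" where
  "triangulates \<T> P \<longleftrightarrow> triangulation \<T> \<and> (\<forall>T\<in>\<T>. aff_dim P simplex T \<and> rel_interior T \<subseteq> P) \<and>
     \<Union>\<T> = closure P"

definition shape_regular :: "real \<Rightarrow> 'a::euclidean_space set set \<Rightarrow> bool" where
  "shape_regular \<sigma> \<T> \<longleftrightarrow>
     (\<forall>T\<in>\<T>. \<exists>c\<in>T. \<exists>r>0. cball c r \<inter> affine hull T \<subseteq> T \<and> diameter T \<le> \<sigma> * r)"

text \<open>The meshes of the subdomains and of the interfaces are unrelated: they need not match.\<close>

record 'a mesh =
  elems :: "'a set \<Rightarrow> 'a set set"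
  melems :: "'a iface \<Rightarrow> 'a set set"

definition ifacets :: "'a::euclidean_space mesh \<Rightarrow> 'a iface \<Rightarrow> ('a set \<times> 'a set) set" where
  "ifacets M i = {(T, F). T \<in> elems M (high i) \<and> F facet_of T \<and> rel_interior F \<subseteq> low i \<and>
     outer_normal T F = normal i}"

text \<open>The last condition on the facets says that the mesh resolves the interfaces and the
  partition of the boundary.\<close>

definition admissible_mesh :: "'a::euclidean_space medium \<Rightarrow> real \<Rightarrow> 'a mesh \<Rightarrow> bool" where
  "admissible_mesh G \<sigma> M \<longleftrightarrow>
     (\<forall>P\<in>subdomains G. triangulates (elems M P) P \<and> shape_regular \<sigma> (elems M P) \<and>
        (\<forall>T\<in>elems M P. \<forall>F. F facet_of T \<longrightarrow>
           rel_interior F \<subseteq> P \<or> (\<exists>i\<in>ifaces G. (T, F) \<in> ifacets M i) \<or>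
           rel_interior F \<subseteq> bdryD G \<or> rel_interior F \<subseteq> bdryN G)) \<and>
     (\<forall>i\<in>ifaces G. triangulates (melems M i) (low i) \<and> shape_regular \<sigma> (melems M i))"

section \<open>Discrete spaces\<close>

text \<open>Elements of the discrete spaces are piecewise polynomial functions, represented canonically:
  they vanish outside the relative interiors of the mesh elements. As the subdomains are disjoint,
  a tuple with one component for each \<open>\<Omega>\<^sup>d\<close> is one function on \<open>\<Omega>\<close>.\<close>

definition P0 :: "'a::euclidean_space set set \<Rightarrow> ('a \<Rightarrow> real) set" where
  "P0 \<T> = {q. (\<forall>T\<in>\<T>. \<exists>c. \<forall>x\<in>rel_interior T. q x = c) \<and>
              (\<forall>x. x \<notin> (\<Union>T\<in>\<T>. rel_interior T) \<longrightarrow> q x = 0)}"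

definition RT0 :: "'a::euclidean_space set \<Rightarrow> ('a \<Rightarrow> 'a) set" where
  "RT0 T = {\<lambda>x. a + c *\<^sub>R (x - b) |a b c. a \<in> tangent T \<and> b \<in> T}"

definition all_elems :: "'a::euclidean_space medium \<Rightarrow> 'a mesh \<Rightarrow> 'a set set" where
  "all_elems G M = (\<Union>P\<in>subdomains G. elems M P)"

text \<open>A piecewise Raviart--Thomas field has a square integrable divergence on a subdomain iff its
  normal component is continuous across the facets inside the subdomain. On a point subdomain
  membership in \<open>RT0\<close> forces the value \<open>0\<close>.\<close>

definition V_h :: "'a::euclidean_space medium \<Rightarrow> 'a mesh \<Rightarrow> ('a \<Rightarrow> 'a) set" where
  "V_h G M = {v.
     (\<forall>P\<in>subdomains G. \<forall>T\<in>elems M P.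
        (\<exists>p\<in>RT0 T. \<forall>x\<in>rel_interior T. v x = p x) \<and>
        (\<forall>F. F facet_of T \<longrightarrow>
           (rel_interior F \<subseteq> P \<longrightarrow> (\<forall>x\<in>rel_interior F.
              ntrace v (outer_normal T F) x + ntrace v (- outer_normal T F) x = 0)) \<and>
           (rel_interior F \<subseteq> bdryN G \<longrightarrow> (\<forall>x\<in>rel_interior F.
              ntrace v (outer_normal T F) x = 0)))) \<and>
     (\<forall>x. x \<notin> (\<Union>T\<in>all_elems G M. rel_interior T) \<longrightarrow> v x = 0)}"

definition V0_h :: "'a::euclidean_space medium \<Rightarrow> 'a mesh \<Rightarrow> ('a \<Rightarrow> 'a) set" where
  "V0_h G M = {v \<in> V_h G M. \<forall>i\<in>ifaces G. \<forall>(T, F)\<in>ifacets M i. \<forall>x\<in>rel_interior F.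
     ntrace v (normal i) x = 0}"

definition Lambda_h ::
  "'a::euclidean_space medium \<Rightarrow> 'a mesh \<Rightarrow> ('a iface \<Rightarrow> 'a \<Rightarrow> real) set" where
  "Lambda_h G M = {l. (\<forall>i\<in>ifaces G. l i \<in> P0 (melems M i)) \<and> (\<forall>i. i \<notin> ifaces G \<longrightarrow> l i = (\<lambda>x. 0))}"

definition Q_h :: "'a::euclidean_space medium \<Rightarrow> 'a mesh \<Rightarrow> ('a \<Rightarrow> real) set" where
  "Q_h G M = P0 (all_elems G M)"

type_synonym 'a wvec = "('a \<Rightarrow> 'a) \<times> ('a iface \<Rightarrow> 'a \<Rightarrow> real)"
type_synonym 'a qvec = "'a \<Rightarrow> real"

definition W_h :: "'a::euclidean_space medium \<Rightarrow> 'a mesh \<Rightarrow> 'a wvec set" where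
  "W_h G M = V0_h G M \<times> Lambda_h G M"

section \<open>Discrete extension\<close>

definition ip_Gamma :: "'a::euclidean_space medium \<Rightarrow>
    ('a iface \<Rightarrow> 'a \<Rightarrow> real) \<Rightarrow> ('a iface \<Rightarrow> 'a \<Rightarrow> real) \<Rightarrow> real" where
  "ip_Gamma G f g = (\<Sum>i\<in>ifaces G. LINT x:low i|flat_measure (low i). f i x * g i x)"

text \<open>The normal trace on the interfaces, again in canonical representation.\<close>

definition itrace :: "'a::euclidean_space medium \<Rightarrow> 'a mesh \<Rightarrow> ('a \<Rightarrow> 'a) \<Rightarrow>
    'a iface \<Rightarrow> 'a \<Rightarrow> real" where
  "itrace G M v i x = (if i \<in> ifaces G \<and> x \<in> (\<Union>(T, F)\<in>ifacets M i. rel_interior F)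
                       then ntrace v (normal i) x else 0)"

definition Pi_hat :: "'a::euclidean_space medium \<Rightarrow> 'a mesh \<Rightarrow>
    ('a iface \<Rightarrow> 'a \<Rightarrow> real) \<Rightarrow> 'a iface \<Rightarrow> 'a \<Rightarrow> real" where
  "Pi_hat G M l = (THE g. g \<in> itrace G M ` V_h G M \<and>
     (\<forall>v\<in>V_h G M. ip_Gamma G (\<lambda>i x. g i x - l i x) (itrace G M v) = 0))"

definition R_h :: "'a::euclidean_space medium \<Rightarrow> 'a mesh \<Rightarrow>
    ('a iface \<Rightarrow> 'a \<Rightarrow> real) \<Rightarrow> 'a \<Rightarrow> 'a" where
  "R_h G M l = (THE v. v \<in> V_h G M \<and> itrace G M v = Pi_hat G M l \<and>
     (\<forall>T\<in>all_elems G M. \<forall>F. F facet_of T \<and> (\<forall>i\<in>ifaces G. (T, F) \<notin> ifacets M i) \<longrightarrow>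
        (\<forall>x\<in>rel_interior F. ntrace v (outer_normal T F) x = 0)))"

text \<open>The flux \<open>v\<^sub>0 + R\<^sub>h \<mu>\<close> of a pair in \<open>W_h\<close>.\<close>

definition flux :: "'a::euclidean_space medium \<Rightarrow> 'a mesh \<Rightarrow> 'a wvec \<Rightarrow> 'a \<Rightarrow> 'a" where
  "flux G M w = (\<lambda>x. fst w x + R_h G M (snd w) x)"

section \<open>Bilinear forms\<close>

definition ip_K :: "'a::euclidean_space medium \<Rightarrow> 'a params \<Rightarrow>
    ('a \<Rightarrow> 'a) \<Rightarrow> ('a \<Rightarrow> 'a) \<Rightarrow> real" where
  "ip_K G k u v =
     (\<Sum>P\<in>subdomains G. LINT x:P|flat_measure P. perm_inv k P (u x) \<bullet> v x)"

text \<open>The basis function of the facet \<open>F\<close> in \<open>RT0 T\<close>.\<close>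

definition rt_basis :: "'a::euclidean_space set \<Rightarrow> 'a set \<Rightarrow> 'a \<Rightarrow> 'a" where
  "rt_basis T F = (THE p. p \<in> RT0 T \<and>
     (\<forall>F'. F' facet_of T \<longrightarrow> (\<forall>x\<in>F'. p x \<bullet> outer_normal T F' = (if F' = F then 1 else 0))))"

text \<open>The constant value of \<open>v \<bullet> \<nu>\<^sub>F\<close> on the facet \<open>F\<close>, for \<open>v\<close> in \<open>RT0 T\<close> on \<open>T\<close>.\<close>

definition facet_flux :: "('a::euclidean_space \<Rightarrow> 'a) \<Rightarrow> 'a set \<Rightarrow> 'a set \<Rightarrow> real" where
  "facet_flux v T F = (THE s. \<forall>x\<in>rel_interior F. ntrace v (outer_normal T F) x = s)"

definition ip_KD :: "'a::euclidean_space medium \<Rightarrow> 'a mesh \<Rightarrow> 'a params \<Rightarrow>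
    ('a \<Rightarrow> 'a) \<Rightarrow> ('a \<Rightarrow> 'a) \<Rightarrow> real" where
  "ip_KD G M k u v = (\<Sum>P\<in>subdomains G. \<Sum>T\<in>elems M P. \<Sum>F\<in>{F. F facet_of T}.
     facet_flux u T F * facet_flux v T F *
     (LINT x:T|flat_measure T. perm_inv k P (rt_basis T F x) \<bullet> rt_basis T F x))"

definition a_form :: "'a::euclidean_space medium \<Rightarrow> 'a mesh \<Rightarrow> 'a params \<Rightarrow>
    'a wvec \<Rightarrow> 'a wvec \<Rightarrow> real" where
  "a_form G M k w r = ip_K G k (flux G M w) (flux G M r) +
     ip_Gamma G (\<lambda>i x. gap k i * inverse (nperm k i) * snd w i x) (snd r)"

definition aD_form :: "'a::euclidean_space medium \<Rightarrow> 'a mesh \<Rightarrow> 'a params \<Rightarrow>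
    'a wvec \<Rightarrow> 'a wvec \<Rightarrow> real" where
  "aD_form G M k w r = ip_KD G M k (flux G M w) (flux G M r) +
     ip_Gamma G (\<lambda>i x. gap k i * inverse (nperm k i) * snd w i x) (snd r)"

definition jump :: "'a::euclidean_space medium \<Rightarrow> ('a iface \<Rightarrow> 'a \<Rightarrow> real) \<Rightarrow>
    'a set \<Rightarrow> 'a \<Rightarrow> real" where
  "jump G l P x = - (\<Sum>i\<in>{i \<in> ifaces G. low i = P}. l i x)"

definition b_form :: "'a::euclidean_space medium \<Rightarrow> 'a mesh \<Rightarrow> 'a wvec \<Rightarrow> 'a qvec \<Rightarrow> real" where
  "b_form G M r q = - (\<Sum>P\<in>subdomains G. LINT x:P|flat_measure P.
     q x * (divergence P (flux G M r) x + jump G (snd r) P x))"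

section \<open>Operators\<close>

text \<open>A functional on \<open>W_h\<close> or \<open>Q_h\<close> is represented by its extensional function, so that
  equality of functionals is equality of functions. The dual of the product of \<open>W_h\<close> and \<open>Q_h\<close> is the product of
  the duals.\<close>

type_synonym 'a wdual = "'a wvec \<Rightarrow> real"
type_synonym 'a qdual = "'a qvec \<Rightarrow> real"

definition A_op :: "'a::euclidean_space medium \<Rightarrow> 'a mesh \<Rightarrow> 'a params \<Rightarrow> 'a wvec \<Rightarrow> 'a wdual" where
  "A_op G M k w = (\<lambda>r\<in>W_h G M. a_form G M k w r)"

definition DA_op :: "'a::euclidean_space medium \<Rightarrow> 'a mesh \<Rightarrow> 'a params \<Rightarrow> 'a wvec \<Rightarrow> 'a wdual" where
  "DA_op G M k w = (\<lambda>r\<in>W_h G M. aD_form G M k w r)"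

definition B_op :: "'a::euclidean_space medium \<Rightarrow> 'a mesh \<Rightarrow> 'a wvec \<Rightarrow> 'a qdual" where
  "B_op G M r = (\<lambda>q\<in>Q_h G M. b_form G M r q)"

definition BT_op :: "'a::euclidean_space medium \<Rightarrow> 'a mesh \<Rightarrow> 'a qvec \<Rightarrow> 'a wdual" where
  "BT_op G M q = (\<lambda>r\<in>W_h G M. b_form G M r q)"

definition S_op :: "'a::euclidean_space medium \<Rightarrow> 'a mesh \<Rightarrow> 'a params \<Rightarrow> 'a qvec \<Rightarrow> 'a qdual" where
  "S_op G M k q = B_op G M (inv_into (W_h G M) (DA_op G M k) (BT_op G M q))"

definition X_h :: "'a::euclidean_space medium \<Rightarrow> 'a mesh \<Rightarrow> ('a wvec \<times> 'a qvec) set" where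
  "X_h G M = W_h G M \<times> Q_h G M"

definition zero_X :: "'a::euclidean_space wvec \<times> 'a qvec" where
  "zero_X = ((\<lambda>x. 0, \<lambda>i x. 0), \<lambda>x. 0)"

definition A_block :: "'a::euclidean_space medium \<Rightarrow> 'a mesh \<Rightarrow> 'a params \<Rightarrow>
    'a wvec \<times> 'a qvec \<Rightarrow> 'a wdual \<times> 'a qdual" where
  "A_block G M k x = (case x of (w, p) \<Rightarrow>
     (\<lambda>r\<in>W_h G M. A_op G M k w r + BT_op G M p r, \<lambda>q\<in>Q_h G M. - B_op G M w q))"

definition U_block :: "'a::euclidean_space medium \<Rightarrow> 'a mesh \<Rightarrow> 'a params \<Rightarrow>
    'a wvec \<times> 'a qvec \<Rightarrow> 'a wdual \<times> 'a qdual" where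
  "U_block G M k x = (case x of (w, p) \<Rightarrow>
     (\<lambda>r\<in>W_h G M. A_op G M k w r + BT_op G M p r, S_op G M k p))"

definition D_block :: "'a::euclidean_space medium \<Rightarrow> 'a mesh \<Rightarrow> 'a params \<Rightarrow>
    'a wvec \<times> 'a qvec \<Rightarrow> 'a wdual \<times> 'a qdual" where
  "D_block G M k x = (case x of (w, p) \<Rightarrow> (A_op G M k w, S_op G M k p))"

definition B_U :: "'a::euclidean_space medium \<Rightarrow> 'a mesh \<Rightarrow> 'a params \<Rightarrow>
    'a wdual \<times> 'a qdual \<Rightarrow> 'a wvec \<times> 'a qvec" where
  "B_U G M k = inv_into (X_h G M) (U_block G M k)"

definition B_D :: "'a::euclidean_space medium \<Rightarrow> 'a mesh \<Rightarrow> 'a params \<Rightarrow>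
    'a wdual \<times> 'a qdual \<Rightarrow> 'a wvec \<times> 'a qvec" where
  "B_D G M k = inv_into (X_h G M) (D_block G M k)"

definition pairing :: "'a::euclidean_space wdual \<times> 'a qdual \<Rightarrow> 'a wvec \<times> 'a qvec \<Rightarrow> real" where
  "pairing x' x = fst x' (fst x) + snd x' (snd x)"

definition dual_ip :: "('a::euclidean_space wdual \<times> 'a qdual \<Rightarrow> 'a wvec \<times> 'a qvec) \<Rightarrow>
    'a wdual \<times> 'a qdual \<Rightarrow> 'a wdual \<times> 'a qdual \<Rightarrow> real" where
  "dual_ip \<M> x' y' = pairing x' (\<M> y')"

definition dual_norm :: "('a::euclidean_space wdual \<times> 'a qdual \<Rightarrow> 'a wvec \<times> 'a qvec) \<Rightarrow>
    'a wdual \<times> 'a qdual \<Rightarrow> real" where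
  "dual_norm \<M> x' = sqrt (dual_ip \<M> x' x')"

end

theory Submission
  imports Defs "HOL-Library.Function_Algebras"
begin

text \<open>
The bounds rest on three facts about the finite dimensional spaces: \<open>a\<close> and \<open>a\<^sup>D\<close> are inner products on
\<open>W_h\<close> that bound each other with constants depending on the dimension, the shape regularity and \<open>\<kappa>\<close> only
(\<open>a_form_le\<close>, \<open>aD_form_le\<close>); \<open>b\<close> is bilinear; and \<open>B\<^sup>T\<close> is injective (\<open>kernel_trivial\<close>). The rest is algebra in
inner product spaces (\<open>field_of_values_bounds\<close>). Given \<open>x = (w, p)\<close>, let \<open>t = A\<^sup>-\<^sup>1 B\<^sup>T p\<close>, \<open>g = w + t\<close> and
\<open>S = B D\<^sub>A\<^sup>-\<^sup>1 B\<^sup>T\<close>. Then the numerator of the first quotient is \<open>a(g, g) - a(g, t) + a(t, t)\<close>, at least half of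
\<open>a(g, g) + a(t, t)\<close>, and the denominator is \<open>a(g, g) + \<langle>S p, p\<rangle>\<close>. As \<open>a(t, t)\<close> and \<open>\<langle>S p, p\<rangle>\<close> are the squared
norms of the functional \<open>B\<^sup>T p\<close> dual to \<open>a\<close> and to \<open>a\<^sup>D\<close>, they are equivalent. The norm bound is similar. The pressure
is measured in the norm of \<open>S\<close> itself, so the constants see \<open>b\<close> only through the spectral equivalence.

The equivalence of the two flux forms is local. On a cell \<open>T\<close> a field is \<open>v = \<Sum>\<^sub>f (v \<bullet> \<nu>\<^sub>f) \<phi>\<^sub>f\<close>, so \<open>a\<close> is bounded by
\<open>a\<^sup>D\<close> up to the number of facets (\<open>elem_upper\<close>). Conversely (\<open>elem_lower\<close>), shape regularity bounds \<open>\<phi>\<^sub>f\<close>, and an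
inverse estimate bounds \<open>|T| |v(x\<^sub>0)|\<^sup>2\<close> by the integral of \<open>|v|\<^sup>2\<close>: since \<open>v\<close> is affine,
\<open>v(x\<^sub>0) = 2 v((x\<^sub>0 + x)/2) - v(x)\<close>, and the homothety \<open>x \<mapsto> (x\<^sub>0 + x)/2\<close> changes integrals by a power of two.

The discrete extension is explicit: the flux of \<open>R_h \<lambda>\<close> through a facet on an interface is the mean of \<open>\<lambda>\<close> over that
facet (\<open>R_h_trace_lift\<close>). With positive weights depending on the cells and facets, \<open>b(r, q)\<close> becomes a sum over the fluxes
of \<open>r\<close> and the values of \<open>q\<close> on the cells, plus a mortar term (\<open>b_form_eq\<close>). Suppose that \<open>b(r, p) = 0\<close> for all \<open>r\<close>.
Testing with the two basis fields of a facet inside a subdomain shows that \<open>p\<close> has the same sign on both sides;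
testing with the mortar function 1 on an interface shows that its signs on the adjacent subdomains agree; and testing with
the basis field of a Dirichlet facet shows that \<open>p\<close> vanishes somewhere. As everything is connected, \<open>p = 0\<close>.

The geometric input is that the cells of a subdomain are connected through facets (\<open>mesh_connected\<close>), that every
interface carries a facet of the adjacent mesh (\<open>iface_has_facet\<close>), and that so does the Dirichlet boundary
(\<open>Dirichlet_facet\<close>). All three hold because a generic point, or a generic segment, avoids finitely many flats of too small
dimension, which are null sets of the flat measure (\<open>generic_point_pos\<close>).
\<close>

section \<open>Linear algebra on subspaces with finitely many separating functionals\<close>

instantiation "fun" :: (type, real_vector) real_vector
begin

definition scaleR_fun :: "real \<Rightarrow> ('a \<Rightarrow> 'b) \<Rightarrow> 'a \<Rightarrow> 'b" where
  "scaleR_fun c f = (\<lambda>x. c *\<^sub>R f x)"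

instance
  by standard (simp_all add: scaleR_fun_def fun_eq_iff scaleR_add_right scaleR_add_left)

end

lemma scaleR_fun_apply [simp]: "(c *\<^sub>R f) x = c *\<^sub>R f x"
  by (simp add: scaleR_fun_def)

definition lin_on :: "'v::real_vector set \<Rightarrow> ('v \<Rightarrow> real) \<Rightarrow> bool" where
  "lin_on V f \<longleftrightarrow> (\<forall>x\<in>V. \<forall>y\<in>V. f (x + y) = f x + f y) \<and> (\<forall>x\<in>V. \<forall>c. f (c *\<^sub>R x) = c * f x)"

lemma lin_on_add: "lin_on V f \<Longrightarrow> x \<in> V \<Longrightarrow> y \<in> V \<Longrightarrow> f (x + y) = f x + f y"
  and lin_on_scale: "lin_on V f \<Longrightarrow> x \<in> V \<Longrightarrow> f (c *\<^sub>R x) = c * f x"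
  by (auto simp: lin_on_def)

lemma lin_on_subset: "lin_on V f \<Longrightarrow> U \<subseteq> V \<Longrightarrow> lin_on U f"
  unfolding lin_on_def by blast

lemma lin_on_diff:
  assumes "lin_on V f" "subspace V" "x \<in> V" "y \<in> V"
  shows "f (x - y) = f x - f y"
proof -
  have "f (x + (-1) *\<^sub>R y) = f x + (-1) * f y"
    using assms lin_on_add lin_on_scale subspace_scale by metis
  then show ?thesis by simp
qed

lemma lin_on_zero: "lin_on V f \<Longrightarrow> subspace V \<Longrightarrow> f 0 = 0"
  using lin_on_scale[of V f 0 0] subspace_0 by auto

definition spd_on :: "'v::real_vector set \<Rightarrow> ('v \<Rightarrow> 'v \<Rightarrow> real) \<Rightarrow> bool" where
  "spd_on V a \<longleftrightarrow> (\<forall>w\<in>V. lin_on V (a w)) \<and> (\<forall>w\<in>V. \<forall>r\<in>V. a w r = a r w) \<and>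
     (\<forall>w\<in>V. w \<noteq> 0 \<longrightarrow> a w w > 0)"

lemma spd_lin: "spd_on V a \<Longrightarrow> w \<in> V \<Longrightarrow> lin_on V (a w)"
  and spd_sym: "spd_on V a \<Longrightarrow> w \<in> V \<Longrightarrow> r \<in> V \<Longrightarrow> a w r = a r w"
  and spd_pos: "spd_on V a \<Longrightarrow> w \<in> V \<Longrightarrow> w \<noteq> 0 \<Longrightarrow> a w w > 0"
  unfolding spd_on_def by (meson | simp)+

lemma spd_nonneg: "subspace V \<Longrightarrow> spd_on V a \<Longrightarrow> w \<in> V \<Longrightarrow> 0 \<le> a w w"
  using spd_pos[of V a w] lin_on_zero[OF spd_lin[of V a w]] by (cases "w = 0") auto

definition finitely_separated :: "'v::real_vector set \<Rightarrow> bool" where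
  "finitely_separated V \<longleftrightarrow> (\<exists>\<Phi>. finite \<Phi> \<and> (\<forall>\<phi>\<in>\<Phi>. lin_on V \<phi>) \<and>
     (\<forall>v\<in>V. (\<forall>\<phi>\<in>\<Phi>. \<phi> v = 0) \<longrightarrow> v = 0))"

lemma spd_on_subset: "spd_on V a \<Longrightarrow> U \<subseteq> V \<Longrightarrow> spd_on U a"
  using lin_on_subset[of V _ U] unfolding spd_on_def subset_iff by meson

text \<open>Induction on the separating functionals: the representer on the kernel of one of them is corrected by a
  multiple of a vector \<open>e'\<close> that is orthogonal to this kernel.\<close>

lemma riesz_aux:
  assumes "finite \<Phi>"
  shows "\<lbrakk>subspace V; \<forall>\<phi>\<in>\<Phi>. lin_on V \<phi>; \<forall>v\<in>V. (\<forall>\<phi>\<in>\<Phi>. \<phi> v = 0) \<longrightarrow> v = 0; spd_on V a; lin_on V l\<rbrakk>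
    \<Longrightarrow> \<exists>w\<in>V. \<forall>r\<in>V. a w r = l r"
  using assms
proof (induction \<Phi> arbitrary: V l rule: finite_induct)
  case empty
  then have "V = {0}" using subspace_0 by auto
  then show ?case 
    using lin_on_zero[OF spd_lin[OF empty.prems(4)] empty.prems(1)] lin_on_zero[OF empty.prems(5,1)]
    by auto
next
  case (insert \<phi> \<Phi>)
  define V0 where "V0 = {v \<in> V. \<phi> v = 0}"
  have lphi: "lin_on V \<phi>" using insert.prems by auto
  have sub0: "subspace V0"
    unfolding V0_def subspace_def
    using insert.prems(1) lphi lin_on_zero[OF lphi] lin_on_add[OF lphi] lin_on_scale[OF lphi]
    by (auto simp: subspace_0 subspace_add subspace_scale)
  have V0V: "V0 \<subseteq> V" by (auto simp: V0_def)
  have sep0: "\<forall>v\<in>V0. (\<forall>\<phi>\<in>\<Phi>. \<phi> v = 0) \<longrightarrow> v = 0" using insert.prems(3) by (auto simp: V0_def)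
  have IH: "\<exists>w\<in>V0. \<forall>r\<in>V0. a w r = l' r" if "lin_on V0 l'" for l'
    using insert.IH[OF sub0 _ sep0 spd_on_subset[OF insert.prems(4) V0V] that] insert.prems(2)
      lin_on_subset[OF _ V0V] by blast
  have la: "lin_on V (a w)" if "w \<in> V" for w using spd_lin[OF insert.prems(4) that] .
  have sym: "a w r = a r w" if "w \<in> V" "r \<in> V" for w r
    using spd_sym[OF insert.prems(4) that] .
  obtain w0 where w0: "w0 \<in> V0" "\<forall>r\<in>V0. a w0 r = l r"
    using IH[OF lin_on_subset[OF insert.prems(5) V0V]] by blast
  show ?case
  proof (cases "\<forall>v\<in>V. \<phi> v = 0")
    case True
    then have "V = V0" by (auto simp: V0_def)
    with w0 show ?thesis by auto
  next
    case False
    then obtain e where e: "e \<in> V" "\<phi> e \<noteq> 0" by auto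
    obtain \<pi> where \<pi>: "\<pi> \<in> V0" "\<forall>r\<in>V0. a \<pi> r = a e r"
      using IH[OF lin_on_subset[OF la[OF e(1)] V0V]] by blast
    \<comment> \<open>subtracting the orthogonal projection \<open>\<pi>\<close> of \<open>e\<close> to the kernel\<close>
    define e' where "e' = e - \<pi>"
    have e'V: "e' \<in> V" using e \<pi> V0V insert.prems(1) unfolding e'_def by (auto intro: subspace_diff)
    have phie': "\<phi> e' \<noteq> 0"
      using lin_on_diff[OF lphi insert.prems(1) e(1)] \<pi> e V0V by (auto simp: e'_def V0_def)
    have orth: "a e' r = 0" if "r \<in> V0" for r
    proof -
      have rV: "r \<in> V" "\<pi> \<in> V" using that \<pi> V0V by auto
      have "a e' r = a r e - a r \<pi>"
        using sym[OF e'V rV(1)] lin_on_diff[OF la[OF rV(1)] insert.prems(1) e(1) rV(2)]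
        by (simp add: e'_def)
      then show ?thesis using \<pi> that sym[OF e(1) rV(1)] sym[OF rV(1) rV(2)] by simp
    qed
    have "e' \<noteq> 0" using phie' lin_on_zero[OF lphi insert.prems(1)] by auto
    then have pos: "a e' e' > 0" using spd_pos[OF insert.prems(4) e'V] by blast
    define c where "c = (l e' - a w0 e') / a e' e'"
    define w where "w = w0 + c *\<^sub>R e'"
    have w0V: "w0 \<in> V" using w0 V0V by auto
    have wV: "w \<in> V" unfolding w_def
      using insert.prems(1) w0V e'V by (auto intro!: subspace_add subspace_scale)
    have awr: "a w r = a w0 r + c * a e' r" if "r \<in> V" for r
    proof -
      have "a r w = a r w0 + c * a r e'" unfolding w_def
        using lin_on_add[OF la[OF that] w0V] lin_on_scale[OF la[OF that] e'V]
          subspace_scale[OF insert.prems(1) e'V] by simp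
      then show ?thesis using sym[OF that wV] sym[OF that w0V] sym[OF that e'V] by simp
    qed
    have "a w r = l r" if rV: "r \<in> V" for r
    proof -
      define k where "k = \<phi> r / \<phi> e'"
      define r0 where "r0 = r - k *\<^sub>R e'"
      have ke: "k *\<^sub>R e' \<in> V" using e'V insert.prems(1) subspace_scale by blast
      have r0V: "r0 \<in> V" unfolding r0_def using rV ke insert.prems(1) subspace_diff by blast
      have "\<phi> r0 = 0" unfolding r0_def
        using lin_on_diff[OF lphi insert.prems(1) rV ke] lin_on_scale[OF lphi e'V] phie'
        by (simp add: k_def)
      then have r00: "r0 \<in> V0" using r0V by (simp add: V0_def)
      have r: "r = r0 + k *\<^sub>R e'" by (simp add: r0_def)
      have "a w r = a w r0 + k * a w e'"
        unfolding r using lin_on_add[OF la[OF wV] r0V ke] lin_on_scale[OF la[OF wV] e'V] by simp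
      also have "a w r0 = l r0" using awr[OF r0V] w0(2) orth[OF r00] r00 by simp
      also have "a w e' = l e'" using awr[OF e'V] pos by (simp add: c_def)
      also have "l r0 + k * l e' = l r"
        unfolding r using lin_on_add[OF insert.prems(5) r0V ke] lin_on_scale[OF insert.prems(5) e'V]
        by simp
      finally show ?thesis .
    qed
    with wV show ?thesis by blast
  qed
qed

lemma riesz:
  assumes "subspace V" "finitely_separated V" "spd_on V a" "lin_on V l"
  obtains w where "w \<in> V" "\<And>r. r \<in> V \<Longrightarrow> a w r = l r"
proof -
  obtain \<Phi> where "finite \<Phi>" "\<forall>\<phi>\<in>\<Phi>. lin_on V \<phi>" "\<forall>v\<in>V. (\<forall>\<phi>\<in>\<Phi>. \<phi> v = 0) \<longrightarrow> v = 0"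
    using assms(2) unfolding finitely_separated_def by (elim exE conjE) (rule that)
  from riesz_aux[OF this(1) assms(1) this(2,3) assms(3,4)] obtain w
    where "w \<in> V" "\<forall>r\<in>V. a w r = l r" by (elim bexE)
  then show thesis by (intro that) auto
qed

lemma spd_cauchy_schwarz:
  assumes "subspace V" "spd_on V a" "x \<in> V" "y \<in> V"
  shows "(a x y)\<^sup>2 \<le> a x x * a y y"
proof (cases "y = 0")
  case True
  then show ?thesis using lin_on_zero[OF spd_lin[OF assms(2,3)] assms(1)]
      lin_on_zero[OF spd_lin[OF assms(2,4)] assms(1)] by simp
next
  case False
  have la: "lin_on V (a w)" if "w \<in> V" for w using spd_lin[OF assms(2) that] .
  have sym: "a w r = a r w" if "w \<in> V" "r \<in> V" for w r using spd_sym[OF assms(2) that] .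
  have pos: "a y y > 0" using spd_pos[OF assms(2,4) False] .
  define c where "c = a x y / a y y"
  have cy: "c *\<^sub>R y \<in> V" using assms subspace_scale by blast
  define u where "u = x - c *\<^sub>R y"
  have uV: "u \<in> V" unfolding u_def using assms cy subspace_diff by blast
  have exp: "a r u = a r x - c * a r y" if "r \<in> V" for r
    unfolding u_def using lin_on_diff[OF la[OF that] assms(1,3) cy] lin_on_scale[OF la[OF that] assms(4)]
    by simp
  have "0 \<le> a u u" using spd_nonneg[OF assms(1,2) uV] .
  also have "a u u = a u x - c * a u y" using exp[OF uV] .
  also have "a u x = a x x - c * a x y" using exp[OF assms(3)] sym[OF uV assms(3)] by simp
  also have "a u y = a x y - c * a y y"
    using exp[OF assms(4)] sym[OF uV assms(4)] sym[OF assms(3,4)] by simp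
  also have "a x x - c * a x y - c * (a x y - c * a y y) = a x x - (a x y)\<^sup>2 / a y y"
    using pos by (simp add: c_def power2_eq_square)
  finally show ?thesis using pos by (simp add: field_simps)
qed

section \<open>Saddle point problems with a spectrally equivalent auxiliary form\<close>

locale saddle_point =
  fixes W :: "'w::real_vector set" and Q :: "'q::real_vector set"
    and a d :: "'w \<Rightarrow> 'w \<Rightarrow> real" and b :: "'w \<Rightarrow> 'q \<Rightarrow> real" and c1 c2 :: real
  assumes sub_W: "subspace W" and sub_Q: "subspace Q"
    and sep_W: "finitely_separated W" and sep_Q: "finitely_separated Q"
    and spd_a: "spd_on W a" and spd_d: "spd_on W d"
    and lin_b1: "\<And>q. q \<in> Q \<Longrightarrow> lin_on W (\<lambda>r. b r q)"
    and lin_b2: "\<And>r. r \<in> W \<Longrightarrow> lin_on Q (b r)"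
    and inj_b: "\<And>q. q \<in> Q \<Longrightarrow> (\<And>r. r \<in> W \<Longrightarrow> b r q = 0) \<Longrightarrow> q = 0"
    and c1: "c1 > 0" and c2: "c2 > 0"
    and lower: "\<And>w. w \<in> W \<Longrightarrow> c1 * d w w \<le> a w w"
    and upper: "\<And>w. w \<in> W \<Longrightarrow> a w w \<le> c2 * d w w"
begin

definition "opA w = restrict (a w) W"
definition "opD w = restrict (d w) W"
definition "opB r = restrict (b r) Q"
definition "opBT q = restrict (\<lambda>r. b r q) W"
definition "opS q = opB (inv_into W opD (opBT q))"
definition "blockA x = (case x of (w, p) \<Rightarrow>
  (restrict (\<lambda>r. opA w r + opBT p r) W, restrict (\<lambda>q. - opB w q) Q))"
definition "blockU x = (case x of (w, p) \<Rightarrow> (restrict (\<lambda>r. opA w r + opBT p r) W, opS p))"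
definition "blockD x = (case x of (w, p) \<Rightarrow> (opA w, opS p))"
definition "dual_pair x' x = fst x' (fst x) + snd x' (snd x)"

lemma spd_restrict_inj:
  assumes "subspace V" "spd_on V f"
  shows "inj_on (\<lambda>w. restrict (f w) V) V"
proof (rule inj_onI)
  fix x y assume xy: "x \<in> V" "y \<in> V" "restrict (f x) V = restrict (f y) V"
  have lf: "lin_on V (f w)" if "w \<in> V" for w using spd_lin[OF assms(2) that] .
  have dV: "x - y \<in> V" using assms xy subspace_diff by blast
  have eq: "f x r = f y r" if "r \<in> V" for r using xy(3) that by (metis restrict_apply')
  have sym: "f w r = f r w" if "w \<in> V" "r \<in> V" for w r using spd_sym[OF assms(2) that] .
  have "f (x - y) (x - y) = f (x - y) x - f (x - y) y"
    using lin_on_diff[OF lf[OF dV] assms(1) xy(1,2)] .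
  also have "\<dots> = f x (x - y) - f y (x - y)" using sym[OF dV xy(1)] sym[OF dV xy(2)] by simp
  also have "\<dots> = 0" using eq[OF dV] by simp
  finally have "\<not> 0 < f (x - y) (x - y)" by simp
  then show "x = y" using spd_pos[OF assms(2) dV] by force
qed

definition "d_rep q = inv_into W opD (opBT q)"

lemma d_rep: assumes "q \<in> Q" shows "d_rep q \<in> W" "\<And>r. r \<in> W \<Longrightarrow> d (d_rep q) r = b r q"
proof -
  obtain w where w: "w \<in> W" "\<And>r. r \<in> W \<Longrightarrow> d w r = b r q"
    by (rule riesz[OF sub_W sep_W spd_d lin_b1[OF assms]]) (rule that)
  have "opD w = opBT q" using w by (auto simp: opD_def opBT_def fun_eq_iff)
  then have "opBT q \<in> opD ` W" using w by force
  then have "d_rep q \<in> W" "opD (d_rep q) = opBT q"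
    unfolding d_rep_def by (auto intro: inv_into_into f_inv_into_f)
  then show "d_rep q \<in> W" by simp
  show "d (d_rep q) r = b r q" if "r \<in> W" for r
    using fun_cong[OF \<open>opD (d_rep q) = opBT q\<close>, of r] that by (simp add: opD_def opBT_def)
qed

definition "schur p q = b (d_rep p) q"

lemma schur_eq: "p \<in> Q \<Longrightarrow> q \<in> Q \<Longrightarrow> schur p q = d (d_rep q) (d_rep p)"
  using d_rep by (simp add: schur_def)

lemma opS_eq: "opS p = restrict (schur p) Q"
  by (simp add: opS_def opB_def schur_def[abs_def] d_rep_def)

lemma sym_d: "w \<in> W \<Longrightarrow> r \<in> W \<Longrightarrow> d w r = d r w"
  and sym_a: "w \<in> W \<Longrightarrow> r \<in> W \<Longrightarrow> a w r = a r w"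
  and lin_a: "w \<in> W \<Longrightarrow> lin_on W (a w)"
  and lin_d: "w \<in> W \<Longrightarrow> lin_on W (d w)"
  using spd_sym[OF spd_d] spd_sym[OF spd_a] spd_lin[OF spd_a] spd_lin[OF spd_d] by blast+

lemma nonneg_d: "w \<in> W \<Longrightarrow> 0 \<le> d w w"
  by (rule spd_nonneg[OF sub_W spd_d])

lemma nonneg_a: "w \<in> W \<Longrightarrow> 0 \<le> a w w"
  by (rule spd_nonneg[OF sub_W spd_a])

lemma spd_schur: "spd_on Q schur"
  unfolding spd_on_def
proof (intro conjI ballI impI)
  fix w assume w: "w \<in> Q"
  show "lin_on Q (schur w)" unfolding schur_def using lin_b2 d_rep[OF w] by auto
  fix r assume r: "r \<in> Q"
  show "schur w r = schur r w" using schur_eq[OF w r] schur_eq[OF r w] sym_d[OF d_rep(1)[OF w] d_rep(1)[OF r]] by simp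
next
  fix w assume w: "w \<in> Q" "w \<noteq> 0"
  have "d_rep w \<noteq> 0"
  proof
    assume "d_rep w = 0"
    then have "b r w = 0" if "r \<in> W" for r
      using d_rep(1)[OF w(1)] d_rep(2)[OF w(1) that] sym_d[OF d_rep(1)[OF w(1)] that]
        lin_on_zero[OF lin_d[OF that] sub_W] by simp
    with inj_b[OF w(1)] w(2) show False by simp
  qed
  then show "0 < schur w w" using spd_pos[OF spd_d d_rep(1)[OF w(1)]] schur_eq[OF w(1) w(1)] by simp
qed

lemma inj_opA: "inj_on opA W"
  using spd_restrict_inj[OF sub_W spd_a] by (simp add: opA_def[abs_def])

lemma inj_opS: "inj_on opS Q"
  using spd_restrict_inj[OF sub_Q spd_schur] by (simp add: opS_eq[abs_def])

lemma inj_blockD: "inj_on blockD (W \<times> Q)"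
  using inj_opA inj_opS by (auto simp: inj_on_def blockD_def)

lemma inj_blockU: "inj_on blockU (W \<times> Q)"
proof (rule inj_onI, clarify)
  fix w p w' p' assume h: "w \<in> W" "p \<in> Q" "w' \<in> W" "p' \<in> Q" "blockU (w, p) = blockU (w', p')"
  then have pp: "p = p'" using inj_opS by (auto simp: inj_on_def blockU_def)
  have "opA w r = opA w' r" if "r \<in> W" for r
    using fun_cong[OF arg_cong[OF h(5), of fst], of r] that pp by (simp add: blockU_def)
  then have "opA w = opA w'" by (auto simp: opA_def fun_eq_iff)
  then show "w = w' \<and> p = p'" using pp h inj_opA by (auto simp: inj_on_def)
qed

text \<open>In the notation of the introduction, \<open>a(t, t) \<le> \<langle>S p, p\<rangle> / c1\<close> and \<open>\<langle>S p, p\<rangle> \<le> c2 a(t, t)\<close> by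
  the Cauchy--Schwarz inequality for \<open>d\<close> and for \<open>a\<close>, applied to the two representers of \<open>B\<^sup>T p\<close>. The
  second component of the image is \<open>-B w\<close>; its norm is at most \<open>d(w, w)\<close>, again by Cauchy--Schwarz.\<close>

theorem field_of_values_bounds:
  assumes x: "x \<in> W \<times> Q" and nz: "x \<noteq> (0, 0)"
    and BU: "BU = inv_into (W \<times> Q) blockU" and BD: "BD = inv_into (W \<times> Q) blockD"
    and x': "x' = blockU x" and y': "y' = blockA (BU x')"
  shows "min 1 (1 / c2) / 2 \<le> dual_pair y' (BD x') / dual_pair x' (BD x')"
    and "sqrt (dual_pair y' (BD y')) / sqrt (dual_pair x' (BD x')) \<le> sqrt (1 + 2 / c1 + 2 / c1\<^sup>2)"
proof -
  obtain w p where xwp: "x = (w, p)" and w: "w \<in> W" and p: "p \<in> Q" using x by auto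
  have BUx: "BU x' = x" unfolding BU x' by (rule inv_into_f_f[OF inj_blockU x])
  obtain t where t: "t \<in> W" "\<And>r. r \<in> W \<Longrightarrow> a t r = b r p"
    by (rule riesz[OF sub_W sep_W spd_a lin_b1[OF p]]) (rule that)
  obtain m where m: "m \<in> Q" "\<And>q. q \<in> Q \<Longrightarrow> schur m q = b w q"
    by (rule riesz[OF sub_Q sep_Q spd_schur lin_b2[OF w]]) (rule that)
  define g where "g = w + t"
  have gW: "g \<in> W" using w t sub_W subspace_add by (auto simp: g_def)
  have exp: "a r g = a r w + a r t" if "r \<in> W" for r
    unfolding g_def using lin_on_add[OF lin_a[OF that] w t(1)] .
  have ag: "a g r = a w r + b r p" if "r \<in> W" for r
    using exp[OF that] sym_a[OF that] gW w t(1) t(2)[OF that] by simp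
  have mg: "opA g = restrict (\<lambda>r. opA w r + opBT p r) W"
    using ag by (auto simp: opA_def opBT_def fun_eq_iff)
  have gp: "(g, p) \<in> W \<times> Q" "blockD (g, p) = x'"
    using gW p mg by (auto simp: x' xwp blockU_def blockD_def)
  have BDx: "BD x' = (g, p)" unfolding BD gp(2)[symmetric] by (rule inv_into_f_f[OF inj_blockD gp(1)])
  have mQ: "- m \<in> Q" using m sub_Q subspace_neg by blast
  have neg: "schur (- m) q = - b w q" if "q \<in> Q" for q
  proof -
    have "schur (- m) q = schur q (-1 *\<^sub>R m)" using spd_sym[OF spd_schur mQ that] by simp
    also have "\<dots> = - schur q m" using lin_on_scale[OF spd_lin[OF spd_schur that] m(1), of "-1"] by simp
    also have "schur q m = schur m q" using spd_sym[OF spd_schur that m(1)] .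
    finally show ?thesis using m that by simp
  qed
  have gm: "(g, - m) \<in> W \<times> Q" "blockD (g, - m) = y'"
    using gW mQ mg neg unfolding y' BUx xwp
    by (auto simp: blockD_def blockA_def opS_eq opB_def fun_eq_iff)
  have BDy: "BD y' = (g, - m)" unfolding BD gm(2)[symmetric] by (rule inv_into_f_f[OF inj_blockD gm(1)])
  have den: "dual_pair x' (BD x') = a g g + schur p p"
    unfolding BDx dual_pair_def unfolding gp(2)[symmetric]
    using gW p by (simp add: blockD_def opA_def opS_eq)
  have num: "dual_pair y' (BD x') = a g g - b w p"
    unfolding BDx dual_pair_def unfolding gm(2)[symmetric]
    using gW p neg by (simp add: blockD_def opA_def opS_eq)
  have ynorm: "dual_pair y' (BD y') = a g g + schur m m"
    unfolding BDy dual_pair_def unfolding gm(2)[symmetric]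
    using gW p neg mQ m(1) lin_on_scale[OF lin_b2[OF w] m(1), of "-1"] m(2)
    by (simp add: blockD_def opA_def opS_eq)
  have zp: "d_rep p \<in> W" and zm: "d_rep m \<in> W" using d_rep p m by auto
  have spp: "schur p p = d (d_rep p) (d_rep p)" using schur_eq p by simp
  have spp0: "0 \<le> schur p p" using nonneg_d[OF zp] spp by simp
  have agg0: "0 \<le> a g g" and att0: "0 \<le> a t t" using nonneg_a[OF gW] nonneg_a[OF t(1)] by blast+
  have den_pos: "0 < a g g + schur p p"
  proof (rule ccontr)
    assume "\<not> 0 < a g g + schur p p"
    then have z: "a g g = 0" "schur p p = 0" using spp0 agg0 by auto
    then have "g = 0" using spd_pos[OF spd_a gW] by force
    moreover have p0: "p = 0" using spd_pos[OF spd_schur p] z by force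
    have "a t t = 0" using t(2)[OF t(1)] p0 lin_on_zero[OF lin_b2[OF t(1)] sub_Q] by simp
    then have "t = 0" using spd_pos[OF spd_a t(1)] by force
    ultimately show False using nz p0 xwp by (simp add: g_def)
  qed
  have att_le: "a t t \<le> schur p p / c1"
  proof (cases "a t t = 0")
    case True then show ?thesis using spp0 c1 by simp
  next
    case False
    have "(a t t)\<^sup>2 = (d (d_rep p) t)\<^sup>2" using t d_rep[OF p] by simp
    also have "\<dots> \<le> schur p p * d t t" using spd_cauchy_schwarz[OF sub_W spd_d zp t(1)] spp by simp
    also have "\<dots> \<le> schur p p * (a t t / c1)"
      using lower[OF t(1)] c1 spp0 by (intro mult_left_mono) (auto simp: field_simps)
    finally have "a t t * a t t \<le> (schur p p / c1) * a t t" by (simp add: power2_eq_square)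
    moreover have "0 < a t t" using False att0 by simp
    ultimately show ?thesis by (rule mult_right_le_imp_le)
  qed
  have schur_le: "schur p p \<le> c2 * a t t"
  proof (cases "schur p p = 0")
    case True then show ?thesis using att0 c2 by simp
  next
    case False
    have "(schur p p)\<^sup>2 = (a t (d_rep p))\<^sup>2" using t zp by (simp add: schur_def)
    also have "\<dots> \<le> a t t * a (d_rep p) (d_rep p)" using spd_cauchy_schwarz[OF sub_W spd_a t(1) zp] .
    also have "\<dots> \<le> a t t * (c2 * schur p p)" using upper[OF zp] att0 spp by (simp add: mult_left_mono)
    finally have "schur p p * schur p p \<le> (c2 * a t t) * schur p p" by (simp add: power2_eq_square ac_simps)
    then show ?thesis using False spp0 by (simp add: mult_le_cancel_right)
  qed
  have smm_le: "schur m m \<le> d w w"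
  proof (cases "schur m m = 0")
    case True then show ?thesis using nonneg_d w by simp
  next
    case False
    have smm: "schur m m = d (d_rep m) (d_rep m)" using schur_eq m by simp
    then have smm0: "0 \<le> schur m m" using nonneg_d zm by simp
    have "schur m m = d (d_rep m) w" using m d_rep[OF m(1)] w by simp
    then have "(schur m m)\<^sup>2 \<le> schur m m * d w w" using spd_cauchy_schwarz[OF sub_W spd_d zm w] smm by simp
    then have "schur m m * schur m m \<le> d w w * schur m m" by (simp add: power2_eq_square ac_simps)
    then show ?thesis using False smm0 by (simp add: mult_le_cancel_right)
  qed
  have bwp: "b w p = a t g - a t t"
    using t(2)[OF w] exp[OF t(1)] by simp
  \<comment> \<open>expand \<open>a\<close> at \<open>g - t\<close> and \<open>g + t\<close>, using \<open>w = g - t\<close>\<close>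
  have young: "2 * a t g \<le> a g g + a t t" "a w w \<le> 2 * (a g g + a t t)"
  proof -
    have dW: "g - t \<in> W" "g + t \<in> W" using gW t sub_W subspace_diff subspace_add by auto
    have e1: "a r (g - t) = a r g - a r t" "a r (g + t) = a r g + a r t" if "r \<in> W" for r
      using lin_on_diff[OF lin_a[OF that] sub_W gW t(1)] lin_on_add[OF lin_a[OF that] gW t(1)] by auto
    have s1: "a (g - t) g = a g g - a t g" "a (g - t) t = a t g - a t t"
      "a (g + t) g = a g g + a t g" "a (g + t) t = a t g + a t t"
      using e1[OF gW] e1[OF t(1)] sym_a[OF dW(1) gW] sym_a[OF dW(1) t(1)]
        sym_a[OF dW(2) gW] sym_a[OF dW(2) t(1)] sym_a[OF gW t(1)] by auto
    have m1: "a (g - t) (g - t) = a g g - 2 * a t g + a t t"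
      using e1[OF dW(1)] s1 by simp
    have m2: "a (g + t) (g + t) = a g g + 2 * a t g + a t t"
      using e1[OF dW(2)] s1 by simp
    show "2 * a t g \<le> a g g + a t t" using m1 nonneg_a[OF dW(1)] by simp
    show "a w w \<le> 2 * (a g g + a t t)" using m1 m2 nonneg_a[OF dW(2)] by (simp add: g_def)
  qed
  have "min 1 (1 / c2) / 2 * (a g g + schur p p) \<le> a g g - b w p"
  proof -
    have "min 1 (1 / c2) * a g g \<le> 1 * a g g" using agg0 by (intro mult_right_mono) auto
    moreover have "min 1 (1 / c2) * schur p p \<le> (1 / c2) * schur p p" using spp0 by (intro mult_right_mono) auto
    moreover have "(1 / c2) * schur p p \<le> a t t" using schur_le c2 by (simp add: field_simps)
    ultimately have "min 1 (1 / c2) * (a g g + schur p p) \<le> a g g + a t t" by (simp add: distrib_left)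
    then show ?thesis using young(1) bwp by simp
  qed
  then show "min 1 (1 / c2) / 2 \<le> dual_pair y' (BD x') / dual_pair x' (BD x')"
    unfolding num den using den_pos by (simp add: pos_le_divide_eq)
  have "a g g + schur m m \<le> (1 + 2 / c1 + 2 / c1\<^sup>2) * (a g g + schur p p)"
  proof -
    have "schur m m \<le> a w w / c1" using order_trans[OF mult_left_mono[OF smm_le less_imp_le[OF c1]] lower[OF w]] c1
      by (simp add: pos_le_divide_eq mult.commute)
    also have "\<dots> \<le> 2 * (a g g + schur p p / c1) / c1"
      using young(2) att_le c1 by (intro divide_right_mono) auto
    finally have "schur m m \<le> (2 / c1) * a g g + (2 / c1\<^sup>2) * schur p p"
      by (simp add: power2_eq_square distrib_left add_divide_distrib)
    moreover have "0 \<le> (2 / c1\<^sup>2) * a g g" "0 \<le> (1 + 2 / c1) * schur p p" using agg0 spp0 c1 by auto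
    ultimately show ?thesis by (simp add: algebra_simps)
  qed
  then have "(a g g + schur m m) / (a g g + schur p p) \<le> 1 + 2 / c1 + 2 / c1\<^sup>2"
    using den_pos by (simp add: pos_divide_le_eq)
  then show "sqrt (dual_pair y' (BD y')) / sqrt (dual_pair x' (BD x')) \<le> sqrt (1 + 2 / c1 + 2 / c1\<^sup>2)"
    unfolding ynorm den by (simp flip: real_sqrt_divide)
qed

end

section \<open>Tangent spaces and orthonormal bases\<close>

lemma subspace_tangent [simp]: "subspace (tangent S)"
  by (simp add: tangent_def)

lemma tangent_affine_hull: "tangent (affine hull S) = tangent S"
proof (cases "S = {}")
  case False
  then obtain a where a: "a \<in> S" by auto
  have "x - y \<in> tangent S" if "x \<in> affine hull S" "y \<in> affine hull S" for x y
  proof -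
    have "span ((\<lambda>x. - a + x) ` S) \<subseteq> tangent S"
      unfolding tangent_def using a by (intro span_mono) (force simp: algebra_simps)
    moreover have "affine hull S = (\<lambda>x. a + x) ` span ((\<lambda>x. - a + x) ` S)"
      using affine_hull_span_gen[of a S] a by (simp add: hull_inc)
    ultimately have "x \<in> (\<lambda>x. a + x) ` tangent S" "y \<in> (\<lambda>x. a + x) ` tangent S"
      using that by blast+
    then obtain u v where "x = a + u" "y = a + v" "u \<in> tangent S" "v \<in> tangent S"
      by (elim imageE)
    then show ?thesis using subspace_diff[OF subspace_tangent, of u S v] by simp
  qed
  then have "tangent (affine hull S) \<subseteq> tangent S"
    unfolding tangent_def[of "affine hull S"] by (intro span_minimal) auto
  moreover have "tangent S \<subseteq> tangent (affine hull S)"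
    unfolding tangent_def by (intro span_mono) (blast intro: hull_inc)
  ultimately show ?thesis by simp
qed simp

lemma tangent_diff: "x \<in> affine hull S \<Longrightarrow> y \<in> affine hull S \<Longrightarrow> x - y \<in> tangent S"
  using tangent_affine_hull[of S] unfolding tangent_def by (blast intro: span_base)

lemma tangent_cong: "affine hull S = affine hull T \<Longrightarrow> tangent S = tangent T"
  by (metis tangent_affine_hull)

lemma tangent_mono: "S \<subseteq> affine hull T \<Longrightarrow> tangent S \<subseteq> tangent T"
  unfolding tangent_def[of S] by (intro span_minimal) (auto intro: tangent_diff)

lemma affine_hull_add_tangent:
  assumes "x \<in> affine hull S" "u \<in> tangent S"
  shows "x + u \<in> affine hull S"
proof -
  have "subspace {u. x + u \<in> affine hull S}"
  proof -
    have "{u. x + u \<in> affine hull S} = (\<lambda>y. - x + y) ` (affine hull S)"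
      by (force simp: image_iff)
    then show ?thesis using affine_diffs_subspace[OF affine_affine_hull assms(1)] by simp
  qed
  moreover have "y - z \<in> {u. x + u \<in> affine hull S}" if "y \<in> S" "z \<in> S" for y z
  proof -
    have "1 *\<^sub>R x + 1 *\<^sub>R y + (-1) *\<^sub>R z \<in> affine hull S"
      using that assms(1) mem_affine_3[of "affine hull S" x y z 1 1 "-1"] by (simp add: hull_inc)
    then show ?thesis by (simp add: algebra_simps)
  qed
  ultimately have "tangent S \<subseteq> {u. x + u \<in> affine hull S}"
    unfolding tangent_def by (intro span_minimal) auto
  then show ?thesis using assms by auto
qed

lemma dim_tangent: assumes "S \<noteq> {}" shows "int (dim (tangent S)) = aff_dim S"
proof -
  obtain a where a: "a \<in> S" using assms by auto
  have "tangent S = (\<lambda>x. - a + x) ` (affine hull S)"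
  proof (intro equalityI subsetI)
    fix u assume "u \<in> tangent S"
    then have "a + u \<in> affine hull S" using a by (intro affine_hull_add_tangent hull_inc)
    then show "u \<in> (\<lambda>x. - a + x) ` (affine hull S)" by (intro image_eqI[of _ _ "a + u"]) auto
  next
    fix u assume "u \<in> (\<lambda>x. - a + x) ` (affine hull S)"
    then show "u \<in> tangent S" using tangent_diff[of _ S a] a by (auto simp: hull_inc)
  qed
  then have "dim (tangent S) = dim ((\<lambda>x. - a + x) ` (affine hull S))" by simp
  moreover have "0 \<in> affine hull ((\<lambda>x. - a + x) ` (affine hull S))"
    using a by (intro hull_inc) (auto simp: hull_inc image_iff intro!: bexI[of _ a])
  ultimately show ?thesis
    using aff_dim_zero[of "(\<lambda>x. - a + x) ` (affine hull S)"]
      aff_dim_translation_eq[of "- a" "affine hull S"] by simp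
qed

lemma onb_spec:
  assumes "subspace U"
  shows "pairwise orthogonal (onb U)" "\<And>b. b \<in> onb U \<Longrightarrow> norm b = 1" "span (onb U) = U"
    "finite (onb U)" "card (onb U) = dim U" "onb U \<subseteq> U"
proof -
  obtain B where B: "B \<subseteq> U" "pairwise orthogonal B" "\<And>x. x \<in> B \<Longrightarrow> norm x = 1" "span B = U"
    using orthonormal_basis_subspace[OF assms] by metis
  have *: "pairwise orthogonal (onb U) \<and> (\<forall>b\<in>onb U. norm b = 1) \<and> span (onb U) = U"
    unfolding onb_def by (rule someI[of _ B]) (use B in auto)
  then show 1: "pairwise orthogonal (onb U)" "\<And>b. b \<in> onb U \<Longrightarrow> norm b = 1" "span (onb U) = U" by auto
  have ind: "independent (onb U)"
    using 1 pairwise_orthogonal_independent by force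
  then show "finite (onb U)" "onb U \<subseteq> U"
    using 1(3) span_superset independent_imp_finite by auto
  show "card (onb U) = dim U" using 1(3) ind dim_span_eq_card_independent by metis
qed

lemma onb_inner:
  assumes "subspace U" "b \<in> onb U" "b' \<in> onb U"
  shows "b \<bullet> b' = (if b = b' then 1 else 0)"
  using onb_spec(1)[OF assms(1)] onb_spec(2)[OF assms(1)] assms(2,3)
  by (auto simp: pairwise_def orthogonal_def dot_square_norm)

lemma onb_sum_inner:
  assumes "subspace U" "b \<in> onb U"
  shows "(\<Sum>b'\<in>onb U. t b' *\<^sub>R b') \<bullet> b = t b"
proof -
  have "(\<Sum>b'\<in>onb U. t b' *\<^sub>R b') \<bullet> b = (\<Sum>b'\<in>onb U. if b' = b then t b' else 0)"
    unfolding inner_sum_left using onb_inner[OF assms(1) _ assms(2)] by (intro sum.cong) auto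
  also have "\<dots> = t b" using onb_spec(4)[OF assms(1)] assms(2) by simp
  finally show ?thesis .
qed

lemma onb_expand:
  assumes "subspace U" "u \<in> U"
  shows "(\<Sum>b\<in>onb U. (u \<bullet> b) *\<^sub>R b) = u"
proof -
  have "u \<in> span (onb U)" using onb_spec(3)[OF assms(1)] assms by simp
  then obtain t where t: "u = (\<Sum>b\<in>onb U. t b *\<^sub>R b)"
    using onb_spec(4)[OF assms(1)] by (auto simp: span_finite)
  have "(\<Sum>b\<in>onb U. (u \<bullet> b) *\<^sub>R b) = (\<Sum>b\<in>onb U. t b *\<^sub>R b)"
    unfolding t using onb_sum_inner[OF assms(1)] by (intro sum.cong) auto
  then show ?thesis using t by simp
qed

section \<open>The flat measure\<close>

definition flat_borel :: "'a::euclidean_space set \<Rightarrow> 'a measure" where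
  "flat_borel S = distr (\<Pi>\<^sub>M b\<in>onb (tangent S). lborel) borel
     (\<lambda>t. (SOME p. p \<in> S) + (\<Sum>b\<in>onb (tangent S). t b *\<^sub>R b))"

lemma flat_measure_eq: "flat_measure S = completion (flat_borel S)"
  by (simp add: flat_measure_def flat_borel_def)

lemma sets_flat_borel [simp, measurable_cong]: "sets (flat_borel S) = sets borel"
  and space_flat_borel [simp]: "space (flat_borel S) = UNIV"
  by (simp_all add: flat_borel_def)

lemma coord_measurable [measurable]:
  fixes B :: "'a::euclidean_space set"
  shows "(\<lambda>t. p + (\<Sum>b\<in>B. t b *\<^sub>R b)) \<in> borel_measurable (\<Pi>\<^sub>M b\<in>B. lborel)"
  by measurable

text \<open>The uniqueness of product measures reduces homotheties and translations in coordinates to the one-dimensional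
  case.\<close>

lemma PiM_lborel_affine:
  fixes B :: "'b set"
  assumes "finite B" "r > 0"
  shows "(\<Pi>\<^sub>M b\<in>B. (lborel :: real measure)) =
    scale_measure (ennreal (r ^ card B))
      (distr (\<Pi>\<^sub>M b\<in>B. lborel) (\<Pi>\<^sub>M b\<in>B. lborel) (\<lambda>t. \<lambda>b\<in>B. c b + r * t b))"
proof -
  interpret product_sigma_finite "\<lambda>_::'b. lborel :: real measure" by standard
  have m[measurable]: "(\<lambda>t. \<lambda>b\<in>B. c b + r * t b) \<in> (\<Pi>\<^sub>M b\<in>B. lborel) \<rightarrow>\<^sub>M (\<Pi>\<^sub>M b\<in>B. (lborel :: real measure))"
    by measurable
  show ?thesis
  proof (rule PiM_eqI[symmetric])
    fix A :: "'b \<Rightarrow> real set" assume A: "\<And>i. i \<in> B \<Longrightarrow> A i \<in> sets lborel"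
    then have Ab: "\<And>i. i \<in> B \<Longrightarrow> A i \<in> sets borel" by simp
    have pre: "(\<lambda>t. \<lambda>b\<in>B. c b + r * t b) -` Pi\<^sub>E B A \<inter> space (\<Pi>\<^sub>M b\<in>B. lborel)
        = Pi\<^sub>E B (\<lambda>b. (\<lambda>x. c b + r * x) -` A b)"
      by (auto simp: space_PiM PiE_def Pi_def extensional_def)
    have meas: "(\<lambda>x. c b + r * x) -` A b \<in> sets borel" if "b \<in> B" for b
      using Ab[OF that] measurable_sets[of "\<lambda>x. c b + r * x" borel borel "A b"] by simp
    have one: "emeasure lborel (A b) = ennreal r * emeasure lborel ((\<lambda>x. c b + r * x) -` A b)"
      if "b \<in> B" for b
      using Ab[OF that] assms(2)
      by (subst lborel_real_affine[of r "c b"])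
        (simp_all add: emeasure_density_const emeasure_distr)
    have "emeasure (scale_measure (ennreal (r ^ card B))
      (distr (\<Pi>\<^sub>M b\<in>B. lborel) (\<Pi>\<^sub>M b\<in>B. lborel) (\<lambda>t. \<lambda>b\<in>B. c b + r * t b))) (Pi\<^sub>E B A)
      = ennreal (r ^ card B) * emeasure (\<Pi>\<^sub>M b\<in>B. lborel) (Pi\<^sub>E B (\<lambda>b. (\<lambda>x. c b + r * x) -` A b))"
      using A assms(1) pre by (simp add: emeasure_distr sets_PiM_I_finite)
    also have "\<dots> = ennreal (r ^ card B) * (\<Prod>b\<in>B. emeasure lborel ((\<lambda>x. c b + r * x) -` A b))"
      using assms(1) meas by (subst emeasure_PiM) auto
    also have "\<dots> = (\<Prod>b\<in>B. ennreal r * emeasure lborel ((\<lambda>x. c b + r * x) -` A b))"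
      using assms by (simp add: prod.distrib ennreal_power)
    also have "\<dots> = (\<Prod>b\<in>B. emeasure lborel (A b))"
      using one by (intro prod.cong) auto
    finally show "emeasure (scale_measure (ennreal (r ^ card B))
      (distr (\<Pi>\<^sub>M b\<in>B. lborel) (\<Pi>\<^sub>M b\<in>B. lborel) (\<lambda>t. \<lambda>b\<in>B. c b + r * t b))) (Pi\<^sub>E B A)
      = (\<Prod>i\<in>B. emeasure lborel (A i))" .
  qed (use assms in auto)
qed

text \<open>Homotheties and translations along the flat scale the flat measure by a power of the ratio.\<close>

lemma flat_borel_affine:
  assumes S: "S \<noteq> {}" and S': "S' \<noteq> {}" and aff: "affine hull S = affine hull S'" and r: "r > 0"
    and map: "\<And>x. x \<in> affine hull S' \<Longrightarrow> u + r *\<^sub>R x \<in> affine hull S"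
  shows "flat_borel S = scale_measure (ennreal (r ^ dim (tangent S)))
      (distr (flat_borel S') borel (\<lambda>x. u + r *\<^sub>R x))"
proof -
  define U where "U = tangent S"
  have U: "subspace U" "tangent S' = U" using tangent_cong[OF aff] by (auto simp: U_def)
  define B where "B = onb U"
  have B: "finite B" "card B = dim U" using onb_spec[OF U(1)] by (auto simp: B_def)
  define p where "p = (SOME p. p \<in> S)"
  define p' where "p' = (SOME p. p \<in> S')"
  have p: "p \<in> affine hull S" using S someI_ex[of "\<lambda>x. x \<in> S"] unfolding p_def by (auto intro: hull_inc)
  have p': "p' \<in> affine hull S'" using S' someI_ex[of "\<lambda>x. x \<in> S'"] unfolding p'_def by (auto intro: hull_inc)
  define c where "c b = (u + r *\<^sub>R p' - p) \<bullet> b" for b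
  have inU: "u + r *\<^sub>R p' - p \<in> U" unfolding U_def by (rule tangent_diff[OF map[OF p'] p])
  have sumc: "(\<Sum>b\<in>B. c b *\<^sub>R b) = u + r *\<^sub>R p' - p"
    using onb_expand[OF U(1) inU] by (simp add: B_def c_def)
  have fS: "flat_borel S = distr (\<Pi>\<^sub>M b\<in>B. lborel) borel (\<lambda>t. p + (\<Sum>b\<in>B. t b *\<^sub>R b))"
    by (simp add: flat_borel_def B_def U_def p_def)
  have fS': "flat_borel S' = distr (\<Pi>\<^sub>M b\<in>B. lborel) borel (\<lambda>t. p' + (\<Sum>b\<in>B. t b *\<^sub>R b))"
    by (simp add: flat_borel_def B_def U p'_def)
  have m[measurable]: "(\<lambda>t. \<lambda>b\<in>B. c b + r * t b) \<in> (\<Pi>\<^sub>M b\<in>B. lborel) \<rightarrow>\<^sub>M (\<Pi>\<^sub>M b\<in>B. (lborel :: real measure))"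
    by measurable
  have comp: "(\<lambda>t. p + (\<Sum>b\<in>B. t b *\<^sub>R b)) \<circ> (\<lambda>t. \<lambda>b\<in>B. c b + r * t b)
      = (\<lambda>x. u + r *\<^sub>R x) \<circ> (\<lambda>t. p' + (\<Sum>b\<in>B. t b *\<^sub>R b))"
  proof
    fix t
    have "(\<Sum>b\<in>B. (\<lambda>b\<in>B. c b + r * t b) b *\<^sub>R b) = (\<Sum>b\<in>B. c b *\<^sub>R b) + r *\<^sub>R (\<Sum>b\<in>B. t b *\<^sub>R b)"
      by (simp add: scaleR_add_left sum.distrib scaleR_sum_right)
    then show "((\<lambda>t. p + (\<Sum>b\<in>B. t b *\<^sub>R b)) \<circ> (\<lambda>t. \<lambda>b\<in>B. c b + r * t b)) t
      = ((\<lambda>x. u + r *\<^sub>R x) \<circ> (\<lambda>t. p' + (\<Sum>b\<in>B. t b *\<^sub>R b))) t"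
      using sumc by (simp add: scaleR_add_right)
  qed
  have "flat_borel S = distr (scale_measure (ennreal (r ^ card B))
      (distr (\<Pi>\<^sub>M b\<in>B. lborel) (\<Pi>\<^sub>M b\<in>B. lborel) (\<lambda>t. \<lambda>b\<in>B. c b + r * t b))) borel
      (\<lambda>t. p + (\<Sum>b\<in>B. t b *\<^sub>R b))"
    unfolding fS using PiM_lborel_affine[OF B(1) r, of c] by simp
  also have "\<dots> = scale_measure (ennreal (r ^ card B)) (distr
      (distr (\<Pi>\<^sub>M b\<in>B. lborel) (\<Pi>\<^sub>M b\<in>B. lborel) (\<lambda>t. \<lambda>b\<in>B. c b + r * t b)) borel
      (\<lambda>t. p + (\<Sum>b\<in>B. t b *\<^sub>R b)))"
    by (rule measure_eqI) (simp_all add: emeasure_distr space_scale_measure)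
  also have "\<dots> = scale_measure (ennreal (r ^ card B)) (distr (flat_borel S') borel (\<lambda>x. u + r *\<^sub>R x))"
    unfolding fS' by (simp add: distr_distr comp)
  finally show ?thesis using B by (simp add: U_def)
qed

text \<open>The base point chosen in the definition of the measure does not matter; hence a subdomain and the cells
  of its mesh have the same flat measure.\<close>

lemma flat_borel_cong:
  assumes "S \<noteq> {}" "S' \<noteq> {}" "affine hull S = affine hull S'"
  shows "flat_borel S = flat_borel S'"
proof -
  have "flat_borel S = scale_measure (ennreal (1 ^ dim (tangent S)))
      (distr (flat_borel S') borel (\<lambda>x. 0 + 1 *\<^sub>R x))"
    using assms by (intro flat_borel_affine) auto
  also have "\<dots> = flat_borel S'" by (simp add: distr_id2)
  finally show ?thesis .
qed

lemma flat_borel_bounded_finite: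
  assumes "bounded A"
  shows "emeasure (flat_borel S) A < \<infinity>"
proof -
  define U where "U = tangent S"
  have U: "subspace U" by (simp add: U_def)
  define B where "B = onb U"
  define p where "p = (SOME p. p \<in> S)"
  have B: "finite B" using onb_spec[OF U(1)] by (auto simp: B_def)
  interpret product_sigma_finite "\<lambda>_::'a. lborel :: real measure" by standard
  obtain R where R: "A \<subseteq> cball p R"
    using bounded_subset_ballD[OF assms, of p] ball_subset_cball by blast
  have "emeasure (flat_borel S) A \<le> emeasure (flat_borel S) (cball p R)"
    using R by (intro emeasure_mono) auto
  also have "\<dots> = emeasure (\<Pi>\<^sub>M b\<in>B. lborel)
      ((\<lambda>t. p + (\<Sum>b\<in>B. t b *\<^sub>R b)) -` cball p R \<inter> space (\<Pi>\<^sub>M b\<in>B. lborel))"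
    unfolding flat_borel_def B_def U_def p_def by (subst emeasure_distr) auto
  also have "\<dots> \<le> emeasure (\<Pi>\<^sub>M b\<in>B. lborel) (Pi\<^sub>E B (\<lambda>_. {-R..R}))"
  proof (intro emeasure_mono subsetI)
    fix t assume t: "t \<in> (\<lambda>t. p + (\<Sum>b\<in>B. t b *\<^sub>R b)) -` cball p R \<inter> space (\<Pi>\<^sub>M b\<in>B. (lborel :: real measure))"
    have "\<bar>t b\<bar> \<le> R" if "b \<in> B" for b
    proof -
      have "\<bar>t b\<bar> = \<bar>(\<Sum>b\<in>B. t b *\<^sub>R b) \<bullet> b\<bar>"
        using onb_sum_inner[OF U] that by (simp add: B_def)
      also have "\<dots> \<le> norm (\<Sum>b\<in>B. t b *\<^sub>R b) * norm b" by (rule Cauchy_Schwarz_ineq2)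
      also have "\<dots> \<le> R" using t onb_spec(2)[OF U] that by (simp add: B_def dist_norm)
      finally show ?thesis .
    qed
    then show "t \<in> Pi\<^sub>E B (\<lambda>_. {-R..R})" using t by (force simp: space_PiM PiE_def abs_le_iff)
  qed (use B in \<open>auto intro!: sets_PiM_I_finite\<close>)
  also have "\<dots> = (\<Prod>b\<in>B. emeasure lborel {-R..R})" using B by (subst emeasure_PiM) auto
  also have "\<dots> < \<infinity>"
    by (cases "-R \<le> R") (simp_all add: ennreal_power power_0_left)
  finally show ?thesis .
qed

lemma flat_borel_open_pos:
  assumes "x \<in> affine hull S" "S \<noteq> {}" "e > 0" "cball x e \<inter> affine hull S \<subseteq> A" "A \<in> sets borel"
  shows "emeasure (flat_borel S) A > 0"
proof -
  define U where "U = tangent S"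
  have U: "subspace U" by (simp add: U_def)
  define B where "B = onb U"
  define p where "p = (SOME p. p \<in> S)"
  have pS: "p \<in> affine hull S"
    using assms(2) someI_ex[of "\<lambda>x. x \<in> S"] unfolding p_def by (auto intro: hull_inc)
  have B: "finite B" using onb_spec[OF U(1)] by (auto simp: B_def)
  interpret product_sigma_finite "\<lambda>_::'a. lborel :: real measure" by standard
  \<comment> \<open>a coordinate box of this half width lies in the ball; the added 1 covers an empty basis\<close>
  define \<delta> where "\<delta> = e / (card B + 1)"
  have \<delta>: "\<delta> > 0" using assms by (simp add: \<delta>_def)
  define y where "y b = (x - p) \<bullet> b" for b
  have y: "(\<Sum>b\<in>B. y b *\<^sub>R b) = x - p"
    using onb_expand[OF U, of "x - p"] tangent_diff[OF assms(1) pS] by (simp add: B_def y_def U_def)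
  have "0 < (\<Prod>b\<in>B. emeasure lborel {y b - \<delta>..y b + \<delta>})"
  proof -
    have "(\<Prod>b\<in>B. emeasure lborel {y b - \<delta>..y b + \<delta>}) = (\<Prod>b\<in>B. ennreal (2 * \<delta>))"
      using \<delta> by (intro prod.cong) auto
    then show ?thesis using \<delta> by (simp add: ennreal_power)
  qed
  also have "\<dots> = emeasure (\<Pi>\<^sub>M b\<in>B. lborel) (Pi\<^sub>E B (\<lambda>b. {y b - \<delta>..y b + \<delta>}))"
    using B by (subst emeasure_PiM) auto
  also have "\<dots> \<le> emeasure (\<Pi>\<^sub>M b\<in>B. lborel)
      ((\<lambda>t. p + (\<Sum>b\<in>B. t b *\<^sub>R b)) -` A \<inter> space (\<Pi>\<^sub>M b\<in>B. lborel))"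
  proof (intro emeasure_mono subsetI)
    fix t assume t: "t \<in> Pi\<^sub>E B (\<lambda>b. {y b - \<delta>..y b + \<delta>})"
    have tU: "(\<Sum>b\<in>B. t b *\<^sub>R b) \<in> U"
      using onb_spec(6)[OF U] U by (auto simp: B_def intro!: subspace_sum subspace_scale)
    have "p + (\<Sum>b\<in>B. t b *\<^sub>R b) \<in> affine hull S"
      using affine_hull_add_tangent[OF pS] tU by (simp add: U_def)
    moreover have "dist x (p + (\<Sum>b\<in>B. t b *\<^sub>R b)) \<le> e"
    proof -
      have "dist x (p + (\<Sum>b\<in>B. t b *\<^sub>R b)) = norm ((\<Sum>b\<in>B. y b *\<^sub>R b) - (\<Sum>b\<in>B. t b *\<^sub>R b))"
        unfolding y by (simp add: dist_norm algebra_simps)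
      also have "\<dots> = norm (\<Sum>b\<in>B. (y b - t b) *\<^sub>R b)"
        by (simp add: scaleR_diff_left sum_subtractf)
      also have "\<dots> \<le> (\<Sum>b\<in>B. norm ((y b - t b) *\<^sub>R b))" by (rule norm_sum)
      also have "\<dots> \<le> (\<Sum>b\<in>B. \<delta>)"
      proof (intro sum_mono)
        fix b assume b: "b \<in> B"
        then have "t b \<in> {y b - \<delta>..y b + \<delta>}" using t by (auto simp: PiE_def)
        then show "norm ((y b - t b) *\<^sub>R b) \<le> \<delta>"
          using onb_spec(2)[OF U] b by (simp add: B_def abs_le_iff)
      qed
      also have "\<dots> \<le> e" using assms(3) by (simp add: \<delta>_def field_simps)
      finally show ?thesis .
    qed
    ultimately show "t \<in> (\<lambda>t. p + (\<Sum>b\<in>B. t b *\<^sub>R b)) -` A \<inter> space (\<Pi>\<^sub>M b\<in>B. lborel)"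
      using t assms(4) by (auto simp: space_PiM PiE_def)
  next
    show "(\<lambda>t. p + (\<Sum>b\<in>B. t b *\<^sub>R b)) -` A \<inter> space (\<Pi>\<^sub>M b\<in>B. lborel) \<in> sets (\<Pi>\<^sub>M b\<in>B. lborel)"
      using assms(5) by (intro measurable_sets[OF coord_measurable])
  qed
  also have "\<dots> = emeasure (flat_borel S) A"
    unfolding flat_borel_def B_def U_def p_def using assms(5) by (subst emeasure_distr) auto
  finally show ?thesis .
qed

text \<open>A proper affine slice of the flat is null: infinitely many of its translates are disjoint and
  lie in one bounded set.\<close>

lemma flat_borel_hyperplane_null:
  assumes S: "S \<noteq> {}" and g: "g \<in> tangent S" "g \<noteq> 0"
  shows "emeasure (flat_borel S) {x. g \<bullet> x = c} = 0"
proof -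
  define \<mu> where "\<mu> = flat_borel S"
  have setsmu: "sets \<mu> = sets borel" by (simp add: \<mu>_def)
  define A where "A R = {x. g \<bullet> x = c} \<inter> cball 0 R" for R :: real
  have Ameas: "A R \<in> sets borel" for R
    unfolding A_def by (intro sets.Int borel_closed closed_hyperplane closed_cball)
  have null: "emeasure \<mu> (A R) = 0" for R
  proof -
    define \<epsilon> where "\<epsilon> k = 1 / real (Suc k)" for k
    have \<epsilon>: "0 < \<epsilon> k" "\<epsilon> k \<le> 1" "\<epsilon> k = \<epsilon> l \<longleftrightarrow> k = l" for k l by (auto simp: \<epsilon>_def)
    define D where "D k = (\<lambda>x. x - \<epsilon> k *\<^sub>R g) -` A R" for k :: nat
    have Dmeas: "D k \<in> sets borel" for k
      using measurable_sets[of "\<lambda>x. x - \<epsilon> k *\<^sub>R g" borel borel "A R"] Ameas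
      by (simp add: D_def)
    have eq: "emeasure \<mu> (D k) = emeasure \<mu> (A R)" for k
    proof -
      have "flat_borel S = scale_measure (ennreal (1 ^ dim (tangent S)))
          (distr (flat_borel S) borel (\<lambda>x. - \<epsilon> k *\<^sub>R g + 1 *\<^sub>R x))"
      proof (intro flat_borel_affine S refl)
        fix x assume "x \<in> affine hull S"
        then have "x + (- \<epsilon> k) *\<^sub>R g \<in> affine hull S"
          using g by (intro affine_hull_add_tangent subspace_scale subspace_tangent)
        then show "- \<epsilon> k *\<^sub>R g + 1 *\<^sub>R x \<in> affine hull S" by (simp add: add.commute)
      qed simp
      then have "\<mu> = distr \<mu> borel (\<lambda>x. x - \<epsilon> k *\<^sub>R g)"
        by (simp add: \<mu>_def)
      then have "emeasure \<mu> (A R) = emeasure (distr \<mu> borel (\<lambda>x. x - \<epsilon> k *\<^sub>R g)) (A R)" by simp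
      also have "\<dots> = emeasure \<mu> (D k)"
        using Ameas setsmu sets_eq_imp_space_eq[OF setsmu]
        by (subst emeasure_distr) (auto simp: D_def measurable_cong_sets[OF setsmu refl])
      finally show ?thesis by simp
    qed
    have Dg: "g \<bullet> x = c + \<epsilon> k * (g \<bullet> g)" if "x \<in> D k" for x k
      using that by (simp add: D_def A_def inner_diff_right)
    have disj: "disjoint_family D"
    unfolding disjoint_family_on_def
    proof (intro ballI impI)
      fix m n :: nat assume "m \<noteq> n"
      show "D m \<inter> D n = {}"
      proof (rule ccontr)
        assume "D m \<inter> D n \<noteq> {}"
        then obtain x where "x \<in> D m" "x \<in> D n" by auto
        then have "\<epsilon> m * (g \<bullet> g) = \<epsilon> n * (g \<bullet> g)"
          using Dg[of x m] Dg[of x n] by linarith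
        then show False using g \<open>m \<noteq> n\<close> \<epsilon>(3)[of m n] by simp
      qed
    qed
    have sub: "(\<Union>k. D k) \<subseteq> cball 0 (R + norm g)"
    proof
      fix x assume "x \<in> (\<Union>k. D k)"
      then obtain k where k: "x \<in> D k" by auto
      have "norm x \<le> norm (x - \<epsilon> k *\<^sub>R g) + norm (\<epsilon> k *\<^sub>R g)"
        using norm_triangle_ineq[of "x - \<epsilon> k *\<^sub>R g" "\<epsilon> k *\<^sub>R g"] by simp
      also have "norm (\<epsilon> k *\<^sub>R g) \<le> 1 * norm g"
        unfolding norm_scaleR using \<epsilon>[of k] by (intro mult_right_mono) auto
      also have "norm (x - \<epsilon> k *\<^sub>R g) \<le> R" using k by (simp add: D_def A_def)
      finally show "x \<in> cball 0 (R + norm g)" by simp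
    qed
    have "(\<Sum>k. emeasure \<mu> (D k)) = emeasure \<mu> (\<Union>k. D k)"
      using Dmeas setsmu disj by (intro suminf_emeasure) auto
    also have "\<dots> \<le> emeasure \<mu> (cball 0 (R + norm g))"
      using sub setsmu by (intro emeasure_mono) auto
    also have "\<dots> < \<infinity>" unfolding \<mu>_def by (intro flat_borel_bounded_finite) auto
    finally have fin: "(\<Sum>k::nat. emeasure \<mu> (A R)) < \<infinity>" unfolding eq .
    show ?thesis
    proof (rule ccontr)
      assume "emeasure \<mu> (A R) \<noteq> 0"
      moreover have "emeasure \<mu> (A R) < \<infinity>"
        unfolding \<mu>_def A_def by (intro flat_borel_bounded_finite) auto
      ultimately obtain v where v: "emeasure \<mu> (A R) = ennreal v" "v > 0"
      proof (cases "emeasure \<mu> (A R)")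
        case (real r)
        with \<open>emeasure \<mu> (A R) \<noteq> 0\<close> have "r > 0" by (cases "r = 0") auto
        with real that show ?thesis by blast
      qed simp
      then have "(\<Sum>k::nat. emeasure \<mu> (A R)) = top"
        unfolding v(1) by (intro summable_iff_suminf_neq_top) (simp_all add: summable_const_iff)
      with fin show False by simp
    qed
  qed
  have "{x. g \<bullet> x = c} = (\<Union>n::nat. A (real n))"
    by (auto simp: A_def) (meson real_arch_simple)
  then have "emeasure \<mu> {x. g \<bullet> x = c} = emeasure \<mu> (\<Union>n::nat. A (real n))" by simp
  also have "\<dots> = 0" using null Ameas setsmu by (intro emeasure_UN_eq_0) auto
  finally show ?thesis by (simp add: \<mu>_def)
qed

lemma flat_borel_lowdim_null:
  assumes "S \<noteq> {}" "aff_dim A < aff_dim S" "A \<subseteq> affine hull S"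
  shows "emeasure (flat_borel S) (affine hull A) = 0"
proof (cases "A = {}")
  case False
  have sub: "tangent A \<subseteq> tangent S" by (rule tangent_mono[OF assms(3)])
  have "tangent A \<noteq> tangent S" using dim_tangent[OF False] dim_tangent[OF assms(1)] assms(2) by auto
  then have "span (tangent A) \<subset> span (tangent S)"
    using sub by (simp add: span_eq_iff[THEN iffD2, OF subspace_tangent] psubset_eq)
  then obtain g where g: "g \<noteq> 0" "g \<in> span (tangent S)" "\<And>y. y \<in> span (tangent A) \<Longrightarrow> orthogonal g y"
    using orthogonal_to_subspace_exists_gen by blast
  have gS: "g \<in> tangent S" using g(2) by (simp add: span_eq_iff[THEN iffD2, OF subspace_tangent])
  obtain a where a: "a \<in> A" using False by auto
  have "affine hull A \<subseteq> {x. g \<bullet> x = g \<bullet> a}"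
  proof
    fix x assume "x \<in> affine hull A"
    then have "x - a \<in> tangent A" using a by (intro tangent_diff) (auto intro: hull_inc)
    then have "orthogonal g (x - a)" using g(3) by (simp add: span_base)
    then show "x \<in> {x. g \<bullet> x = g \<bullet> a}" by (simp add: orthogonal_def inner_diff_right)
  qed
  moreover have "emeasure (flat_borel S) {x. g \<bullet> x = g \<bullet> a} = 0"
    by (rule flat_borel_hyperplane_null[OF assms(1) gS g(1)])
  ultimately show ?thesis
    using emeasure_mono[of "affine hull A" "{x. g \<bullet> x = g \<bullet> a}" "flat_borel S"]
    by (simp add: borel_closed closed_hyperplane)
qed simp

lemma sets_flat_measure: "A \<in> sets borel \<Longrightarrow> A \<in> sets (flat_measure S)"
  unfolding flat_measure_eq by (intro sets_completionI_sets) simp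

lemma borel_measurable_flat: "f \<in> borel_measurable borel \<Longrightarrow> f \<in> borel_measurable (flat_borel S)"
  using measurable_cong_sets[OF sets_flat_borel[of S] refl] by blast

lemma borel_measurable_flat_measure:
  "f \<in> borel_measurable borel \<Longrightarrow> f \<in> borel_measurable (flat_measure S)"
  unfolding flat_measure_eq by (intro measurable_completion borel_measurable_flat)

lemma emeasure_flat: "A \<in> sets borel \<Longrightarrow> emeasure (flat_measure S) A = emeasure (flat_borel S) A"
  unfolding flat_measure_eq by simp

lemma emeasure_flat_finite: "bounded A \<Longrightarrow> A \<in> sets borel \<Longrightarrow> emeasure (flat_measure S) A < \<infinity>"
  using flat_borel_bounded_finite[of A S] by (simp add: emeasure_flat)

lemma flat_measure_cong:
  "S \<noteq> {} \<Longrightarrow> S' \<noteq> {} \<Longrightarrow> affine hull S = affine hull S' \<Longrightarrow> flat_measure S = flat_measure S'"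
  using flat_borel_cong[of S S'] by (simp add: flat_measure_eq)

lemma flat_integrable:
  fixes f :: "'a::euclidean_space \<Rightarrow> real"
  assumes "bounded A" "A \<in> sets borel" "f \<in> borel_measurable borel" "\<And>x. x \<in> A \<Longrightarrow> \<bar>f x\<bar> \<le> C"
  shows "set_integrable (flat_measure S) A f"
  unfolding set_integrable_def
  by (rule integrableI_bounded_set_indicator[where B=C])
    (use assms emeasure_flat_finite[OF assms(1,2)] in
      \<open>auto intro: sets_flat_measure borel_measurable_flat_measure\<close>)

lemma flat_measure_pos:
  assumes "bounded A" "A \<in> sets borel" "x \<in> affine hull S" "S \<noteq> {}" "e > 0"
    "cball x e \<inter> affine hull S \<subseteq> A"
  shows "measure (flat_measure S) A > 0"
proof -
  have "emeasure (flat_measure S) A > 0"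
    using flat_borel_open_pos[OF assms(3,4,5,6,2)] assms(2) by (simp add: emeasure_flat)
  then show ?thesis
    using emeasure_flat_finite[OF assms(1,2), of S] by (simp add: measure_def enn2real_positive_iff)
qed

lemma flat_measure_openin_pos:
  assumes "openin (top_of_set (affine hull S)) A" "A \<noteq> {}" "bounded A"
  shows "measure (flat_measure S) A > 0" "A \<in> sets borel"
proof -
  obtain x where x: "x \<in> A" using assms(2) by auto
  have xS: "x \<in> affine hull S" using x assms(1) openin_imp_subset by blast
  obtain e where e: "e > 0" "cball x e \<inter> affine hull S \<subseteq> A"
    using assms(1) x openin_contains_cball[of "affine hull S" A] by auto
  obtain O' where "open O'" "A = affine hull S \<inter> O'" using assms(1) by (auto simp: openin_open)
  then show b: "A \<in> sets borel" by (auto intro: borel_closed)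
  show "measure (flat_measure S) A > 0"
    by (rule flat_measure_pos[OF assms(3) b xS _ e]) (use xS in auto)
qed

text \<open>The homothety \<open>x \<mapsto> (x\<^sub>0 + x)/2\<close> maps the flat onto itself, so this is a change of variables.\<close>

lemma nn_integral_halving:
  assumes S: "S \<noteq> {}" and x0: "x0 \<in> affine hull S" and h: "h \<in> borel_measurable borel"
  shows "(\<integral>\<^sup>+x. h ((1/2) *\<^sub>R x0 + (1/2) *\<^sub>R x) \<partial>flat_borel S)
    = ennreal (2 ^ dim (tangent S)) * (\<integral>\<^sup>+x. h x \<partial>flat_borel S)"
proof -
  let ?\<Phi> = "\<lambda>x. (1/2) *\<^sub>R x0 + (1/2) *\<^sub>R x"
  have "flat_borel S = scale_measure (ennreal ((1/2) ^ dim (tangent S))) (distr (flat_borel S) borel ?\<Phi>)"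
    by (intro flat_borel_affine S refl mem_affine[OF affine_affine_hull x0]) auto
  then have "(\<integral>\<^sup>+x. h x \<partial>flat_borel S) =
      (\<integral>\<^sup>+x. h x \<partial>scale_measure (ennreal ((1/2) ^ dim (tangent S))) (distr (flat_borel S) borel ?\<Phi>))"
    by simp
  also have "\<dots> = ennreal ((1/2) ^ dim (tangent S)) * (\<integral>\<^sup>+x. h x \<partial>distr (flat_borel S) borel ?\<Phi>)"
    using h by (intro nn_integral_scale_measure) simp
  also have "(\<integral>\<^sup>+x. h x \<partial>distr (flat_borel S) borel ?\<Phi>) = (\<integral>\<^sup>+x. h (?\<Phi> x) \<partial>flat_borel S)"
    using h by (intro nn_integral_distr borel_measurable_flat) auto
  finally have "ennreal (2 ^ dim (tangent S)) * (\<integral>\<^sup>+x. h x \<partial>flat_borel S)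
    = (ennreal (2 ^ dim (tangent S)) * ennreal ((1/2) ^ dim (tangent S)))
      * (\<integral>\<^sup>+x. h (?\<Phi> x) \<partial>flat_borel S)"
    by (simp add: mult.assoc)
  also have "ennreal (2 ^ dim (tangent S)) * ennreal ((1/2) ^ dim (tangent S)) = 1"
    by (simp flip: ennreal_mult power_mult_distrib)
  finally show ?thesis by simp
qed

lemma pow_dim_tangent_le: "(2::real) ^ dim (tangent (S :: 'a::euclidean_space set)) \<le> 2 ^ DIM('a)"
  by (intro power_increasing dim_subset_UNIV) auto

text \<open>For a closed simplex \<open>A\<close> and its relative interior \<open>C\<close> this compares the two measures without
  any analysis of the boundary.\<close>

lemma measure_halving:
  fixes S :: "'a::euclidean_space set"
  assumes "S \<noteq> {}" "x0 \<in> affine hull S" "bounded A" "bounded C" "A \<in> sets borel" "C \<in> sets borel"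
    and mid: "\<And>x. x \<in> A \<Longrightarrow> (1/2) *\<^sub>R x0 + (1/2) *\<^sub>R x \<in> C"
  shows "measure (flat_measure S) A \<le> 2 ^ DIM('a) * measure (flat_measure S) C"
proof -
  have "emeasure (flat_borel S) A = (\<integral>\<^sup>+x. indicator A x \<partial>flat_borel S)"
    using assms by simp
  also have "\<dots> \<le> (\<integral>\<^sup>+x. indicator C ((1/2) *\<^sub>R x0 + (1/2) *\<^sub>R x) \<partial>flat_borel S)"
    using mid by (intro nn_integral_mono) (auto split: split_indicator)
  also have "\<dots> = ennreal (2 ^ dim (tangent S)) * (\<integral>\<^sup>+x. indicator C x \<partial>flat_borel S)"
    using assms by (intro nn_integral_halving) auto
  also have "\<dots> = ennreal (2 ^ dim (tangent S)) * emeasure (flat_borel S) C"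
    using assms by simp
  also have "\<dots> \<le> ennreal (2 ^ DIM('a)) * emeasure (flat_borel S) C"
    by (intro mult_right_mono ennreal_leI pow_dim_tangent_le) auto
  finally have "emeasure (flat_measure S) A \<le> ennreal (2 ^ DIM('a)) * emeasure (flat_measure S) C"
    using assms by (simp add: emeasure_flat)
  moreover have "emeasure (flat_measure S) A = ennreal (measure (flat_measure S) A)"
    "emeasure (flat_measure S) C = ennreal (measure (flat_measure S) C)"
    using emeasure_flat_finite[of A S] emeasure_flat_finite[of C S] assms
    by (auto intro!: emeasure_eq_ennreal_measure)
  ultimately show ?thesis by (simp flip: ennreal_mult)
qed

text \<open>Affine fields satisfy an inverse estimate on convex sets: halving the distance to \<open>x\<^sub>0\<close> gives
  \<open>v x\<^sub>0 = 2 v (midpoint) - v x\<close>, so the value at \<open>x\<^sub>0\<close> is controlled by values inside the set.\<close>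

lemma inverse_estimate:
  fixes S :: "'a::euclidean_space set" and v :: "'a \<Rightarrow> 'a"
  assumes S: "S \<noteq> {}" and x0: "x0 \<in> affine hull S" and C: "bounded C" "C \<in> sets borel"
    and mid: "\<And>x. x \<in> C \<Longrightarrow> (1/2) *\<^sub>R x0 + (1/2) *\<^sub>R x \<in> C"
    and v: "v \<in> borel_measurable borel" and bnd: "\<And>x. x \<in> C \<Longrightarrow> norm (v x) \<le> K"
    and aff: "\<And>x. x \<in> C \<Longrightarrow> v ((1/2) *\<^sub>R x0 + (1/2) *\<^sub>R x) = (1/2) *\<^sub>R v x0 + (1/2) *\<^sub>R v x"
  shows "(norm (v x0))\<^sup>2 * measure (flat_measure S) C
    \<le> (8 * 2 ^ DIM('a) + 2) * (LINT x:C|flat_measure S. (norm (v x))\<^sup>2)"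
proof -
  define h where "h x = ennreal (indicator C x * (norm (v x))\<^sup>2)" for x
  let ?\<Phi> = "\<lambda>x. (1/2) *\<^sub>R x0 + (1/2) *\<^sub>R x"
  have hm: "h \<in> borel_measurable borel" unfolding h_def using v C by measurable
  have h\<Phi>m: "(\<lambda>x. h (?\<Phi> x)) \<in> borel_measurable borel"
    by (rule measurable_compose[OF _ hm]) measurable
  have pt: "ennreal ((norm (v x0))\<^sup>2) * indicator C x \<le> 8 * h (?\<Phi> x) + 2 * h x" for x
  proof (cases "x \<in> C")
    case True
    have "v x0 = 2 *\<^sub>R v (?\<Phi> x) - v x" using aff[OF True] by (simp add: algebra_simps)
    then have "norm (v x0) \<le> 2 * norm (v (?\<Phi> x)) + norm (v x)"
      using norm_triangle_ineq4[of "2 *\<^sub>R v (?\<Phi> x)" "v x"] by simp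
    then have "(norm (v x0))\<^sup>2 \<le> (2 * norm (v (?\<Phi> x)) + norm (v x))\<^sup>2" by (intro power_mono) auto
    also have "\<dots> \<le> 8 * (norm (v (?\<Phi> x)))\<^sup>2 + 2 * (norm (v x))\<^sup>2"
      using sum_squares_ge_zero[of "2 * norm (v (?\<Phi> x)) - norm (v x)" 0]
      by (simp add: power2_eq_square algebra_simps)
    finally have "ennreal ((norm (v x0))\<^sup>2) \<le> ennreal (8 * (norm (v (?\<Phi> x)))\<^sup>2 + 2 * (norm (v x))\<^sup>2)"
      by (rule ennreal_leI)
    also have "\<dots> = 8 * h (?\<Phi> x) + 2 * h x"
      using True mid[OF True] by (simp add: h_def ennreal_plus ennreal_mult)
    finally show ?thesis using True by simp
  qed simp
  have "ennreal ((norm (v x0))\<^sup>2) * emeasure (flat_borel S) C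
      = (\<integral>\<^sup>+x. ennreal ((norm (v x0))\<^sup>2) * indicator C x \<partial>flat_borel S)"
    using C by (simp add: nn_integral_cmult_indicator)
  also have "\<dots> \<le> (\<integral>\<^sup>+x. 8 * h (?\<Phi> x) + 2 * h x \<partial>flat_borel S)"
    by (intro nn_integral_mono pt)
  also have "\<dots> = 8 * (\<integral>\<^sup>+x. h (?\<Phi> x) \<partial>flat_borel S) + 2 * (\<integral>\<^sup>+x. h x \<partial>flat_borel S)"
    using borel_measurable_flat[OF hm] borel_measurable_flat[OF h\<Phi>m]
    by (simp add: nn_integral_add nn_integral_cmult)
  also have "(\<integral>\<^sup>+x. h (?\<Phi> x) \<partial>flat_borel S) = ennreal (2 ^ dim (tangent S)) * (\<integral>\<^sup>+x. h x \<partial>flat_borel S)"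
    by (rule nn_integral_halving[OF S x0 hm])
  also have "8 * (ennreal (2 ^ dim (tangent S)) * (\<integral>\<^sup>+x. h x \<partial>flat_borel S))
      + 2 * (\<integral>\<^sup>+x. h x \<partial>flat_borel S)
    \<le> 8 * (ennreal (2 ^ DIM('a)) * (\<integral>\<^sup>+x. h x \<partial>flat_borel S))
      + 2 * (\<integral>\<^sup>+x. h x \<partial>flat_borel S)"
    by (intro add_right_mono mult_left_mono mult_right_mono ennreal_leI pow_dim_tangent_le) auto
  also have "(\<integral>\<^sup>+x. h x \<partial>flat_borel S) = (\<integral>\<^sup>+x. h x \<partial>flat_measure S)"
    by (simp add: flat_measure_eq nn_integral_completion)
  also have "\<dots> = ennreal (LINT x:C|flat_measure S. (norm (v x))\<^sup>2)"
  proof -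
    have "set_integrable (flat_measure S) C (\<lambda>x. (norm (v x))\<^sup>2)"
    proof (rule flat_integrable[OF C, where C="K\<^sup>2"])
      show "\<bar>(norm (v x))\<^sup>2\<bar> \<le> K\<^sup>2" if "x \<in> C" for x
        using bnd[OF that] by (simp add: power_mono)
    qed (use v in measurable)
    then show ?thesis
      unfolding h_def set_integrable_def set_lebesgue_integral_def real_scaleR_def
      by (intro nn_integral_eq_integral) auto
  qed
  finally have *: "ennreal ((norm (v x0))\<^sup>2) * emeasure (flat_borel S) C
    \<le> 8 * (ennreal (2 ^ DIM('a)) * ennreal (LINT x:C|flat_measure S. (norm (v x))\<^sup>2))
      + 2 * ennreal (LINT x:C|flat_measure S. (norm (v x))\<^sup>2)" .
  have I: "0 \<le> (LINT x:C|flat_measure S. (norm (v x))\<^sup>2)"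
    unfolding set_lebesgue_integral_def by (intro integral_nonneg_AE) auto
  have E: "emeasure (flat_borel S) C = ennreal (measure (flat_measure S) C)"
    using emeasure_flat_finite[OF C, of S] C(2)
    by (subst emeasure_flat[symmetric]) (auto intro!: emeasure_eq_ennreal_measure)
  have "ennreal ((norm (v x0))\<^sup>2 * measure (flat_measure S) C)
    \<le> ennreal ((8 * 2 ^ DIM('a) + 2) * (LINT x:C|flat_measure S. (norm (v x))\<^sup>2))"
    using * I unfolding E
    by (simp add: ennreal_mult distrib_right ennreal_plus mult.assoc)
  then show ?thesis using I by (simp add: ennreal_le_iff)
qed

text \<open>Finitely many flats of smaller dimension meet the flat in a null set.\<close>

lemma generic_point_pos:
  assumes "S \<noteq> {}" "X \<subseteq> affine hull S" "emeasure (flat_measure S) X > 0" "finite \<F>"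
    "\<And>A. A \<in> \<F> \<Longrightarrow> aff_dim A < aff_dim S"
  obtains x where "x \<in> X" "\<And>A. A \<in> \<F> \<Longrightarrow> x \<notin> affine hull A"
proof -
  define N where "N A = affine hull (affine hull A \<inter> affine hull S)" for A :: "'a set"
  have Nb: "N A \<in> sets borel" for A unfolding N_def by (intro borel_closed) auto
  have null: "emeasure (flat_borel S) (N A) = 0" if "A \<in> \<F>" for A
    unfolding N_def
  proof (rule flat_borel_lowdim_null[OF assms(1)])
    have "aff_dim (affine hull A \<inter> affine hull S) \<le> aff_dim (affine hull A)"
      by (intro aff_dim_subset) auto
    then show "aff_dim (affine hull A \<inter> affine hull S) < aff_dim S" using assms(5)[OF that] by simp
  qed auto
  have "\<not> X \<subseteq> (\<Union>A\<in>\<F>. N A)"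
  proof
    assume sub: "X \<subseteq> (\<Union>A\<in>\<F>. N A)"
    have b: "(\<Union>A\<in>\<F>. N A) \<in> sets borel" using Nb assms(4) by (intro sets.finite_UN) auto
    have "emeasure (flat_measure S) X \<le> emeasure (flat_measure S) (\<Union>A\<in>\<F>. N A)"
      using sub by (intro emeasure_mono sets_flat_measure b)
    also have "\<dots> = emeasure (flat_borel S) (\<Union>A\<in>\<F>. N A)" by (rule emeasure_flat[OF b])
    also have "\<dots> \<le> (\<Sum>A\<in>\<F>. emeasure (flat_borel S) (N A))"
      using assms(4) Nb by (intro emeasure_subadditive_finite) auto
    also have "\<dots> = 0" using null by simp
    finally show False using assms(3) by simp
  qed
  then obtain x where x: "x \<in> X" "\<And>A. A \<in> \<F> \<Longrightarrow> x \<notin> N A" by auto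
  have "x \<notin> affine hull A" if "A \<in> \<F>" for A
    using x(2)[OF that] x(1) assms(2) unfolding N_def by (auto intro: hull_inc)
  with x(1) show thesis by (rule that)
qed

lemma generic_point:
  assumes "U \<noteq> {}" "openin (top_of_set (affine hull S)) U" "finite \<F>"
    "\<And>A. A \<in> \<F> \<Longrightarrow> aff_dim A < aff_dim S"
  obtains x where "x \<in> U" "\<And>A. A \<in> \<F> \<Longrightarrow> x \<notin> affine hull A"
proof -
  obtain y where y: "y \<in> U" using assms(1) by auto
  have US: "U \<subseteq> affine hull S" using assms(2) by (rule openin_imp_subset)
  then have S: "S \<noteq> {}" using y by auto
  obtain e where e: "e > 0" "cball y e \<inter> affine hull S \<subseteq> U"
    using assms(2) y openin_contains_cball[of "affine hull S" U] by auto
  have Vm: "cball y e \<inter> affine hull S \<in> sets borel" by (intro sets.Int borel_closed) auto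
  have "emeasure (flat_measure S) (cball y e \<inter> affine hull S) > 0"
    using flat_borel_open_pos[OF subsetD[OF US y] S e(1) subset_refl Vm] Vm by (simp add: emeasure_flat)
  then show thesis
    by (rule generic_point_pos[OF S Int_lower2 _ assms(3,4)]) (use e(2) that in blast)+
qed

section \<open>Barycentric coordinates and Raviart--Thomas fields on a simplex\<close>

text \<open>Extreme points make the vertex set a function of the simplex.\<close>

definition verts :: "'a::euclidean_space set \<Rightarrow> 'a set" where
  "verts T = {x. x extreme_point_of T}"

lemma simplex_verts:
  assumes "n simplex T"
  shows "\<not> affine_dependent (verts T)" "T = convex hull (verts T)" "int (card (verts T)) = n + 1"
    "finite (verts T)"
proof -
  obtain C where C: "\<not> affine_dependent C" "int (card C) = n + 1" "T = convex hull C"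
    using assms by (auto simp: simplex_def)
  then have "verts T = C" by (simp add: verts_def extreme_point_of_convex_hull_affine_independent)
  with C show "\<not> affine_dependent (verts T)" "T = convex hull (verts T)" "int (card (verts T)) = n + 1"
    "finite (verts T)" by (auto intro: aff_independent_finite)
qed

text \<open>The functional that equals -1 on all edges starting at \<open>u\<close> exists because the edges are independent; its Riesz vector is
  projected to the tangent space.\<close>

definition bary_grad :: "'a::euclidean_space set \<Rightarrow> 'a \<Rightarrow> 'a" where
  "bary_grad T u = (SOME g. g \<in> tangent T \<and> (\<forall>c\<in>verts T - {u}. g \<bullet> (u - c) = 1))"

definition bary :: "'a::euclidean_space set \<Rightarrow> 'a \<Rightarrow> 'a \<Rightarrow> real" where
  "bary T u x = 1 + bary_grad T u \<bullet> (x - u)"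

definition opposite_facet :: "'a::euclidean_space set \<Rightarrow> 'a \<Rightarrow> 'a set" where
  "opposite_facet T u = convex hull (verts T - {u})"

locale simplex_geometry =
  fixes T :: "'a::euclidean_space set" and n :: int
  assumes simplex_T: "n simplex T"
begin

abbreviation "V \<equiv> verts T"

lemmas vt = simplex_verts[OF simplex_T]

lemma hullV: "convex hull V = T" using vt(2) by (rule sym)

lemma vT: "u \<in> V \<Longrightarrow> u \<in> T" using hull_inc[of u V convex] hullV by simp

lemma affT: "affine hull T = affine hull V"
  using affine_hull_convex_hull[of V] hullV by simp

lemma bary_grad: assumes u: "u \<in> V"
  shows "bary_grad T u \<in> tangent T" "c \<in> V \<Longrightarrow> c \<noteq> u \<Longrightarrow> bary_grad T u \<bullet> (u - c) = 1"
proof -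
  have ind: "independent ((\<lambda>x. - u + x) ` (V - {u}))"
    using vt(1) affine_dependent_iff_dependent2[OF u] by simp
  obtain f :: "'a \<Rightarrow> real" where f: "linear f" "\<forall>x\<in>(\<lambda>x. - u + x) ` (V - {u}). f x = -1"
    using linear_independent_extend[OF ind, of "\<lambda>_. -1"] by blast
  obtain y z where yz: "y \<in> span (tangent T)" "\<And>w. w \<in> span (tangent T) \<Longrightarrow> orthogonal z w"
    "adjoint f 1 = y + z"
    using orthogonal_subspace_decomp_exists[of "tangent T" "adjoint f 1"] by metis
  have sp: "span (tangent T) = tangent T" by (simp add: span_eq_iff)
  have "y \<bullet> (u - c) = 1" if c: "c \<in> V" "c \<noteq> u" for c
  proof -
    have "u - c \<in> tangent T" using u c vT by (intro tangent_diff) (auto intro: hull_inc)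
    then have "z \<bullet> (u - c) = 0" using yz(2) sp by (auto simp: orthogonal_def)
    then have "y \<bullet> (u - c) = adjoint f 1 \<bullet> (u - c)" using yz(3) by (simp add: inner_add_left)
    also have "\<dots> = f (u - c)" using adjoint_works[OF f(1), of "u - c" 1] by (simp add: inner_commute)
    also have "\<dots> = - f (- u + c)" using linear_neg[OF f(1), of "u - c"] by simp
    also have "f (- u + c) = -1" using f(2) c by blast
    finally show ?thesis by simp
  qed
  then have "\<exists>g. g \<in> tangent T \<and> (\<forall>c\<in>V - {u}. g \<bullet> (u - c) = 1)" using yz(1) sp by auto
  from someI_ex[OF this] have "bary_grad T u \<in> tangent T \<and> (\<forall>c\<in>V - {u}. bary_grad T u \<bullet> (u - c) = 1)"
    unfolding bary_grad_def .
  then show "bary_grad T u \<in> tangent T" "c \<in> V \<Longrightarrow> c \<noteq> u \<Longrightarrow> bary_grad T u \<bullet> (u - c) = 1" by auto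
qed

lemma bary_vertex: "u \<in> V \<Longrightarrow> c \<in> V \<Longrightarrow> bary T u c = (if c = u then 1 else 0)"
  using bary_grad(2)[of u c] by (auto simp: bary_def inner_diff_right)

lemma bary_diff: "bary T u x - bary T u y = bary_grad T u \<bullet> (x - y)"
  by (simp add: bary_def inner_diff_right)

lemma bary_add: "bary T u (x + w) = bary T u x + bary_grad T u \<bullet> w"
  by (simp add: bary_def inner_add_right inner_diff_right)

text \<open>The affine function \<open>bary T u\<close> is the barycentric coordinate of the vertex \<open>u\<close>.\<close>

lemma bary_comb:
  assumes "u \<in> V" "sum \<alpha> V = 1"
  shows "bary T u (\<Sum>c\<in>V. \<alpha> c *\<^sub>R c) = \<alpha> u"
proof -
  have "(\<Sum>c\<in>V. \<alpha> c *\<^sub>R c) - u = (\<Sum>c\<in>V. \<alpha> c *\<^sub>R (c - u))"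
    using assms(2) by (simp add: scaleR_diff_right sum_subtractf flip: scaleR_sum_left)
  then have "bary T u (\<Sum>c\<in>V. \<alpha> c *\<^sub>R c) = 1 + (\<Sum>c\<in>V. \<alpha> c * (bary_grad T u \<bullet> (c - u)))"
    by (simp add: bary_def inner_sum_right)
  also have "(\<Sum>c\<in>V. \<alpha> c * (bary_grad T u \<bullet> (c - u))) = (\<Sum>c\<in>V. \<alpha> c * (bary T u c - 1))"
    by (simp add: bary_def)
  also have "\<dots> = (\<Sum>c\<in>V. (if c = u then \<alpha> c else 0) - \<alpha> c)"
    using assms(1) by (intro sum.cong) (auto simp: bary_vertex)
  also have "\<dots> = \<alpha> u - 1" using assms vt(4) by (simp add: sum_subtractf)
  finally show ?thesis by simp
qed

lemma bary_expand:
  assumes "x \<in> affine hull T"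
  shows "(\<Sum>u\<in>V. bary T u x) = 1" "(\<Sum>u\<in>V. bary T u x *\<^sub>R u) = x"
proof -
  obtain \<alpha> where a: "sum \<alpha> V = 1" "(\<Sum>c\<in>V. \<alpha> c *\<^sub>R c) = x"
    using assms affT affine_hull_finite[OF vt(4)] by auto
  have "bary T u x = \<alpha> u" if "u \<in> V" for u using bary_comb[OF that a(1)] a(2) by simp
  with a show "(\<Sum>u\<in>V. bary T u x) = 1" "(\<Sum>u\<in>V. bary T u x *\<^sub>R u) = x" by auto
qed

lemma bary_grad_expand:
  assumes "w \<in> tangent T" "T \<noteq> {}"
  shows "(\<Sum>u\<in>V. bary_grad T u \<bullet> w) = 0" "(\<Sum>u\<in>V. (bary_grad T u \<bullet> w) *\<^sub>R u) = w"
proof -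
  obtain x where "x \<in> T" using assms(2) by auto
  then have x: "x \<in> affine hull T" by (rule hull_inc)
  have xw: "x + w \<in> affine hull T" by (rule affine_hull_add_tangent[OF x assms(1)])
  have "(\<Sum>u\<in>V. bary T u (x + w)) - (\<Sum>u\<in>V. bary T u x) = (\<Sum>u\<in>V. bary_grad T u \<bullet> w)"
    by (simp add: bary_add sum.distrib)
  then show "(\<Sum>u\<in>V. bary_grad T u \<bullet> w) = 0" using bary_expand(1)[OF x] bary_expand(1)[OF xw] by simp
  have "(\<Sum>u\<in>V. bary T u (x + w) *\<^sub>R u) - (\<Sum>u\<in>V. bary T u x *\<^sub>R u) = (\<Sum>u\<in>V. (bary_grad T u \<bullet> w) *\<^sub>R u)"
    by (simp add: bary_add sum.distrib scaleR_add_left)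
  then show "(\<Sum>u\<in>V. (bary_grad T u \<bullet> w) *\<^sub>R u) = w" using bary_expand(2)[OF x] bary_expand(2)[OF xw] by simp
qed

lemma mem_T_iff: "x \<in> T \<longleftrightarrow> x \<in> affine hull T \<and> (\<forall>u\<in>V. 0 \<le> bary T u x)"
proof
  assume x: "x \<in> T"
  then obtain \<alpha> where a: "\<forall>c\<in>V. 0 \<le> \<alpha> c" "sum \<alpha> V = 1" "(\<Sum>c\<in>V. \<alpha> c *\<^sub>R c) = x"
    using hullV[symmetric] unfolding convex_hull_finite[OF vt(4)] by blast
  then show "x \<in> affine hull T \<and> (\<forall>u\<in>V. 0 \<le> bary T u x)"
    using x bary_comb[OF _ a(2)] by (auto intro: hull_inc)
next
  assume x: "x \<in> affine hull T \<and> (\<forall>u\<in>V. 0 \<le> bary T u x)"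
  then have "x \<in> convex hull V"
    using bary_expand[of x] convex_hull_finite[OF vt(4)] by auto
  then show "x \<in> T" using hullV by simp
qed

lemma mem_rint_iff: "x \<in> rel_interior T \<longleftrightarrow> x \<in> affine hull T \<and> (\<forall>u\<in>V. 0 < bary T u x)"
proof
  assume x: "x \<in> rel_interior T"
  then obtain \<alpha> where a: "\<forall>c\<in>V. 0 < \<alpha> c" "sum \<alpha> V = 1" "(\<Sum>c\<in>V. \<alpha> c *\<^sub>R c) = x"
    using hullV rel_interior_convex_hull_explicit[OF vt(1)] by auto
  then show "x \<in> affine hull T \<and> (\<forall>u\<in>V. 0 < bary T u x)"
    using x bary_comb[OF _ a(2)] rel_interior_subset[of T] by (auto intro: hull_inc)
next
  assume x: "x \<in> affine hull T \<and> (\<forall>u\<in>V. 0 < bary T u x)"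
  then have "x \<in> rel_interior (convex hull V)"
    using bary_expand[of x] rel_interior_convex_hull_explicit[OF vt(1)] by auto
  then show "x \<in> rel_interior T" using hullV by simp
qed

lemma facet_iff: "F facet_of T \<longleftrightarrow> 1 \<le> n \<and> (\<exists>u\<in>V. F = opposite_facet T u)"
proof -
  have "F facet_of T \<longleftrightarrow> F facet_of (convex hull V)" using hullV by simp
  also have "\<dots> \<longleftrightarrow> 2 \<le> card V \<and> (\<exists>u. u \<in> V \<and> F = convex hull (V - {u}))"
    by (rule facet_of_convex_hull_affine_independent_alt[OF vt(1)])
  also have "\<dots> \<longleftrightarrow> 1 \<le> n \<and> (\<exists>u\<in>V. F = opposite_facet T u)" using vt(3) by (auto simp: opposite_facet_def)
  finally show ?thesis .
qed

lemma opposite_facet_simplex: assumes "u \<in> V" shows "(n - 1) simplex (opposite_facet T u)" "verts (opposite_facet T u) = V - {u}"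
proof -
  have ind: "\<not> affine_dependent (V - {u})" using vt(1) affine_independent_subset by blast
  show "(n - 1) simplex (opposite_facet T u)"
    using ind vt(3,4) assms card_Diff_singleton[OF assms] card_gt_0_iff[of V]
    by (auto simp: simplex_def opposite_facet_def of_nat_diff intro!: exI[of _ "V - {u}"])
  show "verts (opposite_facet T u) = V - {u}"
    unfolding opposite_facet_def unfolding verts_def[of "convex hull _"]
    using extreme_point_of_convex_hull_affine_independent[OF ind] by auto
qed

lemma opposite_facet_comb:
  assumes u: "u \<in> V"
  shows "x \<in> opposite_facet T u \<longleftrightarrow> x \<in> T \<and> bary T u x = 0"
proof
  assume "x \<in> opposite_facet T u"
  then obtain \<alpha> where a: "\<forall>c\<in>V - {u}. 0 \<le> \<alpha> c" "sum \<alpha> (V - {u}) = 1" "(\<Sum>c\<in>V - {u}. \<alpha> c *\<^sub>R c) = x"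
    using convex_hull_finite[of "V - {u}"] vt(4) unfolding opposite_facet_def by auto
  define \<beta> where "\<beta> = \<alpha>(u := 0)"
  have b: "sum \<beta> V = 1" "(\<Sum>c\<in>V. \<beta> c *\<^sub>R c) = x"
    using a vt(4) u by (simp_all add: sum.remove[OF vt(4) u] \<beta>_def)
  have "x \<in> T" using \<open>x \<in> opposite_facet T u\<close> hull_mono[of "V - {u}" V] hullV unfolding opposite_facet_def by auto
  moreover have "bary T u x = 0" using bary_comb[OF u b(1)] b(2) by (simp add: \<beta>_def)
  ultimately show "x \<in> T \<and> bary T u x = 0" by simp
next
  assume x: "x \<in> T \<and> bary T u x = 0"
  then have e: "(\<Sum>u\<in>V. bary T u x) = 1" "(\<Sum>u\<in>V. bary T u x *\<^sub>R u) = x" "\<forall>u\<in>V. 0 \<le> bary T u x"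
    using bary_expand[of x] mem_T_iff by auto
  then have "(\<Sum>c\<in>V - {u}. bary T c x) = 1" "(\<Sum>c\<in>V - {u}. bary T c x *\<^sub>R c) = x"
    using x by (simp_all add: sum.remove[OF vt(4) u])
  then show "x \<in> opposite_facet T u"
    unfolding opposite_facet_def using e(3) vt(4) convex_hull_finite[of "V - {u}"] by auto
qed

lemma rint_opposite_facet:
  assumes u: "u \<in> V" and x: "x \<in> rel_interior (opposite_facet T u)"
  shows "x \<in> T" "bary T u x = 0" "\<And>c. c \<in> V \<Longrightarrow> c \<noteq> u \<Longrightarrow> 0 < bary T c x"
proof -
  have "x \<in> opposite_facet T u" using x rel_interior_subset by blast
  then show "x \<in> T" "bary T u x = 0" using opposite_facet_comb[OF u] by auto
  have ind: "\<not> affine_dependent (V - {u})" using vt(1) affine_independent_subset by blast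
  obtain \<alpha> where a: "\<forall>c\<in>V - {u}. 0 < \<alpha> c" "sum \<alpha> (V - {u}) = 1" "(\<Sum>c\<in>V - {u}. \<alpha> c *\<^sub>R c) = x"
    using x rel_interior_convex_hull_explicit[OF ind] unfolding opposite_facet_def by auto
  define \<beta> where "\<beta> = \<alpha>(u := 0)"
  have b: "sum \<beta> V = 1" "(\<Sum>c\<in>V. \<beta> c *\<^sub>R c) = x"
    using a vt(4) u by (simp_all add: sum.remove[OF vt(4) u] \<beta>_def)
  show "0 < bary T c x" if "c \<in> V" "c \<noteq> u" for c
    using bary_comb[OF that(1) b(1)] b(2) a(1) that by (simp add: \<beta>_def)
qed

lemma opposite_facet_inj: "u \<in> V \<Longrightarrow> c \<in> V \<Longrightarrow> opposite_facet T u = opposite_facet T c \<Longrightarrow> u = c"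
proof -
  assume "u \<in> V" "c \<in> V" "opposite_facet T u = opposite_facet T c"
  then have "V - {u} = V - {c}" using opposite_facet_simplex(2)[of u] opposite_facet_simplex(2)[of c] by simp
  with \<open>u \<in> V\<close> \<open>c \<in> V\<close> show "u = c" by auto
qed

lemma other_vertex: assumes "1 \<le> n" "u \<in> V" obtains c where "c \<in> V" "c \<noteq> u"
proof -
  have "2 \<le> card V" using vt(3) assms by simp
  then have "V \<noteq> {u}" by auto
  then obtain c where "c \<in> V" "c \<noteq> u" using assms(2) by auto
  then show ?thesis by (rule that)
qed

lemma bary_grad_nz: assumes "1 \<le> n" "u \<in> V" shows "bary_grad T u \<noteq> 0"
proof -
  obtain c where "c \<in> V" "c \<noteq> u" using other_vertex[OF assms] .
  from bary_grad(2)[OF assms(2) this] show ?thesis by auto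
qed

lemma T_ne: "1 \<le> n \<Longrightarrow> T \<noteq> {}" using simplex_T simplex_empty by force

text \<open>Vectors orthogonal to the gradient have no component along \<open>u\<close> in the barycentric expansion, so they are
  combinations of edges of the facet opposite to \<open>u\<close>.\<close>

lemma tangent_opposite_facet:
  assumes n: "1 \<le> n" and u: "u \<in> V"
  shows "tangent (opposite_facet T u) = {y \<in> tangent T. bary_grad T u \<bullet> y = 0}"
proof
  show "tangent (opposite_facet T u) \<subseteq> {y \<in> tangent T. bary_grad T u \<bullet> y = 0}"
    unfolding tangent_def[of "opposite_facet T u"]
  proof (rule span_minimal)
    show "{x - y |x y. x \<in> opposite_facet T u \<and> y \<in> opposite_facet T u} \<subseteq> {y \<in> tangent T. bary_grad T u \<bullet> y = 0}"
    proof clarify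
      fix x y assume xy: "x \<in> opposite_facet T u" "y \<in> opposite_facet T u"
      then have "bary_grad T u \<bullet> (x - y) = 0" using opposite_facet_comb[OF u] bary_diff[of u x y] by simp
      moreover have "x - y \<in> tangent T" using xy opposite_facet_comb[OF u] by (intro tangent_diff hull_inc) auto
      ultimately show "x - y \<in> tangent T \<and> bary_grad T u \<bullet> (x - y) = 0" by simp
    qed
    show "subspace {y \<in> tangent T. bary_grad T u \<bullet> y = 0}"
      unfolding subspace_def by (auto simp: inner_add_right subspace_0 subspace_add subspace_scale)
  qed
  show "{y \<in> tangent T. bary_grad T u \<bullet> y = 0} \<subseteq> tangent (opposite_facet T u)"
  proof
    fix y assume y: "y \<in> {y \<in> tangent T. bary_grad T u \<bullet> y = 0}"
    obtain c0 where c0: "c0 \<in> V" "c0 \<noteq> u" using other_vertex[OF n u] .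
    have e: "(\<Sum>c\<in>V. bary_grad T c \<bullet> y) = 0" "(\<Sum>c\<in>V. (bary_grad T c \<bullet> y) *\<^sub>R c) = y"
      using bary_grad_expand[of y] y T_ne[OF n] by auto
    have "y = (\<Sum>c\<in>V. (bary_grad T c \<bullet> y) *\<^sub>R (c - c0))"
      using e by (simp add: scaleR_diff_right sum_subtractf flip: scaleR_sum_left)
    also have "\<dots> \<in> tangent (opposite_facet T u)"
    proof (intro subspace_sum subspace_tangent)
      fix c assume c: "c \<in> V"
      show "(bary_grad T c \<bullet> y) *\<^sub>R (c - c0) \<in> tangent (opposite_facet T u)"
      proof (cases "c = u")
        case True then show ?thesis using y subspace_0[OF subspace_tangent] by simp
      next
        case False
        then have "c \<in> opposite_facet T u" "c0 \<in> opposite_facet T u"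
          using c c0 unfolding opposite_facet_def by (auto intro: hull_inc)
        then show ?thesis by (intro subspace_scale subspace_tangent tangent_diff hull_inc)
      qed
    qed
    finally show "y \<in> tangent (opposite_facet T u)" .
  qed
qed

text \<open>The facet has codimension one in the simplex, so its normal within the tangent space is a multiple of
  the barycentric gradient; the sign condition fixes the multiple.\<close>

lemma normal_to_opposite_facet:
  assumes n: "1 \<le> n" and u: "u \<in> V" and w: "w \<in> tangent T" "norm w = 1"
    and orth: "\<And>y. y \<in> tangent (opposite_facet T u) \<Longrightarrow> w \<bullet> y = 0" and sgn: "bary_grad T u \<bullet> w \<le> 0"
  shows "w = - (1 / norm (bary_grad T u)) *\<^sub>R bary_grad T u"
proof -
  define g where "g = bary_grad T u"
  have g: "g \<in> tangent T" "g \<noteq> 0" using bary_grad(1)[OF u] bary_grad_nz[OF n u] by (auto simp: g_def)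
  define k where "k = (g \<bullet> w) / (g \<bullet> g)"
  define z where "z = w - k *\<^sub>R g"
  have gz: "g \<bullet> z = 0" using g by (simp add: z_def k_def inner_diff_right)
  have "z \<in> tangent T" unfolding z_def using w g by (intro subspace_diff subspace_scale) auto
  then have "z \<in> tangent (opposite_facet T u)" using tangent_opposite_facet[OF n u] gz by (simp add: g_def)
  then have "w \<bullet> z = 0" by (rule orth)
  then have "z \<bullet> z = 0" using gz by (simp add: z_def inner_diff_left)
  then have wk: "w = k *\<^sub>R g" by (simp add: z_def)
  then have "\<bar>k\<bar> * norm g = 1" using w by simp
  moreover have "k \<le> 0" using sgn g by (simp add: k_def g_def[symmetric] divide_nonpos_pos)
  ultimately have "k = - (1 / norm g)" using g by (simp add: field_simps)
  then show ?thesis using wk by (simp add: g_def)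
qed

lemma outer_normal_opposite_facet:
  assumes n: "1 \<le> n" and u: "u \<in> V"
  shows "outer_normal T (opposite_facet T u) = - (1 / norm (bary_grad T u)) *\<^sub>R bary_grad T u" (is "_ = ?\<nu>")
  unfolding outer_normal_def
proof (rule the_equality)
  let ?g = "bary_grad T u"
  have g: "?g \<noteq> 0" "?g \<in> tangent T" using bary_grad_nz[OF n u] bary_grad(1)[OF u] by auto
  have "?\<nu> \<bullet> (y - x) \<le> 0" if "x \<in> opposite_facet T u" "y \<in> T" for x y
  proof -
    have "0 \<le> ?g \<bullet> (y - x)" using bary_diff[of u y x] opposite_facet_comb[OF u] that mem_T_iff u by auto
    then show ?thesis by (simp add: divide_nonneg_nonneg)
  qed
  then show "norm ?\<nu> = 1 \<and> ?\<nu> \<in> tangent T \<and> (\<forall>x\<in>opposite_facet T u. \<forall>y\<in>T. ?\<nu> \<bullet> (y - x) \<le> 0)"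
    using g by (auto intro!: subspace_scale subspace_neg)
next
  fix \<nu> assume \<nu>: "norm \<nu> = 1 \<and> \<nu> \<in> tangent T \<and> (\<forall>x\<in>opposite_facet T u. \<forall>y\<in>T. \<nu> \<bullet> (y - x) \<le> 0)"
  have FT: "opposite_facet T u \<subseteq> T" using opposite_facet_comb[OF u] by auto
  have "{x - y |x y. x \<in> opposite_facet T u \<and> y \<in> opposite_facet T u} \<subseteq> {y. \<nu> \<bullet> y = 0}"
  proof clarify
    fix x y assume "x \<in> opposite_facet T u" "y \<in> opposite_facet T u"
    then have "\<nu> \<bullet> (x - y) \<le> 0" "\<nu> \<bullet> (y - x) \<le> 0" using \<nu> FT by blast+
    then show "\<nu> \<bullet> (x - y) = 0" by (simp add: inner_diff_right)
  qed
  then have "tangent (opposite_facet T u) \<subseteq> {y. \<nu> \<bullet> y = 0}"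
    unfolding tangent_def by (intro span_minimal subspace_hyperplane)
  then have orth: "\<nu> \<bullet> y = 0" if "y \<in> tangent (opposite_facet T u)" for y using that by auto
  obtain c where c: "c \<in> V" "c \<noteq> u" using other_vertex[OF n u] .
  have cF: "c \<in> opposite_facet T u" using c unfolding opposite_facet_def by (auto intro: hull_inc)
  show "\<nu> = ?\<nu>"
  proof (cases "bary_grad T u \<bullet> \<nu> \<le> 0")
    case True
    then show ?thesis using normal_to_opposite_facet[OF n u _ _ orth] \<nu> by blast
  next
    case False
    moreover have "- \<nu> \<in> tangent T" using \<nu> by (intro subspace_neg) auto
    ultimately have "- \<nu> = ?\<nu>" using normal_to_opposite_facet[OF n u, of "- \<nu>"] \<nu> orth by simp
    then have "\<nu> = (1 / norm (bary_grad T u)) *\<^sub>R bary_grad T u" by (metis minus_minus scaleR_minus_left)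
    then have "\<nu> \<bullet> (u - c) = 1 / norm (bary_grad T u)" using bary_grad(2)[OF u c] by simp
    moreover have "\<nu> \<bullet> (u - c) \<le> 0" using \<nu> cF vT[OF u] by blast
    ultimately show ?thesis using bary_grad_nz[OF n u] by simp
  qed
qed

text \<open>Moving inwards increases the coordinate of \<open>u\<close>, which is 0 on the facet, while the other coordinates stay
  positive for a short time.\<close>

lemma enter_simplex:
  assumes n: "1 \<le> n" and u: "u \<in> V" and x: "x \<in> rel_interior (opposite_facet T u)"
  shows "\<forall>\<^sub>F t in at_right 0. x - t *\<^sub>R outer_normal T (opposite_facet T u) \<in> rel_interior T"
proof -
  let ?\<nu> = "outer_normal T (opposite_facet T u)"
  have \<nu>: "?\<nu> = - (1 / norm (bary_grad T u)) *\<^sub>R bary_grad T u" by (rule outer_normal_opposite_facet[OF n u])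
  have \<nu>T: "?\<nu> \<in> tangent T" unfolding \<nu> using bary_grad(1)[OF u] by (intro subspace_scale) auto
  have xA: "x \<in> affine hull T" using rint_opposite_facet(1)[OF u x] by (rule hull_inc)
  have aff: "x - t *\<^sub>R ?\<nu> \<in> affine hull T" for t
    using affine_hull_add_tangent[OF xA, of "(- t) *\<^sub>R ?\<nu>"] \<nu>T by (simp add: subspace_scale subspace_neg)
  have b: "bary T c (x - t *\<^sub>R ?\<nu>) = bary T c x - t * (bary_grad T c \<bullet> ?\<nu>)" for c t
    using bary_add[of c x "(- t) *\<^sub>R ?\<nu>"] by simp
  have ev: "\<forall>\<^sub>F t in at_right 0. 0 < bary T c (x - t *\<^sub>R ?\<nu>)" if c: "c \<in> V" for c
  proof (cases "c = u")
    case True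
    have "bary_grad T u \<bullet> ?\<nu> < 0"
      unfolding \<nu> using bary_grad_nz[OF n u] by (simp add: divide_neg_pos)
    then show ?thesis
      unfolding b True using rint_opposite_facet(2)[OF u x] eventually_at_right_less[of "0::real"]
      by (auto elim!: eventually_mono simp: mult_pos_neg)
  next
    case False
    have "((\<lambda>t. bary T c x - t * (bary_grad T c \<bullet> ?\<nu>)) \<longlongrightarrow> bary T c x - 0 * (bary_grad T c \<bullet> ?\<nu>)) (at_right 0)"
      by (intro tendsto_intros)
    then show ?thesis unfolding b using rint_opposite_facet(3)[OF u x c False]
      by (auto dest: order_tendstoD(1))
  qed
  then have "\<forall>\<^sub>F t in at_right 0. \<forall>c\<in>V. 0 < bary T c (x - t *\<^sub>R ?\<nu>)"
    using vt(4) by (simp add: eventually_ball_finite_distrib)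
  then show ?thesis using aff by (auto elim!: eventually_mono simp: mem_rint_iff)
qed

lemma entering_normal:
  assumes n: "1 \<le> n" and u: "u \<in> V" and x: "x \<in> opposite_facet T u" and w: "w \<in> tangent T" "norm w = 1"
    and orth: "\<And>y. y \<in> tangent (opposite_facet T u) \<Longrightarrow> w \<bullet> y = 0" and t: "t > 0" "x - t *\<^sub>R w \<in> T"
  shows "w = outer_normal T (opposite_facet T u)"
proof -
  have "0 \<le> bary T u (x + (- t) *\<^sub>R w)" using t(2) mem_T_iff u by simp
  also have "\<dots> = - t * (bary_grad T u \<bullet> w)"
    unfolding bary_add using x opposite_facet_comb[OF u] by simp
  finally have "bary_grad T u \<bullet> w \<le> 0" using t(1) by (simp add: mult_le_0_iff)
  then show ?thesis using normal_to_opposite_facet[OF n u w orth] outer_normal_opposite_facet[OF n u] by simp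
qed

text \<open>The length of the barycentric gradient is the inverse of the height over the opposite facet.\<close>

definition rtb :: "'a \<Rightarrow> 'a \<Rightarrow> 'a" where
  "rtb u x = norm (bary_grad T u) *\<^sub>R (x - u)"

lemma rtb_RT0: assumes "u \<in> V" shows "rtb u \<in> RT0 T"
proof -
  have "rtb u = (\<lambda>x. 0 + norm (bary_grad T u) *\<^sub>R (x - u))" by (simp add: rtb_def fun_eq_iff)
  then show ?thesis unfolding RT0_def using vT[OF assms] subspace_0[OF subspace_tangent, of T] by blast
qed

lemma rtb_flux:
  assumes n: "1 \<le> n" and u: "u \<in> V" and c: "c \<in> V" and x: "bary T c x = 0"
  shows "rtb u x \<bullet> outer_normal T (opposite_facet T c) = (if c = u then 1 else 0)"
proof -
  have "rtb u x \<bullet> outer_normal T (opposite_facet T c)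
      = - (norm (bary_grad T u) / norm (bary_grad T c)) * (bary_grad T c \<bullet> (x - u))"
    unfolding outer_normal_opposite_facet[OF n c] rtb_def by (simp add: inner_commute)
  also have "bary_grad T c \<bullet> (x - u) = bary T c x - bary T c u" by (simp add: bary_diff)
  also have "\<dots> = (if c = u then - 1 else 0)" using x bary_vertex[OF c u] by simp
  finally show ?thesis using bary_grad_nz[OF n c] by (auto split: if_splits)
qed

text \<open>For \<open>p x = a + k (x - b)\<close> the flux through the facet opposite to \<open>u\<close>, times the length of the
  gradient \<open>g\<^sub>u\<close>, is \<open>k \<lambda>\<^sub>u(b) - g\<^sub>u \<bullet> a\<close>. Inserting this, the expansion follows from the barycentric identities for the
  point \<open>b\<close> and the vector \<open>a\<close>.\<close>

lemma RT0_flux_expand: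
  assumes n: "1 \<le> n" and p: "p \<in> RT0 T"
    and s: "\<And>u. u \<in> V \<Longrightarrow> \<exists>x\<in>opposite_facet T u. p x \<bullet> outer_normal T (opposite_facet T u) = s u"
  shows "p = (\<lambda>x. \<Sum>u\<in>V. s u *\<^sub>R rtb u x)"
    "\<And>u x. u \<in> V \<Longrightarrow> x \<in> opposite_facet T u \<Longrightarrow> p x \<bullet> outer_normal T (opposite_facet T u) = s u"
proof -
  obtain a b k where p: "p = (\<lambda>x. a + k *\<^sub>R (x - b))" "a \<in> tangent T" "b \<in> T"
    using p by (auto simp: RT0_def)
  have flux: "(p x \<bullet> outer_normal T (opposite_facet T u)) * norm (bary_grad T u) = - (bary_grad T u \<bullet> a) + k * bary T u b"
    if "u \<in> V" "x \<in> opposite_facet T u" for u x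
  proof -
    have "(p x \<bullet> outer_normal T (opposite_facet T u)) * norm (bary_grad T u) = - (bary_grad T u \<bullet> p x)"
      unfolding outer_normal_opposite_facet[OF n that(1)] using bary_grad_nz[OF n that(1)] by (simp add: inner_commute)
    also have "bary_grad T u \<bullet> p x = bary_grad T u \<bullet> a + k * (bary T u x - bary T u b)"
      unfolding p(1) bary_diff by (simp add: inner_add_right)
    finally show ?thesis using opposite_facet_comb[OF that(1)] that(2) by (simp add: algebra_simps)
  qed
  have sf: "s u * norm (bary_grad T u) = - (bary_grad T u \<bullet> a) + k * bary T u b" if u: "u \<in> V" for u
  proof -
    obtain x where x: "x \<in> opposite_facet T u" "p x \<bullet> outer_normal T (opposite_facet T u) = s u" using s[OF u] by auto
    show ?thesis using flux[OF u x(1)] unfolding x(2) .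
  qed
  show "p x \<bullet> outer_normal T (opposite_facet T u) = s u" if "u \<in> V" "x \<in> opposite_facet T u" for u x
  proof -
    have "(p x \<bullet> outer_normal T (opposite_facet T u)) * norm (bary_grad T u) = s u * norm (bary_grad T u)"
      using flux[OF that] sf[OF that(1)] by linarith
    then show ?thesis using bary_grad_nz[OF n that(1)] by simp
  qed
  have bA: "b \<in> affine hull T" using p(3) by (rule hull_inc)
  show "p = (\<lambda>x. \<Sum>u\<in>V. s u *\<^sub>R rtb u x)"
  proof
    fix x
    have "(\<Sum>u\<in>V. s u *\<^sub>R rtb u x) = (\<Sum>u\<in>V. (- (bary_grad T u \<bullet> a) + k * bary T u b) *\<^sub>R (x - u))"
      using sf by (intro sum.cong) (auto simp: rtb_def)
    also have "\<dots> = (\<Sum>u\<in>V. (- (bary_grad T u \<bullet> a) + k * bary T u b)) *\<^sub>R x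
        - (\<Sum>u\<in>V. (- (bary_grad T u \<bullet> a) + k * bary T u b) *\<^sub>R u)"
      by (simp add: scaleR_diff_right sum_subtractf flip: scaleR_sum_left)
    also have "(\<Sum>u\<in>V. (- (bary_grad T u \<bullet> a) + k * bary T u b)) = k"
      using bary_grad_expand(1)[OF p(2) T_ne[OF n]] bary_expand(1)[OF bA]
      by (simp add: sum_subtractf flip: sum_distrib_left)
    also have "(\<Sum>u\<in>V. (- (bary_grad T u \<bullet> a) + k * bary T u b) *\<^sub>R u) = - a + k *\<^sub>R b"
    proof -
      have "(\<Sum>u\<in>V. (- (bary_grad T u \<bullet> a) + k * bary T u b) *\<^sub>R u)
        = - (\<Sum>u\<in>V. (bary_grad T u \<bullet> a) *\<^sub>R u) + k *\<^sub>R (\<Sum>u\<in>V. bary T u b *\<^sub>R u)"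
        by (simp add: scaleR_diff_left sum_subtractf scaleR_sum_right)
      then show ?thesis using bary_grad_expand(2)[OF p(2) T_ne[OF n]] bary_expand(2)[OF bA] by simp
    qed
    finally show "p x = (\<Sum>u\<in>V. s u *\<^sub>R rtb u x)" by (simp add: p(1) algebra_simps)
  qed
qed

lemma RT0_flux_const:
  assumes n: "1 \<le> n" and p: "p \<in> RT0 T" and u: "u \<in> V" "x \<in> opposite_facet T u" "y \<in> opposite_facet T u"
  shows "p x \<bullet> outer_normal T (opposite_facet T u) = p y \<bullet> outer_normal T (opposite_facet T u)"
proof -
  have ne: "opposite_facet T c \<noteq> {}" if "c \<in> V" for c
    using other_vertex[OF n that] by (auto simp: opposite_facet_def)
  define s where "s c = (if c = u then p x \<bullet> outer_normal T (opposite_facet T u)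
      else p (SOME z. z \<in> opposite_facet T c) \<bullet> outer_normal T (opposite_facet T c))" for c
  have "\<exists>z\<in>opposite_facet T c. p z \<bullet> outer_normal T (opposite_facet T c) = s c" if "c \<in> V" for c
    using ne[OF that] u(2) some_in_eq[of "opposite_facet T c"] by (cases "c = u") (auto simp: s_def)
  from RT0_flux_expand(2)[OF n p this u(1,3)] show ?thesis by (simp add: s_def)
qed

lemma rt_basis_opposite_facet:
  assumes n: "1 \<le> n" and u: "u \<in> V"
  shows "rt_basis T (opposite_facet T u) = rtb u"
  unfolding rt_basis_def
proof (rule the_equality)
  have H: "rtb u x \<bullet> outer_normal T (opposite_facet T c) = (if opposite_facet T c = opposite_facet T u then 1 else 0)"
    if "c \<in> V" "x \<in> opposite_facet T c" for c x
    using rtb_flux[OF n u that(1)] opposite_facet_comb[OF that(1)] that opposite_facet_inj[OF u that(1)] by auto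
  show "rtb u \<in> RT0 T \<and> (\<forall>F'. F' facet_of T \<longrightarrow>
      (\<forall>x\<in>F'. rtb u x \<bullet> outer_normal T F' = (if F' = opposite_facet T u then 1 else 0)))"
  proof (intro conjI allI impI ballI rtb_RT0[OF u])
    fix F' x assume F': "F' facet_of T" "x \<in> F'"
    then obtain c where c: "c \<in> V" "F' = opposite_facet T c" using facet_iff by blast
    show "rtb u x \<bullet> outer_normal T F' = (if F' = opposite_facet T u then 1 else 0)"
      using H[OF c(1), of x] F'(2) unfolding c(2) by simp
  qed
next
  fix p assume p: "p \<in> RT0 T \<and> (\<forall>F'. F' facet_of T \<longrightarrow>
      (\<forall>x\<in>F'. p x \<bullet> outer_normal T F' = (if F' = opposite_facet T u then 1 else 0)))"
  have ne: "opposite_facet T c \<noteq> {}" if "c \<in> V" for c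
    using other_vertex[OF n that] by (auto simp: opposite_facet_def)
  have ex: "\<exists>x\<in>opposite_facet T c. p x \<bullet> outer_normal T (opposite_facet T c) = (if c = u then 1 else 0)" if c: "c \<in> V" for c
  proof -
    obtain x where x: "x \<in> opposite_facet T c" using ne[OF c] by auto
    have "opposite_facet T c facet_of T" using facet_iff n c by auto
    then have "p x \<bullet> outer_normal T (opposite_facet T c) = (if opposite_facet T c = opposite_facet T u then 1 else 0)"
      using p x by blast
    then show ?thesis using x opposite_facet_inj[OF c u] by (auto intro!: bexI[of _ x])
  qed
  have "p = (\<lambda>x. \<Sum>c\<in>V. (if c = u then 1 else 0) *\<^sub>R rtb c x)"
    using RT0_flux_expand(1)[OF n _ ex] p by blast
  also have "\<dots> = rtb u"
  proof
    fix x
    have "(\<Sum>c\<in>V. (if c = u then 1 else 0) *\<^sub>R rtb c x) = (\<Sum>c\<in>V. if c = u then rtb c x else 0)"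
      by (intro sum.cong) auto
    then show "(\<Sum>c\<in>V. (if c = u then 1 else 0) *\<^sub>R rtb c x) = rtb u x" using vt(4) u by simp
  qed
  finally show "p = rtb u" .
qed

text \<open>Along the gradient \<open>g\<close> the ball contained in the simplex has length \<open>2 r\<close>, and \<open>bary\<close> varies by at most 1 on the
  simplex; hence \<open>|g| \<le> 1/(2 r)\<close>, whereas \<open>|x - u| \<le> \<sigma> r\<close>.\<close>

lemma rtb_norm_le:
  assumes n: "1 \<le> n" and u: "u \<in> V" and ball: "cball c r \<inter> affine hull T \<subseteq> T" "c \<in> T" "r > 0"
    and diam: "diameter T \<le> \<sigma> * r" and x: "x \<in> T"
  shows "norm (rtb u x) \<le> \<sigma> / 2"
proof -
  let ?g = "bary_grad T u"
  have g: "?g \<noteq> 0" "?g \<in> tangent T" using bary_grad_nz[OF n u] bary_grad(1)[OF u] by auto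
  have mem: "c + s *\<^sub>R ?g \<in> T" if "\<bar>s\<bar> * norm ?g \<le> r" for s
  proof -
    have "c + s *\<^sub>R ?g \<in> affine hull T"
      using g(2) ball(2) by (intro affine_hull_add_tangent subspace_scale subspace_tangent hull_inc)
    moreover have "c + s *\<^sub>R ?g \<in> cball c r" using that by (simp add: dist_norm)
    ultimately show ?thesis using ball(1) by auto
  qed
  have le1: "bary T u y \<le> 1" "0 \<le> bary T u y" if "y \<in> T" for y
  proof -
    have y: "y \<in> affine hull T" "\<forall>u\<in>V. 0 \<le> bary T u y" using that mem_T_iff by auto
    have "bary T u y \<le> (\<Sum>u\<in>V. bary T u y)" using y u vt(4) by (intro member_le_sum) auto
    then show "bary T u y \<le> 1" using bary_expand(1)[OF y(1)] by simp
    show "0 \<le> bary T u y" using y u by simp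
  qed
  define s where "s = r / norm ?g"
  have s: "\<bar>s\<bar> * norm ?g \<le> r" "\<bar>- s\<bar> * norm ?g \<le> r" using g ball(3) by (auto simp: s_def)
  have "bary T u (c + s *\<^sub>R ?g) - bary T u (c + (- s) *\<^sub>R ?g) \<le> 1"
    using le1[OF mem[OF s(1)]] le1[OF mem[OF s(2)]] by linarith
  then have "2 * s * (?g \<bullet> ?g) \<le> 1" unfolding bary_add by (simp add: algebra_simps)
  moreover have "s * (?g \<bullet> ?g) = r * norm ?g"
    using g by (simp add: s_def dot_square_norm power2_eq_square)
  ultimately have rg: "r * norm ?g \<le> 1 / 2" by simp
  have "norm (x - u) \<le> diameter T"
    using diameter_bounded_bound[OF compact_imp_bounded[OF compact_simplex[OF simplex_T]] x vT[OF u]]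
    by (simp add: dist_norm)
  then have xu: "norm (x - u) \<le> \<sigma> * r" using diam by simp
  then have "0 \<le> \<sigma> * r" using norm_ge_zero order_trans by blast
  then have \<sigma>: "0 \<le> \<sigma>" using ball(3) by (simp add: zero_le_mult_iff)
  have "norm (rtb u x) = norm ?g * norm (x - u)" by (simp add: rtb_def)
  also have "\<dots> \<le> norm ?g * (\<sigma> * r)" using xu by (intro mult_left_mono) auto
  also have "\<dots> = \<sigma> * (r * norm ?g)" by simp
  also have "\<dots> \<le> \<sigma> * (1 / 2)" using \<sigma> rg by (intro mult_left_mono) auto
  finally show ?thesis by simp
qed

end

lemma facetE:
  assumes "n simplex T" "F facet_of T"
  obtains u where "u \<in> verts T" "F = opposite_facet T u" "1 \<le> n" "simplex_geometry T n"
proof -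
  interpret simplex_geometry T n by standard fact
  show ?thesis using assms(2) that facet_iff simplex_geometry_axioms by blast
qed

text \<open>From here on the opposite facet replaces the vertex as index, so that sums run over the facets of a cell.\<close>

lemma facet_facts:
  assumes "n simplex T" "F facet_of T"
  shows "1 \<le> n" "(n - 1) simplex F" "F \<subseteq> T" "rel_interior F \<noteq> {}"
    "outer_normal T F \<in> tangent T" "norm (outer_normal T F) = 1"
    "\<And>y. y \<in> tangent F \<Longrightarrow> outer_normal T F \<bullet> y = 0"
    "rt_basis T F \<in> RT0 T"
    "\<exists>\<gamma>>0. \<exists>v\<in>T. \<forall>x. rt_basis T F x = \<gamma> *\<^sub>R (x - v)"
    "\<And>x. x \<in> rel_interior F \<Longrightarrow> \<forall>\<^sub>F t in at_right 0. x - t *\<^sub>R outer_normal T F \<in> rel_interior T"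
    "\<And>x w t. x \<in> F \<Longrightarrow> w \<in> tangent T \<Longrightarrow> norm w = 1 \<Longrightarrow> (\<And>y. y \<in> tangent F \<Longrightarrow> w \<bullet> y = 0) \<Longrightarrow>
      t > 0 \<Longrightarrow> x - t *\<^sub>R w \<in> T \<Longrightarrow> w = outer_normal T F"
    "\<And>w. w \<in> tangent T \<Longrightarrow> norm w = 1 \<Longrightarrow> (\<And>y. y \<in> tangent F \<Longrightarrow> w \<bullet> y = 0) \<Longrightarrow>
      w = outer_normal T F \<or> w = - outer_normal T F"
proof -
  obtain u where u: "u \<in> verts T" "F = opposite_facet T u" "1 \<le> n" "simplex_geometry T n"
    using facetE[OF assms] .
  interpret simplex_geometry T n by (rule u(4))
  note n = u(3)
  show "1 \<le> n" by (rule n)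
  show sF: "(n - 1) simplex F" unfolding u(2) by (rule opposite_facet_simplex(1)[OF u(1)])
  show "F \<subseteq> T" using assms(2) facet_of_imp_subset by blast
  have "F \<noteq> {}" using assms(2) by (auto simp: facet_of_def)
  then show "rel_interior F \<noteq> {}" using convex_simplex[OF sF] rel_interior_eq_empty by blast
  have \<nu>: "outer_normal T F = - (1 / norm (bary_grad T u)) *\<^sub>R bary_grad T u"
    unfolding u(2) by (rule outer_normal_opposite_facet[OF n u(1)])
  show "outer_normal T F \<in> tangent T"
    unfolding \<nu> using bary_grad(1)[OF u(1)] by (intro subspace_scale subspace_tangent)
  show "norm (outer_normal T F) = 1" unfolding \<nu> using bary_grad_nz[OF n u(1)] by simp
  show "outer_normal T F \<bullet> y = 0" if "y \<in> tangent F" for y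
    using that tangent_opposite_facet[OF n u(1)] unfolding \<nu> unfolding u(2) by simp
  have rb: "rt_basis T F = rtb u" unfolding u(2) by (rule rt_basis_opposite_facet[OF n u(1)])
  show "rt_basis T F \<in> RT0 T" unfolding rb by (rule rtb_RT0[OF u(1)])
  show "\<exists>\<gamma>>0. \<exists>v\<in>T. \<forall>x. rt_basis T F x = \<gamma> *\<^sub>R (x - v)"
    unfolding rb rtb_def using bary_grad_nz[OF n u(1)] vT[OF u(1)]
    by (intro exI[of _ "norm (bary_grad T u)"] conjI bexI[of _ u]) auto
  show "\<forall>\<^sub>F t in at_right 0. x - t *\<^sub>R outer_normal T F \<in> rel_interior T" if "x \<in> rel_interior F" for x
    using enter_simplex[OF n u(1)] that unfolding u(2) by blast
  show "w = outer_normal T F" if "x \<in> F" "w \<in> tangent T" "norm w = 1"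
    "\<And>y. y \<in> tangent F \<Longrightarrow> w \<bullet> y = 0" "t > 0" "x - t *\<^sub>R w \<in> T" for x w t
    using entering_normal[OF n u(1), of x w t] that unfolding u(2) by blast
  show "w = outer_normal T F \<or> w = - outer_normal T F" if w: "w \<in> tangent T" "norm w = 1"
    "\<And>y. y \<in> tangent F \<Longrightarrow> w \<bullet> y = 0" for w
  proof (cases "bary_grad T u \<bullet> w \<le> 0")
    case True
    then show ?thesis using normal_to_opposite_facet[OF n u(1) w(1,2)] w(3) \<nu> unfolding u(2) by simp
  next
    case False
    have "- w \<in> tangent T" using w(1) by (intro subspace_neg) auto
    then have "- w = outer_normal T F"
      using normal_to_opposite_facet[OF n u(1), of "- w"] w False \<nu> unfolding u(2) by simp
    then show ?thesis by (metis minus_minus)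
  qed
qed

lemma rt_basis_flux:
  assumes "n simplex T" "F facet_of T" "F' facet_of T" "x \<in> F'"
  shows "rt_basis T F x \<bullet> outer_normal T F' = (if F' = F then 1 else 0)"
proof -
  obtain u where u: "u \<in> verts T" "F = opposite_facet T u" "1 \<le> n" "simplex_geometry T n"
    using facetE[OF assms(1,2)] .
  obtain c where c: "c \<in> verts T" "F' = opposite_facet T c" using facetE[OF assms(1,3)] .
  interpret simplex_geometry T n by (rule u(4))
  have "bary T c x = 0" using assms(4) c opposite_facet_comb by auto
  then show ?thesis
    using rtb_flux[OF u(3,1) c(1)] rt_basis_opposite_facet[OF u(3,1)] opposite_facet_inj[OF u(1) c(1)] u(2) c(2) by auto
qed

lemma RT0_expand:
  assumes "n simplex T" "1 \<le> n" "p \<in> RT0 T"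
    and s: "\<And>F. F facet_of T \<Longrightarrow> \<exists>x\<in>F. p x \<bullet> outer_normal T F = s F"
  shows "p x = (\<Sum>F\<in>{F. F facet_of T}. s F *\<^sub>R rt_basis T F x)"
    "\<And>F x. F facet_of T \<Longrightarrow> x \<in> F \<Longrightarrow> p x \<bullet> outer_normal T F = s F"
proof -
  interpret simplex_geometry T n by standard fact
  have Fs: "{F. F facet_of T} = opposite_facet T ` verts T" using facet_iff assms(2) by auto
  have "\<exists>x\<in>opposite_facet T u. p x \<bullet> outer_normal T (opposite_facet T u) = s (opposite_facet T u)" if "u \<in> verts T" for u
    using s Fs that by blast
  note e = RT0_flux_expand[OF assms(2,3), of "\<lambda>u. s (opposite_facet T u)", OF this]
  have inj: "inj_on (opposite_facet T) (verts T)" using opposite_facet_inj by (auto simp: inj_on_def)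
  show "p x = (\<Sum>F\<in>{F. F facet_of T}. s F *\<^sub>R rt_basis T F x)"
    unfolding Fs sum.reindex[OF inj] using rt_basis_opposite_facet[OF assms(2)] e(1) by (simp cong: sum.cong)
  show "p x \<bullet> outer_normal T F = s F" if "F facet_of T" "x \<in> F" for F x
    using e(2) that facet_iff by auto
qed

lemma facets_finite_card:
  assumes "n simplex T"
  shows "finite {F. F facet_of T}" "real (card {F. F facet_of T}) \<le> of_int n + 1"
proof -
  interpret simplex_geometry T n by standard fact
  have sub: "{F. F facet_of T} \<subseteq> opposite_facet T ` verts T" using facet_iff by auto
  then show "finite {F. F facet_of T}" using vt(4) finite_subset by blast
  have "card {F. F facet_of T} \<le> card (verts T)"
    using card_mono[OF finite_imageI[OF vt(4)] sub] card_image_le[OF vt(4), of "opposite_facet T"] by linarith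
  then show "real (card {F. F facet_of T}) \<le> of_int n + 1" using vt(3) by linarith
qed

lemma RT0_const:
  assumes "n simplex T" "F facet_of T" "p \<in> RT0 T" "x \<in> F" "y \<in> F"
  shows "p x \<bullet> outer_normal T F = p y \<bullet> outer_normal T F"
proof -
  obtain u where u: "u \<in> verts T" "F = opposite_facet T u" "1 \<le> n" "simplex_geometry T n"
    using facetE[OF assms(1,2)] .
  interpret simplex_geometry T n by (rule u(4))
  show ?thesis using assms(4,5) unfolding u(2) by (rule RT0_flux_const[OF u(3) assms(3) u(1)])
qed

lemma rt_basis_norm_le:
  assumes "n simplex T" "F facet_of T" "cball c r \<inter> affine hull T \<subseteq> T" "c \<in> T" "r > 0"
    "diameter T \<le> \<sigma> * r" "x \<in> T"
  shows "norm (rt_basis T F x) \<le> \<sigma> / 2"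
proof -
  obtain u where u: "u \<in> verts T" "F = opposite_facet T u" "1 \<le> n" "simplex_geometry T n"
    using facetE[OF assms(1,2)] .
  interpret simplex_geometry T n by (rule u(4))
  show ?thesis unfolding u(2) rt_basis_opposite_facet[OF u(3,1)] by (rule rtb_norm_le[OF u(3,1) assms(3-7)])
qed

lemma simplex_boundary_facet:
  assumes "n simplex T" "x \<in> T" "x \<notin> rel_interior T"
  obtains F where "F facet_of T" "x \<in> F"
  using rel_boundary_of_polyhedron[OF simplex_imp_polyhedron[OF assms(1)]] assms(2,3) that by auto

section \<open>Piecewise Raviart--Thomas fields\<close>

lemma subspace_RT0:
  assumes "T \<noteq> {}" shows "subspace (RT0 T)"
proof -
  obtain z where z: "z \<in> T" using assms by auto
  show ?thesis unfolding subspace_def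
  proof (intro conjI ballI allI)
    have "(0 :: 'a \<Rightarrow> 'a) = (\<lambda>x. 0 + 0 *\<^sub>R (x - z))" by (simp add: fun_eq_iff)
    then show "0 \<in> RT0 T" unfolding RT0_def using z subspace_0[OF subspace_tangent, of T] by blast
  next
    fix p q assume "p \<in> RT0 T" "q \<in> RT0 T"
    then obtain a b c a' b' c' where p: "p = (\<lambda>x. a + c *\<^sub>R (x - b))" "a \<in> tangent T" "b \<in> T"
      and q: "q = (\<lambda>x. a' + c' *\<^sub>R (x - b'))" "a' \<in> tangent T" "b' \<in> T" by (auto simp: RT0_def)
    have "b - b' \<in> tangent T" using p q by (intro tangent_diff hull_inc)
    then have m: "a + a' + c' *\<^sub>R (b - b') \<in> tangent T"
      using p q by (intro subspace_add subspace_scale subspace_tangent)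
    have "p + q = (\<lambda>x. (a + a' + c' *\<^sub>R (b - b')) + (c + c') *\<^sub>R (x - b))"
      by (simp add: p(1) q(1) fun_eq_iff algebra_simps)
    then show "p + q \<in> RT0 T" unfolding RT0_def using m p(3) by blast
  next
    fix r p assume "p \<in> RT0 T"
    then obtain a b c where p: "p = (\<lambda>x. a + c *\<^sub>R (x - b))" "a \<in> tangent T" "b \<in> T" by (auto simp: RT0_def)
    have "r *\<^sub>R p = (\<lambda>x. r *\<^sub>R a + (r * c) *\<^sub>R (x - b))" by (simp add: p(1) fun_eq_iff algebra_simps)
    moreover have "r *\<^sub>R a \<in> tangent T" using p by (intro subspace_scale subspace_tangent)
    ultimately show "r *\<^sub>R p \<in> RT0 T" unfolding RT0_def using p(3) by blast
  qed
qed

lemma RT0_continuous: "p \<in> RT0 T \<Longrightarrow> continuous_on A p"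
  by (auto simp: RT0_def intro!: continuous_intros)

lemma RT0_tangent: "p \<in> RT0 T \<Longrightarrow> x \<in> affine hull T \<Longrightarrow> p x \<in> tangent T"
  by (auto simp: RT0_def intro!: subspace_add subspace_scale tangent_diff hull_inc)

text \<open>A ray meets a convex set in an interval, so close to its origin it is either inside or outside.\<close>

lemma convex_eventually:
  assumes "convex C"
  shows "(\<forall>\<^sub>F t in at_right (0::real). x - t *\<^sub>R \<nu> \<in> C) \<or> (\<forall>\<^sub>F t in at_right 0. x - t *\<^sub>R \<nu> \<notin> C)"
proof (cases "\<exists>e>0. \<forall>t. 0 < t \<and> t < e \<longrightarrow> x - t *\<^sub>R \<nu> \<notin> C")
  case True
  then show ?thesis by (auto simp: eventually_at_right_field)
next
  case False
  then have small: "\<exists>t. 0 < t \<and> t < e \<and> x - t *\<^sub>R \<nu> \<in> C" if "e > 0" for e using that by blast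
  obtain t0 where t0: "0 < t0" "x - t0 *\<^sub>R \<nu> \<in> C" using small[of 1] by auto
  have "x - t *\<^sub>R \<nu> \<in> C" if t: "0 < t" "t < t0" for t
  proof -
    obtain s where s: "0 < s" "s < t" "x - s *\<^sub>R \<nu> \<in> C" using small[OF t(1)] by auto
    define \<alpha> where "\<alpha> = (t - s) / (t0 - s)"
    have \<alpha>: "0 \<le> \<alpha>" "\<alpha> \<le> 1" using s t by (auto simp: \<alpha>_def divide_simps)
    have "(1 - \<alpha>) *\<^sub>R (x - s *\<^sub>R \<nu>) + \<alpha> *\<^sub>R (x - t0 *\<^sub>R \<nu>) \<in> C"
      using assms s(3) t0(2) \<alpha> unfolding convex_alt by blast
    moreover have "(1 - \<alpha>) *\<^sub>R (x - s *\<^sub>R \<nu>) + \<alpha> *\<^sub>R (x - t0 *\<^sub>R \<nu>) = x - (s + \<alpha> * (t0 - s)) *\<^sub>R \<nu>"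
      by (simp add: algebra_simps)
    moreover have "s + \<alpha> * (t0 - s) = t" using s t by (simp add: \<alpha>_def)
    ultimately show ?thesis by simp
  qed
  then show ?thesis using t0(1) by (auto simp: eventually_at_right_field)
qed

lemma P0_zero_outside: "q \<in> P0 \<T> \<Longrightarrow> x \<notin> (\<Union>T\<in>\<T>. rel_interior T) \<Longrightarrow> q x = 0"
  by (simp add: P0_def)

locale cells =
  fixes \<E> :: "'a::euclidean_space set set"
  assumes finE: "finite \<E>" and simplexE: "\<And>T. T \<in> \<E> \<Longrightarrow> aff_dim T simplex T"
    and neE: "\<And>T. T \<in> \<E> \<Longrightarrow> T \<noteq> {}"
    and disjE: "\<And>T T' x. T \<in> \<E> \<Longrightarrow> T' \<in> \<E> \<Longrightarrow> x \<in> rel_interior T \<Longrightarrow> x \<in> rel_interior T' \<Longrightarrow> T = T'"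
begin

lemma convexE: "T \<in> \<E> \<Longrightarrow> convex T" using simplexE convex_simplex by blast

lemma compactE: "T \<in> \<E> \<Longrightarrow> compact T" using simplexE compact_simplex by blast

lemma rintE: "T \<in> \<E> \<Longrightarrow> rel_interior T \<noteq> {}" using neE convexE rel_interior_eq_empty by blast

lemma borelE: "T \<in> \<E> \<Longrightarrow> rel_interior T \<in> sets borel"
proof -
  assume T: "T \<in> \<E>"
  have "openin (top_of_set (affine hull T)) (rel_interior T)" by (rule openin_rel_interior)
  then obtain O' where "open O'" "rel_interior T = affine hull T \<inter> O'" by (auto simp: openin_open)
  then show ?thesis by (auto intro: borel_closed)
qed

lemma boundedE: "T \<in> \<E> \<Longrightarrow> bounded (rel_interior T)"
  using compactE compact_imp_bounded bounded_subset rel_interior_subset by metis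

lemma midE:
  assumes "T \<in> \<E>" "x0 \<in> T" "x \<in> rel_interior T"
  shows "(1/2) *\<^sub>R x0 + (1/2) *\<^sub>R x \<in> rel_interior T"
proof -
  have "x0 - (1/2) *\<^sub>R (x0 - x) \<in> rel_interior T"
    by (rule rel_interior_convex_shrink[OF convexE[OF assms(1)] assms(3) assms(2)]) auto
  moreover have "x0 - (1/2) *\<^sub>R (x0 - x) = (1/2) *\<^sub>R x0 + (1/2) *\<^sub>R x"
    using scaleR_half_double[of x0] by (simp add: algebra_simps)
  ultimately show ?thesis by simp
qed

definition glue :: "('a set \<Rightarrow> 'a \<Rightarrow> 'b::real_vector) \<Rightarrow> 'a \<Rightarrow> 'b" where
  "glue f x = (\<Sum>T\<in>\<E>. if x \<in> rel_interior T then f T x else 0)"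

lemma glue_in: "T \<in> \<E> \<Longrightarrow> x \<in> rel_interior T \<Longrightarrow> glue f x = f T x"
proof -
  assume T: "T \<in> \<E>" "x \<in> rel_interior T"
  have "glue f x = (\<Sum>T'\<in>\<E>. if T' = T then f T x else 0)"
    unfolding glue_def using T disjE by (intro sum.cong) auto
  then show ?thesis using T finE by simp
qed

lemma glue_out: "x \<notin> (\<Union>T\<in>\<E>. rel_interior T) \<Longrightarrow> glue f x = 0"
  unfolding glue_def by (intro sum.neutral) auto

lemma glue_eqI:
  assumes "\<And>T x. T \<in> \<E> \<Longrightarrow> x \<in> rel_interior T \<Longrightarrow> v x = f T x"
    and "\<And>x. x \<notin> (\<Union>T\<in>\<E>. rel_interior T) \<Longrightarrow> v x = 0"
  shows "v = glue f"
proof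
  fix x show "v x = glue f x"
  proof (cases "x \<in> (\<Union>T\<in>\<E>. rel_interior T)")
    case True
    then obtain T where T: "T \<in> \<E>" "x \<in> rel_interior T" by auto
    show ?thesis unfolding glue_in[OF T] by (rule assms(1)[OF T])
  next
    case False
    show ?thesis unfolding glue_out[OF False] by (rule assms(2)[OF False])
  qed
qed

lemma glue_borel:
  fixes f :: "'a set \<Rightarrow> 'a \<Rightarrow> 'b::euclidean_space"
  assumes "\<And>T. T \<in> \<E> \<Longrightarrow> continuous_on UNIV (f T)"
  shows "glue f \<in> borel_measurable borel"
proof -
  have "(\<lambda>x. if x \<in> rel_interior T then f T x else 0) \<in> borel_measurable borel" if "T \<in> \<E>" for T
    using borelE[OF that] borel_measurable_continuous_onI[OF assms[OF that]]
    by (intro measurable_If_set) auto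
  then show ?thesis unfolding glue_def[abs_def] by (intro borel_measurable_sum) auto
qed

lemma glue_bounded:
  fixes f :: "'a set \<Rightarrow> 'a \<Rightarrow> 'b::euclidean_space"
  assumes "\<And>T. T \<in> \<E> \<Longrightarrow> continuous_on UNIV (f T)"
  obtains C where "\<And>x. norm (glue f x) \<le> C"
proof -
  have "\<exists>B. \<forall>x\<in>T. norm (f T x) \<le> B" if "T \<in> \<E>" for T
  proof -
    have "compact (f T ` T)"
      using compact_continuous_image[OF continuous_on_subset[OF assms[OF that]] compactE[OF that]] by simp
    then show ?thesis using compact_imp_bounded bounded_iff by (metis image_eqI)
  qed
  then obtain B where B: "\<And>T x. T \<in> \<E> \<Longrightarrow> x \<in> T \<Longrightarrow> norm (f T x) \<le> B T" by metis
  have "norm (glue f x) \<le> (\<Sum>T\<in>\<E>. \<bar>B T\<bar>)" for x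
    unfolding glue_def
  proof (rule order_trans[OF norm_sum] , rule sum_mono)
    fix T assume T: "T \<in> \<E>"
    show "norm (if x \<in> rel_interior T then f T x else 0) \<le> \<bar>B T\<bar>"
      using B[OF T, of x] rel_interior_subset[of T] by (auto simp: abs_le_iff) 
  qed
  then show ?thesis by (rule that)
qed

lemma P0_glue: "q \<in> P0 \<E> \<Longrightarrow> glue (\<lambda>T _. q (SOME x. x \<in> rel_interior T)) = q"
proof (rule glue_eqI[symmetric])
  fix T x assume q: "q \<in> P0 \<E>" and T: "T \<in> \<E>" "x \<in> rel_interior T"
  then obtain c where c: "\<And>x. x \<in> rel_interior T \<Longrightarrow> q x = c" by (auto simp: P0_def)
  have "(SOME x. x \<in> rel_interior T) \<in> rel_interior T" using T(2) by (rule someI)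
  then show "q x = q (SOME x. x \<in> rel_interior T)" using c T(2) by simp
qed (simp add: P0_def)

definition val :: "('a \<Rightarrow> real) \<Rightarrow> 'a set \<Rightarrow> real" where
  "val q T = q (SOME x. x \<in> rel_interior T)"

lemma P0_val: "q \<in> P0 \<E> \<Longrightarrow> T \<in> \<E> \<Longrightarrow> x \<in> rel_interior T \<Longrightarrow> q x = val q T"
  using P0_glue[of q] glue_in[of T x "\<lambda>T _. q (SOME x. x \<in> rel_interior T)"] by (simp add: val_def)

lemma P0_borel: "q \<in> P0 \<E> \<Longrightarrow> q \<in> borel_measurable borel"
  using P0_glue[of q] glue_borel[of "\<lambda>T _. q (SOME x. x \<in> rel_interior T)"] by simp

lemma P0_bounded: assumes "q \<in> P0 \<E>" obtains C where "\<And>x. \<bar>q x\<bar> \<le> C"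
proof -
  obtain C where "\<And>x. norm (glue (\<lambda>T _. q (SOME x. x \<in> rel_interior T)) x) \<le> C"
    using glue_bounded[of "\<lambda>T _. q (SOME x. x \<in> rel_interior T)"] by auto
  then have "\<bar>q x\<bar> \<le> C" for x unfolding P0_glue[OF assms] real_norm_def .
  then show ?thesis by (rule that)
qed

lemma subspace_P0: "subspace (P0 \<E>)"
  unfolding subspace_def
proof (intro conjI ballI allI)
  show "0 \<in> P0 \<E>" by (auto simp: P0_def)
  show "p + q \<in> P0 \<E>" if "p \<in> P0 \<E>" "q \<in> P0 \<E>" for p q
    using P0_val[OF that(1)] P0_val[OF that(2)] P0_zero_outside[OF that(1)] P0_zero_outside[OF that(2)]
    unfolding P0_def by auto
  show "c *\<^sub>R p \<in> P0 \<E>" if "p \<in> P0 \<E>" for c p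
    using P0_val[OF that(1)] P0_zero_outside[OF that(1)] unfolding P0_def by auto
qed

lemma val_lin: "val (p + q) T = val p T + val q T" "val (c *\<^sub>R p) T = c * val p T"
  by (simp_all add: val_def)

lemma P0_eq_0: "q \<in> P0 \<E> \<Longrightarrow> (\<And>T. T \<in> \<E> \<Longrightarrow> val q T = 0) \<Longrightarrow> q = 0"
  using P0_val[of q] P0_zero_outside[of q \<E>] by (fastforce simp: fun_eq_iff)

text \<open>The broken Raviart--Thomas space. As the cells are finitely many convex sets, a field of this space has
  one-sided limits along every ray, so that \<open>ntrace\<close> is linear on it.\<close>

definition broken_RT :: "('a \<Rightarrow> 'a) set" where
  "broken_RT = {v. (\<forall>T\<in>\<E>. \<exists>p\<in>RT0 T. \<forall>x\<in>rel_interior T. v x = p x) \<and>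
     (\<forall>x. x \<notin> (\<Union>T\<in>\<E>. rel_interior T) \<longrightarrow> v x = 0)}"

lemma broken_RT_piece: assumes "v \<in> broken_RT" "T \<in> \<E>"
  obtains p where "p \<in> RT0 T" "\<And>x. x \<in> rel_interior T \<Longrightarrow> v x = p x"
  using assms unfolding broken_RT_def by blast

lemma subspace_broken_RT: "subspace broken_RT"
  unfolding subspace_def
proof (intro conjI ballI allI)
  have "\<exists>p\<in>RT0 T. \<forall>x\<in>rel_interior T. (0 :: 'a \<Rightarrow> 'a) x = p x" if "T \<in> \<E>" for T
    using subspace_0[OF subspace_RT0[OF neE[OF that]]] by (intro bexI[of _ 0]) auto
  then show "0 \<in> broken_RT" unfolding broken_RT_def by auto
  fix v w assume v: "v \<in> broken_RT" and w: "w \<in> broken_RT"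
  have "\<exists>p\<in>RT0 T. \<forall>x\<in>rel_interior T. (v + w) x = p x" if T: "T \<in> \<E>" for T
  proof -
    obtain p where p: "p \<in> RT0 T" "\<And>x. x \<in> rel_interior T \<Longrightarrow> v x = p x" by (rule broken_RT_piece[OF v T]) (rule that)
    obtain q where q: "q \<in> RT0 T" "\<And>x. x \<in> rel_interior T \<Longrightarrow> w x = q x" by (rule broken_RT_piece[OF w T]) (rule that)
    show ?thesis using subspace_add[OF subspace_RT0[OF neE[OF T]] p(1) q(1)] p(2) q(2)
      by (intro bexI[of _ "p + q"]) auto
  qed
  then show "v + w \<in> broken_RT" using v w by (auto simp: broken_RT_def)
next
  fix c v assume v: "v \<in> broken_RT"
  have "\<exists>p\<in>RT0 T. \<forall>x\<in>rel_interior T. (c *\<^sub>R v) x = p x" if T: "T \<in> \<E>" for T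
  proof -
    obtain p where p: "p \<in> RT0 T" "\<And>x. x \<in> rel_interior T \<Longrightarrow> v x = p x" by (rule broken_RT_piece[OF v T]) (rule that)
    show ?thesis using subspace_scale[OF subspace_RT0[OF neE[OF T]] p(1)] p(2)
      by (intro bexI[of _ "c *\<^sub>R p"]) auto
  qed
  then show "c *\<^sub>R v \<in> broken_RT" using v by (auto simp: broken_RT_def)
qed

lemma broken_RT_glue:
  assumes "v \<in> broken_RT"
  obtains p where "\<And>T. T \<in> \<E> \<Longrightarrow> p T \<in> RT0 T" "v = glue p"
proof -
  have "\<exists>p. \<forall>T\<in>\<E>. p T \<in> RT0 T \<and> (\<forall>x\<in>rel_interior T. v x = p T x)"
    using assms by (intro bchoice) (auto simp: broken_RT_def)
  then obtain p where p: "\<And>T. T \<in> \<E> \<Longrightarrow> p T \<in> RT0 T"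
    "\<And>T x. T \<in> \<E> \<Longrightarrow> x \<in> rel_interior T \<Longrightarrow> v x = p T x" by auto
  have "v = glue p" using p assms by (intro glue_eqI) (auto simp: broken_RT_def)
  with p that show ?thesis by blast
qed

lemma broken_RT_borel: assumes "v \<in> broken_RT" shows "v \<in> borel_measurable borel"
proof -
  obtain p where p: "\<And>T. T \<in> \<E> \<Longrightarrow> p T \<in> RT0 T" "v = glue p" by (rule broken_RT_glue[OF assms]) (rule that)
  show ?thesis unfolding p(2) by (rule glue_borel) (rule RT0_continuous[OF p(1)])
qed

lemma broken_RT_bounded: assumes "v \<in> broken_RT" obtains C where "\<And>x. norm (v x) \<le> C"
proof -
  obtain p where p: "\<And>T. T \<in> \<E> \<Longrightarrow> p T \<in> RT0 T" "v = glue p" by (rule broken_RT_glue[OF assms]) (rule that)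
  show ?thesis using glue_bounded[of p, OF RT0_continuous[OF p(1)]] that p(2) by auto
qed

lemma broken_RT_limit:
  assumes "v \<in> broken_RT"
  obtains L where "((\<lambda>t. v (x - t *\<^sub>R \<nu>)) \<longlongrightarrow> L) (at_right 0)"
proof (cases "\<exists>T\<in>\<E>. \<forall>\<^sub>F t in at_right 0. x - t *\<^sub>R \<nu> \<in> rel_interior T")
  case True
  then obtain T where T: "T \<in> \<E>" "\<forall>\<^sub>F t in at_right 0. x - t *\<^sub>R \<nu> \<in> rel_interior T" by auto
  obtain p where p: "p \<in> RT0 T" "\<And>x. x \<in> rel_interior T \<Longrightarrow> v x = p x" by (rule broken_RT_piece[OF assms T(1)]) (rule that)
  have "((\<lambda>t. x - t *\<^sub>R \<nu>) \<longlongrightarrow> x - 0 *\<^sub>R \<nu>) (at_right 0)" by (intro tendsto_intros)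
  then have "((\<lambda>t. p (x - t *\<^sub>R \<nu>)) \<longlongrightarrow> p (x - 0 *\<^sub>R \<nu>)) (at_right 0)"
    using RT0_continuous[OF p(1), of UNIV] by (intro continuous_on_tendsto_compose[of UNIV p]) auto
  moreover have "\<forall>\<^sub>F t in at_right 0. p (x - t *\<^sub>R \<nu>) = v (x - t *\<^sub>R \<nu>)"
    using T(2) by eventually_elim (simp add: p(2))
  ultimately have "((\<lambda>t. v (x - t *\<^sub>R \<nu>)) \<longlongrightarrow> p (x - 0 *\<^sub>R \<nu>)) (at_right 0)"
    by (rule Lim_transform_eventually)
  then show ?thesis by (rule that)
next
  case False
  then have "\<forall>\<^sub>F t in at_right 0. x - t *\<^sub>R \<nu> \<notin> rel_interior T" if "T \<in> \<E>" for T
    using convex_eventually[OF convex_rel_interior[OF convexE[OF that]], of x \<nu>] that by blast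
  then have "\<forall>\<^sub>F t in at_right 0. \<forall>T\<in>\<E>. x - t *\<^sub>R \<nu> \<notin> rel_interior T"
    using finE by (simp add: eventually_ball_finite_distrib)
  then have "\<forall>\<^sub>F t in at_right 0. v (x - t *\<^sub>R \<nu>) = 0"
    by eventually_elim (use assms in \<open>auto simp: broken_RT_def\<close>)
  then have "((\<lambda>t. v (x - t *\<^sub>R \<nu>)) \<longlongrightarrow> 0) (at_right 0)" by (rule tendsto_eventually)
  then show ?thesis by (rule that)
qed

lemma ntrace_limit:
  assumes "((\<lambda>t. v (x - t *\<^sub>R \<nu>)) \<longlongrightarrow> L) (at_right 0)"
  shows "ntrace v \<nu> x = L \<bullet> \<nu>"
  unfolding ntrace_def using tendsto_Lim[OF _ assms] by simp

lemma ntrace_add: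
  assumes "v \<in> broken_RT" "w \<in> broken_RT" shows "ntrace (v + w) \<nu> x = ntrace v \<nu> x + ntrace w \<nu> x"
proof -
  obtain L where L: "((\<lambda>t. v (x - t *\<^sub>R \<nu>)) \<longlongrightarrow> L) (at_right 0)" using broken_RT_limit[OF assms(1)] .
  obtain K where K: "((\<lambda>t. w (x - t *\<^sub>R \<nu>)) \<longlongrightarrow> K) (at_right 0)" using broken_RT_limit[OF assms(2)] .
  have "((\<lambda>t. (v + w) (x - t *\<^sub>R \<nu>)) \<longlongrightarrow> L + K) (at_right 0)" using tendsto_add[OF L K] by simp
  then have "ntrace (v + w) \<nu> x = (L + K) \<bullet> \<nu>" by (rule ntrace_limit)
  then show ?thesis using ntrace_limit[OF L] ntrace_limit[OF K] by (simp add: inner_add_left)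
qed

lemma ntrace_scale:
  assumes "v \<in> broken_RT" shows "ntrace (c *\<^sub>R v) \<nu> x = c * ntrace v \<nu> x"
proof -
  obtain L where L: "((\<lambda>t. v (x - t *\<^sub>R \<nu>)) \<longlongrightarrow> L) (at_right 0)" using broken_RT_limit[OF assms(1)] .
  have "((\<lambda>t. (c *\<^sub>R v) (x - t *\<^sub>R \<nu>)) \<longlongrightarrow> c *\<^sub>R L) (at_right 0)"
    using tendsto_scaleR[OF tendsto_const L, of c] by simp
  then have "ntrace (c *\<^sub>R v) \<nu> x = (c *\<^sub>R L) \<bullet> \<nu>" by (rule ntrace_limit)
  then show ?thesis using ntrace_limit[OF L] by simp
qed

lemma ntrace_inside:
  assumes "\<forall>\<^sub>F t in at_right 0. x - t *\<^sub>R \<nu> \<in> rel_interior T" "p \<in> RT0 T"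
    "\<And>x. x \<in> rel_interior T \<Longrightarrow> v x = p x"
  shows "ntrace v \<nu> x = p x \<bullet> \<nu>"
proof (rule ntrace_limit)
  have "((\<lambda>t. x - t *\<^sub>R \<nu>) \<longlongrightarrow> x - 0 *\<^sub>R \<nu>) (at_right 0)" by (intro tendsto_intros)
  then have "((\<lambda>t. p (x - t *\<^sub>R \<nu>)) \<longlongrightarrow> p (x - 0 *\<^sub>R \<nu>)) (at_right 0)"
    using RT0_continuous[OF assms(2), of UNIV] by (intro continuous_on_tendsto_compose[of UNIV p]) auto
  moreover have "\<forall>\<^sub>F t in at_right 0. p (x - t *\<^sub>R \<nu>) = v (x - t *\<^sub>R \<nu>)"
    using assms(1) by eventually_elim (simp add: assms(3))
  ultimately have "((\<lambda>t. v (x - t *\<^sub>R \<nu>)) \<longlongrightarrow> p (x - 0 *\<^sub>R \<nu>)) (at_right 0)"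
    by (rule Lim_transform_eventually)
  then show "((\<lambda>t. v (x - t *\<^sub>R \<nu>)) \<longlongrightarrow> p x) (at_right 0)" by simp
qed

lemma ntrace_facet:
  assumes "T \<in> \<E>" "F facet_of T" "x \<in> rel_interior F" "p \<in> RT0 T"
    "\<And>x. x \<in> rel_interior T \<Longrightarrow> v x = p x"
  shows "ntrace v (outer_normal T F) x = p x \<bullet> outer_normal T F"
  by (rule ntrace_inside[OF facet_facts(10)[OF simplexE[OF assms(1)] assms(2,3)] assms(4,5)])

text \<open>The normal component of a Raviart--Thomas field is constant on a facet, hence the description defining
  \<open>facet_flux\<close> is satisfied by exactly one number.\<close>

lemma ntrace_flux:
  assumes "v \<in> broken_RT" "T \<in> \<E>" "F facet_of T" "x \<in> rel_interior F"
  shows "ntrace v (outer_normal T F) x = facet_flux v T F"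
proof -
  obtain p where p: "p \<in> RT0 T" "\<And>x. x \<in> rel_interior T \<Longrightarrow> v x = p x" by (rule broken_RT_piece[OF assms(1,2)]) (rule that)
  have c: "ntrace v (outer_normal T F) y = p x \<bullet> outer_normal T F" if "y \<in> rel_interior F" for y
    using ntrace_facet[OF assms(2,3) that p]
      RT0_const[OF simplexE[OF assms(2)] assms(3) p(1), of y x] that assms(4) rel_interior_subset[of F]
    by auto
  have "facet_flux v T F = p x \<bullet> outer_normal T F"
    unfolding facet_flux_def using c assms(4) by (intro the_equality) auto
  then show ?thesis using c[OF assms(4)] by simp
qed

lemma facet_flux_piece:
  assumes "v \<in> broken_RT" "T \<in> \<E>" "F facet_of T" "x \<in> rel_interior F" "p \<in> RT0 T"
    "\<And>x. x \<in> rel_interior T \<Longrightarrow> v x = p x"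
  shows "facet_flux v T F = p x \<bullet> outer_normal T F"
  using ntrace_flux[OF assms(1-4)] ntrace_facet[OF assms(2-6)] by simp

lemma facet_pt: assumes "T \<in> \<E>" "F facet_of T" obtains x where "x \<in> rel_interior F" "x \<in> F"
  using facet_facts(4)[OF simplexE[OF assms(1)] assms(2)] rel_interior_subset[of F] by blast

lemma facet_flux_add:
  assumes "v \<in> broken_RT" "w \<in> broken_RT" "T \<in> \<E>" "F facet_of T"
  shows "facet_flux (v + w) T F = facet_flux v T F + facet_flux w T F"
proof -
  obtain x where x: "x \<in> rel_interior F" using facet_pt[OF assms(3,4)] .
  show ?thesis
    using ntrace_flux[OF assms(1,3,4) x] ntrace_flux[OF assms(2,3,4) x] ntrace_add[OF assms(1,2)]
      ntrace_flux[OF subspace_add[OF subspace_broken_RT assms(1,2)] assms(3,4) x] by simp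
qed

lemma facet_flux_scale:
  assumes "v \<in> broken_RT" "T \<in> \<E>" "F facet_of T"
  shows "facet_flux (c *\<^sub>R v) T F = c * facet_flux v T F"
proof -
  obtain x where x: "x \<in> rel_interior F" using facet_pt[OF assms(2,3)] .
  show ?thesis
    using ntrace_flux[OF assms x] ntrace_scale[OF assms(1)]
      ntrace_flux[OF subspace_scale[OF subspace_broken_RT assms(1)] assms(2,3) x] by simp
qed

text \<open>Zero-dimensional cells are included: they have no facets, and the field vanishes on them because membership in
  \<open>RT0\<close> forces the value 0.\<close>

lemma broken_RT_expand:
  assumes v: "v \<in> broken_RT" and T: "T \<in> \<E>" and x: "x \<in> rel_interior T"
  shows "v x = (\<Sum>F\<in>{F. F facet_of T}. facet_flux v T F *\<^sub>R rt_basis T F x)"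
proof -
  obtain p where p: "p \<in> RT0 T" "\<And>x. x \<in> rel_interior T \<Longrightarrow> v x = p x" by (rule broken_RT_piece[OF v T]) (rule that)
  have "0 \<le> aff_dim T" using neE[OF T] aff_dim_negative_iff[of T] by linarith
  then consider "1 \<le> aff_dim T" | "aff_dim T = 0" by linarith
  then show ?thesis
  proof cases
    case 1
    have "\<exists>y\<in>F. p y \<bullet> outer_normal T F = facet_flux v T F" if F: "F facet_of T" for F
    proof -
      obtain y where y: "y \<in> rel_interior F" "y \<in> F" using facet_pt[OF T F] .
      show ?thesis using facet_flux_piece[OF v T F y(1) p] y(2) by auto
    qed
    from RT0_expand(1)[OF simplexE[OF T] 1 p(1) this] p(2)[OF x] show ?thesis by simp
  next
    case 2
    then obtain a where a: "T = {a}" by (auto simp: aff_dim_eq_0)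
    have nof: "{F. F facet_of T} = {}"
      using facet_facts(1)[OF simplexE[OF T]] 2 by force
    have tT: "tangent T = {0}" using a by (simp add: tangent_def)
    obtain a0 b c where pr: "p = (\<lambda>x. a0 + c *\<^sub>R (x - b))" "a0 \<in> tangent T" "b \<in> T"
      using p(1) unfolding RT0_def by auto
    have "a0 = 0" "b = a" using pr(2,3) tT a by simp_all
    then have "p a = 0" using pr(1) by simp
    moreover have "x = a" using x a rel_interior_subset[of T] by auto
    ultimately have "v x = 0" using p(2)[OF x] by simp
    then show ?thesis by (simp add: nof)
  qed
qed

lemma broken_RT_eq_0:
  assumes "v \<in> broken_RT" "\<And>T F. T \<in> \<E> \<Longrightarrow> F facet_of T \<Longrightarrow> facet_flux v T F = 0"
  shows "v = 0"
proof
  fix x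
  show "v x = 0 x"
  proof (cases "x \<in> (\<Union>T\<in>\<E>. rel_interior T)")
    case True
    then obtain T where T: "T \<in> \<E>" "x \<in> rel_interior T" by auto
    show ?thesis using broken_RT_expand[OF assms(1) T] assms(2)[OF T(1)] by simp
  next
    case False
    then show ?thesis using assms(1) by (auto simp: broken_RT_def)
  qed
qed

text \<open>The basis field of one side of a facet, extended by zero to the other cells.\<close>

definition facet_field :: "'a set \<Rightarrow> 'a set \<Rightarrow> 'a \<Rightarrow> 'a" where
  "facet_field T F x = (if x \<in> rel_interior T then rt_basis T F x else 0)"

lemma facet_field_piece:
  assumes "T \<in> \<E>" "F facet_of T" "T' \<in> \<E>"
  shows "(if T' = T then rt_basis T F else 0) \<in> RT0 T'"
    "\<And>x. x \<in> rel_interior T' \<Longrightarrow> facet_field T F x = (if T' = T then rt_basis T F else 0) x"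
  using facet_facts(8)[OF simplexE[OF assms(1)] assms(2)] subspace_0[OF subspace_RT0[OF neE[OF assms(3)]]]
    disjE[OF assms(1,3)] by (auto simp: facet_field_def)

lemma facet_field_broken_RT: assumes "T \<in> \<E>" "F facet_of T" shows "facet_field T F \<in> broken_RT"
proof -
  have "\<exists>p\<in>RT0 T'. \<forall>x\<in>rel_interior T'. facet_field T F x = p x" if T': "T' \<in> \<E>" for T'
    by (rule bexI[OF _ facet_field_piece(1)[OF assms T']]) (intro ballI facet_field_piece(2)[OF assms T'])
  moreover have "facet_field T F x = 0" if "x \<notin> (\<Union>T\<in>\<E>. rel_interior T)" for x
    using that assms(1) by (auto simp: facet_field_def)
  ultimately show ?thesis unfolding broken_RT_def by blast
qed

lemma facet_field_flux:
  assumes "T \<in> \<E>" "F facet_of T" "T' \<in> \<E>" "F' facet_of T'"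
  shows "facet_flux (facet_field T F) T' F' = (if T' = T \<and> F' = F then 1 else 0)"
proof -
  obtain x where x: "x \<in> rel_interior F'" "x \<in> F'" using facet_pt[OF assms(3,4)] .
  have "facet_flux (facet_field T F) T' F' = (if T' = T then rt_basis T F else 0) x \<bullet> outer_normal T' F'"
    by (rule facet_flux_piece[OF facet_field_broken_RT[OF assms(1,2)] assms(3,4) x(1) facet_field_piece[OF assms(1-3)]])
  then show ?thesis
    using rt_basis_flux[OF simplexE[OF assms(1)] assms(2), of F' x] assms(4) x(2)
    by (cases "T' = T") simp_all
qed

end

section \<open>Geometry of the mesh\<close>

locale fractured_mesh =
  fixes G :: "'a::euclidean_space medium" and M :: "'a mesh" and \<sigma> :: real
  assumes medium: "fractured_medium G" and mesh: "admissible_mesh G \<sigma> M"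
begin

abbreviation "Sub \<equiv> subdomains G"
abbreviation "\<Omega> \<equiv> \<Union>Sub"
abbreviation "EE \<equiv> all_elems G M"

lemma sub:
  assumes "P \<in> Sub"
  shows "P \<noteq> {}" "connected P" "bounded P" "openin (top_of_set (affine hull P)) P"
  using medium assms unfolding fractured_medium_def by auto

lemma finSub: "finite Sub" and open\<Omega>: "open \<Omega>"
  and disjSub: "P \<in> Sub \<Longrightarrow> Q \<in> Sub \<Longrightarrow> x \<in> P \<Longrightarrow> x \<in> Q \<Longrightarrow> P = Q"
  and linkedSub: "P \<in> Sub \<Longrightarrow> Q \<in> Sub \<Longrightarrow> (linked G)\<^sup>*\<^sup>* P Q"
  and bdry: "bdryD G \<union> bdryN G = frontier \<Omega>" "bdryD G \<inter> bdryN G = {}"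
  using medium unfolding fractured_medium_def pairwise_def disjnt_def by blast+

lemma bdry_disj: "x \<in> P \<Longrightarrow> P \<in> Sub \<Longrightarrow> x \<notin> bdryD G \<and> x \<notin> bdryN G"
  using bdry(1) open\<Omega> frontier_disjoint_eq[of \<Omega>] by blast

lemma sub_borel: "P \<in> Sub \<Longrightarrow> P \<in> sets borel"
  using flat_measure_openin_pos(2) sub by blast

lemma sub_open: assumes "P \<in> Sub" "x \<in> P" "w \<in> tangent P"
  shows "\<forall>\<^sub>F t in at_right 0. x - t *\<^sub>R w \<in> P"
proof -
  obtain e where e: "e > 0" "cball x e \<inter> affine hull P \<subseteq> P"
    using sub(4)[OF assms(1)] assms(2) openin_contains_cball[of "affine hull P" P] by auto
  have "((\<lambda>t. x - t *\<^sub>R w) \<longlongrightarrow> x - 0 *\<^sub>R w) (at_right 0)" by (intro tendsto_intros)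
  then have "\<forall>\<^sub>F t in at_right 0. dist (x - t *\<^sub>R w) (x - 0 *\<^sub>R w) < e" using e(1) by (rule tendstoD)
  then show ?thesis
  proof eventually_elim
    case (elim t)
    have "x + (- t) *\<^sub>R w \<in> affine hull P"
      using assms by (intro affine_hull_add_tangent subspace_scale subspace_tangent hull_inc)
    moreover have "x - t *\<^sub>R w \<in> cball x e" using elim by (simp add: dist_commute less_imp_le)
    ultimately show ?case using e(2) by auto
  qed
qed

lemma triang:
  assumes "P \<in> Sub" shows "triangulation (elems M P)" "\<Union>(elems M P) = closure P" "shape_regular \<sigma> (elems M P)"
  using mesh assms unfolding admissible_mesh_def triangulates_def by auto

lemma elem:
  assumes "P \<in> Sub" "T \<in> elems M P"
  shows "aff_dim P simplex T" "rel_interior T \<subseteq> P" "aff_dim T = aff_dim P" "T \<noteq> {}"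
    "affine hull T = affine hull P" "tangent T = tangent P"
proof -
  show s: "aff_dim P simplex T" and r: "rel_interior T \<subseteq> P"
    using mesh assms unfolding admissible_mesh_def triangulates_def by auto
  show d: "aff_dim T = aff_dim P" by (rule aff_dim_simplex[OF s])
  show ne: "T \<noteq> {}" using d sub(1)[OF assms(1)] aff_dim_negative_iff by (metis aff_dim_empty_eq)
  have "affine hull T = affine hull (rel_interior T)"
    using convex_simplex[OF s] by (simp add: rel_interior_same_affine_hull)
  also have "\<dots> \<subseteq> affine hull P" using r by (rule hull_mono)
  finally show aff: "affine hull T = affine hull P"
    using d ne by (intro affine_dim_equal) auto
  show "tangent T = tangent P" by (rule tangent_cong[OF aff])
qed

lemma all_elemsE: "T \<in> EE \<Longrightarrow> \<exists>P\<in>Sub. T \<in> elems M P"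
  by (auto simp: all_elems_def)

lemma all_elemsI: "P \<in> Sub \<Longrightarrow> T \<in> elems M P \<Longrightarrow> T \<in> EE"
  by (auto simp: all_elems_def)

lemma triangulation_disjoint:
  assumes "triangulation \<T>" "T \<in> \<T>" "T' \<in> \<T>" "x \<in> rel_interior T" "x \<in> rel_interior T'"
  shows "T = T'"
proof -
  have f: "(T \<inter> T') face_of T" "(T' \<inter> T) face_of T'" using assms(1,2,3) unfolding triangulation_def by auto
  have x: "x \<in> T" "x \<in> T'" using assms(4,5) rel_interior_subset by auto
  have "T \<subseteq> T \<inter> T'" using subset_of_face_of[OF f(1), of T] assms(4) x by auto
  moreover have "T' \<subseteq> T' \<inter> T" using subset_of_face_of[OF f(2), of T'] assms(5) x by auto
  ultimately show ?thesis by auto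
qed

lemma triangulation_cells:
  assumes "triangulation \<T>" "\<And>T. T \<in> \<T> \<Longrightarrow> T \<noteq> {}"
  shows "cells \<T>"
proof
  show "finite \<T>" using assms(1) by (simp add: triangulation_def)
  show "aff_dim T simplex T" if "T \<in> \<T>" for T
    using assms(1) that aff_dim_simplex by (force simp: triangulation_def)
next
  show "T = T'" if "T \<in> \<T>" "T' \<in> \<T>" "x \<in> rel_interior T" "x \<in> rel_interior T'" for T T' x
    by (rule triangulation_disjoint[OF assms(1) that])
qed (rule assms(2))

lemma elem_subdomain: "P \<in> Sub \<Longrightarrow> Q \<in> Sub \<Longrightarrow> T \<in> elems M P \<Longrightarrow> T \<in> elems M Q \<Longrightarrow> P = Q"
proof -
  assume h: "P \<in> Sub" "Q \<in> Sub" "T \<in> elems M P" "T \<in> elems M Q"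
  have "rel_interior T \<noteq> {}"
    using elem(4)[OF h(1,3)] convex_simplex[OF elem(1)[OF h(1,3)]] by (simp add: rel_interior_eq_empty)
  then show "P = Q" using elem(2)[OF h(1,3)] elem(2)[OF h(2,4)] disjSub[OF h(1,2)] by blast
qed

sublocale cells EE
proof
  show "finite EE" unfolding all_elems_def
    using finSub triang(1) by (auto simp: triangulation_def)
  fix T assume "T \<in> EE"
  then obtain P where P: "P \<in> Sub" "T \<in> elems M P" using all_elemsE by blast
  show "T \<noteq> {}" by (rule elem(4)[OF P])
  show "aff_dim T simplex T" using elem(1,3)[OF P] by simp
next
  fix T T' x assume h: "T \<in> EE" "T' \<in> EE" "x \<in> rel_interior T" "x \<in> rel_interior T'"
  obtain P where P: "P \<in> Sub" "T \<in> elems M P" using all_elemsE[OF h(1)] by blast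
  obtain Q where Q: "Q \<in> Sub" "T' \<in> elems M Q" using all_elemsE[OF h(2)] by blast
  have "P = Q" using disjSub[OF P(1) Q(1)] elem(2)[OF P] elem(2)[OF Q] h(3,4) by blast
  then show "T = T'" using triangulation_disjoint[OF triang(1)[OF P(1)] P(2)] Q(2) h(3,4) by blast
qed

lemma elem_facet_dim:
  assumes "P \<in> Sub" "T \<in> elems M P" "F facet_of T"
  shows "aff_dim F = aff_dim P - 1"
  using assms(3) elem(3)[OF assms(1,2)] by (simp add: facet_of_def)

lemma facet_cases:
  assumes "P \<in> Sub" "T \<in> elems M P" "F facet_of T"
  shows "rel_interior F \<subseteq> P \<or> (\<exists>i\<in>ifaces G. (T, F) \<in> ifacets M i) \<or>
    rel_interior F \<subseteq> bdryD G \<or> rel_interior F \<subseteq> bdryN G"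
  using mesh assms unfolding admissible_mesh_def by blast

subsection \<open>Interfaces\<close>

lemma iface:
  assumes "i \<in> ifaces G"
  shows "low i \<in> Sub" "high i \<in> Sub" "aff_dim (high i) = aff_dim (low i) + 1" "norm (normal i) = 1"
    "\<And>s. s \<in> tangent (low i) \<Longrightarrow> normal i \<bullet> s = 0"
    "\<And>x. x \<in> low i \<Longrightarrow> \<forall>\<^sub>F t in at_right 0. x - t *\<^sub>R normal i \<in> high i"
  using assms by (auto simp: ifaces_def)

lemma iface_tangent:
  assumes i: "i \<in> ifaces G"
  shows "low i \<subseteq> affine hull (high i)" "normal i \<in> tangent (high i)"
proof -
  have *: "x \<in> affine hull (high i) \<and> normal i \<in> tangent (high i)" if x: "x \<in> low i" for x
  proof -
    obtain e where e: "e > 0" "\<And>t. 0 < t \<Longrightarrow> t < e \<Longrightarrow> x - t *\<^sub>R normal i \<in> high i"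
      using iface(6)[OF i x] by (auto simp: eventually_at_right_field)
    define a where "a = x - (e/2) *\<^sub>R normal i"
    define b where "b = x - (e/4) *\<^sub>R normal i"
    have ab: "a \<in> affine hull (high i)" "b \<in> affine hull (high i)"
      using e by (auto simp: a_def b_def intro!: hull_inc)
    have d: "b - a = (e/4) *\<^sub>R normal i" by (simp add: a_def b_def algebra_simps flip: scaleR_add_left)
    have "(4/e) *\<^sub>R (b - a) \<in> tangent (high i)" using ab by (intro subspace_scale subspace_tangent tangent_diff)
    then have n: "normal i \<in> tangent (high i)" using e(1) by (simp add: d)
    have "b + (e/4) *\<^sub>R normal i \<in> affine hull (high i)"
      using ab n by (intro affine_hull_add_tangent subspace_scale subspace_tangent)
    then show ?thesis using n by (simp add: b_def)
  qed
  then show "low i \<subseteq> affine hull (high i)" by auto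
  obtain x where "x \<in> low i" using sub(1)[OF iface(1)[OF i]] by auto
  then show "normal i \<in> tangent (high i)" using * by auto
qed

text \<open>The unit normal spans the orthogonal complement of the tangent space of \<open>low i\<close> in that of \<open>high i\<close>, which
  is a line; hence there are at most two interfaces for each pair of subdomains.\<close>

lemma finite_ifaces: "finite (ifaces G)"
proof -
  define N where "N S P = {\<nu>. \<exists>i\<in>ifaces G. low i = S \<and> high i = P \<and> normal i = \<nu>}" for S P
  have fin: "finite (N S P)" if SP: "S \<in> Sub" "P \<in> Sub" for S P
  proof (cases "N S P = {}")
    case False
    then obtain \<nu> where "\<nu> \<in> N S P" by auto
    then obtain i where i: "i \<in> ifaces G" "low i = S" "high i = P" "normal i = \<nu>" by (auto simp: N_def)
    define U where "U = span (insert \<nu> (tangent S))"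
    have "\<nu> \<notin> span (tangent S)"
    proof
      assume "\<nu> \<in> span (tangent S)"
      then have "\<nu> \<in> tangent S" by (simp add: span_eq_iff[THEN iffD2, OF subspace_tangent])
      then have "\<nu> \<bullet> \<nu> = 0" using iface(5)[OF i(1)] i by auto
      then show False using iface(4)[OF i(1)] i by simp
    qed
    then have "dim U = dim (tangent S) + 1" by (simp add: U_def dim_insert)
    moreover have "int (dim (tangent P)) = int (dim (tangent S)) + 1"
      using dim_tangent[OF sub(1)[OF SP(1)]] dim_tangent[OF sub(1)[OF SP(2)]] iface(3)[OF i(1)] i by simp
    moreover have "U \<subseteq> tangent P"
      unfolding U_def using iface_tangent[OF i(1)] tangent_mono[of S P] i by (intro span_minimal) auto
    ultimately have UP: "U = tangent P"
      by (intro subspace_dim_equal) (auto simp: U_def)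
    have "N S P \<subseteq> {\<nu>, - \<nu>}"
    proof
      fix \<mu> assume "\<mu> \<in> N S P"
      then obtain j where j: "j \<in> ifaces G" "low j = S" "high j = P" "normal j = \<mu>" by (auto simp: N_def)
      have "\<mu> \<in> U" using iface_tangent(2)[OF j(1)] j UP by simp
      then obtain k where k: "\<mu> - k *\<^sub>R \<nu> \<in> span (tangent S)" unfolding U_def span_breakdown_eq by auto
      then have s: "\<mu> - k *\<^sub>R \<nu> \<in> tangent S" by (simp add: span_eq_iff[THEN iffD2, OF subspace_tangent])
      have "\<mu> \<bullet> (\<mu> - k *\<^sub>R \<nu>) = 0" "\<nu> \<bullet> (\<mu> - k *\<^sub>R \<nu>) = 0"
        using iface(5)[OF j(1)] iface(5)[OF i(1)] s i j by auto
      then have "(\<mu> - k *\<^sub>R \<nu>) \<bullet> (\<mu> - k *\<^sub>R \<nu>) = 0"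
        by (simp add: inner_diff_left[of \<mu> "k *\<^sub>R \<nu>"])
      then have m: "\<mu> = k *\<^sub>R \<nu>" by simp
      then have "\<bar>k\<bar> = 1" using iface(4)[OF j(1)] iface(4)[OF i(1)] i j by simp
      then show "\<mu> \<in> {\<nu>, - \<nu>}" using m by (auto simp: abs_if split: if_splits)
    qed
    then show ?thesis using finite_subset by blast
  qed simp
  have "ifaces G \<subseteq> (\<lambda>(S, P, \<nu>). Iface S P \<nu>) ` (SIGMA S:Sub. SIGMA P:Sub. N S P)"
  proof
    fix i assume i: "i \<in> ifaces G"
    have "(low i, high i, normal i) \<in> (SIGMA S:Sub. SIGMA P:Sub. N S P)"
      using i iface(1,2)[OF i] by (auto simp: N_def)
    then have "(\<lambda>(S, P, \<nu>). Iface S P \<nu>) (low i, high i, normal i)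
        \<in> (\<lambda>(S, P, \<nu>). Iface S P \<nu>) ` (SIGMA S:Sub. SIGMA P:Sub. N S P)" by (rule imageI)
    then show "i \<in> (\<lambda>(S, P, \<nu>). Iface S P \<nu>) ` (SIGMA S:Sub. SIGMA P:Sub. N S P)" by simp
  qed
  moreover have "finite (SIGMA S:Sub. SIGMA P:Sub. N S P)"
    using finSub fin by (intro finite_SigmaI) auto
  ultimately show ?thesis using finite_subset by blast
qed

lemma ifacet:
  assumes "i \<in> ifaces G" "(T, F) \<in> ifacets M i"
  shows "T \<in> elems M (high i)" "F facet_of T" "rel_interior F \<subseteq> low i" "outer_normal T F = normal i" "T \<in> EE"
  using assms iface(2)[OF assms(1)] by (auto simp: ifacets_def intro: all_elemsI)

lemma ifacet_unique:
  assumes "i \<in> ifaces G" "(T, F) \<in> ifacets M i" "j \<in> ifaces G" "(T, F) \<in> ifacets M j"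
  shows "i = j"
proof -
  note fi = ifacet[OF assms(1,2)] and fj = ifacet[OF assms(3,4)]
  obtain x where "x \<in> rel_interior F" using facet_pt[OF fi(5,2)] .
  then have "low i = low j" using disjSub[OF iface(1)[OF assms(1)] iface(1)[OF assms(3)]] fi(3) fj(3) by blast
  moreover have "high i = high j"
    by (rule elem_subdomain[OF iface(2)[OF assms(1)] iface(2)[OF assms(3)] fi(1) fj(1)])
  moreover have "normal i = normal j" using fi(4) fj(4) by simp
  ultimately show ?thesis by (rule iface.expand[OF conjI[OF _ conjI]])
qed

text \<open>Both cells contain the points just behind a common point of the facets, so they coincide.\<close>

lemma facet_side_unique:
  assumes "T \<in> EE" "F facet_of T" "T' \<in> EE" "F' facet_of T'"
    "x \<in> rel_interior F" "x \<in> rel_interior F'" "outer_normal T F = outer_normal T' F'"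
  shows "T = T'" "F = F'"
proof -
  have "\<forall>\<^sub>F t in at_right 0. x - t *\<^sub>R outer_normal T F \<in> rel_interior T"
    by (rule facet_facts(10)[OF simplexE[OF assms(1)] assms(2,5)])
  moreover have "\<forall>\<^sub>F t in at_right 0. x - t *\<^sub>R outer_normal T F \<in> rel_interior T'"
    unfolding assms(7) by (rule facet_facts(10)[OF simplexE[OF assms(3)] assms(4,6)])
  ultimately have "\<forall>\<^sub>F t in at_right (0::real). T = T'"
    by eventually_elim (rule disjE[OF assms(1,3)])
  then show TT: "T = T'" by simp
  show "F = F'"
    using assms(2,4-6) unfolding TT by (intro face_of_eq[of F T' F']) (auto dest: facet_of_imp_face_of)
qed

lemma ifacet_disjoint:
  assumes "i \<in> ifaces G" "(T, F) \<in> ifacets M i" "(T', F') \<in> ifacets M i"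
    "x \<in> rel_interior F" "x \<in> rel_interior F'"
  shows "T = T'" "F = F'"
  using facet_side_unique[of T F T' F' x] ifacet[OF assms(1,2)] ifacet[OF assms(1,3)] assms(4,5) by auto

lemma finite_ifacets: "i \<in> ifaces G \<Longrightarrow> finite (ifacets M i)"
proof -
  assume i: "i \<in> ifaces G"
  have "ifacets M i \<subseteq> (SIGMA T:EE. {F. F facet_of T})" using ifacet[OF i] by auto
  moreover have "finite (SIGMA T:EE. {F. F facet_of T})"
    using finE facets_finite_card(1)[OF simplexE] by (intro finite_SigmaI)
  ultimately show ?thesis using finite_subset by blast
qed

lemma facet_affine_hull:
  assumes "T \<in> EE" "F facet_of T" "rel_interior F \<subseteq> S" "aff_dim S = aff_dim T - 1"
  shows "affine hull F = affine hull S" "tangent F = tangent S"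
proof -
  have c: "convex F" using facet_facts(2)[OF simplexE[OF assms(1)] assms(2)] convex_simplex by blast
  have "affine hull F = affine hull (rel_interior F)" using c by (simp add: rel_interior_same_affine_hull)
  also have "\<dots> \<subseteq> affine hull S" using assms(3) by (rule hull_mono)
  finally have "affine hull F \<subseteq> affine hull S" .
  then show "affine hull F = affine hull S"
    using assms(2,4) by (intro affine_dim_equal) (auto simp: facet_of_def)
  then show "tangent F = tangent S" by (rule tangent_cong)
qed

lemma ifacet_affine_hull:
  assumes "i \<in> ifaces G" "(T, F) \<in> ifacets M i"
  shows "affine hull F = affine hull (low i)" "tangent F = tangent (low i)"
  using facet_affine_hull[OF ifacet(5,2,3)[OF assms]] iface(3)[OF assms(1)]
    elem(3)[OF iface(2)[OF assms(1)] ifacet(1)[OF assms]] by auto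

lemma facet_openin: "openin (top_of_set (affine hull F)) (rel_interior F)"
  by (rule openin_rel_interior)

lemma ifacet_measure:
  assumes "i \<in> ifaces G" "(T, F) \<in> ifacets M i"
  shows "measure (flat_measure (low i)) (rel_interior F) > 0" "rel_interior F \<in> sets borel" "bounded (rel_interior F)"
proof -
  have op: "openin (top_of_set (affine hull (low i))) (rel_interior F)"
    using facet_openin[of F] ifacet_affine_hull[OF assms] by simp
  show b: "bounded (rel_interior F)"
    using bounded_subset[OF sub(3)[OF iface(1)[OF assms(1)]] ifacet(3)[OF assms]] .
  have ne: "rel_interior F \<noteq> {}" using facet_facts(4)[OF simplexE[OF ifacet(5)[OF assms]] ifacet(2)[OF assms]] .
  show "measure (flat_measure (low i)) (rel_interior F) > 0" "rel_interior F \<in> sets borel"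
    using flat_measure_openin_pos[OF op ne b] by auto
qed

subsection \<open>The two sides of a facet\<close>

text \<open>Conformity of the triangulation: the intersection of the cells is a face of both, and a face that meets the relative
  interior of a facet contains it.\<close>

lemma facet_shared:
  assumes P: "P \<in> Sub" "T \<in> elems M P" "T' \<in> elems M P" "F' facet_of T'"
    and x: "x \<in> rel_interior F'" "x \<in> T"
  shows "F' facet_of T"
proof -
  have F'T': "F' \<subseteq> T'" using P(4) by (rule facet_of_imp_subset)
  have xF': "x \<in> F'" using x rel_interior_subset by blast
  have tr: "(T \<inter> T') face_of T" "(T' \<inter> T) face_of T'"
    using triang(1)[OF P(1)] P(2,3) unfolding triangulation_def by auto
  note tr = tr[unfolded Int_commute[of T' T]]
  have sub': "F' \<subseteq> T \<inter> T'" using subset_of_face_of[OF tr(2) F'T'] x xF' F'T' by auto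
  have "F' face_of (T \<inter> T')"
    using face_of_subset[OF facet_of_imp_face_of[OF P(4)] sub'] by auto
  then have "F' face_of T" using tr(1) face_of_trans by blast
  moreover have "aff_dim F' = aff_dim T - 1"
    using elem_facet_dim[OF P(1,3,4)] elem(3)[OF P(1,2)] by simp
  ultimately show ?thesis using P(4) by (auto simp: facet_of_def)
qed

text \<open>Just across a facet inside a subdomain the field is either extended by zero or given on a cell that
  shares this facet, where its normal component is known.\<close>

lemma facet_field_other_side:
  assumes TF: "T \<in> EE" "F facet_of T" and P: "P \<in> Sub" "T' \<in> elems M P" "F' facet_of T'"
    and int: "rel_interior F' \<subseteq> P" and x: "x \<in> rel_interior F'"
  shows "ntrace (facet_field T F) (- outer_normal T' F') x
    = (if F' = F \<and> - outer_normal T' F' = outer_normal T F then 1 else 0)"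
proof -
  define \<mu> where "\<mu> = - outer_normal T' F'"
  have T'E: "T' \<in> EE" using P by (intro all_elemsI)
  have sT': "aff_dim T' simplex T'" by (rule simplexE[OF T'E])
  note f' = facet_facts[OF sT' P(3)]
  have \<mu>: "\<mu> \<in> tangent P" "norm \<mu> = 1" "\<And>y. y \<in> tangent F' \<Longrightarrow> \<mu> \<bullet> y = 0"
    using f'(5,6,7) elem(6)[OF P(1,2)] by (auto simp: \<mu>_def intro: subspace_neg)
  have xP: "x \<in> P" using int x by auto
  have inT: "F' = F \<Longrightarrow> \<mu> = outer_normal T F \<Longrightarrow> \<forall>\<^sub>F t in at_right 0. x - t *\<^sub>R \<mu> \<in> rel_interior T"
    using facet_facts(10)[OF simplexE[OF TF(1)] TF(2)] x by simp
  have "ntrace (facet_field T F) \<mu> x = (if F' = F \<and> \<mu> = outer_normal T F then 1 else 0)"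
    using convex_eventually[OF convex_rel_interior[OF convexE[OF TF(1)]], of x \<mu>]
  proof
    assume ev: "\<forall>\<^sub>F t in at_right 0. x - t *\<^sub>R \<mu> \<in> rel_interior T"
    have "\<forall>\<^sub>F t in at_right 0. x - t *\<^sub>R \<mu> \<in> rel_interior T \<and> x - t *\<^sub>R \<mu> \<in> P \<and> 0 < t"
      using ev sub_open[OF P(1) xP \<mu>(1)] eventually_at_right_less[of 0] by eventually_elim auto
    then obtain t where t: "x - t *\<^sub>R \<mu> \<in> rel_interior T" "x - t *\<^sub>R \<mu> \<in> P" "0 < t"
      using eventually_happens'[OF trivial_limit_at_right_real] by blast
    obtain Q where Q: "Q \<in> Sub" "T \<in> elems M Q" using all_elemsE[OF TF(1)] by blast
    have "P = Q" using disjSub[OF P(1) Q(1) t(2)] elem(2)[OF Q] t(1) by blast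
    then have TP: "T \<in> elems M P" using Q by simp
    have xT: "x \<in> T"
    proof (rule Lim_in_closed_set)
      show "closed T" using compactE[OF TF(1)] compact_imp_closed by blast
      have "((\<lambda>t. x - t *\<^sub>R \<mu>) \<longlongrightarrow> x - 0 *\<^sub>R \<mu>) (at_right 0)" by (intro tendsto_intros)
      then show "((\<lambda>t. x - t *\<^sub>R \<mu>) \<longlongrightarrow> x) (at_right 0)" by simp
      show "\<forall>\<^sub>F t in at_right 0. x - t *\<^sub>R \<mu> \<in> T"
        using ev by eventually_elim (use rel_interior_subset in blast)
    qed simp
    have F'T: "F' facet_of T" by (rule facet_shared[OF P(1) TP P(2,3) x xT])
    have xF': "x \<in> F'" using x rel_interior_subset by blast
    have \<mu>n: "\<mu> = outer_normal T F'"
    proof (rule facet_facts(11)[OF simplexE[OF TF(1)] F'T xF' _ \<mu>(2,3) t(3)])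
      show "\<mu> \<in> tangent T" using \<mu>(1) elem(6)[OF P(1) TP] by simp
      show "x - t *\<^sub>R \<mu> \<in> T" using t(1) rel_interior_subset by blast
    qed
    have "ntrace (facet_field T F) \<mu> x = rt_basis T F x \<bullet> \<mu>"
      by (rule ntrace_inside[OF ev facet_facts(8)[OF simplexE[OF TF(1)] TF(2)]]) (simp add: facet_field_def)
    also have "\<dots> = (if F' = F then 1 else 0)"
      unfolding \<mu>n by (rule rt_basis_flux[OF simplexE[OF TF(1)] TF(2) F'T xF'])
    finally show ?thesis using \<mu>n by auto
  next
    assume ev: "\<forall>\<^sub>F t in at_right 0. x - t *\<^sub>R \<mu> \<notin> rel_interior T"
    have "\<forall>\<^sub>F t in at_right 0. facet_field T F (x - t *\<^sub>R \<mu>) = 0"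
      using ev by eventually_elim (simp add: facet_field_def)
    then have "((\<lambda>t. facet_field T F (x - t *\<^sub>R \<mu>)) \<longlongrightarrow> 0) (at_right 0)" by (rule tendsto_eventually)
    then have z: "ntrace (facet_field T F) \<mu> x = 0" using ntrace_limit[of "facet_field T F" x \<mu> 0] by simp
    have "\<not> (F' = F \<and> \<mu> = outer_normal T F)"
    proof
      assume "F' = F \<and> \<mu> = outer_normal T F"
      then have "\<forall>\<^sub>F t in at_right 0. x - t *\<^sub>R \<mu> \<in> rel_interior T" using inT by blast
      with ev have "\<forall>\<^sub>F t in at_right (0::real). False" by eventually_elim blast
      then show False by simp
    qed
    with z show ?thesis by auto
  qed
  then show ?thesis by (simp add: \<mu>_def)
qed

lemma facet_field_this_side:
  assumes "T \<in> EE" "F facet_of T" "T' \<in> EE" "F' facet_of T'" "x \<in> rel_interior F'"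
  shows "ntrace (facet_field T F) (outer_normal T' F') x = (if T' = T \<and> F' = F then 1 else 0)"
  using ntrace_flux[OF facet_field_broken_RT[OF assms(1,2)] assms(3,4,5)] facet_field_flux[OF assms(1-4)] by simp

lemma V_h_iff: "v \<in> V_h G M \<longleftrightarrow> v \<in> broken_RT \<and> (\<forall>P\<in>Sub. \<forall>T\<in>elems M P. \<forall>F. F facet_of T \<longrightarrow>
    (rel_interior F \<subseteq> P \<longrightarrow> (\<forall>x\<in>rel_interior F.
       ntrace v (outer_normal T F) x + ntrace v (- outer_normal T F) x = 0)) \<and>
    (rel_interior F \<subseteq> bdryN G \<longrightarrow> (\<forall>x\<in>rel_interior F. ntrace v (outer_normal T F) x = 0)))"
  (is "_ \<longleftrightarrow> _ \<and> (\<forall>P\<in>Sub. \<forall>T\<in>elems M P. ?C P T)")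
proof -
  define p where "p T \<longleftrightarrow> (\<exists>p\<in>RT0 T. \<forall>x\<in>rel_interior T. v x = p x)" for T
  define z where "z \<longleftrightarrow> (\<forall>x. x \<notin> (\<Union>T\<in>EE. rel_interior T) \<longrightarrow> v x = 0)"
  define c where "c = ?C"
  have "v \<in> V_h G M \<longleftrightarrow> (\<forall>P\<in>Sub. \<forall>T\<in>elems M P. p T \<and> c P T) \<and> z"
    unfolding V_h_def p_def z_def c_def mem_Collect_eq ..
  moreover have "v \<in> broken_RT \<longleftrightarrow> (\<forall>T\<in>EE. p T) \<and> z" unfolding broken_RT_def p_def z_def mem_Collect_eq ..
  moreover have "(\<forall>T\<in>EE. p T) \<longleftrightarrow> (\<forall>P\<in>Sub. \<forall>T\<in>elems M P. p T)" by (auto simp: all_elems_def)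
  ultimately have "v \<in> V_h G M \<longleftrightarrow> v \<in> broken_RT \<and> (\<forall>P\<in>Sub. \<forall>T\<in>elems M P. c P T)" by blast
  then show ?thesis by (simp only: c_def)
qed

lemma V_h_broken_RT: "V_h G M \<subseteq> broken_RT"
  using V_h_iff by blast

lemma V_hD:
  assumes "v \<in> V_h G M"
  shows "v \<in> broken_RT"
    "\<And>P T F x. P \<in> Sub \<Longrightarrow> T \<in> elems M P \<Longrightarrow> F facet_of T \<Longrightarrow> rel_interior F \<subseteq> P \<Longrightarrow>
      x \<in> rel_interior F \<Longrightarrow> ntrace v (outer_normal T F) x + ntrace v (- outer_normal T F) x = 0"
    "\<And>P T F x. P \<in> Sub \<Longrightarrow> T \<in> elems M P \<Longrightarrow> F facet_of T \<Longrightarrow> rel_interior F \<subseteq> bdryN G \<Longrightarrow>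
      x \<in> rel_interior F \<Longrightarrow> ntrace v (outer_normal T F) x = 0"
  using assms unfolding V_h_iff by simp_all

lemma subspace_V_h: "subspace (V_h G M)"
  unfolding subspace_def
proof (intro conjI ballI allI)
  have z: "ntrace 0 \<nu> x = 0" for \<nu> x :: 'a
    using ntrace_scale[OF subspace_0[OF subspace_broken_RT], of 0 \<nu> x] by simp
  show "0 \<in> V_h G M" unfolding V_h_iff using subspace_0[OF subspace_broken_RT] z by simp
next
  fix v w assume v: "v \<in> V_h G M" and w: "w \<in> V_h G M"
  then have PWs: "v \<in> broken_RT" "w \<in> broken_RT" "v + w \<in> broken_RT" using V_h_broken_RT subspace_add[OF subspace_broken_RT] by auto
  show "v + w \<in> V_h G M" unfolding V_h_iff
  proof (intro conjI PWs(3) ballI allI impI)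
    fix P T F x assume h: "P \<in> Sub" "T \<in> elems M P" "F facet_of T" "rel_interior F \<subseteq> P" "x \<in> rel_interior F"
    have "ntrace v (outer_normal T F) x + ntrace v (- outer_normal T F) x = 0"
      "ntrace w (outer_normal T F) x + ntrace w (- outer_normal T F) x = 0"
      by (rule V_hD(2)[OF v h], rule V_hD(2)[OF w h])
    then show "ntrace (v + w) (outer_normal T F) x + ntrace (v + w) (- outer_normal T F) x = 0"
      unfolding ntrace_add[OF PWs(1,2)] by linarith
  next
    fix P T F x assume h: "P \<in> Sub" "T \<in> elems M P" "F facet_of T" "rel_interior F \<subseteq> bdryN G" "x \<in> rel_interior F"
    have "ntrace v (outer_normal T F) x = 0" "ntrace w (outer_normal T F) x = 0"
      by (rule V_hD(3)[OF v h], rule V_hD(3)[OF w h])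
    then show "ntrace (v + w) (outer_normal T F) x = 0" unfolding ntrace_add[OF PWs(1,2)] by simp
  qed
next
  fix c v assume v: "v \<in> V_h G M"
  then have PWs: "v \<in> broken_RT" "c *\<^sub>R v \<in> broken_RT" using V_h_broken_RT subspace_scale[OF subspace_broken_RT] by auto
  show "c *\<^sub>R v \<in> V_h G M" unfolding V_h_iff
  proof (intro conjI PWs(2) ballI allI impI)
    fix P T F x assume h: "P \<in> Sub" "T \<in> elems M P" "F facet_of T" "rel_interior F \<subseteq> P" "x \<in> rel_interior F"
    have "ntrace v (outer_normal T F) x + ntrace v (- outer_normal T F) x = 0"
      by (rule V_hD(2)[OF v h])
    then show "ntrace (c *\<^sub>R v) (outer_normal T F) x + ntrace (c *\<^sub>R v) (- outer_normal T F) x = 0"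
      unfolding ntrace_scale[OF PWs(1)] by (simp flip: distrib_left)
  next
    fix P T F x assume h: "P \<in> Sub" "T \<in> elems M P" "F facet_of T" "rel_interior F \<subseteq> bdryN G" "x \<in> rel_interior F"
    have "ntrace v (outer_normal T F) x = 0"
      by (rule V_hD(3)[OF v h])
    then show "ntrace (c *\<^sub>R v) (outer_normal T F) x = 0" unfolding ntrace_scale[OF PWs(1)] by simp
  qed
qed

lemma V0_h_iff: "v \<in> V0_h G M \<longleftrightarrow> v \<in> V_h G M \<and>
    (\<forall>i\<in>ifaces G. \<forall>T F. (T, F) \<in> ifacets M i \<longrightarrow> facet_flux v T F = 0)"
proof -
  have "(\<forall>(T, F)\<in>ifacets M i. \<forall>x\<in>rel_interior F. ntrace v (normal i) x = 0) \<longleftrightarrow>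
    (\<forall>T F. (T, F) \<in> ifacets M i \<longrightarrow> facet_flux v T F = 0)" if v: "v \<in> V_h G M" and i: "i \<in> ifaces G" for i
  proof -
    have "(\<forall>x\<in>rel_interior F. ntrace v (normal i) x = 0) \<longleftrightarrow> facet_flux v T F = 0" if TF: "(T, F) \<in> ifacets M i" for T F
    proof -
      note f = ifacet[OF i TF]
      obtain y where "y \<in> rel_interior F" using facet_pt[OF f(5,2)] .
      moreover have "ntrace v (normal i) x = facet_flux v T F" if "x \<in> rel_interior F" for x
        using ntrace_flux[OF _ f(5,2) that] v V_h_broken_RT f(4) by auto
      ultimately show ?thesis by auto
    qed
    then show ?thesis by blast
  qed
  then show ?thesis unfolding V0_h_def by blast
qed

lemma subspace_V0_h: "subspace (V0_h G M)"
proof -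
  have fl: "facet_flux 0 T F = 0" if "T \<in> EE" "F facet_of T" for T F
    using facet_flux_scale[OF subspace_0[OF subspace_broken_RT] that, of 0] by simp
  show ?thesis
    unfolding subspace_def
  proof (intro conjI ballI allI)
    show "0 \<in> V0_h G M" unfolding V0_h_iff using subspace_0[OF subspace_V_h] fl ifacet(2,5) by blast
    fix v w assume "v \<in> V0_h G M" "w \<in> V0_h G M"
    then have v: "v \<in> V_h G M" "\<And>i T F. i \<in> ifaces G \<Longrightarrow> (T, F) \<in> ifacets M i \<Longrightarrow> facet_flux v T F = 0"
      and w: "w \<in> V_h G M" "\<And>i T F. i \<in> ifaces G \<Longrightarrow> (T, F) \<in> ifacets M i \<Longrightarrow> facet_flux w T F = 0"
      unfolding V0_h_iff by blast+
    have "facet_flux (v + w) T F = 0" if "i \<in> ifaces G" "(T, F) \<in> ifacets M i" for i T F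
      using facet_flux_add[OF V_hD(1)[OF v(1)] V_hD(1)[OF w(1)] ifacet(5,2)[OF that]] v(2)[OF that] w(2)[OF that]
      by simp
    then show "v + w \<in> V0_h G M" unfolding V0_h_iff using subspace_add[OF subspace_V_h v(1) w(1)] by blast
  next
    fix c v assume "v \<in> V0_h G M"
    then have v: "v \<in> V_h G M" "\<And>i T F. i \<in> ifaces G \<Longrightarrow> (T, F) \<in> ifacets M i \<Longrightarrow> facet_flux v T F = 0"
      unfolding V0_h_iff by blast+
    have "facet_flux (c *\<^sub>R v) T F = 0" if "i \<in> ifaces G" "(T, F) \<in> ifacets M i" for i T F
      using facet_flux_scale[OF V_hD(1)[OF v(1)] ifacet(5,2)[OF that]] v(2)[OF that] by simp
    then show "c *\<^sub>R v \<in> V0_h G M" unfolding V0_h_iff using subspace_scale[OF subspace_V_h v(1)] by blast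
  qed
qed

text \<open>A facet that lies in no subdomain of full dimension carries a basis field of its own; the facets on
  the interfaces and on the Dirichlet boundary are of this kind.\<close>

lemma facet_field_V_h:
  assumes TF: "T \<in> EE" "F facet_of T"
    and ni: "\<And>P T'. P \<in> Sub \<Longrightarrow> T' \<in> elems M P \<Longrightarrow> F facet_of T' \<Longrightarrow> \<not> rel_interior F \<subseteq> P"
    and nN: "\<not> rel_interior F \<subseteq> bdryN G"
  shows "facet_field T F \<in> V_h G M"
  unfolding V_h_iff
proof (intro conjI facet_field_broken_RT[OF TF] ballI allI impI)
  fix P T' F' x assume h: "P \<in> Sub" "T' \<in> elems M P" "F' facet_of T'" "rel_interior F' \<subseteq> P" "x \<in> rel_interior F'"
  have "F' \<noteq> F" using ni h by blast
  then show "ntrace (facet_field T F) (outer_normal T' F') x + ntrace (facet_field T F) (- outer_normal T' F') x = 0"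
    using facet_field_this_side[OF TF all_elemsI[OF h(1,2)] h(3,5)] facet_field_other_side[OF TF h] by simp
next
  fix P T' F' x assume h: "P \<in> Sub" "T' \<in> elems M P" "F' facet_of T'" "rel_interior F' \<subseteq> bdryN G" "x \<in> rel_interior F'"
  then have "F' \<noteq> F" using nN by blast
  then show "ntrace (facet_field T F) (outer_normal T' F') x = 0"
    using facet_field_this_side[OF TF all_elemsI[OF h(1,2)] h(3,5)] by simp
qed

lemma facet_field_ifacet_V_h:
  assumes "i \<in> ifaces G" "(T, F) \<in> ifacets M i"
  shows "facet_field T F \<in> V_h G M"
proof (rule facet_field_V_h[OF ifacet(5,2)[OF assms]])
  note f = ifacet[OF assms]
  obtain x where x: "x \<in> rel_interior F" using facet_pt[OF f(5,2)] .
  then have xl: "x \<in> low i" using f(3) by blast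
  show "\<not> rel_interior F \<subseteq> bdryN G" using bdry_disj[OF xl iface(1)[OF assms(1)]] x by blast
  fix P T' assume P: "P \<in> Sub" "T' \<in> elems M P" "F facet_of T'"
  show "\<not> rel_interior F \<subseteq> P"
  proof
    assume "rel_interior F \<subseteq> P"
    then have "P = low i" using disjSub[OF P(1) iface(1)[OF assms(1)] _ xl] x by blast
    then show False
      using elem_facet_dim[OF P] elem_facet_dim[OF iface(2)[OF assms(1)] f(1,2)] iface(3)[OF assms(1)] by simp
  qed
qed

lemma facet_field_Dirichlet_V0_h:
  assumes TF: "T \<in> EE" "F facet_of T" and D: "rel_interior F \<subseteq> bdryD G"
  shows "facet_field T F \<in> V0_h G M"
proof -
  obtain x where x: "x \<in> rel_interior F" using facet_pt[OF TF] .
  have nP: "\<not> rel_interior F \<subseteq> P" if "P \<in> Sub" for P using bdry_disj[OF _ that, of x] x D by blast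
  have V: "facet_field T F \<in> V_h G M"
  proof (rule facet_field_V_h[OF TF])
    show "\<not> rel_interior F \<subseteq> bdryN G" using D bdry(2) x by blast
  qed (use nP in auto)
  have "facet_flux (facet_field T F) T' F' = 0" if "i \<in> ifaces G" "(T', F') \<in> ifacets M i" for i T' F'
  proof -
    have "F' \<noteq> F" using nP[OF iface(1)[OF that(1)]] ifacet(3)[OF that] by blast
    then show ?thesis using facet_field_flux[OF TF ifacet(5,2)[OF that]] by simp
  qed
  with V show ?thesis unfolding V0_h_iff by blast
qed

lemma shared_facet_normals:
  assumes "P \<in> Sub" "T \<in> elems M P" "T' \<in> elems M P" "T \<noteq> T'" "F facet_of T" "F facet_of T'"
  shows "outer_normal T' F = - outer_normal T F"
proof -
  have E: "T \<in> EE" "T' \<in> EE" using assms by (auto intro: all_elemsI)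
  note f = facet_facts[OF simplexE[OF E(1)] assms(5)] and f' = facet_facts[OF simplexE[OF E(2)] assms(6)]
  have "outer_normal T' F \<in> tangent T" using f'(5) elem(6)[OF assms(1,2)] elem(6)[OF assms(1,3)] by simp
  then have "outer_normal T' F = outer_normal T F \<or> outer_normal T' F = - outer_normal T F"
    by (rule f(12)[OF _ f'(6,7)])
  moreover have "outer_normal T' F \<noteq> outer_normal T F"
  proof
    assume e: "outer_normal T' F = outer_normal T F"
    obtain x where x: "x \<in> rel_interior F" using facet_pt[OF E(1) assms(5)] .
    have "T = T'" by (rule facet_side_unique[OF E(1) assms(5) E(2) assms(6) x x e[symmetric]])
    with assms(4) show False by simp
  qed
  ultimately show ?thesis by blast
qed

text \<open>The normals of the two cells at the common facet are opposite, so the difference of the two basis fields has a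
  continuous normal component there.\<close>

lemma facet_field_pair_V0_h:
  assumes P: "P \<in> Sub" "T \<in> elems M P" "T' \<in> elems M P" "T \<noteq> T'" "F facet_of T" "F facet_of T'"
    and int: "rel_interior F \<subseteq> P"
  shows "facet_field T F - facet_field T' F \<in> V0_h G M"
proof -
  have E: "T \<in> EE" "T' \<in> EE" using P by (auto intro: all_elemsI)
  note PWs = facet_field_broken_RT[OF E(1) P(5)] facet_field_broken_RT[OF E(2) P(6)]
  have diff: "facet_field T F - facet_field T' F = facet_field T F + (-1) *\<^sub>R facet_field T' F" by simp
  have PWd: "facet_field T F - facet_field T' F \<in> broken_RT" using subspace_diff[OF subspace_broken_RT PWs] .
  have nt: "ntrace (facet_field T F - facet_field T' F) \<nu> x = ntrace (facet_field T F) \<nu> x - ntrace (facet_field T' F) \<nu> x" for \<nu> x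
    unfolding diff ntrace_add[OF PWs(1) subspace_scale[OF subspace_broken_RT PWs(2)]] ntrace_scale[OF PWs(2)] by simp
  have fl: "facet_flux (facet_field T F - facet_field T' F) T'' F'' = facet_flux (facet_field T F) T'' F'' - facet_flux (facet_field T' F) T'' F''"
    if "T'' \<in> EE" "F'' facet_of T''" for T'' F''
    unfolding diff facet_flux_add[OF PWs(1) subspace_scale[OF subspace_broken_RT PWs(2)] that]
      facet_flux_scale[OF PWs(2) that] by simp
  have nn: "outer_normal T' F = - outer_normal T F" by (rule shared_facet_normals[OF P])
  obtain x0 where x0: "x0 \<in> rel_interior F" using facet_pt[OF E(1) P(5)] .
  have x0P: "x0 \<in> P" using x0 int by blast
  have Vh: "facet_field T F - facet_field T' F \<in> V_h G M"
    unfolding V_h_iff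
  proof (intro conjI PWd ballI allI impI)
    fix P' T'' F'' x
    assume h: "P' \<in> Sub" "T'' \<in> elems M P'" "F'' facet_of T''" "rel_interior F'' \<subseteq> P'" "x \<in> rel_interior F''"
    have E'': "T'' \<in> EE" using h by (intro all_elemsI)
    note b = facet_field_this_side[OF E(1) P(5) E'' h(3,5)] facet_field_this_side[OF E(2) P(6) E'' h(3,5)]
      facet_field_other_side[OF E(1) P(5) h] facet_field_other_side[OF E(2) P(6) h]
    show "ntrace (facet_field T F - facet_field T' F) (outer_normal T'' F'') x
        + ntrace (facet_field T F - facet_field T' F) (- outer_normal T'' F'') x = 0"
    proof (cases "F'' = F")
      case False
      then show ?thesis unfolding nt using b by simp
    next
      case True
      have same: "T'' = S \<longleftrightarrow> outer_normal T'' F = outer_normal S F" if "S \<in> EE" "F facet_of S" for S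
        using facet_side_unique(1)[OF E'' _ that, of F x0] h(3) True x0 by auto
      show ?thesis
        unfolding nt using b same[OF E(1) P(5)] same[OF E(2) P(6)] nn True
        by (auto simp: minus_equation_iff)
    qed
  next
    fix P' T'' F'' x
    assume h: "P' \<in> Sub" "T'' \<in> elems M P'" "F'' facet_of T''" "rel_interior F'' \<subseteq> bdryN G" "x \<in> rel_interior F''"
    have E'': "T'' \<in> EE" using h by (intro all_elemsI)
    have "F'' \<noteq> F" using h(4) x0 bdry_disj[OF x0P P(1)] by blast
    then show "ntrace (facet_field T F - facet_field T' F) (outer_normal T'' F'') x = 0"
      unfolding nt facet_field_this_side[OF E(1) P(5) E'' h(3,5)] facet_field_this_side[OF E(2) P(6) E'' h(3,5)] by simp
  qed
  have "facet_flux (facet_field T F - facet_field T' F) T'' F'' = 0" if i: "i \<in> ifaces G" "(T'', F'') \<in> ifacets M i" for i T'' F''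
  proof -
    note f = ifacet[OF i]
    have "F'' \<noteq> F"
    proof
      assume F: "F'' = F"
      then have "P = low i" using disjSub[OF P(1) iface(1)[OF i(1)] x0P] f(3) x0 by blast
      then show False using elem_facet_dim[OF P(1,2,5)] elem_facet_dim[OF iface(2)[OF i(1)] f(1,2)] F iface(3)[OF i(1)] by simp
    qed
    then show ?thesis unfolding fl[OF f(5,2)] facet_field_flux[OF E(1) P(5) f(5,2)] facet_field_flux[OF E(2) P(6) f(5,2)] by simp
  qed
  with Vh show ?thesis unfolding V0_h_iff by blast
qed

subsection \<open>Connectedness of the mesh\<close>

text \<open>Faces of codimension at least two; generic points avoid them.\<close>

definition low_faces :: "'a set \<Rightarrow> 'a set set" where
  "low_faces P = {H. \<exists>T\<in>elems M P. H face_of T \<and> aff_dim H \<le> aff_dim P - 2}"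

lemma finite_low_faces: assumes "P \<in> Sub" shows "finite (low_faces P)"
proof -
  have "finite (\<Union>T\<in>elems M P. {H. H face_of T})"
    using triang(1)[OF assms] finite_polytope_faces[OF simplex_imp_polytope[OF elem(1)[OF assms]]]
    by (intro finite_UN_I) (auto simp: triangulation_def)
  then show ?thesis by (rule rev_finite_subset) (auto simp: low_faces_def)
qed

lemma generic_in_elem:
  assumes P: "P \<in> Sub" "T \<in> elems M P" and x: "x \<in> T" and gen: "\<And>H. H \<in> low_faces P \<Longrightarrow> x \<notin> H"
    and nr: "x \<notin> rel_interior T"
  obtains F where "F facet_of T" "x \<in> rel_interior F"
proof -
  obtain F where F: "F facet_of T" "x \<in> F" using simplex_boundary_facet[OF elem(1)[OF P] x nr] .
  have "x \<in> rel_interior F"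
  proof (rule ccontr)
    assume "x \<notin> rel_interior F"
    then obtain H where H: "H facet_of F" "x \<in> H"
      using simplex_boundary_facet[OF facet_facts(2)[OF elem(1)[OF P] F(1)] F(2)] by blast
    have "H face_of T" using H(1) F(1) face_of_trans by (blast dest: facet_of_imp_face_of)
    moreover have "aff_dim H = aff_dim P - 2"
      using H(1) elem_facet_dim[OF P F(1)] by (simp add: facet_of_def)
    ultimately have "H \<in> low_faces P" using P(2) by (auto simp: low_faces_def)
    with gen H(2) show False by blast
  qed
  with F(1) show thesis by (rule that)
qed

text \<open>The mesh resolves the interfaces and the boundary, so a single point decides on which of them a facet lies.\<close>

lemma facet_at_point:
  assumes P: "P \<in> Sub" "T \<in> elems M P" "F facet_of T" and x: "x \<in> rel_interior F"
  shows "x \<in> P \<Longrightarrow> rel_interior F \<subseteq> P"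
    "S \<in> Sub \<Longrightarrow> S \<noteq> P \<Longrightarrow> x \<in> S \<Longrightarrow> \<exists>i\<in>ifaces G. (T, F) \<in> ifacets M i \<and> low i = S"
    "x \<in> bdryD G \<Longrightarrow> rel_interior F \<subseteq> bdryD G"
proof -
  have i: "x \<in> low i \<and> low i \<in> Sub \<and> low i \<noteq> P" if "i \<in> ifaces G" "(T, F) \<in> ifacets M i" for i
  proof -
    have "high i = P" by (rule elem_subdomain[OF iface(2)[OF that(1)] P(1) ifacet(1)[OF that] P(2)])
    then have "low i \<noteq> P" using iface(3)[OF that(1)] by auto
    then show ?thesis using ifacet(3)[OF that] x iface(1)[OF that(1)] by blast
  qed
  note c = facet_cases[OF P]
  show "rel_interior F \<subseteq> P" if "x \<in> P"
    using c i disjSub[OF P(1) _ that] bdry_disj[OF that P(1)] x by blast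
  show "\<exists>i\<in>ifaces G. (T, F) \<in> ifacets M i \<and> low i = S" if S: "S \<in> Sub" "S \<noteq> P" "x \<in> S"
  proof -
    have "\<not> rel_interior F \<subseteq> P" using disjSub[OF P(1) S(1) _ S(3)] x S(2) by blast
    moreover have "\<not> rel_interior F \<subseteq> bdryD G" "\<not> rel_interior F \<subseteq> bdryN G"
      using bdry_disj[OF S(3,1)] x by auto
    ultimately obtain i where "i \<in> ifaces G" "(T, F) \<in> ifacets M i" using c by blast
    then show ?thesis using i disjSub[OF _ S(1) _ S(3)] by blast
  qed
  show "rel_interior F \<subseteq> bdryD G" if "x \<in> bdryD G"
  proof -
    have "x \<notin> Q" if "Q \<in> Sub" for Q using bdry_disj[OF _ that, of x] \<open>x \<in> bdryD G\<close> by blast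
    moreover have "x \<notin> bdryN G" using bdry(2) that by blast
    ultimately show ?thesis using c i P(1) x by blast
  qed
qed

definition adj :: "'a set \<Rightarrow> 'a set \<Rightarrow> 'a set \<Rightarrow> bool" where
  "adj P T T' \<longleftrightarrow> T \<in> elems M P \<and> T' \<in> elems M P \<and> T \<noteq> T' \<and>
     (\<exists>F. F facet_of T \<and> F facet_of T' \<and> rel_interior F \<subseteq> P)"

lemma elem_rint_open:
  assumes "P \<in> Sub" "T \<in> elems M P" "open W" "x \<in> W" "x \<in> T"
  shows "openin (top_of_set (affine hull P)) (W \<inter> rel_interior T)" "W \<inter> rel_interior T \<noteq> {}"
proof -
  have "openin (top_of_set (affine hull T)) (rel_interior T)" by (rule openin_rel_interior)
  then show "openin (top_of_set (affine hull P)) (W \<inter> rel_interior T)"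
    using openin_Int_open[OF _ assms(3), of "affine hull P" "rel_interior T"]
    by (simp add: elem(5)[OF assms(1,2)] Int_commute)
  have "T \<subseteq> closure (rel_interior T)"
    using convex_closure_rel_interior[OF convex_simplex[OF elem(1)[OF assms(1,2)]]] closure_subset by blast
  then have "x \<in> closure (rel_interior T)" using assms(5) by blast
  then show "W \<inter> rel_interior T \<noteq> {}"
    using assms(3,4) open_Int_closure_eq_empty[of W "rel_interior T"] by blast
qed

text \<open>The cells of a subdomain are connected through facets: two neighbourhoods of a point of \<open>P\<close> can be joined
  by a segment that misses all faces of codimension at least two.\<close>

lemma mesh_connected:
  assumes P: "P \<in> Sub" and T0: "T0 \<in> elems M P" and T1: "T1 \<in> elems M P"
  shows "(adj P)\<^sup>*\<^sup>* T0 T1"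
proof (rule ccontr)
  assume not: "\<not> (adj P)\<^sup>*\<^sup>* T0 T1"
  define C where "C = {T \<in> elems M P. (adj P)\<^sup>*\<^sup>* T0 T}"
  define D where "D = elems M P - C"
  have CD: "C \<union> D = elems M P" "C \<inter> D = {}" "T0 \<in> C" "T1 \<in> D"
    using T0 T1 not by (auto simp: C_def D_def)
  have fin: "finite (elems M P)" using triang(1)[OF P] by (simp add: triangulation_def)
  have closedT: "closed T" if "T \<in> elems M P" for T using closed_simplex[OF elem(1)[OF P that]] .
  have cl: "closed (\<Union>C)" "closed (\<Union>D)"
    using fin CD(1) closedT by (auto intro!: closed_Union intro: finite_subset)
  have cover: "closure P = \<Union>C \<union> \<Union>D" using triang(2)[OF P] CD(1) by (metis Union_Un_distrib)
  \<comment> \<open>two closed sets covering the connected set \<open>P\<close>\<close>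
  have meet: "\<Union>C \<inter> P \<noteq> {}" "\<Union>D \<inter> P \<noteq> {}"
  proof -
    have "T \<inter> P \<noteq> {}" if "T \<in> elems M P" for T
      using elem(2)[OF P that] rintE[OF all_elemsI[OF P that]] rel_interior_subset[of T] by blast
    then show "\<Union>C \<inter> P \<noteq> {}" "\<Union>D \<inter> P \<noteq> {}" using CD by blast+
  qed
  have "\<Union>C \<inter> \<Union>D \<inter> P \<noteq> {}"
    using connected_closedD[OF sub(2)[OF P] _ _ cl] cover closure_subset[of P] meet by blast
  then obtain x Ta Tb where x: "x \<in> P" "Ta \<in> C" "x \<in> Ta" "Tb \<in> D" "x \<in> Tb" by blast
  have TaP: "Ta \<in> elems M P" and TbP: "Tb \<in> elems M P" using x CD(1) by auto
  obtain e where e: "e > 0" "cball x e \<inter> affine hull P \<subseteq> P"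
    using sub(4)[OF P] x(1) openin_contains_cball[of "affine hull P" P] by auto
  define U where "U = ball x e \<inter> affine hull P"
  have U: "convex U" "U \<subseteq> P" unfolding U_def
    using e(2) by (auto intro!: convex_Int affine_imp_convex[OF affine_affine_hull])
  have oa: "openin (top_of_set (affine hull P)) (ball x e \<inter> rel_interior Ta)" "ball x e \<inter> rel_interior Ta \<noteq> {}"
    using elem_rint_open[OF P TaP, of "ball x e" x] e(1) x by auto
  have ob: "openin (top_of_set (affine hull P)) (ball x e \<inter> rel_interior Tb)" "ball x e \<inter> rel_interior Tb \<noteq> {}"
    using elem_rint_open[OF P TbP, of "ball x e" x] e(1) x by auto
  have lf: "aff_dim H \<le> aff_dim P - 2" if "H \<in> low_faces P" for H using that by (auto simp: low_faces_def)
  obtain a where a: "a \<in> ball x e \<inter> rel_interior Ta" "\<And>H. H \<in> low_faces P \<Longrightarrow> a \<notin> affine hull H"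
  proof (rule generic_point[OF oa(2,1) finite_low_faces[OF P]])
    show "aff_dim H < aff_dim P" if "H \<in> low_faces P" for H using lf[OF that] by simp
  qed (rule that)
  \<comment> \<open>a face of codimension two spans a hyperplane at most together with \<open>a\<close>; the segment from \<open>a\<close> to a point outside
    these hyperplanes misses the faces\<close>
  obtain b where b: "b \<in> ball x e \<inter> rel_interior Tb"
    "\<And>H. H \<in> insert a ` low_faces P \<Longrightarrow> b \<notin> affine hull H"
  proof (rule generic_point[OF ob(2,1) finite_imageI[OF finite_low_faces[OF P]]])
    fix H assume "H \<in> insert a ` low_faces P"
    then obtain H' where H': "H' \<in> low_faces P" "H = insert a H'" by auto
    show "aff_dim H < aff_dim P" using lf[OF H'(1)] by (simp add: H'(2) aff_dim_insert)
  qed (rule that)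
  have aU: "a \<in> U" "b \<in> U" using a(1) b(1) openin_imp_subset[OF oa(1)] openin_imp_subset[OF ob(1)]
    by (auto simp: U_def)
  have segU: "closed_segment a b \<subseteq> U" using aU U(1) by (rule closed_segment_subset)
  have gen: "z \<notin> H" if z: "z \<in> closed_segment a b" and H: "H \<in> low_faces P" for z H
  proof
    assume zH: "z \<in> H"
    obtain s where s: "z = (1 - s) *\<^sub>R a + s *\<^sub>R b" "0 \<le> s" "s \<le> 1" using z by (auto simp: closed_segment_def)
    have "z \<noteq> a" using zH a(2)[OF H] by (auto intro: hull_inc)
    then have s0: "s \<noteq> 0" using s(1) by auto
    have "b = (1 - 1/s) *\<^sub>R a + (1/s) *\<^sub>R z"
      unfolding s(1) using s0 by (simp add: algebra_simps)
    also have "\<dots> \<in> affine hull (insert a H)"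
      using zH by (intro mem_affine[OF affine_affine_hull]) (auto intro: hull_inc)
    finally show False using b(2)[of "insert a H"] H by blast
  qed
  have "\<Union>C \<inter> closed_segment a b \<noteq> {}" "\<Union>D \<inter> closed_segment a b \<noteq> {}"
    using a(1) b(1) x rel_interior_subset[of Ta] rel_interior_subset[of Tb] by auto
  moreover have "closed_segment a b \<subseteq> \<Union>C \<union> \<Union>D" using segU U(2) closure_subset[of P] cover by blast
  ultimately have "\<Union>C \<inter> \<Union>D \<inter> closed_segment a b \<noteq> {}"
    using connected_closedD[OF connected_segment(1) _ _ cl] by blast
  \<comment> \<open>where the segment passes from one class of cells to the other, it crosses a common facet\<close>
  then obtain z T2 T3 where z: "z \<in> closed_segment a b" "T2 \<in> C" "z \<in> T2" "T3 \<in> D" "z \<in> T3" by blast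
  have T23: "T2 \<in> elems M P" "T3 \<in> elems M P" "T2 \<noteq> T3" using z CD by auto
  have zP: "z \<in> P" using z(1) segU U(2) by blast
  have nr: "z \<notin> rel_interior T2"
  proof
    assume zr: "z \<in> rel_interior T2"
    have tr: "(T2 \<inter> T3) face_of T2" "(T3 \<inter> T2) face_of T3"
      using triang(1)[OF P] T23 unfolding triangulation_def by auto
    have "T2 \<subseteq> T2 \<inter> T3" using subset_of_face_of[OF tr(1), of T2] zr z by auto
    then have "T3 \<inter> T2 = T2" by blast
    then have "T2 face_of T3" using tr(2) by simp
    then have "aff_dim T2 < aff_dim T3"
      using face_of_aff_dim_lt[OF convex_simplex[OF elem(1)[OF P T23(2)]]] T23(3) by blast
    then show False using elem(3)[OF P T23(1)] elem(3)[OF P T23(2)] by simp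
  qed
  obtain F where F: "F facet_of T2" "z \<in> rel_interior F"
    using generic_in_elem[OF P T23(1) z(3) gen[OF z(1)] nr] .
  have "F facet_of T3" by (rule facet_shared[OF P T23(2,1) F(1,2) z(5)])
  moreover have "rel_interior F \<subseteq> P" by (rule facet_at_point(1)[OF P T23(1) F zP])
  ultimately have "adj P T2 T3" using T23 F(1) by (auto simp: adj_def)
  then have "T3 \<in> C" using z(2) T23(2) by (auto simp: C_def)
  then show False using z(4) CD(2) by blast
qed

text \<open>Finitely many convex cells cover the points close to \<open>x\<close> on the ray, so one of them contains them all.\<close>

lemma elem_covers_ray:
  assumes P: "P \<in> Sub" and ev: "\<forall>\<^sub>F t in at_right 0. x - t *\<^sub>R \<nu> \<in> P"
  obtains T where "T \<in> elems M P" "x \<in> T" "\<forall>\<^sub>F t in at_right 0. x - t *\<^sub>R \<nu> \<in> T"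
proof -
  have fin: "finite (elems M P)" using triang(1)[OF P] by (simp add: triangulation_def)
  have "\<exists>T\<in>elems M P. \<forall>\<^sub>F t in at_right 0. x - t *\<^sub>R \<nu> \<in> T"
  proof (rule ccontr)
    assume "\<not> ?thesis"
    then have "\<forall>\<^sub>F t in at_right 0. x - t *\<^sub>R \<nu> \<notin> T" if "T \<in> elems M P" for T
      using convex_eventually[OF convex_simplex[OF elem(1)[OF P that]], of x \<nu>] that by blast
    then have "\<forall>\<^sub>F t in at_right 0. \<forall>T\<in>elems M P. x - t *\<^sub>R \<nu> \<notin> T"
      using fin by (simp add: eventually_ball_finite_distrib)
    with ev have "\<forall>\<^sub>F t in at_right (0::real). False"
    proof eventually_elim
      case (elim t)
      then have "x - t *\<^sub>R \<nu> \<in> \<Union>(elems M P)" using triang(2)[OF P] closure_subset[of P] by auto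
      with elim show False by auto
    qed
    then show False by simp
  qed
  then obtain T where T: "T \<in> elems M P" "\<forall>\<^sub>F t in at_right 0. x - t *\<^sub>R \<nu> \<in> T" by auto
  have "((\<lambda>t. x - t *\<^sub>R \<nu>) \<longlongrightarrow> x - 0 *\<^sub>R \<nu>) (at_right 0)" by (intro tendsto_intros)
  then have "((\<lambda>t. x - t *\<^sub>R \<nu>) \<longlongrightarrow> x) (at_right 0)" by simp
  then have "x \<in> T"
    using Lim_in_closed_set[OF closed_simplex[OF elem(1)[OF P T(1)]] T(2)] by simp
  with T show thesis using that by blast
qed

text \<open>At a generic point of \<open>low i\<close>, the cell of \<open>high i\<close> that contains the points just behind it has a facet
  there; this facet belongs to some interface, and its normal and its two subdomains are those of \<open>i\<close>.\<close>

lemma iface_has_facet: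
  assumes i: "i \<in> ifaces G"
  shows "ifacets M i \<noteq> {}"
proof -
  note f = iface[OF i]
  have ne: "low i \<noteq> high i" using f(3) by auto
  obtain x where x: "x \<in> low i" "\<And>H. H \<in> low_faces (high i) \<Longrightarrow> x \<notin> affine hull H"
  proof (rule generic_point[OF sub(1)[OF f(1)] sub(4)[OF f(1)] finite_low_faces[OF f(2)]])
    show "aff_dim H < aff_dim (low i)" if "H \<in> low_faces (high i)" for H
      using that f(3) by (auto simp: low_faces_def)
  qed (rule that)
  obtain T where T: "T \<in> elems M (high i)" "x \<in> T" "\<forall>\<^sub>F t in at_right 0. x - t *\<^sub>R normal i \<in> T"
    using elem_covers_ray[OF f(2) f(6)[OF x(1)]] .
  have "x \<notin> rel_interior T" using elem(2)[OF f(2) T(1)] disjSub[OF f(1,2) x(1)] ne by blast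
  then obtain F where F: "F facet_of T" "x \<in> rel_interior F"
    using generic_in_elem[OF f(2) T(1,2)] x(2) hull_inc by metis
  obtain j where j: "j \<in> ifaces G" "(T, F) \<in> ifacets M j" "low j = low i"
    using facet_at_point(2)[OF f(2) T(1) F f(1) ne x(1)] by blast
  have hj: "high j = high i" by (rule elem_subdomain[OF iface(2)[OF j(1)] f(2) ifacet(1)[OF j(1,2)] T(1)])
  have TE: "T \<in> EE" by (rule ifacet(5)[OF j(1,2)])
  have "\<forall>\<^sub>F t in at_right 0. x - t *\<^sub>R normal i \<in> T \<and> 0 < t"
    using T(3) eventually_at_right_less[of 0] by eventually_elim auto
  then obtain t where t: "x - t *\<^sub>R normal i \<in> T" "0 < t"
    using eventually_happens'[OF trivial_limit_at_right_real] by blast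
  have xF: "x \<in> F" using F(2) rel_interior_subset by blast
  have "normal i = outer_normal T F"
  proof (rule facet_facts(11)[OF simplexE[OF TE] F(1) xF _ f(4) _ t(2,1)])
    show "normal i \<in> tangent T" using iface_tangent(2)[OF i] elem(6)[OF f(2) T(1)] by simp
    show "normal i \<bullet> y = 0" if "y \<in> tangent F" for y
      using that ifacet_affine_hull(2)[OF j(1,2)] j(3) f(5) by simp
  qed
  then have "normal i = normal j" using ifacet(4)[OF j(1,2)] by simp
  then have "i = j" using j(3) hj by (intro iface.expand) auto
  then show ?thesis using j(2) by auto
qed

text \<open>The Dirichlet part of a hyperplane has positive measure, so it contains a point outside all faces of
  codimension at least two. The closures of the cells cover the closure of the medium, so this point lies on a facet.\<close>

lemma Dirichlet_facet:
  obtains P T F where "P \<in> Sub" "T \<in> elems M P" "F facet_of T" "rel_interior F \<subseteq> bdryD G"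
proof -
  obtain H where H: "affine H" "aff_dim H = int DIM('a) - 1" "emeasure (flat_measure H) (bdryD G \<inter> H) > 0"
    using medium unfolding fractured_medium_def by blast
  have Hne: "H \<noteq> {}" using H(2) DIM_positive[where 'a='a] by (intro notI) simp
  define J where "J = {K. \<exists>T\<in>EE. K face_of T \<and> aff_dim K \<le> int DIM('a) - 2}"
  have finJ: "finite J"
  proof -
    have "finite (\<Union>T\<in>EE. {K. K face_of T})"
      using finE finite_polytope_faces[OF simplex_imp_polytope[OF simplexE]] by (intro finite_UN_I) auto
    then show ?thesis by (rule rev_finite_subset) (auto simp: J_def)
  qed
  obtain x where x: "x \<in> bdryD G \<inter> H" "\<And>K. K \<in> J \<Longrightarrow> x \<notin> affine hull K"
  proof (rule generic_point_pos[OF Hne _ H(3) finJ])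
    show "bdryD G \<inter> H \<subseteq> affine hull H" by (auto intro: hull_inc)
    show "aff_dim K < aff_dim H" if "K \<in> J" for K using that H(2) by (auto simp: J_def)
  qed (rule that)
  have "x \<in> closure \<Omega>" using x(1) bdry(1) by (auto simp: frontier_def)
  moreover have "closure \<Omega> \<subseteq> (\<Union>P\<in>Sub. closure P)"
    using finSub closure_subset by (intro closure_minimal closed_UN) fastforce+
  ultimately have "x \<in> (\<Union>P\<in>Sub. closure P)" by blast
  then obtain P where P: "P \<in> Sub" "x \<in> closure P" by auto
  then obtain T where T: "T \<in> elems M P" "x \<in> T" using triang(2)[OF P(1)] by auto
  have TE: "T \<in> EE" using P(1) T(1) by (rule all_elemsI)
  have nP: "x \<notin> P" using bdry_disj[OF _ P(1), of x] x(1) by blast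
  then have "x \<notin> rel_interior T" using elem(2)[OF P(1) T(1)] by blast
  then obtain F where F: "F facet_of T" "x \<in> F" using simplex_boundary_facet[OF simplexE[OF TE] T(2)] by blast
  have "x \<in> rel_interior F"
  proof (rule ccontr)
    assume "x \<notin> rel_interior F"
    then obtain K where K: "K facet_of F" "x \<in> K"
      using simplex_boundary_facet[OF facet_facts(2)[OF simplexE[OF TE] F(1)] F(2)] by blast
    have "K face_of T" using K(1) F(1) face_of_trans by (blast dest: facet_of_imp_face_of)
    moreover have "aff_dim K \<le> int DIM('a) - 2"
      using K(1) F(1) aff_dim_le_DIM[of T] by (simp add: facet_of_def)
    ultimately have "K \<in> J" using TE by (auto simp: J_def)
    then show False using x(2) K(2) hull_inc by metis
  qed
  then have "rel_interior F \<subseteq> bdryD G" using facet_at_point(3)[OF P(1) T(1) F(1)] x(1) by blast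
  with P(1) T(1) F(1) show thesis by (rule that)
qed

end

section \<open>The discrete extension\<close>

lemma set_integral_cells:
  fixes f :: "'b \<Rightarrow> real"
  assumes J: "finite J" and sub: "\<And>j. j \<in> J \<Longrightarrow> A j \<subseteq> B"
    and disj: "\<And>j k x. j \<in> J \<Longrightarrow> k \<in> J \<Longrightarrow> x \<in> A j \<Longrightarrow> x \<in> A k \<Longrightarrow> j = k"
    and zero: "\<And>x. x \<in> B \<Longrightarrow> x \<notin> (\<Union>j\<in>J. A j) \<Longrightarrow> f x = 0"
    and int: "\<And>j. j \<in> J \<Longrightarrow> set_integrable \<mu> (A j) f"
  shows "(LINT x:B|\<mu>. f x) = (\<Sum>j\<in>J. LINT x:A j|\<mu>. f x)"
proof -
  have "indicat_real B x *\<^sub>R f x = (\<Sum>j\<in>J. indicat_real (A j) x *\<^sub>R f x)" for x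
  proof (cases "x \<in> (\<Union>j\<in>J. A j)")
    case True
    then obtain j where j: "j \<in> J" "x \<in> A j" by auto
    have "(\<Sum>k\<in>J. indicat_real (A k) x *\<^sub>R f x) = (\<Sum>k\<in>J. if k = j then f x else 0)"
    proof (intro sum.cong refl)
      fix k assume "k \<in> J"
      then show "indicat_real (A k) x *\<^sub>R f x = (if k = j then f x else 0)"
        using j disj[of j k x] by (cases "k = j") (auto simp: indicator_def)
    qed
    then show ?thesis using J j sub[OF j(1)] by auto
  next
    case False
    then show ?thesis using zero[of x] by (auto simp: indicator_def)
  qed
  then show ?thesis
    unfolding set_lebesgue_integral_def
    using int by (simp add: integral_sum set_integrable_def)
qed

lemma set_integral_const_real: "(LINT x:A|\<mu>. (c::real)) = c * measure \<mu> A" if "A \<in> sets \<mu>"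
  using that sets.sets_into_space[OF that] by (simp add: set_lebesgue_integral_def Int_absorb2)

context fractured_mesh
begin

lemma melem:
  assumes "i \<in> ifaces G" "E \<in> melems M i"
  shows "aff_dim (low i) simplex E" "rel_interior E \<subseteq> low i" "E \<noteq> {}" "affine hull E = affine hull (low i)"
proof -
  show s: "aff_dim (low i) simplex E" and r: "rel_interior E \<subseteq> low i"
    using mesh assms unfolding admissible_mesh_def triangulates_def by auto
  have d: "aff_dim E = aff_dim (low i)" by (rule aff_dim_simplex[OF s])
  show ne: "E \<noteq> {}" using d sub(1)[OF iface(1)[OF assms(1)]] aff_dim_negative_iff by (metis aff_dim_empty_eq)
  have "affine hull E = affine hull (rel_interior E)"
    using convex_simplex[OF s] by (simp add: rel_interior_same_affine_hull)
  also have "\<dots> \<subseteq> affine hull (low i)" using r by (rule hull_mono)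
  finally show "affine hull E = affine hull (low i)" using d ne by (intro affine_dim_equal) auto
qed

lemma mtriang:
  assumes "i \<in> ifaces G" shows "triangulation (melems M i)" "\<Union>(melems M i) = closure (low i)"
  using mesh assms unfolding admissible_mesh_def triangulates_def by auto

lemma mcells: "i \<in> ifaces G \<Longrightarrow> cells (melems M i)"
  using triangulation_cells[OF mtriang(1)] melem(3) by blast

lemma Lambda_P0: "l \<in> Lambda_h G M \<Longrightarrow> i \<in> ifaces G \<Longrightarrow> l i \<in> P0 (melems M i)"
  by (simp add: Lambda_h_def)

lemma Lambda_borel: "l \<in> Lambda_h G M \<Longrightarrow> i \<in> ifaces G \<Longrightarrow> l i \<in> borel_measurable borel"
  using cells.P0_borel[OF mcells Lambda_P0] .

lemma Lambda_bounded:
  assumes "l \<in> Lambda_h G M" "i \<in> ifaces G" obtains C where "\<And>x. \<bar>l i x\<bar> \<le> C"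
proof -
  obtain C where "\<And>x. \<bar>l i x\<bar> \<le> C"
    by (rule cells.P0_bounded[OF mcells[OF assms(2)] Lambda_P0[OF assms]]) (rule that)
  then show ?thesis by (rule that)
qed

lemma Lambda_integrable:
  assumes "l \<in> Lambda_h G M" "i \<in> ifaces G" "bounded A" "A \<in> sets borel"
  shows "set_integrable (flat_measure S) A (l i)"
proof -
  obtain C where "\<And>x. \<bar>l i x\<bar> \<le> C" by (rule Lambda_bounded[OF assms(1,2)]) (rule that)
  then show ?thesis by (intro flat_integrable[OF assms(3,4) Lambda_borel[OF assms(1,2)]])
qed

lemma subspace_Lambda: "subspace (Lambda_h G M)"
  unfolding subspace_def
proof (intro conjI ballI allI)
  show "0 \<in> Lambda_h G M"
    using subspace_0[OF cells.subspace_P0[OF mcells]] by (simp add: Lambda_h_def fun_eq_iff)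
  show "k + l \<in> Lambda_h G M" if "k \<in> Lambda_h G M" "l \<in> Lambda_h G M" for k l
    using that subspace_add[OF cells.subspace_P0[OF mcells]] by (simp add: Lambda_h_def fun_eq_iff)
  show "c *\<^sub>R l \<in> Lambda_h G M" if "l \<in> Lambda_h G M" for c l
    using that subspace_scale[OF cells.subspace_P0[OF mcells]] by (simp add: Lambda_h_def fun_eq_iff)
qed

subsection \<open>Traces on the interfaces\<close>

definition facet_area :: "'a iface \<Rightarrow> 'a set \<Rightarrow> real" where
  "facet_area i F = measure (flat_measure (low i)) (rel_interior F)"

definition facet_int :: "'a iface \<Rightarrow> 'a set \<Rightarrow> ('a iface \<Rightarrow> 'a \<Rightarrow> real) \<Rightarrow> real" where
  "facet_int i F l = (LINT x:rel_interior F|flat_measure (low i). l i x)"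

lemma itrace_in:
  assumes "v \<in> broken_RT" "i \<in> ifaces G" "(T, F) \<in> ifacets M i" "x \<in> rel_interior F"
  shows "itrace G M v i x = facet_flux v T F"
proof -
  note f = ifacet[OF assms(2,3)]
  have "itrace G M v i x = ntrace v (normal i) x" using assms by (auto simp: itrace_def)
  then show ?thesis using ntrace_flux[OF assms(1) f(5,2) assms(4)] f(4) by simp
qed

lemma itrace_out:
  assumes "\<And>T F. (T, F) \<in> ifacets M i \<Longrightarrow> x \<notin> rel_interior F" shows "itrace G M v i x = 0"
  using assms by (auto simp: itrace_def)

lemma itrace_cong:
  assumes "v \<in> broken_RT" "w \<in> broken_RT"
    "\<And>i T F. i \<in> ifaces G \<Longrightarrow> (T, F) \<in> ifacets M i \<Longrightarrow> facet_flux v T F = facet_flux w T F"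
  shows "itrace G M v = itrace G M w"
proof (intro ext)
  fix i x
  show "itrace G M v i x = itrace G M w i x"
  proof (cases "i \<in> ifaces G \<and> (\<exists>T F. (T, F) \<in> ifacets M i \<and> x \<in> rel_interior F)")
    case True
    then obtain T F where "i \<in> ifaces G" "(T, F) \<in> ifacets M i" "x \<in> rel_interior F" by auto
    then show ?thesis using itrace_in assms by simp
  next
    case False
    then show ?thesis by (auto simp: itrace_def)
  qed
qed

text \<open>The normal traces are piecewise constant on the facets, so testing with them only sees the integrals of the mortar
  function over the facets.\<close>

lemma Gamma_test:
  assumes v: "v \<in> broken_RT" and w: "w \<in> broken_RT" and l: "l \<in> Lambda_h G M"
  shows "ip_Gamma G (\<lambda>i x. itrace G M w i x - l i x) (itrace G M v)
    = (\<Sum>i\<in>ifaces G. \<Sum>(T, F)\<in>ifacets M i.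
        facet_flux v T F * (facet_flux w T F * facet_area i F - facet_int i F l))"
  unfolding ip_Gamma_def
proof (intro sum.cong refl)
  fix i assume i: "i \<in> ifaces G"
  define A where "A = (\<lambda>(T :: 'a set, F :: 'a set). rel_interior F)"
  define f where "f x = (itrace G M w i x - l i x) * itrace G M v i x" for x
  have loc: "set_integrable (flat_measure (low i)) (rel_interior F) f \<and>
      (LINT x:rel_interior F|flat_measure (low i). f x)
      = facet_flux v T F * (facet_flux w T F * facet_area i F - facet_int i F l)" if TF: "(T, F) \<in> ifacets M i" for T F
  proof -
    note m = ifacet_measure[OF i TF]
    have s: "rel_interior F \<in> sets (flat_measure (low i))" by (rule sets_flat_measure[OF m(2)])
    have int: "set_integrable (flat_measure (low i)) (rel_interior F) (l i)"
      by (rule Lambda_integrable[OF l i m(3,2)])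
    have c: "set_integrable (flat_measure (low i)) (rel_interior F) (\<lambda>x. facet_flux w T F)"
      by (rule flat_integrable[OF m(3,2), where C="\<bar>facet_flux w T F\<bar>"]) auto
    have eq: "f x = (facet_flux w T F - l i x) * facet_flux v T F" if "x \<in> rel_interior F" for x
      using itrace_in[OF v i TF that] itrace_in[OF w i TF that] by (simp add: f_def)
    have int2: "set_integrable (flat_measure (low i)) (rel_interior F)
        (\<lambda>x. (facet_flux w T F - l i x) * facet_flux v T F)"
      using set_integral_diff(1)[OF c int] by (simp add: set_integrable_mult_left)
    have "set_integrable (flat_measure (low i)) (rel_interior F) f"
    proof -
      have "(\<lambda>x. indicat_real (rel_interior F) x *\<^sub>R f x)
        = (\<lambda>x. indicat_real (rel_interior F) x *\<^sub>R ((facet_flux w T F - l i x) * facet_flux v T F))"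
        using eq by (auto simp: fun_eq_iff indicator_def)
      then show ?thesis using int2 by (simp add: set_integrable_def)
    qed
    moreover have "(LINT x:rel_interior F|flat_measure (low i). f x)
        = (LINT x:rel_interior F|flat_measure (low i). (facet_flux w T F - l i x) * facet_flux v T F)"
      using s eq by (intro set_lebesgue_integral_cong) auto
    moreover have "\<dots> = (LINT x:rel_interior F|flat_measure (low i). facet_flux w T F - l i x) * facet_flux v T F"
      by (simp add: set_integral_mult_left)
    moreover have "(LINT x:rel_interior F|flat_measure (low i). facet_flux w T F - l i x)
        = facet_flux w T F * facet_area i F - facet_int i F l"
      using set_integral_diff(2)[OF c int] set_integral_const_real[OF s] by (simp add: facet_area_def facet_int_def)
    ultimately show ?thesis by (simp add: mult.commute)
  qed
  have "(LINT x:low i|flat_measure (low i). f x) = (\<Sum>j\<in>ifacets M i. LINT x:A j|flat_measure (low i). f x)"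
  proof (rule set_integral_cells[OF finite_ifacets[OF i]])
    show "A j \<subseteq> low i" if "j \<in> ifacets M i" for j using that ifacet(3)[OF i] by (auto simp: A_def)
    show "j = k" if "j \<in> ifacets M i" "k \<in> ifacets M i" "x \<in> A j" "x \<in> A k" for j k x
      using that ifacet_disjoint[OF i] by (auto simp: A_def split: prod.splits)
    show "f x = 0" if "x \<notin> (\<Union>j\<in>ifacets M i. A j)" for x
      using that itrace_out[of i x v] by (force simp: A_def f_def)
    show "set_integrable (flat_measure (low i)) (A j) f" if "j \<in> ifacets M i" for j
      using that loc by (cases j) (auto simp: A_def)
  qed
  also have "\<dots> = (\<Sum>(T, F)\<in>ifacets M i. facet_flux v T F * (facet_flux w T F * facet_area i F - facet_int i F l))"
    using loc by (intro sum.cong) (auto simp: A_def)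
  finally show "(LINT x:low i|flat_measure (low i). (itrace G M w i x - l i x) * itrace G M v i x)
    = (\<Sum>(T, F)\<in>ifacets M i. facet_flux v T F * (facet_flux w T F * facet_area i F - facet_int i F l))"
    by (simp add: f_def)
qed

text \<open>A facet belongs to at most one interface; the sum over the set of such interfaces selects it and gives 0
  elsewhere.\<close>

definition facet_mean :: "('a iface \<Rightarrow> 'a \<Rightarrow> real) \<Rightarrow> 'a set \<Rightarrow> 'a set \<Rightarrow> real" where
  "facet_mean l T F = (\<Sum>i\<in>{i \<in> ifaces G. (T, F) \<in> ifacets M i}. facet_int i F l / facet_area i F)"

lemma facet_mean_ifacet:
  assumes "i \<in> ifaces G" "(T, F) \<in> ifacets M i" shows "facet_mean l T F = facet_int i F l / facet_area i F"
proof -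
  have "{j \<in> ifaces G. (T, F) \<in> ifacets M j} = {i}" using assms ifacet_unique by auto
  then show ?thesis by (simp add: facet_mean_def)
qed

lemma facet_mean_other: "(\<And>i. i \<in> ifaces G \<Longrightarrow> (T, F) \<notin> ifacets M i) \<Longrightarrow> facet_mean l T F = 0"
  unfolding facet_mean_def by (rule sum.neutral) blast

definition trace_lift :: "('a iface \<Rightarrow> 'a \<Rightarrow> real) \<Rightarrow> 'a \<Rightarrow> 'a" where
  "trace_lift l = (\<Sum>T\<in>EE. \<Sum>F\<in>{F. F facet_of T}. facet_mean l T F *\<^sub>R facet_field T F)"

lemma facet_flux_sum:
  assumes "finite J" "\<And>j. j \<in> J \<Longrightarrow> f j \<in> broken_RT" "T \<in> EE" "F facet_of T"
  shows "facet_flux (\<Sum>j\<in>J. f j) T F = (\<Sum>j\<in>J. facet_flux (f j) T F)"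
  using assms(1,2)
proof (induction J rule: finite_induct)
  case empty
  have "facet_flux 0 T F = 0"
    using facet_flux_scale[OF subspace_0[OF subspace_broken_RT] assms(3,4), of 0] by simp
  then show ?case unfolding sum.empty .
next
  case (insert j J)
  have "(\<Sum>j\<in>J. f j) \<in> broken_RT" using insert by (intro subspace_sum[OF subspace_broken_RT]) auto
  then have "facet_flux (f j + (\<Sum>j\<in>J. f j)) T F = facet_flux (f j) T F + facet_flux (\<Sum>j\<in>J. f j) T F"
    using insert by (intro facet_flux_add[OF _ _ assms(3,4)]) auto
  also have "facet_flux (\<Sum>j\<in>J. f j) T F = (\<Sum>j\<in>J. facet_flux (f j) T F)" using insert by auto
  finally show ?case unfolding sum.insert[OF insert(1,2)] .
qed

lemma trace_lift_V_h: "trace_lift l \<in> V_h G M"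
  unfolding trace_lift_def
proof (intro subspace_sum[OF subspace_V_h])
  fix T F assume "T \<in> EE" "F \<in> {F. F facet_of T}"
  show "facet_mean l T F *\<^sub>R facet_field T F \<in> V_h G M"
  proof (cases "\<exists>i\<in>ifaces G. (T, F) \<in> ifacets M i")
    case True
    then show ?thesis using facet_field_ifacet_V_h subspace_scale[OF subspace_V_h] by blast
  next
    case False
    then have "facet_mean l T F = 0" by (intro facet_mean_other) auto
    then show ?thesis using subspace_0[OF subspace_V_h] by simp
  qed
qed

lemma trace_lift_broken_RT: "trace_lift l \<in> broken_RT" using trace_lift_V_h V_h_broken_RT by blast

lemma trace_lift_flux:
  assumes "T \<in> EE" "F facet_of T"
  shows "facet_flux (trace_lift l) T F = facet_mean l T F"
proof -
  have PWs: "facet_mean l T' F' *\<^sub>R facet_field T' F' \<in> broken_RT" if "T' \<in> EE" "F' facet_of T'" for T' F'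
    using subspace_scale[OF subspace_broken_RT facet_field_broken_RT[OF that]] .
  have fin: "finite {F. F facet_of T'}" if "T' \<in> EE" for T' by (rule facets_finite_card(1)[OF simplexE[OF that]])
  have "facet_flux (trace_lift l) T F = (\<Sum>T'\<in>EE. facet_flux (\<Sum>F'\<in>{F. F facet_of T'}. facet_mean l T' F' *\<^sub>R facet_field T' F') T F)"
    unfolding trace_lift_def using PWs by (intro facet_flux_sum[OF finE _ assms] subspace_sum[OF subspace_broken_RT]) auto
  also have "\<dots> = (\<Sum>T'\<in>EE. \<Sum>F'\<in>{F. F facet_of T'}. facet_flux (facet_mean l T' F' *\<^sub>R facet_field T' F') T F)"
    using PWs by (intro sum.cong refl facet_flux_sum[OF fin _ assms]) auto
  also have "\<dots> = (\<Sum>T'\<in>EE. \<Sum>F'\<in>{F. F facet_of T'}. if T' = T \<and> F' = F then facet_mean l T F else 0)"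
  proof (intro sum.cong refl)
    fix T' F' assume "T' \<in> EE" "F' \<in> {F. F facet_of T'}"
    then show "facet_flux (facet_mean l T' F' *\<^sub>R facet_field T' F') T F = (if T' = T \<and> F' = F then facet_mean l T F else 0)"
      using facet_flux_scale[OF facet_field_broken_RT assms] facet_field_flux[OF _ _ assms] by auto
  qed
  also have "\<dots> = (\<Sum>T'\<in>EE. if T' = T then facet_mean l T F else 0)"
  proof (intro sum.cong refl)
    fix T' assume T': "T' \<in> EE"
    show "(\<Sum>F'\<in>{F. F facet_of T'}. if T' = T \<and> F' = F then facet_mean l T F else 0)
      = (if T' = T then facet_mean l T F else 0)"
      using fin[OF T'] assms(2) by (cases "T' = T") auto
  qed
  also have "\<dots> = facet_mean l T F" using finE assms(1) by simp
  finally show ?thesis .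
qed

text \<open>Testing with the basis field of each interface facet shows that the projection has the facet means as its
  values.\<close>

lemma Pi_hat_trace_lift:
  assumes l: "l \<in> Lambda_h G M" shows "Pi_hat G M l = itrace G M (trace_lift l)"
  unfolding Pi_hat_def
proof (rule the_equality)
  have "facet_flux (trace_lift l) T F * facet_area i F - facet_int i F l = 0" if "i \<in> ifaces G" "(T, F) \<in> ifacets M i" for i T F
    using trace_lift_flux[OF ifacet(5,2)[OF that]] facet_mean_ifacet[OF that] ifacet_measure(1)[OF that] by (simp add: facet_area_def)
  then have "ip_Gamma G (\<lambda>i x. itrace G M (trace_lift l) i x - l i x) (itrace G M v) = 0" if "v \<in> V_h G M" for v
    unfolding Gamma_test[OF V_hD(1)[OF that] trace_lift_broken_RT l] by (intro sum.neutral ballI) auto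
  then show "itrace G M (trace_lift l) \<in> itrace G M ` V_h G M \<and>
    (\<forall>v\<in>V_h G M. ip_Gamma G (\<lambda>i x. itrace G M (trace_lift l) i x - l i x) (itrace G M v) = 0)"
    using trace_lift_V_h by blast
next
  fix g assume g: "g \<in> itrace G M ` V_h G M \<and> (\<forall>v\<in>V_h G M. ip_Gamma G (\<lambda>i x. g i x - l i x) (itrace G M v) = 0)"
  then obtain w where w: "w \<in> V_h G M" "g = itrace G M w" by auto
  have wPW: "w \<in> broken_RT" using w V_h_broken_RT by blast
  have "facet_flux w T F = facet_flux (trace_lift l) T F" if TF: "i \<in> ifaces G" "(T, F) \<in> ifacets M i" for i T F
  proof -
    note f = ifacet[OF TF]
    have bV: "facet_field T F \<in> V_h G M" by (rule facet_field_ifacet_V_h[OF TF])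
    have "0 = ip_Gamma G (\<lambda>i x. itrace G M w i x - l i x) (itrace G M (facet_field T F))"
      using g w bV by simp
    also have "\<dots> = (\<Sum>j\<in>ifaces G. \<Sum>(T', F')\<in>ifacets M j.
        facet_flux (facet_field T F) T' F' * (facet_flux w T' F' * facet_area j F' - facet_int j F' l))"
      using Gamma_test[OF _ wPW l] bV V_h_broken_RT by blast
    also have "\<dots> = (\<Sum>j\<in>ifaces G. if j = i then facet_flux w T F * facet_area i F - facet_int i F l else 0)"
    proof (intro sum.cong refl)
      fix j assume j: "j \<in> ifaces G"
      have "(\<Sum>(T', F')\<in>ifacets M j. facet_flux (facet_field T F) T' F' * (facet_flux w T' F' * facet_area j F' - facet_int j F' l))
        = (\<Sum>p\<in>ifacets M j. if p = (T, F) then facet_flux w T F * facet_area j F - facet_int j F l else 0)"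
      proof (intro sum.cong refl)
        fix p assume p: "p \<in> ifacets M j"
        obtain T' F' where [simp]: "p = (T', F')" by (cases p)
        show "(case p of (T', F') \<Rightarrow> facet_flux (facet_field T F) T' F' * (facet_flux w T' F' * facet_area j F' - facet_int j F' l))
          = (if p = (T, F) then facet_flux w T F * facet_area j F - facet_int j F l else 0)"
          using facet_field_flux[OF f(5,2) ifacet(5,2)[OF j]] p by auto
      qed
      also have "\<dots> = (if j = i then facet_flux w T F * facet_area i F - facet_int i F l else 0)"
      proof (cases "j = i")
        case True
        then show ?thesis using finite_ifacets[OF j] TF(2) by simp
      next
        case False
        then have "(T, F) \<notin> ifacets M j" using ifacet_unique[OF TF j] by blast
        then show ?thesis using False by (auto intro!: sum.neutral)
      qed
      finally show "(\<Sum>(T', F')\<in>ifacets M j. facet_flux (facet_field T F) T' F' * (facet_flux w T' F' * facet_area j F' - facet_int j F' l))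
        = (if j = i then facet_flux w T F * facet_area i F - facet_int i F l else 0)" .
    qed
    also have "\<dots> = facet_flux w T F * facet_area i F - facet_int i F l" using finite_ifaces TF(1) by simp
    finally have "facet_flux w T F = facet_int i F l / facet_area i F"
      using ifacet_measure(1)[OF TF] by (simp add: facet_area_def eq_divide_eq)
    then show ?thesis using trace_lift_flux[OF f(5,2), of l] facet_mean_ifacet[OF TF, of l] by simp
  qed
  then show "g = itrace G M (trace_lift l)" unfolding w(2) by (intro itrace_cong[OF wPW trace_lift_broken_RT])
qed

lemma broken_RT_eqI:
  assumes "v \<in> broken_RT" "w \<in> broken_RT" "\<And>T F. T \<in> EE \<Longrightarrow> F facet_of T \<Longrightarrow> facet_flux v T F = facet_flux w T F"
  shows "v = w"
proof -
  have "v - w = 0"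
  proof (rule broken_RT_eq_0)
    show "v - w \<in> broken_RT" using subspace_diff[OF subspace_broken_RT assms(1,2)] .
    fix T F assume TF: "T \<in> EE" "F facet_of T"
    have "facet_flux (v + (-1) *\<^sub>R w) T F = facet_flux v T F + (-1) * facet_flux w T F"
      unfolding facet_flux_add[OF assms(1) subspace_scale[OF subspace_broken_RT assms(2)] TF]
        facet_flux_scale[OF assms(2) TF] ..
    moreover have diff: "v - w = v + (-1) *\<^sub>R w" by simp
    ultimately show "facet_flux (v - w) T F = 0" unfolding diff using assms(3)[OF TF] by linarith
  qed
  then show ?thesis by simp
qed

lemma R_h_trace_lift:
  assumes l: "l \<in> Lambda_h G M" shows "R_h G M l = trace_lift l"
  unfolding R_h_def
proof (rule the_equality)
  show "trace_lift l \<in> V_h G M \<and> itrace G M (trace_lift l) = Pi_hat G M l \<and>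
    (\<forall>T\<in>EE. \<forall>F. F facet_of T \<and> (\<forall>i\<in>ifaces G. (T, F) \<notin> ifacets M i) \<longrightarrow>
      (\<forall>x\<in>rel_interior F. ntrace (trace_lift l) (outer_normal T F) x = 0))"
    using trace_lift_V_h Pi_hat_trace_lift[OF l] ntrace_flux[OF trace_lift_broken_RT] trace_lift_flux facet_mean_other by simp
next
  fix v assume v: "v \<in> V_h G M \<and> itrace G M v = Pi_hat G M l \<and>
    (\<forall>T\<in>EE. \<forall>F. F facet_of T \<and> (\<forall>i\<in>ifaces G. (T, F) \<notin> ifacets M i) \<longrightarrow>
      (\<forall>x\<in>rel_interior F. ntrace v (outer_normal T F) x = 0))"
  then have vPW: "v \<in> broken_RT" using V_h_broken_RT by blast
  show "v = trace_lift l"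
  proof (rule broken_RT_eqI[OF vPW trace_lift_broken_RT])
    fix T F assume TF: "T \<in> EE" "F facet_of T"
    obtain x where x: "x \<in> rel_interior F" using facet_pt[OF TF] .
    show "facet_flux v T F = facet_flux (trace_lift l) T F"
    proof (cases "\<exists>i\<in>ifaces G. (T, F) \<in> ifacets M i")
      case True
      then obtain i where i: "i \<in> ifaces G" "(T, F) \<in> ifacets M i" by auto
      have "itrace G M v i x = itrace G M (trace_lift l) i x" using v Pi_hat_trace_lift[OF l] by simp
      then show ?thesis using itrace_in[OF vPW i x] itrace_in[OF trace_lift_broken_RT i x] by simp
    next
      case False
      then have "ntrace v (outer_normal T F) x = 0" using v TF x by blast
      then show ?thesis using ntrace_flux[OF vPW TF x] trace_lift_flux[OF TF] facet_mean_other[of T F l] False by auto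
    qed
  qed
qed

lemma facet_int_lin:
  assumes "k \<in> Lambda_h G M" "l \<in> Lambda_h G M" "i \<in> ifaces G" "(T, F) \<in> ifacets M i"
  shows "facet_int i F (k + l) = facet_int i F k + facet_int i F l" "facet_int i F (c *\<^sub>R k) = c * facet_int i F k"
  using set_integral_add(2)[OF Lambda_integrable[OF assms(1,3)] Lambda_integrable[OF assms(2,3)]]
    ifacet_measure[OF assms(3,4)] by (simp_all add: facet_int_def)

lemma facet_mean_lin:
  assumes "k \<in> Lambda_h G M" "l \<in> Lambda_h G M"
  shows "facet_mean (k + l) T F = facet_mean k T F + facet_mean l T F" "facet_mean (c *\<^sub>R k) T F = c * facet_mean k T F"
  using facet_int_lin[OF assms]
  by (auto simp: facet_mean_def add_divide_distrib sum_distrib_left simp flip: sum.distrib intro!: sum.cong)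

lemma trace_lift_lin:
  assumes "k \<in> Lambda_h G M" "l \<in> Lambda_h G M"
  shows "trace_lift (k + l) = trace_lift k + trace_lift l" "trace_lift (c *\<^sub>R k) = c *\<^sub>R trace_lift k"
  unfolding trace_lift_def
  by (simp_all add: facet_mean_lin[OF assms] facet_mean_lin(2)[OF assms(1,1)] scaleR_add_left sum.distrib scaleR_sum_right)

lemma W_hD:
  assumes "w \<in> W_h G M"
  shows "fst w \<in> V0_h G M" "fst w \<in> broken_RT" "snd w \<in> Lambda_h G M"
  using assms V_h_broken_RT by (auto simp: W_h_def V0_h_iff)

lemma flux_eq: "w \<in> W_h G M \<Longrightarrow> flux G M w = fst w + trace_lift (snd w)"
  using R_h_trace_lift[OF W_hD(3)] by (simp add: flux_def fun_eq_iff)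

lemma flux_broken_RT: "w \<in> W_h G M \<Longrightarrow> flux G M w \<in> broken_RT"
  using flux_eq W_hD(2) trace_lift_broken_RT subspace_add[OF subspace_broken_RT] by simp

lemma subspace_W_h: "subspace (W_h G M)"
  unfolding W_h_def using subspace_V0_h subspace_Lambda by (auto simp: subspace_def zero_prod_def)

lemma flux_lin:
  assumes "w \<in> W_h G M" "r \<in> W_h G M"
  shows "flux G M (w + r) = flux G M w + flux G M r" "flux G M (c *\<^sub>R w) = c *\<^sub>R flux G M w"
  using flux_eq[OF assms(1)] flux_eq[OF assms(2)] flux_eq[OF subspace_add[OF subspace_W_h assms]]
    flux_eq[OF subspace_scale[OF subspace_W_h assms(1)]] trace_lift_lin[OF W_hD(3)[OF assms(1)] W_hD(3)[OF assms(2)]]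
  by (simp_all add: scaleR_add_right)

lemma separated_W_h: "finitely_separated (W_h G M)"
proof -
  define \<Phi>1 :: "('a wvec \<Rightarrow> real) set"
    where "\<Phi>1 = (\<lambda>(T, F) w. facet_flux (fst w) T F) ` (SIGMA T:EE. {F. F facet_of T})"
  define \<Phi>2 :: "('a wvec \<Rightarrow> real) set" where "\<Phi>2 = (\<lambda>(i, E) w. snd w i (SOME x. x \<in> rel_interior E)) ` (SIGMA i:ifaces G. melems M i)"
  have f1: "finite \<Phi>1" unfolding \<Phi>1_def
    using finE facets_finite_card(1)[OF simplexE] by (intro finite_imageI finite_SigmaI)
  have f2: "finite \<Phi>2" unfolding \<Phi>2_def
    using finite_ifaces cells.finE[OF mcells] by (intro finite_imageI finite_SigmaI)
  have l1: "lin_on (W_h G M) \<phi>" if \<phi>: "\<phi> \<in> \<Phi>1" for \<phi>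
  proof -
    obtain T F where TF: "T \<in> EE" "F facet_of T" "\<phi> = (\<lambda>w. facet_flux (fst w) T F)"
      using \<phi> by (auto simp: \<Phi>1_def)
    show ?thesis unfolding lin_on_def TF(3)
      using facet_flux_add[OF W_hD(2) W_hD(2) TF(1,2)] facet_flux_scale[OF W_hD(2) TF(1,2)] by simp
  qed
  have l2: "lin_on (W_h G M) \<phi>" if "\<phi> \<in> \<Phi>2" for \<phi> using that by (auto simp: \<Phi>2_def lin_on_def)
  have sep: "w = 0" if w: "w \<in> W_h G M" and z: "\<forall>\<phi>\<in>\<Phi>1 \<union> \<Phi>2. \<phi> w = 0" for w
  proof -
    have "facet_flux (fst w) T F = 0" if "T \<in> EE" "F facet_of T" for T F
      using z that by (auto simp: \<Phi>1_def)
    then have 1: "fst w = 0" by (rule broken_RT_eq_0[OF W_hD(2)[OF w]])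
    have "snd w i = 0" if i: "i \<in> ifaces G" for i
    proof (rule cells.P0_eq_0[OF mcells[OF i] Lambda_P0[OF W_hD(3)[OF w] i]])
      fix E assume "E \<in> melems M i"
      then show "cells.val (snd w i) E = 0"
        unfolding cells.val_def[OF mcells[OF i]] using z i by (force simp: \<Phi>2_def)
    qed
    moreover have "snd w i = 0" if "i \<notin> ifaces G" for i
      using W_hD(3)[OF w] that by (simp add: Lambda_h_def zero_fun_def)
    ultimately have "snd w i = 0" for i by blast
    then have "snd w = 0" by (simp add: fun_eq_iff)
    with 1 show ?thesis by (simp add: prod_eq_iff)
  qed
  show ?thesis unfolding finitely_separated_def
    using f1 f2 l1 l2 sep by (intro exI[of _ "\<Phi>1 \<union> \<Phi>2"]) blast
qed

lemma subspace_Q_h: "subspace (Q_h G M)"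
  unfolding Q_h_def by (rule subspace_P0)

lemma separated_Q_h: "finitely_separated (Q_h G M)"
  unfolding finitely_separated_def
proof (intro exI[of _ "(\<lambda>T q. val q T) ` EE"] conjI ballI impI)
  show "finite ((\<lambda>T q. val q T) ` EE)" using finE by simp
  show "lin_on (Q_h G M) \<phi>" if "\<phi> \<in> (\<lambda>T q. val q T) ` EE" for \<phi>
    using that by (auto simp: lin_on_def val_lin)
  show "q = 0" if "q \<in> Q_h G M" "\<forall>\<phi>\<in>(\<lambda>T q. val q T) ` EE. \<phi> q = 0" for q
    using that P0_eq_0[of q] by (simp add: Q_h_def)
qed

end

section \<open>The permeability forms\<close>

lemma set_integral_lincomb:
  fixes f :: "'i \<Rightarrow> 'b \<Rightarrow> real"
  assumes "\<And>j. j \<in> J \<Longrightarrow> set_integrable \<mu> A (f j)"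
  shows "set_integrable \<mu> A (\<lambda>x. \<Sum>j\<in>J. c j * f j x)"
    "(LINT x:A|\<mu>. (\<Sum>j\<in>J. c j * f j x)) = (\<Sum>j\<in>J. c j * (LINT x:A|\<mu>. f j x))"
proof -
  have eq: "(\<lambda>x. indicat_real A x *\<^sub>R (\<Sum>j\<in>J. c j * f j x)) = (\<lambda>x. \<Sum>j\<in>J. c j * (indicat_real A x *\<^sub>R f j x))"
    by (simp add: fun_eq_iff sum_distrib_left mult.left_commute)
  have int: "integrable \<mu> (\<lambda>x. c j * (indicat_real A x *\<^sub>R f j x))" if "j \<in> J" for j
    using assms[OF that] unfolding set_integrable_def by (rule integrable_mult_right)
  show "set_integrable \<mu> A (\<lambda>x. \<Sum>j\<in>J. c j * f j x)"
    unfolding set_integrable_def eq using int by (rule Bochner_Integration.integrable_sum)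
  show "(LINT x:A|\<mu>. (\<Sum>j\<in>J. c j * f j x)) = (\<Sum>j\<in>J. c j * (LINT x:A|\<mu>. f j x))"
  proof -
    have "integral\<^sup>L \<mu> (\<lambda>x. \<Sum>j\<in>J. c j * (indicat_real A x *\<^sub>R f j x))
      = (\<Sum>j\<in>J. integral\<^sup>L \<mu> (\<lambda>x. c j * (indicat_real A x *\<^sub>R f j x)))"
      using int by (rule Bochner_Integration.integral_sum)
    then show ?thesis unfolding set_lebesgue_integral_def eq by simp
  qed
qed

lemma set_integral_mono_subset:
  fixes f :: "'b \<Rightarrow> real"
  assumes "set_integrable \<mu> A f" "set_integrable \<mu> B f" "A \<subseteq> B" "\<And>x. x \<in> B \<Longrightarrow> 0 \<le> f x"
  shows "(LINT x:A|\<mu>. f x) \<le> (LINT x:B|\<mu>. f x)"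
  using assms(1,2) unfolding set_lebesgue_integral_def set_integrable_def
  by (rule integral_mono) (use assms(3,4) in \<open>auto simp: indicator_def\<close>)

lemma set_integral_nonneg_real:
  fixes f :: "'b \<Rightarrow> real"
  assumes "\<And>x. x \<in> A \<Longrightarrow> 0 \<le> f x" shows "0 \<le> (LINT x:A|\<mu>. f x)"
  unfolding set_lebesgue_integral_def by (intro integral_nonneg_AE) (auto simp: assms indicator_def)

locale fractured_problem = fractured_mesh G M \<sigma>
  for G :: "'a::euclidean_space medium" and M :: "'a mesh" and \<sigma> :: real +
  fixes k :: "'a params" and \<kappa> :: real
  assumes params: "admissible_params G \<kappa> k"
begin

abbreviation "J \<equiv> perm_inv k"

lemma perm:
  assumes "P \<in> Sub"
  shows "linear (perm k P)" "perm k P ` tangent P \<subseteq> tangent P"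
    "\<And>x y. x \<in> tangent P \<Longrightarrow> y \<in> tangent P \<Longrightarrow> perm k P x \<bullet> y = x \<bullet> perm k P y"
    "\<exists>m>0. \<forall>x\<in>tangent P. m * (x \<bullet> x) \<le> perm k P x \<bullet> x \<and> perm k P x \<bullet> x \<le> \<kappa> * m * (x \<bullet> x)"
  using params assms unfolding admissible_params_def by blast+

lemma perm_inj: assumes P: "P \<in> Sub" shows "inj_on (perm k P) (tangent P)"
proof (rule inj_onI)
  fix x y assume xy: "x \<in> tangent P" "y \<in> tangent P" "perm k P x = perm k P y"
  obtain m where m: "m > 0" "\<forall>x\<in>tangent P. m * (x \<bullet> x) \<le> perm k P x \<bullet> x" using perm(4)[OF P] by blast
  have d: "x - y \<in> tangent P" using xy by (intro subspace_diff subspace_tangent)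
  have "perm k P (x - y) = 0" using xy(3) linear_diff[OF perm(1)[OF P]] by simp
  then have "m * ((x - y) \<bullet> (x - y)) \<le> 0" using bspec[OF m(2) d] by simp
  then show "x = y" using m(1) inner_ge_zero[of "x - y"] by (simp add: mult_le_0_iff)
qed

text \<open>An injective linear map of the finite dimensional tangent space into itself is onto.\<close>

lemma perm_surj: assumes P: "P \<in> Sub" shows "perm k P ` tangent P = tangent P"
proof (rule subspace_dim_equal)
  show "subspace (perm k P ` tangent P)" using linear_subspace_image[OF perm(1)[OF P]] by simp
  have "dim (perm k P ` tangent P) = dim (tangent P)"
    using perm_inj[OF P] by (intro dim_image_eq[OF perm(1)[OF P]]) (simp add: span_eq_iff[THEN iffD2])
  then show "dim (tangent P) \<le> dim (perm k P ` tangent P)" by simp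
qed (use perm(2)[OF P] in auto)

lemma J: assumes P: "P \<in> Sub" and y: "y \<in> tangent P"
  shows "J P y \<in> tangent P" "perm k P (J P y) = y"
  using y perm_surj[OF P] unfolding perm_inv_def by (metis inv_into_into, metis f_inv_into_f)

lemma J_unique: assumes P: "P \<in> Sub" and x: "x \<in> tangent P" "perm k P x = y" shows "J P y = x"
  unfolding perm_inv_def x(2)[symmetric] by (rule inv_into_f_f[OF perm_inj[OF P] x(1)])

lemma J_linear:
  assumes P: "P \<in> Sub"
  obtains L where "linear L" "\<And>y. y \<in> tangent P \<Longrightarrow> J P y = L y"
proof -
  have add: "J P (x + y) = J P x + J P y" if "x \<in> tangent P" "y \<in> tangent P" for x y
    using that J[OF P] linear_add[OF perm(1)[OF P]]
    by (intro J_unique[OF P]) (auto intro: subspace_add)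
  have scale: "J P (c *\<^sub>R x) = c *\<^sub>R J P x" if "x \<in> tangent P" for c x
    using that J[OF P] linear_scale[OF perm(1)[OF P]]
    by (intro J_unique[OF P]) (auto intro: subspace_scale)
  define pr where "pr x = (\<Sum>b\<in>onb (tangent P). (x \<bullet> b) *\<^sub>R b)" for x
  have prU: "pr x \<in> tangent P" for x
    unfolding pr_def using onb_spec(6)[OF subspace_tangent, of P]
    by (intro subspace_sum subspace_scale subspace_tangent) auto
  have pradd: "pr (x + y) = pr x + pr y" and prscale: "pr (c *\<^sub>R x) = c *\<^sub>R pr x" for x y c
    by (simp_all add: pr_def inner_add_left scaleR_add_left sum.distrib scaleR_sum_right)
  have "linear (\<lambda>x. J P (pr x))"
    by (rule linearI) (simp_all add: pradd prscale add[OF prU prU] scale[OF prU])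
  moreover have "J P y = J P (pr y)" if "y \<in> tangent P" for y
    using onb_expand[OF subspace_tangent that] by (simp add: pr_def)
  ultimately show thesis by (rule that)
qed

lemma J_sym:
  assumes P: "P \<in> Sub" and xy: "x \<in> tangent P" "y \<in> tangent P"
  shows "J P x \<bullet> y = J P y \<bullet> x"
  using perm(3)[OF P J(1)[OF P xy(1)] J(1)[OF P xy(2)]] J(2)[OF P xy(1)] J(2)[OF P xy(2)]
  by (metis inner_commute)

text \<open>The eigenvalues of the permeability lie between \<open>m\<close> and \<open>\<kappa> m\<close>, those of its inverse between \<open>1/(\<kappa> m)\<close> and
  \<open>1/m\<close>; both bounds are derived by Cauchy--Schwarz arguments for the form \<open>k x \<bullet> y\<close>. The maximum with 1
  covers the subdomains that are points, on which \<open>\<kappa>\<close> is unconstrained.\<close>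

lemma J_bounds:
  assumes P: "P \<in> Sub"
  obtains m where "m > 0" "\<And>y. y \<in> tangent P \<Longrightarrow> 0 \<le> J P y \<bullet> y"
    "\<And>y. y \<in> tangent P \<Longrightarrow> J P y \<bullet> y \<le> (norm y)\<^sup>2 / m"
    "\<And>y. y \<in> tangent P \<Longrightarrow> (norm y)\<^sup>2 \<le> max \<kappa> 1 * m * (J P y \<bullet> y)"
proof -
  obtain m where m: "m > 0" "\<And>x. x \<in> tangent P \<Longrightarrow> m * (x \<bullet> x) \<le> perm k P x \<bullet> x"
    "\<And>x. x \<in> tangent P \<Longrightarrow> perm k P x \<bullet> x \<le> \<kappa> * m * (x \<bullet> x)" using perm(4)[OF P] by blast
  have low: "m * (J P y \<bullet> J P y) \<le> J P y \<bullet> y" if "y \<in> tangent P" for y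
    using m(2)[OF J(1)[OF P that]] J(2)[OF P that] by (simp add: inner_commute)
  have nn: "0 \<le> J P y \<bullet> y" if "y \<in> tangent P" for y
    using low[OF that] m(1) inner_ge_zero[of "J P y"] by (meson mult_nonneg_nonneg less_imp_le order_trans)
  show thesis
  proof (rule that[OF m(1) nn])
    fix y assume y: "y \<in> tangent P"
    define a where "a = norm (J P y)"
    define b where "b = norm y"
    have c: "J P y \<bullet> y \<le> a * b" unfolding a_def b_def by (rule norm_cauchy_schwarz)
    have ma: "m * a\<^sup>2 \<le> a * b" using low[OF y] c by (simp add: a_def dot_square_norm)
    have "m * a \<le> b"
    proof (cases "a = 0")
      case True then show ?thesis by (simp add: b_def)
    next
      case False
      then have "a > 0" by (simp add: a_def)
      moreover have "(m * a) * a \<le> b * a" using ma by (simp add: power2_eq_square ac_simps)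
      ultimately show ?thesis by (intro mult_right_le_imp_le[of "m * a" a b])
    qed
    then have "a \<le> b / m" using m(1) by (simp add: field_simps)
    then have "a * b \<le> b / m * b" by (intro mult_right_mono) (auto simp: b_def)
    then show "J P y \<bullet> y \<le> (norm y)\<^sup>2 / m" using c by (simp add: b_def power2_eq_square)
  next
    fix y assume y: "y \<in> tangent P"
    define q where "q = J P y \<bullet> y"
    have q0: "0 \<le> q" using nn[OF y] by (simp add: q_def)
    have "y \<bullet> y \<le> max \<kappa> 1 * m * q"
    proof (cases "y = 0")
      case True then show ?thesis using q0 m(1) by simp
    next
      case False
      have kyy: "perm k P y \<in> tangent P" using perm(2)[OF P] y by blast
      have J1: "J P (perm k P y) = y" using J_unique[OF P y] by simp
      have qy: "perm k P y \<bullet> y \<le> max \<kappa> 1 * m * (y \<bullet> y)"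
      proof -
        have "\<kappa> * m * (y \<bullet> y) \<le> max \<kappa> 1 * m * (y \<bullet> y)"
          using m(1) by (intro mult_right_mono) auto
        then show ?thesis using m(3)[OF y] by simp
      qed
      \<comment> \<open>Cauchy--Schwarz for the form of the permeability at the vectors \<open>J y\<close> and \<open>y\<close>\<close>
      define t where "t = (y \<bullet> y) / (perm k P y \<bullet> y)"
      have kpos: "0 < perm k P y \<bullet> y"
      proof -
        have "0 < m * (y \<bullet> y)" using m(1) False by simp
        then show ?thesis using m(2)[OF y] by linarith
      qed
      have zU: "J P y - t *\<^sub>R y \<in> tangent P"
        using J(1)[OF P y] y by (intro subspace_diff subspace_scale subspace_tangent)
      have "0 \<le> m * ((J P y - t *\<^sub>R y) \<bullet> (J P y - t *\<^sub>R y))" using m(1) by simp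
      also have "\<dots> \<le> perm k P (J P y - t *\<^sub>R y) \<bullet> (J P y - t *\<^sub>R y)" by (rule m(2)[OF zU])
      also have "perm k P (J P y - t *\<^sub>R y) = y - t *\<^sub>R perm k P y"
        using linear_diff[OF perm(1)[OF P]] linear_scale[OF perm(1)[OF P]] J(2)[OF P y] by simp
      also have "(y - t *\<^sub>R perm k P y) \<bullet> (J P y - t *\<^sub>R y)
          = q - t * (y \<bullet> y) - t * (perm k P y \<bullet> J P y) + t * t * (perm k P y \<bullet> y)"
        by (simp add: q_def inner_diff_left inner_diff_right inner_commute algebra_simps)
      also have "perm k P y \<bullet> J P y = y \<bullet> y"
        using perm(3)[OF P y J(1)[OF P y]] J(2)[OF P y] by simp
      also have "t * t * (perm k P y \<bullet> y) = t * (y \<bullet> y)" using kpos by (simp add: t_def)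
      finally have "(y \<bullet> y)\<^sup>2 / (perm k P y \<bullet> y) \<le> q" by (simp add: t_def power2_eq_square)
      then have "(y \<bullet> y) * (y \<bullet> y) \<le> q * (perm k P y \<bullet> y)"
        using kpos by (simp add: field_simps power2_eq_square)
      also have "\<dots> \<le> q * (max \<kappa> 1 * m * (y \<bullet> y))" using qy q0 by (rule mult_left_mono)
      finally have "(y \<bullet> y) * (y \<bullet> y) \<le> (max \<kappa> 1 * m * q) * (y \<bullet> y)" by (simp add: ac_simps)
      moreover have "0 < y \<bullet> y" using False by simp
      ultimately show ?thesis by (rule mult_right_le_imp_le)
    qed
    then show "(norm y)\<^sup>2 \<le> max \<kappa> 1 * m * (J P y \<bullet> y)" by (simp add: dot_square_norm q_def)
  qed
qed

lemma J_integrable: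
  assumes P: "P \<in> Sub" and A: "bounded A" "A \<in> sets borel"
    and u: "u \<in> borel_measurable borel" "\<And>x. x \<in> A \<Longrightarrow> u x \<in> tangent P" "\<And>x. x \<in> A \<Longrightarrow> norm (u x) \<le> C"
    and v: "v \<in> borel_measurable borel" "\<And>x. x \<in> A \<Longrightarrow> norm (v x) \<le> D"
  shows "set_integrable (flat_measure S) A (\<lambda>x. J P (u x) \<bullet> v x)"
proof -
  obtain L where L: "linear L" "\<And>y. y \<in> tangent P \<Longrightarrow> J P y = L y"
    by (rule J_linear[OF P]) (rule that)
  have bl: "bounded_linear L" using L(1) by (simp add: linear_conv_bounded_linear)
  obtain B where B: "\<And>x. norm (L x) \<le> norm x * B" using bounded_linear.bounded[OF bl] by blast
  have Lu: "(\<lambda>x. L (u x)) \<in> borel_measurable borel"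
    using measurable_compose[OF u(1) borel_measurable_continuous_onI[OF linear_continuous_on[OF bl]]] .
  have "set_integrable (flat_measure S) A (\<lambda>x. L (u x) \<bullet> v x)"
  proof (rule flat_integrable[OF A, where C="(C * \<bar>B\<bar>) * D"])
    show "(\<lambda>x. L (u x) \<bullet> v x) \<in> borel_measurable borel" using Lu v(1) by measurable
    fix x assume x: "x \<in> A"
    have "norm (L (u x)) \<le> norm (u x) * \<bar>B\<bar>"
      using B[of "u x"] mult_left_mono[OF abs_ge_self[of B] norm_ge_zero[of "u x"]] by linarith
    also have "\<dots> \<le> C * \<bar>B\<bar>" using u(3)[OF x] by (intro mult_right_mono) auto
    finally have "norm (L (u x)) * norm (v x) \<le> (C * \<bar>B\<bar>) * D"
      using v(2)[OF x] by (intro mult_mono) (auto intro: order_trans[OF norm_ge_zero])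
    then show "\<bar>L (u x) \<bullet> v x\<bar> \<le> (C * \<bar>B\<bar>) * D"
      using Cauchy_Schwarz_ineq2[of "L (u x)" "v x"] by linarith
  qed
  moreover have "(\<lambda>x. indicat_real A x *\<^sub>R (J P (u x) \<bullet> v x)) = (\<lambda>x. indicat_real A x *\<^sub>R (L (u x) \<bullet> v x))"
    using L(2) u(2) by (auto simp: indicator_def fun_eq_iff)
  ultimately show ?thesis by (simp add: set_integrable_def)
qed

text \<open>Discrete Cauchy--Schwarz inequality, from \<open>2 J y\<^sub>i \<bullet> y\<^sub>j \<le> J y\<^sub>i \<bullet> y\<^sub>i + J y\<^sub>j \<bullet> y\<^sub>j\<close>.\<close>

lemma J_sum_le:
  assumes P: "P \<in> Sub" and y: "\<And>i. i \<in> I \<Longrightarrow> y i \<in> tangent P"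
  shows "J P (\<Sum>i\<in>I. y i) \<bullet> (\<Sum>i\<in>I. y i) \<le> real (card I) * (\<Sum>i\<in>I. J P (y i) \<bullet> y i)"
proof -
  obtain L where L: "linear L" "\<And>y. y \<in> tangent P \<Longrightarrow> J P y = L y"
    by (rule J_linear[OF P]) (rule that)
  obtain m where nn: "\<And>y. y \<in> tangent P \<Longrightarrow> 0 \<le> J P y \<bullet> y" by (rule J_bounds[OF P]) (rule that)
  have sU: "(\<Sum>i\<in>I. y i) \<in> tangent P" using y by (intro subspace_sum subspace_tangent)
  have young: "J P (y i) \<bullet> y j \<le> (J P (y i) \<bullet> y i + J P (y j) \<bullet> y j) / 2" if "i \<in> I" "j \<in> I" for i j
  proof -
    have d: "y i - y j \<in> tangent P" using y that by (intro subspace_diff subspace_tangent)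
    have "0 \<le> L (y i - y j) \<bullet> (y i - y j)" using nn[OF d] L(2)[OF d] by simp
    also have "\<dots> = J P (y i) \<bullet> y i - J P (y i) \<bullet> y j - J P (y j) \<bullet> y i + J P (y j) \<bullet> y j"
      using linear_diff[OF L(1)] L(2) y that by (simp add: inner_diff_left inner_diff_right)
    also have "J P (y j) \<bullet> y i = J P (y i) \<bullet> y j" using J_sym[OF P] y that by simp
    finally show ?thesis by simp
  qed
  have "J P (\<Sum>i\<in>I. y i) \<bullet> (\<Sum>i\<in>I. y i) = (\<Sum>i\<in>I. \<Sum>j\<in>I. J P (y i) \<bullet> y j)"
    using L y by (simp add: L(2)[OF sU] linear_sum[OF L(1)] inner_sum_left inner_sum_right) (rule sum.swap)
  also have "\<dots> \<le> (\<Sum>i\<in>I. \<Sum>j\<in>I. (J P (y i) \<bullet> y i + J P (y j) \<bullet> y j) / 2)"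
    using young by (intro sum_mono)
  also have "\<dots> = real (card I) * (\<Sum>i\<in>I. J P (y i) \<bullet> y i)"
    by (simp add: add_divide_distrib sum.distrib sum_divide_distrib[symmetric] sum_distrib_left[symmetric])
  finally show ?thesis .
qed

subsection \<open>The form on the broken space\<close>

lemma elem_unique_sub: assumes "P \<in> Sub" "x \<in> P" "T \<in> EE" "x \<in> rel_interior T" shows "T \<in> elems M P"
proof -
  obtain Q where Q: "Q \<in> Sub" "T \<in> elems M Q" using all_elemsE[OF assms(3)] by blast
  have "P = Q" using disjSub[OF assms(1) Q(1) assms(2)] elem(2)[OF Q] assms(4) by blast
  with Q show ?thesis by simp
qed

lemma broken_RT_tangent:
  assumes "v \<in> broken_RT" "P \<in> Sub" "x \<in> P" shows "v x \<in> tangent P"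
proof (cases "x \<in> (\<Union>T\<in>EE. rel_interior T)")
  case True
  then obtain T where T: "T \<in> EE" "x \<in> rel_interior T" by auto
  have TP: "T \<in> elems M P" by (rule elem_unique_sub[OF assms(2,3) T])
  obtain p where p: "p \<in> RT0 T" "\<And>x. x \<in> rel_interior T \<Longrightarrow> v x = p x"
    by (rule broken_RT_piece[OF assms(1) T(1)]) (rule that)
  have "x \<in> affine hull T" using T(2) rel_interior_subset[of T] by (auto intro: hull_inc)
  then show ?thesis using RT0_tangent[OF p(1)] p(2)[OF T(2)] elem(6)[OF assms(2) TP] by simp
next
  case False
  then show ?thesis using assms(1) subspace_0[OF subspace_tangent] by (simp add: broken_RT_def)
qed

definition Kf :: "'a set \<Rightarrow> ('a \<Rightarrow> 'a) \<Rightarrow> ('a \<Rightarrow> 'a) \<Rightarrow> real" where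
  "Kf P u v = (LINT x:P|flat_measure P. J P (u x) \<bullet> v x)"

lemma ip_K_Kf: "ip_K G k u v = (\<Sum>P\<in>Sub. Kf P u v)"
  by (simp add: ip_K_def Kf_def)

lemma Kf_integrable:
  assumes P: "P \<in> Sub" and u: "u \<in> broken_RT" and v: "v \<in> broken_RT" and A: "A \<subseteq> P" "A \<in> sets borel"
  shows "set_integrable (flat_measure S) A (\<lambda>x. J P (u x) \<bullet> v x)"
proof -
  obtain C where C: "\<And>x. norm (u x) \<le> C" by (rule broken_RT_bounded[OF u]) (rule that)
  obtain D where D: "\<And>x. norm (v x) \<le> D" by (rule broken_RT_bounded[OF v]) (rule that)
  show ?thesis
    using C D broken_RT_tangent[OF u P] A
    by (intro J_integrable[OF P bounded_subset[OF sub(3)[OF P] A(1)] A(2) broken_RT_borel[OF u] _ _ broken_RT_borel[OF v]]) auto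
qed

lemma Kf_lin:
  assumes P: "P \<in> Sub" and u: "u \<in> broken_RT" and v: "v \<in> broken_RT" "w \<in> broken_RT"
  shows "Kf P u (v + w) = Kf P u v + Kf P u w" "Kf P u (c *\<^sub>R v) = c * Kf P u v"
  using set_integral_add(2)[OF Kf_integrable[OF P u v(1) subset_refl sub_borel[OF P]]
      Kf_integrable[OF P u v(2) subset_refl sub_borel[OF P]]]
  by (simp_all add: Kf_def inner_add_right)

lemma Kf_sym:
  assumes P: "P \<in> Sub" and u: "u \<in> broken_RT" and v: "v \<in> broken_RT"
  shows "Kf P u v = Kf P v u"
  unfolding Kf_def using J_sym[OF P] broken_RT_tangent[OF u P] broken_RT_tangent[OF v P] sets_flat_measure[OF sub_borel[OF P]]
  by (intro set_lebesgue_integral_cong) auto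

lemma Kf_elems:
  assumes P: "P \<in> Sub" and v: "v \<in> broken_RT"
  shows "Kf P v v = (\<Sum>T\<in>elems M P. LINT x:rel_interior T|flat_measure P. J P (v x) \<bullet> v x)"
  unfolding Kf_def
proof (rule set_integral_cells)
  show "finite (elems M P)" using triang(1)[OF P] by (simp add: triangulation_def)
  show "rel_interior T \<subseteq> P" if "T \<in> elems M P" for T by (rule elem(2)[OF P that])
  show "T = T'" if "T \<in> elems M P" "T' \<in> elems M P" "x \<in> rel_interior T" "x \<in> rel_interior T'" for T T' x
    using triangulation_disjoint[OF triang(1)[OF P] that] .
  show "J P (v x) \<bullet> v x = 0" if x: "x \<in> P" "x \<notin> (\<Union>T\<in>elems M P. rel_interior T)" for x
  proof -
    have "x \<notin> (\<Union>T\<in>EE. rel_interior T)" using elem_unique_sub[OF P x(1)] x(2) by blast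
    then have "v x = 0" using v by (simp add: broken_RT_def)
    then show ?thesis by simp
  qed
  show "set_integrable (flat_measure P) (rel_interior T) (\<lambda>x. J P (v x) \<bullet> v x)" if T: "T \<in> elems M P" for T
    by (rule Kf_integrable[OF P v v elem(2)[OF P T] borelE[OF all_elemsI[OF P T]]])
qed

subsection \<open>Spectral equivalence with the lumped form\<close>

definition lump :: "'a set \<Rightarrow> 'a set \<Rightarrow> 'a set \<Rightarrow> real" where
  "lump P T F = (LINT x:T|flat_measure T. J P (rt_basis T F x) \<bullet> rt_basis T F x)"

lemma ip_KD_lump: "ip_KD G M k u v = (\<Sum>P\<in>Sub. \<Sum>T\<in>elems M P. \<Sum>F\<in>{F. F facet_of T}.
    facet_flux u T F * facet_flux v T F * lump P T F)"
  by (simp add: ip_KD_def lump_def)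

text \<open>The factors come from the contrast within a subdomain, the basis functions, the measure of \<open>T\<close> against
  its relative interior, and the inverse estimate. The added 1 and the maximum with 1 keep the constant at least 1, so that it
  serves for the mortar part of the forms as well.\<close>

definition c_lump :: real where
  "c_lump = max \<kappa> 1 * (\<sigma>\<^sup>2 / 4 + 1) * 2 ^ DIM('a) * (8 * 2 ^ DIM('a) + 2)"

context
  fixes P T assumes P: "P \<in> Sub" and T: "T \<in> elems M P"
begin

lemma TE: "T \<in> EE" using P T by (rule all_elemsI)

lemma flatPT: "flat_measure P = flat_measure T"
  using flat_measure_cong[OF sub(1)[OF P] neE[OF TE]] elem(5)[OF P T] by simp

lemma Tborel: "T \<in> sets borel" and Tbounded: "bounded T"
  using compactE[OF TE] by (auto intro: borel_compact compact_imp_bounded)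

lemma basis_tangent: "F facet_of T \<Longrightarrow> x \<in> T \<Longrightarrow> rt_basis T F x \<in> tangent P"
  using RT0_tangent[OF facet_facts(8)[OF simplexE[OF TE]], of F x] elem(6)[OF P T] by (simp add: hull_inc)

lemma RT0_bounded: assumes "p \<in> RT0 T" obtains C where "\<And>x. x \<in> T \<Longrightarrow> norm (p x) \<le> C"
proof -
  have "compact (p ` T)"
    using compact_continuous_image[OF RT0_continuous[OF assms] compactE[OF TE]] .
  then have "bounded (p ` T)" by (rule compact_imp_bounded)
  then obtain C where "\<forall>y\<in>p ` T. norm y \<le> C" by (auto simp: bounded_iff)
  then show thesis by (intro that[of C]) auto
qed

lemma basis_integrable:
  assumes F: "F facet_of T" and A: "A \<subseteq> T" "A \<in> sets borel"
  shows "set_integrable (flat_measure S) A (\<lambda>x. J P (rt_basis T F x) \<bullet> rt_basis T F x)"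
proof -
  have r: "rt_basis T F \<in> RT0 T" by (rule facet_facts(8)[OF simplexE[OF TE] F])
  obtain C where C: "\<And>x. x \<in> T \<Longrightarrow> norm (rt_basis T F x) \<le> C" by (rule RT0_bounded[OF r]) (rule that)
  have b: "rt_basis T F \<in> borel_measurable borel"
    by (rule borel_measurable_continuous_onI[OF RT0_continuous[OF r]])
  show ?thesis
    using C basis_tangent[OF F] A
    by (intro J_integrable[OF P bounded_subset[OF Tbounded A(1)] A(2) b _ _ b]) auto
qed

lemma lump_nonneg: "F facet_of T \<Longrightarrow> 0 \<le> lump P T F"
proof -
  assume F: "F facet_of T"
  obtain m where nn: "\<And>y. y \<in> tangent P \<Longrightarrow> 0 \<le> J P y \<bullet> y" by (rule J_bounds[OF P]) (rule that)
  show ?thesis unfolding lump_def using nn basis_tangent[OF F] by (intro set_integral_nonneg_real) auto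
qed

text \<open>The field is the sum of its facet contributions, of which there are at most \<open>DIM('a) + 1\<close>.\<close>

lemma elem_upper:
  assumes v: "v \<in> broken_RT"
  shows "(LINT x:rel_interior T|flat_measure P. J P (v x) \<bullet> v x)
    \<le> (real DIM('a) + 1) * (\<Sum>F\<in>{F. F facet_of T}. facet_flux v T F * facet_flux v T F * lump P T F)"
proof -
  let ?Fs = "{F. F facet_of T}"
  define N where "N = real (card ?Fs)"
  define s where "s F = facet_flux v T F" for F
  obtain m where nn: "\<And>y. y \<in> tangent P \<Longrightarrow> 0 \<le> J P y \<bullet> y" by (rule J_bounds[OF P]) (rule that)
  obtain L where L: "linear L" "\<And>y. y \<in> tangent P \<Longrightarrow> J P y = L y" by (rule J_linear[OF P]) (rule that)
  have intr: "set_integrable (flat_measure P) (rel_interior T) (\<lambda>x. J P (rt_basis T F x) \<bullet> rt_basis T F x)"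
    if "F \<in> ?Fs" for F
    using that by (intro basis_integrable rel_interior_subset borelE[OF TE]) auto
  have pt: "J P (v x) \<bullet> v x \<le> (\<Sum>F\<in>?Fs. (N * (s F * s F)) * (J P (rt_basis T F x) \<bullet> rt_basis T F x))"
    if x: "x \<in> rel_interior T" for x
  proof -
    have xT: "x \<in> T" using x rel_interior_subset by blast
    have t: "s F *\<^sub>R rt_basis T F x \<in> tangent P" if "F \<in> ?Fs" for F
      using basis_tangent[of F x] that xT by (intro subspace_scale subspace_tangent) auto
    have "J P (v x) \<bullet> v x \<le> N * (\<Sum>F\<in>?Fs. J P (s F *\<^sub>R rt_basis T F x) \<bullet> (s F *\<^sub>R rt_basis T F x))"
      unfolding broken_RT_expand[OF v TE x] N_def s_def[symmetric] by (rule J_sum_le[OF P t])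
    also have "\<dots> = (\<Sum>F\<in>?Fs. (N * (s F * s F)) * (J P (rt_basis T F x) \<bullet> rt_basis T F x))"
      unfolding sum_distrib_left
    proof (intro sum.cong refl)
      fix F assume F: "F \<in> ?Fs"
      have "J P (s F *\<^sub>R rt_basis T F x) = s F *\<^sub>R J P (rt_basis T F x)"
        using L(2)[OF t[OF F]] L(2)[OF basis_tangent[of F x]] F xT linear_scale[OF L(1)] by simp
      then show "N * (J P (s F *\<^sub>R rt_basis T F x) \<bullet> (s F *\<^sub>R rt_basis T F x))
        = N * (s F * s F) * (J P (rt_basis T F x) \<bullet> rt_basis T F x)" by simp
    qed
    finally show ?thesis .
  qed
  have "(LINT x:rel_interior T|flat_measure P. J P (v x) \<bullet> v x)
    \<le> (LINT x:rel_interior T|flat_measure P. (\<Sum>F\<in>?Fs. (N * (s F * s F)) * (J P (rt_basis T F x) \<bullet> rt_basis T F x)))"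
    by (rule set_integral_mono[OF Kf_integrable[OF P v v elem(2)[OF P T] borelE[OF TE]]
          set_integral_lincomb(1)[OF intr] pt])
  also have "\<dots> = (\<Sum>F\<in>?Fs. (N * (s F * s F)) *
      (LINT x:rel_interior T|flat_measure P. J P (rt_basis T F x) \<bullet> rt_basis T F x))"
    by (rule set_integral_lincomb(2)[OF intr])
  also have "\<dots> \<le> (\<Sum>F\<in>?Fs. (N * (s F * s F)) * lump P T F)"
  proof (intro sum_mono mult_left_mono)
    fix F assume F: "F \<in> ?Fs"
    show "(LINT x:rel_interior T|flat_measure P. J P (rt_basis T F x) \<bullet> rt_basis T F x) \<le> lump P T F"
      unfolding lump_def flatPT
      using intr[OF F] basis_integrable[of F T] F Tborel nn basis_tangent[of F] unfolding flatPT
      by (intro set_integral_mono_subset rel_interior_subset) auto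
  qed (simp add: N_def)
  also have "\<dots> = N * (\<Sum>F\<in>?Fs. s F * s F * lump P T F)" by (simp add: sum_distrib_left mult.assoc)
  also have "\<dots> \<le> (real DIM('a) + 1) * (\<Sum>F\<in>?Fs. s F * s F * lump P T F)"
  proof (intro mult_right_mono sum_nonneg)
    show "N \<le> real DIM('a) + 1"
      using facets_finite_card(2)[OF simplexE[OF TE]] aff_dim_le_DIM[of T] unfolding N_def by linarith
  qed (use lump_nonneg in auto)
  finally show ?thesis by (simp add: s_def)
qed

text \<open>With \<open>x\<^sub>0\<close> on the facet, the flux is at most \<open>|v(x\<^sub>0)|\<close>. The inverse estimate bounds \<open>|v(x\<^sub>0)|\<^sup>2 |T|\<close> and shape
  regularity bounds the basis function; the scale \<open>m\<close> of the permeability cancels.\<close>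

lemma elem_lower:
  assumes v: "v \<in> broken_RT" and F: "F facet_of T"
  shows "facet_flux v T F * facet_flux v T F * lump P T F
    \<le> c_lump * (LINT x:rel_interior T|flat_measure P. J P (v x) \<bullet> v x)"
    "(LINT x:rel_interior T|flat_measure P. J P (v x) \<bullet> v x) = 0 \<Longrightarrow> facet_flux v T F = 0"
proof -
  define \<mu> where "\<mu> = measure (flat_measure T) (rel_interior T)"
  define I where "I = (LINT x:rel_interior T|flat_measure T. J P (v x) \<bullet> v x)"
  define B :: real where "B = 8 * 2 ^ DIM('a) + 2"
  obtain m where m: "m > 0" and nn: "\<And>y. y \<in> tangent P \<Longrightarrow> 0 \<le> J P y \<bullet> y"
    and up: "\<And>y. y \<in> tangent P \<Longrightarrow> J P y \<bullet> y \<le> (norm y)\<^sup>2 / m"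
    and lo: "\<And>y. y \<in> tangent P \<Longrightarrow> (norm y)\<^sup>2 \<le> max \<kappa> 1 * m * (J P y \<bullet> y)"
    by (rule J_bounds[OF P]) (rule that)
  have rT: "rel_interior T \<subseteq> T" by (rule rel_interior_subset)
  obtain x0 where x0: "x0 \<in> rel_interior F" "x0 \<in> F" using facet_pt[OF TE F] .
  have x0T: "x0 \<in> T" using facet_facts(3)[OF simplexE[OF TE] F] x0(2) by blast
  obtain p where p: "p \<in> RT0 T" "\<And>x. x \<in> rel_interior T \<Longrightarrow> v x = p x"
    by (rule broken_RT_piece[OF v TE]) (rule that)
  obtain C where C: "\<And>x. x \<in> T \<Longrightarrow> norm (p x) \<le> C" by (rule RT0_bounded[OF p(1)]) (rule that)
  have pb: "p \<in> borel_measurable borel"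
    by (rule borel_measurable_continuous_onI[OF RT0_continuous[OF p(1)]])
  have inv: "(norm (p x0))\<^sup>2 * \<mu> \<le> B * (LINT x:rel_interior T|flat_measure T. (norm (p x))\<^sup>2)"
    unfolding \<mu>_def B_def
  proof (rule inverse_estimate[OF neE[OF TE] hull_inc[OF x0T] boundedE[OF TE] borelE[OF TE] _ pb])
    show "(1/2) *\<^sub>R x0 + (1/2) *\<^sub>R x \<in> rel_interior T" if "x \<in> rel_interior T" for x
      by (rule midE[OF TE x0T that])
    show "norm (p x) \<le> C" if "x \<in> rel_interior T" for x using C that rT by blast
    show "p ((1/2) *\<^sub>R x0 + (1/2) *\<^sub>R x) = (1/2) *\<^sub>R p x0 + (1/2) *\<^sub>R p x" if "x \<in> rel_interior T" for x
    proof -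
      obtain a c b where pe: "p = (\<lambda>x. a + c *\<^sub>R (x - b))" using p(1) by (auto simp: RT0_def)
      define d where "d = a - c *\<^sub>R b"
      have pd: "p y = d + c *\<^sub>R y" for y by (simp add: pe d_def algebra_simps)
      have "(1/2) *\<^sub>R d + (1/2) *\<^sub>R d = d" by (simp flip: scaleR_add_left)
      moreover have "(1/2) *\<^sub>R (d + c *\<^sub>R x0) + (1/2) *\<^sub>R (d + c *\<^sub>R x)
          = ((1/2) *\<^sub>R d + (1/2) *\<^sub>R d) + c *\<^sub>R ((1/2) *\<^sub>R x0 + (1/2) *\<^sub>R x)"
        by (simp add: scaleR_add_right)
      ultimately show ?thesis unfolding pd by simp
    qed
  qed
  have "(LINT x:rel_interior T|flat_measure T. (norm (p x))\<^sup>2)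
    \<le> (LINT x:rel_interior T|flat_measure T. (max \<kappa> 1 * m) * (J P (v x) \<bullet> v x))"
  proof (rule set_integral_mono)
    show "set_integrable (flat_measure T) (rel_interior T) (\<lambda>x. (norm (p x))\<^sup>2)"
    proof (rule flat_integrable[OF boundedE[OF TE] borelE[OF TE], where C="C\<^sup>2"])
      show "\<bar>(norm (p x))\<^sup>2\<bar> \<le> C\<^sup>2" if "x \<in> rel_interior T" for x
        using C[of x] that rT by (simp add: power_mono subset_iff)
    qed (use pb in measurable)
    show "set_integrable (flat_measure T) (rel_interior T) (\<lambda>x. (max \<kappa> 1 * m) * (J P (v x) \<bullet> v x))"
      using Kf_integrable[OF P v v elem(2)[OF P T] borelE[OF TE]] by (intro set_integrable_mult_right)
    show "(norm (p x))\<^sup>2 \<le> (max \<kappa> 1 * m) * (J P (v x) \<bullet> v x)" if "x \<in> rel_interior T" for x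
      using lo[of "v x"] p(2)[OF that] broken_RT_tangent[OF v P, of x] elem(2)[OF P T] that by auto
  qed
  also have "\<dots> = (max \<kappa> 1 * m) * I" unfolding I_def by simp
  finally have I1: "(norm (p x0))\<^sup>2 * \<mu> \<le> B * ((max \<kappa> 1 * m) * I)"
    using inv mult_left_mono[of _ _ B] by (fastforce simp: B_def)
  have s: "facet_flux v T F * facet_flux v T F \<le> (norm (p x0))\<^sup>2"
  proof -
    have "facet_flux v T F = p x0 \<bullet> outer_normal T F"
      by (rule facet_flux_piece[OF v TE F x0(1) p])
    then have "\<bar>facet_flux v T F\<bar> \<le> norm (p x0)"
      using Cauchy_Schwarz_ineq2[of "p x0" "outer_normal T F"] facet_facts(6)[OF simplexE[OF TE] F] by simp
    then have "\<bar>facet_flux v T F\<bar>\<^sup>2 \<le> (norm (p x0))\<^sup>2" by (intro power_mono) auto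
    then show ?thesis by (simp add: power2_eq_square)
  qed
  obtain c r where cr: "c \<in> T" "r > 0" "cball c r \<inter> affine hull T \<subseteq> T" "diameter T \<le> \<sigma> * r"
    using triang(3)[OF P] T unfolding shape_regular_def by blast
  have l: "lump P T F \<le> (\<sigma>\<^sup>2 / 4) / m * (2 ^ DIM('a) * \<mu>)"
  proof -
    have "lump P T F \<le> (LINT x:T|flat_measure T. (\<sigma>\<^sup>2 / 4) / m)"
      unfolding lump_def
    proof (rule set_integral_mono)
      show "set_integrable (flat_measure T) T (\<lambda>x. J P (rt_basis T F x) \<bullet> rt_basis T F x)"
        by (rule basis_integrable[OF F subset_refl Tborel])
      show "set_integrable (flat_measure T) T (\<lambda>x. (\<sigma>\<^sup>2 / 4) / m)"
        by (rule flat_integrable[OF Tbounded Tborel, where C="\<bar>(\<sigma>\<^sup>2 / 4) / m\<bar>"]) auto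
      fix x assume x: "x \<in> T"
      have "norm (rt_basis T F x) \<le> \<sigma> / 2"
        by (rule rt_basis_norm_le[OF simplexE[OF TE] F cr(3,1,2,4) x])
      then have "(norm (rt_basis T F x))\<^sup>2 \<le> (\<sigma> / 2)\<^sup>2" by (intro power_mono) auto
      then have "(norm (rt_basis T F x))\<^sup>2 / m \<le> (\<sigma>\<^sup>2 / 4) / m"
        using m by (intro divide_right_mono) (auto simp: power_divide)
      then show "J P (rt_basis T F x) \<bullet> rt_basis T F x \<le> (\<sigma>\<^sup>2 / 4) / m"
        using up[OF basis_tangent[OF F x]] by linarith
    qed
    also have "\<dots> = (\<sigma>\<^sup>2 / 4) / m * measure (flat_measure T) T"
      by (rule set_integral_const_real[OF sets_flat_measure[OF Tborel]])
    also have "\<dots> \<le> (\<sigma>\<^sup>2 / 4) / m * (2 ^ DIM('a) * \<mu>)"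
    proof (intro mult_left_mono)
      obtain z where z: "z \<in> rel_interior T" using rintE[OF TE] by auto
      have zT: "z \<in> T" using z rT by blast
      show "measure (flat_measure T) T \<le> 2 ^ DIM('a) * \<mu>"
        unfolding \<mu>_def
      proof (rule measure_halving[OF neE[OF TE] hull_inc[OF zT] Tbounded boundedE[OF TE] Tborel borelE[OF TE]])
        fix x assume "x \<in> T"
        from midE[OF TE this z] show "(1/2) *\<^sub>R z + (1/2) *\<^sub>R x \<in> rel_interior T" by (simp add: add.commute)
      qed
    qed (use m in auto)
    finally show ?thesis .
  qed
  have \<mu>0: "0 < \<mu>" unfolding \<mu>_def
    by (rule flat_measure_openin_pos(1)[OF openin_rel_interior rintE[OF TE] boundedE[OF TE]])
  show "facet_flux v T F = 0" if "(LINT x:rel_interior T|flat_measure P. J P (v x) \<bullet> v x) = 0"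
  proof -
    have "I = 0" using that by (simp add: I_def flatPT)
    then have "(norm (p x0))\<^sup>2 * \<mu> \<le> 0" using I1 by simp
    then have "(norm (p x0))\<^sup>2 \<le> 0" using \<mu>0 by (simp add: mult_le_0_iff)
    then have "facet_flux v T F * facet_flux v T F \<le> 0" using s by linarith
    then show ?thesis using zero_le_square[of "facet_flux v T F"] by simp
  qed
  have I0: "0 \<le> I" unfolding I_def using nn broken_RT_tangent[OF v P] elem(2)[OF P T]
    by (intro set_integral_nonneg_real) auto
  have l0: "0 \<le> lump P T F" by (rule lump_nonneg[OF F])
  have "facet_flux v T F * facet_flux v T F * lump P T F \<le> (norm (p x0))\<^sup>2 * lump P T F"
    using s l0 by (rule mult_right_mono)
  also have "\<dots> \<le> (norm (p x0))\<^sup>2 * ((\<sigma>\<^sup>2 / 4) / m * (2 ^ DIM('a) * \<mu>))"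
    using l by (intro mult_left_mono) auto
  also have "\<dots> = ((\<sigma>\<^sup>2 / 4) / m * 2 ^ DIM('a)) * ((norm (p x0))\<^sup>2 * \<mu>)" by simp
  also have "\<dots> \<le> ((\<sigma>\<^sup>2 / 4) / m * 2 ^ DIM('a)) * (B * ((max \<kappa> 1 * m) * I))"
    using I1 m by (intro mult_left_mono) auto
  also have "\<dots> = (\<sigma>\<^sup>2 / 4) * (max \<kappa> 1 * 2 ^ DIM('a) * B * I)" using m by simp
  also have "\<dots> \<le> (\<sigma>\<^sup>2 / 4 + 1) * (max \<kappa> 1 * 2 ^ DIM('a) * B * I)"
    using I0 by (intro mult_right_mono mult_nonneg_nonneg) (auto simp: B_def)
  also have "\<dots> = c_lump * I" by (simp add: c_lump_def B_def)
  finally show "facet_flux v T F * facet_flux v T F * lump P T F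
    \<le> c_lump * (LINT x:rel_interior T|flat_measure P. J P (v x) \<bullet> v x)" by (simp add: I_def flatPT)
qed

end

lemma Kf_nonneg: assumes "P \<in> Sub" "v \<in> broken_RT" shows "0 \<le> Kf P v v"
proof -
  obtain m where nn: "\<And>y. y \<in> tangent P \<Longrightarrow> 0 \<le> J P y \<bullet> y" by (rule J_bounds[OF assms(1)]) (rule that)
  show ?thesis unfolding Kf_def using nn broken_RT_tangent[OF assms(2,1)] by (intro set_integral_nonneg_real) auto
qed

lemma ip_K_le: assumes "v \<in> broken_RT" shows "ip_K G k v v \<le> (real DIM('a) + 1) * ip_KD G M k v v"
  unfolding ip_K_Kf ip_KD_lump sum_distrib_left
  using elem_upper[OF _ _ assms] by (intro sum_mono) (auto simp: Kf_elems[OF _ assms] sum_distrib_left intro!: sum_mono)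

definition C_lump :: real where "C_lump = (real DIM('a) + 1) * c_lump"

lemma c_lump_ge_1: "1 \<le> c_lump" "1 \<le> C_lump"
proof -
  have "1 * 1 * 1 * 1 \<le> c_lump"
    unfolding c_lump_def by (intro mult_mono) (auto simp: algebra_simps intro!: add_increasing)
  then show "1 \<le> c_lump" by simp
  then show "1 \<le> C_lump" unfolding C_lump_def using mult_mono[of 1 "real DIM('a) + 1" 1 c_lump] by simp
qed

lemma ip_KD_le: assumes "v \<in> broken_RT" shows "ip_KD G M k v v \<le> C_lump * ip_K G k v v"
  unfolding ip_K_Kf ip_KD_lump sum_distrib_left
proof (rule sum_mono)
  fix P assume P: "P \<in> Sub"
  show "(\<Sum>T\<in>elems M P. \<Sum>F\<in>{F. F facet_of T}. facet_flux v T F * facet_flux v T F * lump P T F) \<le> C_lump * Kf P v v"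
    unfolding Kf_elems[OF P assms] sum_distrib_left
  proof (rule sum_mono)
    fix T assume T: "T \<in> elems M P"
    have TE: "T \<in> EE" by (rule all_elemsI[OF P T])
    define I where "I = (LINT x:rel_interior T|flat_measure P. J P (v x) \<bullet> v x)"
    obtain m where nn: "\<And>y. y \<in> tangent P \<Longrightarrow> 0 \<le> J P y \<bullet> y" by (rule J_bounds[OF P]) (rule that)
    have I0: "0 \<le> I" unfolding I_def using nn broken_RT_tangent[OF assms P] elem(2)[OF P T]
      by (intro set_integral_nonneg_real) auto
    have "(\<Sum>F\<in>{F. F facet_of T}. facet_flux v T F * facet_flux v T F * lump P T F)
      \<le> (\<Sum>F\<in>{F. F facet_of T}. c_lump * I)"
      using elem_lower(1)[OF P T assms] by (intro sum_mono) (auto simp: I_def)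
    also have "\<dots> = real (card {F. F facet_of T}) * (c_lump * I)" by simp
    also have "\<dots> \<le> (real DIM('a) + 1) * (c_lump * I)"
    proof (rule mult_right_mono)
      show "real (card {F. F facet_of T}) \<le> real DIM('a) + 1"
        using facets_finite_card(2)[OF simplexE[OF TE]] aff_dim_le_DIM[of T] by linarith
      show "0 \<le> c_lump * I" using I0 c_lump_ge_1 by simp
    qed
    finally show "(\<Sum>F\<in>{F. F facet_of T}. facet_flux v T F * facet_flux v T F * lump P T F)
      \<le> C_lump * (LINT x:rel_interior T|flat_measure P. J P (v x) \<bullet> v x)"
      by (simp add: C_lump_def I_def mult.assoc)
  qed
qed

end

section \<open>The divergence form\<close>

context fractured_mesh
begin

definition rt_slope :: "'a set \<Rightarrow> 'a set \<Rightarrow> real" where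
  "rt_slope T F = (SOME \<gamma>. \<gamma> > 0 \<and> (\<exists>v. \<forall>x. rt_basis T F x = \<gamma> *\<^sub>R (x - v)))"

text \<open>The integral of the divergence of the basis function of \<open>F\<close> over \<open>T\<close>.\<close>

definition div_weight :: "'a set \<Rightarrow> 'a set \<Rightarrow> real" where
  "div_weight T F = rt_slope T F * real (dim (tangent T)) * measure (flat_measure T) (rel_interior T)"

lemma rt_slope:
  assumes "T \<in> EE" "F facet_of T"
  shows "rt_slope T F > 0" "\<exists>v. \<forall>x. rt_basis T F x = rt_slope T F *\<^sub>R (x - v)"
proof -
  have "\<exists>\<gamma>. \<gamma> > 0 \<and> (\<exists>v. \<forall>x. rt_basis T F x = \<gamma> *\<^sub>R (x - v))"
    using facet_facts(9)[OF simplexE[OF assms(1)] assms(2)] by blast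
  from someI_ex[OF this] show "rt_slope T F > 0" "\<exists>v. \<forall>x. rt_basis T F x = rt_slope T F *\<^sub>R (x - v)"
    unfolding rt_slope_def by blast+
qed

lemma div_weight_pos: assumes "T \<in> EE" "F facet_of T" shows "div_weight T F > 0"
proof -
  have "1 \<le> aff_dim T" by (rule facet_facts(1)[OF simplexE[OF assms(1)] assms(2)])
  then have "dim (tangent T) > 0" using dim_tangent[OF neE[OF assms(1)]] by linarith
  moreover have "measure (flat_measure T) (rel_interior T) > 0"
    by (rule flat_measure_openin_pos(1)[OF openin_rel_interior rintE[OF assms(1)] boundedE[OF assms(1)]])
  ultimately show ?thesis using rt_slope(1)[OF assms] by (simp add: div_weight_def)
qed

definition cell_div :: "('a \<Rightarrow> 'a) \<Rightarrow> 'a set \<Rightarrow> real" where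
  "cell_div v T = (\<Sum>F\<in>{F. F facet_of T}. facet_flux v T F * rt_slope T F) * real (dim (tangent T))"

text \<open>Every basis function is a multiple \<open>rt_slope\<close> of \<open>x - v\<close>, whose divergence along the cell is the dimension.\<close>

lemma divergence_broken_RT:
  assumes P: "P \<in> Sub" "T \<in> elems M P" and v: "v \<in> broken_RT" and x: "x \<in> rel_interior T"
  shows "divergence P v x = cell_div v T"
proof -
  have TE: "T \<in> EE" by (rule all_elemsI[OF P])
  let ?Fs = "{F. F facet_of T}"
  define c where "c = (\<Sum>F\<in>?Fs. facet_flux v T F * rt_slope T F)"
  have "\<forall>F\<in>?Fs. \<exists>v. \<forall>x. rt_basis T F x = rt_slope T F *\<^sub>R (x - v)" using rt_slope(2)[OF TE] by auto
  then obtain a where a: "\<And>F x. F facet_of T \<Longrightarrow> rt_basis T F x = rt_slope T F *\<^sub>R (x - a F)"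
    by (metis mem_Collect_eq)
  define q where "q y = (\<Sum>F\<in>?Fs. facet_flux v T F *\<^sub>R (rt_slope T F *\<^sub>R (y - a F)))" for y
  have vq: "v y = q y" if "y \<in> rel_interior T" for y
    unfolding broken_RT_expand[OF v TE that] q_def using a by (intro sum.cong) auto
  obtain e where e: "e > 0" "cball x e \<inter> affine hull T \<subseteq> rel_interior T"
    using openin_rel_interior[of T] x openin_contains_cball[of "affine hull T" "rel_interior T"] by auto
  have xA: "x \<in> affine hull T" using x rel_interior_subset[of T] by (auto intro: hull_inc)
  have der: "vector_derivative (\<lambda>t. v (x + t *\<^sub>R b)) (at 0) = c *\<^sub>R b" if b: "b \<in> onb (tangent P)" for b
  proof (rule vector_derivative_at)
    have nb: "norm b = 1" by (rule onb_spec(2)[OF subspace_tangent b])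
    have bT: "b \<in> tangent T" using onb_spec(6)[OF subspace_tangent, of P] b elem(6)[OF P] by auto
    have qlin: "q (x + t *\<^sub>R b) = q x + t *\<^sub>R (c *\<^sub>R b)" for t
      by (simp add: q_def c_def scaleR_add_right scaleR_diff_right sum.distrib sum_subtractf
          scaleR_sum_left scaleR_sum_right ac_simps)
    have "((\<lambda>t. q x + t *\<^sub>R (c *\<^sub>R b)) has_vector_derivative c *\<^sub>R b) (at 0)"
      by (auto intro!: derivative_eq_intros)
    then have "((\<lambda>t. q (x + t *\<^sub>R b)) has_vector_derivative c *\<^sub>R b) (at 0)" unfolding qlin .
    then show "((\<lambda>t. v (x + t *\<^sub>R b)) has_vector_derivative c *\<^sub>R b) (at 0)"
    proof (rule has_vector_derivative_transform_within_open[where S="ball 0 e"])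
      fix t :: real assume t: "t \<in> ball 0 e"
      have "x + t *\<^sub>R b \<in> affine hull T"
        using bT by (intro affine_hull_add_tangent[OF xA] subspace_scale subspace_tangent)
      moreover have "x + t *\<^sub>R b \<in> cball x e" using t nb by (simp add: dist_norm)
      ultimately show "q (x + t *\<^sub>R b) = v (x + t *\<^sub>R b)" using e(2) vq by auto
    qed (use e in auto)
  qed
  have "divergence P v x = (\<Sum>b\<in>onb (tangent P). (c *\<^sub>R b) \<bullet> b)"
    unfolding divergence_def using der by (intro sum.cong) auto
  also have "\<dots> = (\<Sum>b\<in>onb (tangent P). c)"
  proof (intro sum.cong refl)
    fix b assume b: "b \<in> onb (tangent P)"
    have "b \<bullet> b = 1" using onb_spec(2)[OF subspace_tangent b] by (simp add: dot_square_norm)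
    then show "(c *\<^sub>R b) \<bullet> b = c" by simp
  qed
  also have "\<dots> = c * real (dim (tangent T))"
    using onb_spec(5)[OF subspace_tangent, of P] elem(6)[OF P] by simp
  finally show ?thesis by (simp add: cell_div_def c_def)
qed

lemma Q_h_P0: "q \<in> Q_h G M \<Longrightarrow> q \<in> P0 EE"
  by (simp add: Q_h_def)

lemma Q_h_zero: "q \<in> Q_h G M \<Longrightarrow> x \<notin> (\<Union>T\<in>EE. rel_interior T) \<Longrightarrow> q x = 0"
  using P0_zero_outside[OF Q_h_P0] by blast

lemma prod_integrable:
  fixes f g :: "'a \<Rightarrow> real"
  assumes "bounded A" "A \<in> sets borel" "f \<in> borel_measurable borel" "g \<in> borel_measurable borel"
    "\<And>x. \<bar>f x\<bar> \<le> C" "\<And>x. \<bar>g x\<bar> \<le> D"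
  shows "set_integrable (flat_measure S) A (\<lambda>x. f x * g x)"
proof (rule flat_integrable[OF assms(1,2), where C="C * D"])
  show "(\<lambda>x. f x * g x) \<in> borel_measurable borel" using assms(3,4) by measurable
  show "\<bar>f x * g x\<bar> \<le> C * D" for x
    unfolding abs_mult using assms(5)[of x] assms(6)[of x] by (intro mult_mono) auto
qed

lemma q_l_integrable:
  assumes "q \<in> Q_h G M" "l \<in> Lambda_h G M" "i \<in> ifaces G" "bounded A" "A \<in> sets borel"
  shows "set_integrable (flat_measure S) A (\<lambda>x. q x * l i x)"
proof -
  obtain C where C: "\<And>x. \<bar>q x\<bar> \<le> C" by (rule P0_bounded[OF Q_h_P0[OF assms(1)]]) (rule that)
  obtain D where D: "\<And>x. \<bar>l i x\<bar> \<le> D" by (rule Lambda_bounded[OF assms(2,3)]) (rule that)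
  show ?thesis
    by (rule prod_integrable[OF assms(4,5) P0_borel[OF Q_h_P0[OF assms(1)]] Lambda_borel[OF assms(2,3)] C D])
qed

definition mortar_mass :: "('a \<Rightarrow> real) \<Rightarrow> ('a iface \<Rightarrow> 'a \<Rightarrow> real) \<Rightarrow> 'a iface \<Rightarrow> real" where
  "mortar_mass q l i = (LINT x:low i|flat_measure (low i). q x * l i x)"

lemma flat_elem: assumes "P \<in> Sub" "T \<in> elems M P" shows "flat_measure P = flat_measure T"
  using flat_measure_cong[OF sub(1)[OF assms(1)] elem(4)[OF assms]] elem(5)[OF assms] by simp

lemma Q_h_elems_integral:
  assumes P: "P \<in> Sub" and q: "q \<in> Q_h G M" and g: "g \<in> borel_measurable borel" "\<And>x. \<bar>g x\<bar> \<le> D"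
  shows "(LINT x:P|flat_measure P. q x * g x)
    = (\<Sum>T\<in>elems M P. val q T * (LINT x:rel_interior T|flat_measure P. g x))"
proof -
  obtain C where C: "\<And>x. \<bar>q x\<bar> \<le> C" by (rule P0_bounded[OF Q_h_P0[OF q]]) (rule that)
  note qb = P0_borel[OF Q_h_P0[OF q]]
  have "(LINT x:P|flat_measure P. q x * g x) = (\<Sum>T\<in>elems M P. LINT x:rel_interior T|flat_measure P. q x * g x)"
  proof (rule set_integral_cells)
    show "finite (elems M P)" using triang(1)[OF P] by (simp add: triangulation_def)
    show "rel_interior T \<subseteq> P" if "T \<in> elems M P" for T by (rule elem(2)[OF P that])
    show "T = T'" if "T \<in> elems M P" "T' \<in> elems M P" "x \<in> rel_interior T" "x \<in> rel_interior T'" for T T' x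
      using triangulation_disjoint[OF triang(1)[OF P] that] .
    show "q x * g x = 0" if x: "x \<in> P" "x \<notin> (\<Union>T\<in>elems M P. rel_interior T)" for x
    proof -
      have "x \<notin> (\<Union>T\<in>EE. rel_interior T)"
      proof
        assume "x \<in> (\<Union>T\<in>EE. rel_interior T)"
        then obtain T where T: "T \<in> EE" "x \<in> rel_interior T" by auto
        obtain Q where Q: "Q \<in> Sub" "T \<in> elems M Q" using all_elemsE[OF T(1)] by blast
        have "P = Q" using disjSub[OF P Q(1) x(1)] elem(2)[OF Q] T(2) by blast
        then show False using x(2) Q T by blast
      qed
      then show ?thesis using Q_h_zero[OF q] by simp
    qed
    show "set_integrable (flat_measure P) (rel_interior T) (\<lambda>x. q x * g x)" if T: "T \<in> elems M P" for T
      by (rule prod_integrable[OF boundedE[OF all_elemsI[OF P T]] borelE[OF all_elemsI[OF P T]] qb g(1) C g(2)])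
  qed
  also have "\<dots> = (\<Sum>T\<in>elems M P. val q T * (LINT x:rel_interior T|flat_measure P. g x))"
  proof (intro sum.cong refl)
    fix T assume T: "T \<in> elems M P"
    have "(LINT x:rel_interior T|flat_measure P. q x * g x) = (LINT x:rel_interior T|flat_measure P. val q T * g x)"
      using P0_val[OF Q_h_P0[OF q] all_elemsI[OF P T]] sets_flat_measure[OF borelE[OF all_elemsI[OF P T]]]
      by (intro set_lebesgue_integral_cong) auto
    then show "(LINT x:rel_interior T|flat_measure P. q x * g x)
      = val q T * (LINT x:rel_interior T|flat_measure P. g x)" by simp
  qed
  finally show ?thesis .
qed

text \<open>On each cell the divergence is a positive combination of the outward fluxes. The jumps, summed over the
  subdomains, give one term for each interface.\<close>

lemma b_form_eq:
  assumes r: "r \<in> W_h G M" and q: "q \<in> Q_h G M"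
  shows "b_form G M r q = (\<Sum>i\<in>ifaces G. mortar_mass q (snd r) i)
    - (\<Sum>T\<in>EE. \<Sum>F\<in>{F. F facet_of T}. div_weight T F * facet_flux (flux G M r) T F * val q T)"
proof -
  let ?f = "flux G M r" and ?l = "snd r"
  have f: "?f \<in> broken_RT" by (rule flux_broken_RT[OF r])
  have l: "?l \<in> Lambda_h G M" by (rule W_hD(3)[OF r])
  define D where "D = glue (\<lambda>T _. cell_div ?f T)"
  have Db: "D \<in> borel_measurable borel" unfolding D_def by (rule glue_borel) auto
  obtain CD where CD: "\<And>x. \<bar>D x\<bar> \<le> CD"
    using glue_bounded[of "\<lambda>T _. cell_div ?f T"] by (auto simp: D_def)
  obtain C where C: "\<And>x. \<bar>q x\<bar> \<le> C" by (rule P0_bounded[OF Q_h_P0[OF q]]) (rule that)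
  note qb = P0_borel[OF Q_h_P0[OF q]]
  have loc: "(LINT x:P|flat_measure P. q x * (divergence P ?f x + jump G ?l P x))
    = (\<Sum>T\<in>elems M P. \<Sum>F\<in>{F. F facet_of T}. div_weight T F * facet_flux ?f T F * val q T)
      - (\<Sum>i\<in>{i \<in> ifaces G. low i = P}. mortar_mass q ?l i)" if P: "P \<in> Sub" for P
  proof -
    let ?I = "{i \<in> ifaces G. low i = P}"
    have Ps: "P \<in> sets (flat_measure P)" by (rule sets_flat_measure[OF sub_borel[OF P]])
    have eq: "q x * (divergence P ?f x + jump G ?l P x) = q x * D x - (\<Sum>i\<in>?I. 1 * (q x * ?l i x))"
      if x: "x \<in> P" for x
    proof (cases "x \<in> (\<Union>T\<in>EE. rel_interior T)")
      case True
      then obtain T where T: "T \<in> EE" "x \<in> rel_interior T" by auto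
      obtain Q where Q: "Q \<in> Sub" "T \<in> elems M Q" using all_elemsE[OF T(1)] by blast
      have "P = Q" using disjSub[OF P Q(1) x] elem(2)[OF Q] T(2) by blast
      then have "divergence P ?f x = cell_div ?f T" using divergence_broken_RT[OF P _ f T(2)] Q by simp
      also have "\<dots> = D x" unfolding D_def glue_in[OF T] ..
      finally show ?thesis by (simp add: jump_def right_diff_distrib sum_distrib_left)
    next
      case False
      then show ?thesis using Q_h_zero[OF q] by simp
    qed
    have i1: "set_integrable (flat_measure P) P (\<lambda>x. q x * D x)"
      by (rule prod_integrable[OF sub(3)[OF P] sub_borel[OF P] qb Db C CD])
    have i2: "set_integrable (flat_measure P) P (\<lambda>x. q x * ?l i x)" if "i \<in> ?I" for i
      using that by (intro q_l_integrable[OF q l _ sub(3)[OF P] sub_borel[OF P]]) auto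
    have "(LINT x:P|flat_measure P. q x * (divergence P ?f x + jump G ?l P x))
      = (LINT x:P|flat_measure P. q x * D x - (\<Sum>i\<in>?I. 1 * (q x * ?l i x)))"
      using Ps eq by (intro set_lebesgue_integral_cong) auto
    also have "\<dots> = (LINT x:P|flat_measure P. q x * D x) - (LINT x:P|flat_measure P. (\<Sum>i\<in>?I. 1 * (q x * ?l i x)))"
      by (rule set_integral_diff(2)[OF i1 set_integral_lincomb(1)[OF i2]])
    also have "(LINT x:P|flat_measure P. (\<Sum>i\<in>?I. 1 * (q x * ?l i x))) = (\<Sum>i\<in>?I. 1 * (LINT x:P|flat_measure P. q x * ?l i x))"
      by (rule set_integral_lincomb(2)[OF i2])
    also have "\<dots> = (\<Sum>i\<in>?I. mortar_mass q ?l i)" by (intro sum.cong) (auto simp: mortar_mass_def)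
    also have "(LINT x:P|flat_measure P. q x * D x)
      = (\<Sum>T\<in>elems M P. val q T * (LINT x:rel_interior T|flat_measure P. D x))"
      by (rule Q_h_elems_integral[OF P q Db CD])
    also have "\<dots> = (\<Sum>T\<in>elems M P. \<Sum>F\<in>{F. F facet_of T}. div_weight T F * facet_flux ?f T F * val q T)"
    proof (intro sum.cong refl)
      fix T assume T: "T \<in> elems M P"
      have TE: "T \<in> EE" by (rule all_elemsI[OF P T])
      have s: "rel_interior T \<in> sets (flat_measure P)" by (rule sets_flat_measure[OF borelE[OF TE]])
      have "(LINT x:rel_interior T|flat_measure P. D x) = (LINT x:rel_interior T|flat_measure P. cell_div ?f T)"
        using s glue_in[OF TE] unfolding D_def by (intro set_lebesgue_integral_cong) auto
      also have "\<dots> = cell_div ?f T * measure (flat_measure P) (rel_interior T)"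
        by (rule set_integral_const_real[OF s])
      also have "flat_measure P = flat_measure T" by (rule flat_elem[OF P T])
      finally show "val q T * (LINT x:rel_interior T|flat_measure P. D x)
        = (\<Sum>F\<in>{F. F facet_of T}. div_weight T F * facet_flux ?f T F * val q T)"
        unfolding flat_elem[OF P T] by (simp add: cell_div_def div_weight_def sum_distrib_left sum_distrib_right ac_simps)
    qed
    finally show ?thesis .
  qed
  have "b_form G M r q = - (\<Sum>P\<in>Sub. (\<Sum>T\<in>elems M P. \<Sum>F\<in>{F. F facet_of T}. div_weight T F * facet_flux ?f T F * val q T)
      - (\<Sum>i\<in>{i \<in> ifaces G. low i = P}. mortar_mass q ?l i))"
    unfolding b_form_def using loc by (intro arg_cong[of _ _ uminus] sum.cong) auto
  also have "\<dots> = (\<Sum>P\<in>Sub. \<Sum>i\<in>{i \<in> ifaces G. low i = P}. mortar_mass q ?l i)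
      - (\<Sum>P\<in>Sub. \<Sum>T\<in>elems M P. \<Sum>F\<in>{F. F facet_of T}. div_weight T F * facet_flux ?f T F * val q T)"
    by (simp add: sum_subtractf)
  also have "(\<Sum>P\<in>Sub. \<Sum>i\<in>{i \<in> ifaces G. low i = P}. mortar_mass q ?l i) = (\<Sum>i\<in>ifaces G. mortar_mass q ?l i)"
    using iface(1) by (intro sum.group[OF finite_ifaces finSub]) auto
  also have "(\<Sum>P\<in>Sub. \<Sum>T\<in>elems M P. \<Sum>F\<in>{F. F facet_of T}. div_weight T F * facet_flux ?f T F * val q T)
      = (\<Sum>T\<in>EE. \<Sum>F\<in>{F. F facet_of T}. div_weight T F * facet_flux ?f T F * val q T)"
    unfolding all_elems_def
  proof (rule sum.UNION_disjoint[symmetric, OF finSub])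
    show "\<forall>P\<in>Sub. finite (elems M P)" using triang(1) by (simp add: triangulation_def)
    show "\<forall>P\<in>Sub. \<forall>Q\<in>Sub. P \<noteq> Q \<longrightarrow> elems M P \<inter> elems M Q = {}" using elem_subdomain by blast
  qed
  finally show ?thesis .
qed

lemma mortar_mass_lin1:
  assumes "q \<in> Q_h G M" "l \<in> Lambda_h G M" "m \<in> Lambda_h G M" "i \<in> ifaces G"
  shows "mortar_mass q (l + m) i = mortar_mass q l i + mortar_mass q m i" "mortar_mass q (c *\<^sub>R l) i = c * mortar_mass q l i"
proof -
  note P = iface(1)[OF assms(4)]
  have "(\<lambda>x. q x * (l + m) i x) = (\<lambda>x. q x * l i x + q x * m i x)" by (simp add: fun_eq_iff distrib_left)
  then show "mortar_mass q (l + m) i = mortar_mass q l i + mortar_mass q m i"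
    using set_integral_add(2)[OF q_l_integrable[OF assms(1,2,4) sub(3)[OF P] sub_borel[OF P]]
        q_l_integrable[OF assms(1,3,4) sub(3)[OF P] sub_borel[OF P]]] by (simp add: mortar_mass_def)
  have "(\<lambda>x. q x * (c *\<^sub>R l) i x) = (\<lambda>x. c * (q x * l i x))" by (simp add: fun_eq_iff)
  then show "mortar_mass q (c *\<^sub>R l) i = c * mortar_mass q l i" by (simp add: mortar_mass_def)
qed

lemma mortar_mass_lin2:
  assumes "q \<in> Q_h G M" "p \<in> Q_h G M" "l \<in> Lambda_h G M" "i \<in> ifaces G"
  shows "mortar_mass (q + p) l i = mortar_mass q l i + mortar_mass p l i" "mortar_mass (c *\<^sub>R q) l i = c * mortar_mass q l i"
proof -
  note P = iface(1)[OF assms(4)]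
  have "(\<lambda>x. (q + p) x * l i x) = (\<lambda>x. q x * l i x + p x * l i x)" by (simp add: fun_eq_iff distrib_right)
  then show "mortar_mass (q + p) l i = mortar_mass q l i + mortar_mass p l i"
    using set_integral_add(2)[OF q_l_integrable[OF assms(1,3,4) sub(3)[OF P] sub_borel[OF P]]
        q_l_integrable[OF assms(2,3,4) sub(3)[OF P] sub_borel[OF P]]] by (simp add: mortar_mass_def)
  have "(\<lambda>x. (c *\<^sub>R q) x * l i x) = (\<lambda>x. c * (q x * l i x))" by (simp add: fun_eq_iff)
  then show "mortar_mass (c *\<^sub>R q) l i = c * mortar_mass q l i" by (simp add: mortar_mass_def)
qed

lemma b_form_lin1: assumes q: "q \<in> Q_h G M" shows "lin_on (W_h G M) (\<lambda>r. b_form G M r q)"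
  unfolding lin_on_def
proof (intro conjI ballI allI)
  fix r s assume rs: "r \<in> W_h G M" "s \<in> W_h G M"
  have fl: "facet_flux (flux G M (r + s)) T F = facet_flux (flux G M r) T F + facet_flux (flux G M s) T F"
    if "T \<in> EE" "F facet_of T" for T F
    unfolding flux_lin(1)[OF rs] by (rule facet_flux_add[OF flux_broken_RT[OF rs(1)] flux_broken_RT[OF rs(2)] that])
  have "(\<Sum>i\<in>ifaces G. mortar_mass q (snd (r + s)) i) = (\<Sum>i\<in>ifaces G. mortar_mass q (snd r) i + mortar_mass q (snd s) i)"
    using mortar_mass_lin1(1)[OF q W_hD(3)[OF rs(1)] W_hD(3)[OF rs(2)]] by (intro sum.cong) auto
  moreover have "(\<Sum>T\<in>EE. \<Sum>F\<in>{F. F facet_of T}. div_weight T F * facet_flux (flux G M (r + s)) T F * val q T)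
    = (\<Sum>T\<in>EE. \<Sum>F\<in>{F. F facet_of T}. div_weight T F * facet_flux (flux G M r) T F * val q T
        + div_weight T F * facet_flux (flux G M s) T F * val q T)"
    using fl by (intro sum.cong) (auto simp: algebra_simps)
  ultimately show "b_form G M (r + s) q = b_form G M r q + b_form G M s q"
    unfolding b_form_eq[OF rs(1) q] b_form_eq[OF rs(2) q] b_form_eq[OF subspace_add[OF subspace_W_h rs] q]
    by (simp add: sum.distrib)
next
  fix r c assume r: "r \<in> W_h G M"
  have fl: "facet_flux (flux G M (c *\<^sub>R r)) T F = c * facet_flux (flux G M r) T F"
    if "T \<in> EE" "F facet_of T" for T F
    unfolding flux_lin(2)[OF r r] by (rule facet_flux_scale[OF flux_broken_RT[OF r] that])
  have "(\<Sum>i\<in>ifaces G. mortar_mass q (snd (c *\<^sub>R r)) i) = (\<Sum>i\<in>ifaces G. c * mortar_mass q (snd r) i)"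
    using mortar_mass_lin1(2)[OF q W_hD(3)[OF r] W_hD(3)[OF r]] by (intro sum.cong) auto
  moreover have "(\<Sum>T\<in>EE. \<Sum>F\<in>{F. F facet_of T}. div_weight T F * facet_flux (flux G M (c *\<^sub>R r)) T F * val q T)
    = (\<Sum>T\<in>EE. \<Sum>F\<in>{F. F facet_of T}. c * (div_weight T F * facet_flux (flux G M r) T F * val q T))"
    using fl by (intro sum.cong) auto
  ultimately show "b_form G M (c *\<^sub>R r) q = c * b_form G M r q"
    unfolding b_form_eq[OF r q] b_form_eq[OF subspace_scale[OF subspace_W_h r] q]
    by (simp add: right_diff_distrib sum_distrib_left)
qed

lemma b_form_lin2: assumes r: "r \<in> W_h G M" shows "lin_on (Q_h G M) (b_form G M r)"
  unfolding lin_on_def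
proof (intro conjI ballI allI)
  fix p q assume pq: "p \<in> Q_h G M" "q \<in> Q_h G M"
  have "(\<Sum>i\<in>ifaces G. mortar_mass (p + q) (snd r) i) = (\<Sum>i\<in>ifaces G. mortar_mass p (snd r) i + mortar_mass q (snd r) i)"
    using mortar_mass_lin2(1)[OF pq W_hD(3)[OF r]] by (intro sum.cong) auto
  then show "b_form G M r (p + q) = b_form G M r p + b_form G M r q"
    unfolding b_form_eq[OF r pq(1)] b_form_eq[OF r pq(2)] b_form_eq[OF r subspace_add[OF subspace_Q_h pq]]
    by (simp add: sum.distrib val_lin distrib_left)
next
  fix q c assume q: "q \<in> Q_h G M"
  have "(\<Sum>i\<in>ifaces G. mortar_mass (c *\<^sub>R q) (snd r) i) = (\<Sum>i\<in>ifaces G. c * mortar_mass q (snd r) i)"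
    using mortar_mass_lin2(2)[OF q q W_hD(3)[OF r]] by (intro sum.cong) auto
  then show "b_form G M r (c *\<^sub>R q) = c * b_form G M r q"
    unfolding b_form_eq[OF r q] b_form_eq[OF r subspace_scale[OF subspace_Q_h q]]
    by (simp add: right_diff_distrib sum_distrib_left val_lin ac_simps)
qed

end

section \<open>Injectivity of the transposed divergence\<close>

context fractured_mesh
begin

lemma W_h_flux_only:
  assumes "v \<in> V0_h G M" shows "(v, 0) \<in> W_h G M" "flux G M (v, 0) = v"
proof -
  have z: "(0 :: 'a iface \<Rightarrow> 'a \<Rightarrow> real) \<in> Lambda_h G M" using subspace_0[OF subspace_Lambda] .
  show w: "(v, 0) \<in> W_h G M" using assms z by (simp add: W_h_def)
  have "trace_lift (0 *\<^sub>R 0) = 0 *\<^sub>R trace_lift 0" by (rule trace_lift_lin(2)[OF z z])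
  then have "trace_lift 0 = 0" by simp
  then show "flux G M (v, 0) = v" using flux_eq[OF w] by simp
qed

lemma b_form_flux_only:
  assumes v: "v \<in> V0_h G M" and q: "q \<in> Q_h G M"
  shows "b_form G M (v, 0) q = - (\<Sum>T\<in>EE. \<Sum>F\<in>{F. F facet_of T}. div_weight T F * facet_flux v T F * val q T)"
proof -
  have "mortar_mass q (0 :: 'a iface \<Rightarrow> 'a \<Rightarrow> real) i = 0" for i by (simp add: mortar_mass_def)
  then show ?thesis using b_form_eq[OF W_h_flux_only(1)[OF v] q] W_h_flux_only(2)[OF v] by simp
qed

lemma facet_field_pairing:
  assumes TF: "T \<in> EE" "F facet_of T"
  shows "(\<Sum>T'\<in>EE. \<Sum>F'\<in>{F. F facet_of T'}. div_weight T' F' * facet_flux (facet_field T F) T' F' * val q T') = div_weight T F * val q T"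
proof -
  have "(\<Sum>T'\<in>EE. \<Sum>F'\<in>{F. F facet_of T'}. div_weight T' F' * facet_flux (facet_field T F) T' F' * val q T')
    = (\<Sum>T'\<in>EE. if T' = T then div_weight T F * val q T else 0)"
  proof (intro sum.cong refl)
    fix T' assume T': "T' \<in> EE"
    have "(\<Sum>F'\<in>{F. F facet_of T'}. div_weight T' F' * facet_flux (facet_field T F) T' F' * val q T')
      = (\<Sum>F'\<in>{F. F facet_of T'}. if F' = F then (if T' = T then div_weight T F * val q T else 0) else 0)"
      using facet_field_flux[OF TF T'] by (intro sum.cong) auto
    also have "\<dots> = (if T' = T then div_weight T F * val q T else 0)"
      using facets_finite_card(1)[OF simplexE[OF T']] TF(2) by (cases "T' = T") auto
    finally show "(\<Sum>F'\<in>{F. F facet_of T'}. div_weight T' F' * facet_flux (facet_field T F) T' F' * val q T')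
      = (if T' = T then div_weight T F * val q T else 0)" .
  qed
  then show ?thesis using finE TF(1) by simp
qed

definition mortar_one :: "'a iface \<Rightarrow> 'a iface \<Rightarrow> 'a \<Rightarrow> real" where
  "mortar_one i j x = (if j = i then indicator (\<Union>E\<in>melems M i. rel_interior E) x else 0)"

lemma mortar_one_Lambda: assumes "i \<in> ifaces G" shows "mortar_one i \<in> Lambda_h G M"
proof -
  have "mortar_one i i \<in> P0 (melems M i)" unfolding P0_def
    by (auto simp: mortar_one_def indicator_def)
  moreover have other: "mortar_one i j = (\<lambda>x. 0)" if "j \<noteq> i" for j using that by (simp add: mortar_one_def fun_eq_iff)
  moreover have "(\<lambda>x. 0) \<in> P0 (melems M j)" if "j \<in> ifaces G" for j
    using subspace_0[OF cells.subspace_P0[OF mcells[OF that]]] by (simp add: zero_fun_def)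
  ultimately have "mortar_one i j \<in> P0 (melems M j)" if "j \<in> ifaces G" for j
    using that by (cases "j = i") auto
  moreover have "mortar_one i j = (\<lambda>x. 0)" if "j \<notin> ifaces G" for j
    using that assms by (intro other) auto
  ultimately show ?thesis unfolding Lambda_h_def by simp
qed

text \<open>The cells of the mortar mesh cover the interface, so each of its relatively open parts meets the relative
  interior of one of them, in a set of positive measure.\<close>

lemma mortar_one_pos:
  assumes i: "i \<in> ifaces G" and O: "openin (top_of_set (affine hull (low i))) U" "U \<noteq> {}" "U \<subseteq> low i"
  shows "0 < (LINT x:U|flat_measure (low i). mortar_one i i x)"
proof -
  obtain x where x: "x \<in> U" using O(2) by auto
  obtain W where W: "open W" "U = affine hull (low i) \<inter> W" using O(1) by (auto simp: openin_open)
  have "x \<in> \<Union>(melems M i)" using mtriang(2)[OF i] closure_subset[of "low i"] x O(3) by auto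
  then obtain E where E: "E \<in> melems M i" "x \<in> E" by auto
  interpret mc: cells "melems M i" by (rule mcells[OF i])
  have "E \<subseteq> closure (rel_interior E)"
    using convex_closure_rel_interior[OF mc.convexE[OF E(1)]] closure_subset[of E] by simp
  then have "x \<in> closure (rel_interior E)" using E(2) by blast
  then have ne: "W \<inter> rel_interior E \<noteq> {}"
    using W x open_Int_closure_eq_empty[of W "rel_interior E"] by blast
  have subE: "rel_interior E \<subseteq> affine hull (low i)"
    using melem(4)[OF i E(1)] rel_interior_subset[of E] hull_subset[of E affine] by auto
  have UE: "U \<inter> rel_interior E = W \<inter> rel_interior E" using W(2) subE by blast
  have op: "openin (top_of_set (affine hull (low i))) (U \<inter> rel_interior E)"
    using openin_rel_interior[of E] melem(4)[OF i E(1)] O(1) by (intro openin_Int) auto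
  have bU: "bounded U" "bounded (U \<inter> rel_interior E)"
    using bounded_subset[OF sub(3)[OF iface(1)[OF i]]] O(3) by auto
  note m = flat_measure_openin_pos[OF op _ bU(2)]
  have ne': "U \<inter> rel_interior E \<noteq> {}" using ne UE by simp
  have Ub: "U \<in> sets borel" by (rule flat_measure_openin_pos(2)[OF O(1,2) bU(1)])
  have s: "U \<inter> rel_interior E \<in> sets (flat_measure (low i))" by (rule sets_flat_measure[OF m(2)[OF ne']])
  have "0 < measure (flat_measure (low i)) (U \<inter> rel_interior E)" by (rule m(1)[OF ne'])
  also have "\<dots> = (LINT x:U \<inter> rel_interior E|flat_measure (low i). 1)"
    using set_integral_const_real[OF s, of 1] by simp
  also have "\<dots> = (LINT x:U \<inter> rel_interior E|flat_measure (low i). mortar_one i i x)"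
    using s E(1) by (intro set_lebesgue_integral_cong) (auto simp: mortar_one_def indicator_def)
  also have "\<dots> \<le> (LINT x:U|flat_measure (low i). mortar_one i i x)"
    by (intro set_integral_mono_subset Lambda_integrable[OF mortar_one_Lambda[OF i] i] bU Ub m(2)[OF ne'])
      (auto simp: mortar_one_def indicator_def)
  finally show ?thesis .
qed

context
  fixes p assumes p: "p \<in> Q_h G M" and ker: "\<And>r. r \<in> W_h G M \<Longrightarrow> b_form G M r p = 0"
begin

text \<open>Testing with the difference of the two basis fields gives
  \<open>div_weight T F * p\<^sub>T = div_weight T' F * p\<^sub>T'\<close>.\<close>

lemma same_sign_adj: assumes "P \<in> Sub" "adj P T T'" shows "sgn (val p T) = sgn (val p T')"
proof -
  obtain F where a: "T \<in> elems M P" "T' \<in> elems M P" "T \<noteq> T'" "F facet_of T" "F facet_of T'" "rel_interior F \<subseteq> P"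
    using assms(2) by (auto simp: adj_def)
  have E: "T \<in> EE" "T' \<in> EE" using a assms(1) by (auto intro: all_elemsI)
  let ?v = "facet_field T F - facet_field T' F"
  note PWs = facet_field_broken_RT[OF E(1) a(4)] facet_field_broken_RT[OF E(2) a(5)]
  have fl: "facet_flux ?v S H = facet_flux (facet_field T F) S H - facet_flux (facet_field T' F) S H"
    if "S \<in> EE" "H facet_of S" for S H
  proof -
    have d: "?v = facet_field T F + (-1) *\<^sub>R facet_field T' F" by simp
    show ?thesis unfolding d facet_flux_add[OF PWs(1) subspace_scale[OF subspace_broken_RT PWs(2)] that]
      facet_flux_scale[OF PWs(2) that] by simp
  qed
  have V: "?v \<in> V0_h G M" by (rule facet_field_pair_V0_h[OF assms(1) a])
  have "0 = (\<Sum>S\<in>EE. \<Sum>H\<in>{F. F facet_of S}. div_weight S H * facet_flux ?v S H * val p S)"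
    using ker[OF W_h_flux_only(1)[OF V]] b_form_flux_only[OF V p] by simp
  also have "\<dots> = (\<Sum>S\<in>EE. \<Sum>H\<in>{F. F facet_of S}. div_weight S H * facet_flux (facet_field T F) S H * val p S
      - div_weight S H * facet_flux (facet_field T' F) S H * val p S)"
    using fl by (intro sum.cong refl) (simp add: right_diff_distrib left_diff_distrib)
  also have "\<dots> = div_weight T F * val p T - div_weight T' F * val p T'"
    by (simp add: sum_subtractf facet_field_pairing[OF E(1) a(4)] facet_field_pairing[OF E(2) a(5)])
  finally have "sgn (div_weight T F * val p T) = sgn (div_weight T' F * val p T')" by simp
  then show ?thesis using div_weight_pos[OF E(1) a(4)] div_weight_pos[OF E(2) a(5)] by (simp add: sgn_mult)
qed

lemma same_sign_sub:
  assumes "P \<in> Sub" "T \<in> elems M P" "T' \<in> elems M P" shows "sgn (val p T) = sgn (val p T')"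
  using mesh_connected[OF assms]
  by (induction rule: rtranclp_induct) (auto dest: same_sign_adj[OF assms(1)])

text \<open>The common sign of the values of \<open>p\<close> on the cells of \<open>P\<close>, read off from one of them.\<close>

definition sub_sign :: "'a set \<Rightarrow> real" where
  "sub_sign P = sgn (val p (SOME T. T \<in> elems M P))"

lemma sub_sign: assumes "P \<in> Sub" "T \<in> elems M P" shows "val p T = sub_sign P * \<bar>val p T\<bar>"
proof -
  have "(SOME T. T \<in> elems M P) \<in> elems M P" using assms(2) by (rule someI)
  then have "sub_sign P = sgn (val p T)" unfolding sub_sign_def by (rule same_sign_sub[OF assms(1) _ assms(2)])
  then show ?thesis by (simp add: sgn_mult_abs)
qed

lemma elems_ne: assumes "P \<in> Sub" shows "elems M P \<noteq> {}"
  using triang(2)[OF assms] sub(1)[OF assms] closure_subset[of P] by auto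

lemma sub_sign_cases: "sub_sign P = 0 \<or> sub_sign P = 1 \<or> sub_sign P = -1"
  by (auto simp: sub_sign_def sgn_if)

lemma sub_sign_nz: assumes "P \<in> Sub" "T \<in> elems M P" "sub_sign P \<noteq> 0" shows "0 < \<bar>val p T\<bar>"
proof -
  have "(SOME T. T \<in> elems M P) \<in> elems M P" using assms(2) by (rule someI)
  then have "sgn (val p T) \<noteq> 0" using same_sign_sub[OF assms(1) _ assms(2)] assms(3) by (metis sub_sign_def)
  then show ?thesis by (simp add: sgn_if split: if_splits)
qed

text \<open>Testing with the mortar function 1 balances a positive combination of the values of \<open>p\<close> on \<open>low i\<close>
  against one of its values on \<open>high i\<close>. The values have constant sign on each of the two, so the signs agree.\<close>

lemma sub_sign_iface:
  assumes i: "i \<in> ifaces G" shows "sub_sign (low i) = sub_sign (high i)"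
proof -
  note P = iface(1)[OF i] and Q = iface(2)[OF i]
  note l = mortar_one_Lambda[OF i]
  have rW: "(0, mortar_one i) \<in> W_h G M" using l subspace_0[OF subspace_V0_h] by (simp add: W_h_def)
  have fl: "flux G M (0, mortar_one i) = trace_lift (mortar_one i)" using flux_eq[OF rW] by simp
  define X where "X = (\<Sum>T\<in>EE. \<Sum>F\<in>{F. F facet_of T}. div_weight T F * facet_mean (mortar_one i) T F * val p T)"
  define Y where "Y = (\<Sum>T\<in>EE. \<Sum>F\<in>{F. F facet_of T}. div_weight T F * facet_mean (mortar_one i) T F * \<bar>val p T\<bar>)"
  define Z where "Z = (\<Sum>T\<in>elems M (low i). \<bar>val p T\<bar> * (LINT x:rel_interior T|flat_measure (low i). mortar_one i i x))"
  have c_pos: "0 < facet_mean (mortar_one i) T F" if TF: "(T, F) \<in> ifacets M i" for T F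
  proof -
    have "openin (top_of_set (affine hull (low i))) (rel_interior F)"
      using facet_openin[of F] ifacet_affine_hull[OF i TF] by simp
    moreover have "rel_interior F \<noteq> {}"
      using facet_facts(4)[OF simplexE[OF ifacet(5)[OF i TF]] ifacet(2)[OF i TF]] .
    ultimately have "0 < facet_int i F (mortar_one i)" unfolding facet_int_def by (rule mortar_one_pos[OF i _ _ ifacet(3)[OF i TF]])
    then show ?thesis using facet_mean_ifacet[OF i TF] ifacet_measure(1)[OF i TF] by (simp add: facet_area_def)
  qed
  have c_zero: "facet_mean (mortar_one i) T F = 0" if TF: "(T, F) \<notin> ifacets M i" for T F
  proof (cases "\<exists>j\<in>ifaces G. (T, F) \<in> ifacets M j")
    case True
    then obtain j where j: "j \<in> ifaces G" "(T, F) \<in> ifacets M j" by auto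
    then have "j \<noteq> i" using TF by auto
    then have "facet_int j F (mortar_one i) = 0" by (simp add: facet_int_def mortar_one_def)
    then show ?thesis using facet_mean_ifacet[OF j] by simp
  next
    case False
    then show ?thesis by (intro facet_mean_other) auto
  qed
  have c_nn: "0 \<le> facet_mean (mortar_one i) T F" for T F
    using c_pos[of T F] c_zero[of T F] by (cases "(T, F) \<in> ifacets M i") (auto simp: less_imp_le)
  have fin: "finite {F. F facet_of T}" if "T \<in> EE" for T by (rule facets_finite_card(1)[OF simplexE[OF that]])
  have t_nn: "0 \<le> div_weight T F * facet_mean (mortar_one i) T F * \<bar>val p T\<bar>" if "T \<in> EE" "F facet_of T" for T F
    using div_weight_pos[OF that] c_nn[of T F] by simp
  \<comment> \<open>only facets on \<open>i\<close> have a nonzero mean, and their cells belong to \<open>high i\<close>\<close>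
  have XY: "X = sub_sign (high i) * Y"
    unfolding X_def Y_def sum_distrib_left
  proof (intro sum.cong refl)
    fix T F assume "T \<in> EE" "F \<in> {F. F facet_of T}"
    show "div_weight T F * facet_mean (mortar_one i) T F * val p T = sub_sign (high i) * (div_weight T F * facet_mean (mortar_one i) T F * \<bar>val p T\<bar>)"
    proof (cases "(T, F) \<in> ifacets M i")
      case True
      then show ?thesis using sub_sign[OF Q ifacet(1)[OF i True]] by (metis mult.left_commute mult.commute)
    next
      case False
      then show ?thesis using c_zero by simp
    qed
  qed
  have Y0: "0 < Y" if "sub_sign (high i) \<noteq> 0"
  proof -
    obtain T F where TF: "(T, F) \<in> ifacets M i" using iface_has_facet[OF i] by auto
    note f = ifacet[OF i TF]
    have "0 < div_weight T F * facet_mean (mortar_one i) T F * \<bar>val p T\<bar>"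
      using div_weight_pos[OF f(5,2)] c_pos[OF TF] sub_sign_nz[OF Q f(1) that] by simp
    then have "0 < (\<Sum>F\<in>{F. F facet_of T}. div_weight T F * facet_mean (mortar_one i) T F * \<bar>val p T\<bar>)"
      using f(2) t_nn[OF f(5)] by (intro sum_pos2[OF fin[OF f(5)], of F]) auto
    then show ?thesis unfolding Y_def using f(5) t_nn
      by (intro sum_pos2[OF finE, of T] sum_nonneg) auto
  qed
  obtain D where D: "\<And>x. \<bar>mortar_one i i x\<bar> \<le> D" by (rule Lambda_bounded[OF l i]) (rule that)
  have mZ: "mortar_mass p (mortar_one i) i = sub_sign (low i) * Z"
    unfolding mortar_mass_def Q_h_elems_integral[OF P p Lambda_borel[OF l i] D] Z_def sum_distrib_left
  proof (intro sum.cong refl)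
    fix T assume T: "T \<in> elems M (low i)"
    show "val p T * (LINT x:rel_interior T|flat_measure (low i). mortar_one i i x)
      = sub_sign (low i) * (\<bar>val p T\<bar> * (LINT x:rel_interior T|flat_measure (low i). mortar_one i i x))"
      using sub_sign[OF P T] by (metis mult.assoc)
  qed
  have Z0: "0 < Z" if "sub_sign (low i) \<noteq> 0"
  proof -
    have "0 < \<bar>val p T\<bar> * (LINT x:rel_interior T|flat_measure (low i). mortar_one i i x)" if T: "T \<in> elems M (low i)" for T
    proof -
      have "openin (top_of_set (affine hull (low i))) (rel_interior T)"
        using openin_rel_interior[of T] elem(5)[OF P T] by simp
      then have "0 < (LINT x:rel_interior T|flat_measure (low i). mortar_one i i x)"
        by (rule mortar_one_pos[OF i _ rintE[OF all_elemsI[OF P T]] elem(2)[OF P T]])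
      then show ?thesis using sub_sign_nz[OF P T \<open>sub_sign (low i) \<noteq> 0\<close>] by simp
    qed
    then show ?thesis unfolding Z_def
      using elems_ne[OF P] triang(1)[OF P] by (intro sum_pos) (auto simp: triangulation_def)
  qed
  have "mortar_mass p (mortar_one i) j = 0" if "j \<noteq> i" for j using that by (simp add: mortar_mass_def mortar_one_def)
  then have "(\<Sum>j\<in>ifaces G. mortar_mass p (mortar_one i) j) = (\<Sum>j\<in>ifaces G. if j = i then mortar_mass p (mortar_one i) i else 0)"
    by (intro sum.cong) auto
  also have "\<dots> = mortar_mass p (mortar_one i) i" using finite_ifaces i by simp
  finally have "b_form G M (0, mortar_one i) p = mortar_mass p (mortar_one i) i - X"
    unfolding b_form_eq[OF rW p] fl X_def using trace_lift_flux by simp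
  then have "sub_sign (low i) * Z = sub_sign (high i) * Y" using ker[OF rW] mZ XY by simp
  then show ?thesis using sub_sign_cases[of "low i"] sub_sign_cases[of "high i"] Y0 Z0 by auto
qed

lemma sub_sign_const: assumes "P \<in> Sub" "Q \<in> Sub" shows "sub_sign P = sub_sign Q"
  using linkedSub[OF assms]
  by (induction rule: rtranclp_induct) (auto simp: linked_def dest: sub_sign_iface)

lemma kernel_trivial: "p = 0"
proof (rule P0_eq_0[OF Q_h_P0[OF p]])
  obtain P T F where D: "P \<in> Sub" "T \<in> elems M P" "F facet_of T" "rel_interior F \<subseteq> bdryD G"
    by (rule Dirichlet_facet) (rule that)
  have TE: "T \<in> EE" by (rule all_elemsI[OF D(1,2)])
  have V: "facet_field T F \<in> V0_h G M" by (rule facet_field_Dirichlet_V0_h[OF TE D(3,4)])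
  have "div_weight T F * val p T = 0"
    using ker[OF W_h_flux_only(1)[OF V]] b_form_flux_only[OF V p] facet_field_pairing[OF TE D(3)] by simp
  then have "val p T = 0" using div_weight_pos[OF TE D(3)] by simp
  then have z: "sub_sign P = 0" using sub_sign_nz[OF D(1,2)] by auto
  fix S assume "S \<in> EE"
  then obtain Q where Q: "Q \<in> Sub" "S \<in> elems M Q" using all_elemsE by blast
  show "val p S = 0" using sub_sign[OF Q] sub_sign_const[OF D(1) Q(1)] z by simp
qed

end

end

section \<open>The forms on the discrete space\<close>

context fractured_problem
begin

definition resistance :: "'a iface \<Rightarrow> real" where "resistance i = gap k i * inverse (nperm k i)"

definition mortar_form :: "('a iface \<Rightarrow> 'a \<Rightarrow> real) \<Rightarrow> ('a iface \<Rightarrow> 'a \<Rightarrow> real) \<Rightarrow> real" where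
  "mortar_form l m = ip_Gamma G (\<lambda>i x. resistance i * l i x) m"

lemma resistance_pos: "i \<in> ifaces G \<Longrightarrow> resistance i > 0"
  using params by (simp add: admissible_params_def resistance_def)

lemma lm_integrable:
  assumes "l \<in> Lambda_h G M" "m \<in> Lambda_h G M" "i \<in> ifaces G"
  shows "set_integrable (flat_measure S) (low i) (\<lambda>x. l i x * m i x)"
proof -
  obtain C where C: "\<And>x. \<bar>l i x\<bar> \<le> C" by (rule Lambda_bounded[OF assms(1,3)]) (rule that)
  obtain D where D: "\<And>x. \<bar>m i x\<bar> \<le> D" by (rule Lambda_bounded[OF assms(2,3)]) (rule that)
  show ?thesis
    by (rule prod_integrable[OF sub(3)[OF iface(1)[OF assms(3)]] sub_borel[OF iface(1)[OF assms(3)]]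
          Lambda_borel[OF assms(1,3)] Lambda_borel[OF assms(2,3)] C D])
qed

lemma mortar_form_eq: "mortar_form l m = (\<Sum>i\<in>ifaces G. resistance i * (LINT x:low i|flat_measure (low i). l i x * m i x))"
  by (simp add: mortar_form_def ip_Gamma_def mult.assoc)

lemma mortar_form_sym: "mortar_form l m = mortar_form m l"
  unfolding mortar_form_eq by (simp add: mult.commute)

lemma mortar_form_lin:
  assumes "l \<in> Lambda_h G M" "m \<in> Lambda_h G M" "n \<in> Lambda_h G M"
  shows "mortar_form l (m + n) = mortar_form l m + mortar_form l n" "mortar_form l (c *\<^sub>R m) = c * mortar_form l m"
proof -
  have "(LINT x:low i|flat_measure (low i). l i x * (m + n) i x)
    = (LINT x:low i|flat_measure (low i). l i x * m i x) + (LINT x:low i|flat_measure (low i). l i x * n i x)"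
    if i: "i \<in> ifaces G" for i
    using set_integral_add(2)[OF lm_integrable[OF assms(1,2) i] lm_integrable[OF assms(1,3) i]]
    by (simp add: distrib_left)
  then show "mortar_form l (m + n) = mortar_form l m + mortar_form l n"
    unfolding mortar_form_eq by (simp add: distrib_left sum.distrib)
  show "mortar_form l (c *\<^sub>R m) = c * mortar_form l m"
    unfolding mortar_form_eq by (simp add: sum_distrib_left mult.left_commute)
qed

lemma mortar_form_nonneg: "0 \<le> mortar_form l l"
  unfolding mortar_form_eq
  by (intro sum_nonneg mult_nonneg_nonneg[OF less_imp_le[OF resistance_pos]] set_integral_nonneg_real zero_le_square)

text \<open>Each cell of a mortar mesh has positive measure, so the constant value on it must vanish.\<close>

lemma mortar_form_zero:
  assumes l: "l \<in> Lambda_h G M" and z: "mortar_form l l = 0" shows "l = 0"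
proof -
  have "l i = 0" if i: "i \<in> ifaces G" for i
  proof (rule cells.P0_eq_0[OF mcells[OF i] Lambda_P0[OF l i]])
    interpret mc: cells "melems M i" by (rule mcells[OF i])
    fix E assume E: "E \<in> melems M i"
    define I where "I = (LINT x:low i|flat_measure (low i). l i x * l i x)"
    have nn: "0 \<le> resistance j * (LINT x:low j|flat_measure (low j). l j x * l j x)" if "j \<in> ifaces G" for j
      by (intro mult_nonneg_nonneg[OF less_imp_le[OF resistance_pos[OF that]]] set_integral_nonneg_real zero_le_square)
    have "resistance i * I = 0"
      unfolding I_def by (rule sum_nonneg_0[OF finite_ifaces nn z[unfolded mortar_form_eq] i])
    then have I0: "I = 0" using resistance_pos[OF i] by simp
    have s: "rel_interior E \<in> sets (flat_measure (low i))" by (rule sets_flat_measure[OF mc.borelE[OF E]])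
    have "mc.val (l i) E * mc.val (l i) E * measure (flat_measure (low i)) (rel_interior E)
      = (LINT x:rel_interior E|flat_measure (low i). l i x * l i x)"
      unfolding set_integral_const_real[OF s, symmetric]
      using s mc.P0_val[OF Lambda_P0[OF l i] E] by (intro set_lebesgue_integral_cong) auto
    also have "\<dots> \<le> I" unfolding I_def
      using lm_integrable[OF l l i] melem(2)[OF i E] s
      by (intro set_integral_mono_subset) (auto intro: set_integrable_subset)
    finally have le: "mc.val (l i) E * mc.val (l i) E * measure (flat_measure (low i)) (rel_interior E) \<le> 0"
      using I0 by simp
    have "0 < measure (flat_measure (low i)) (rel_interior E)"
      using openin_rel_interior[of E] melem(4)[OF i E] mc.rintE[OF E] mc.boundedE[OF E]
      by (intro flat_measure_openin_pos(1)) auto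
    then have "mc.val (l i) E * mc.val (l i) E \<le> 0" using le by (simp add: mult_le_0_iff)
    then show "mc.val (l i) E = 0" using zero_le_square[of "mc.val (l i) E"] by simp
  qed
  moreover have "l i = 0" if "i \<notin> ifaces G" for i using l that by (simp add: Lambda_h_def zero_fun_def)
  ultimately have "l i = 0" for i by blast
  then show ?thesis by (simp add: fun_eq_iff)
qed

lemma a_form_eq: "a_form G M k w r = ip_K G k (flux G M w) (flux G M r) + mortar_form (snd w) (snd r)"
  and aD_form_eq: "aD_form G M k w r = ip_KD G M k (flux G M w) (flux G M r) + mortar_form (snd w) (snd r)"
  by (simp_all add: a_form_def aD_form_def mortar_form_def resistance_def)

lemma ip_K_nonneg: "v \<in> broken_RT \<Longrightarrow> 0 \<le> ip_K G k v v"
  unfolding ip_K_Kf by (intro sum_nonneg Kf_nonneg)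

lemma ip_K_zero:
  assumes v: "v \<in> broken_RT" and z: "ip_K G k v v = 0" shows "v = 0"
proof (rule broken_RT_eq_0[OF v])
  fix T F assume TF: "T \<in> EE" "F facet_of T"
  obtain P where P: "P \<in> Sub" "T \<in> elems M P" using all_elemsE[OF TF(1)] by blast
  obtain m where nn: "\<And>y. y \<in> tangent P \<Longrightarrow> 0 \<le> J P y \<bullet> y" by (rule J_bounds[OF P(1)]) (rule that)
  have "Kf P v v = 0"
    by (rule sum_nonneg_0[OF finSub Kf_nonneg[OF _ v] z[unfolded ip_K_Kf] P(1)])
  moreover have nn2: "0 \<le> (LINT x:rel_interior S|flat_measure P. J P (v x) \<bullet> v x)" if "S \<in> elems M P" for S
    using nn broken_RT_tangent[OF v P(1)] elem(2)[OF P(1) that] by (intro set_integral_nonneg_real) auto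
  moreover have fin: "finite (elems M P)" using triang(1)[OF P(1)] by (simp add: triangulation_def)
  ultimately have "(LINT x:rel_interior T|flat_measure P. J P (v x) \<bullet> v x) = 0"
    unfolding Kf_elems[OF P(1) v] by (intro sum_nonneg_0[OF fin nn2 _ P(2)])
  then show "facet_flux v T F = 0" by (rule elem_lower(2)[OF P v TF(2)])
qed

text \<open>If the mortar component vanishes, so does its extension, and the flux is the first component.\<close>

lemma a_form_zero:
  assumes w: "w \<in> W_h G M" and z: "a_form G M k w w \<le> 0" shows "w = 0"
proof -
  have "ip_K G k (flux G M w) (flux G M w) = 0" "mortar_form (snd w) (snd w) = 0"
    using z ip_K_nonneg[OF flux_broken_RT[OF w]] mortar_form_nonneg[of "snd w"] unfolding a_form_eq by linarith+
  then have f: "flux G M w = 0" and s: "snd w = 0"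
    using ip_K_zero[OF flux_broken_RT[OF w]] mortar_form_zero[OF W_hD(3)[OF w]] by auto
  have "fst w \<in> V0_h G M" by (rule W_hD(1)[OF w])
  moreover have "w = (fst w, 0)" using s by (metis prod.collapse)
  ultimately have "fst w = 0" using W_h_flux_only(2)[of "fst w"] f by simp
  with s show ?thesis by (simp add: prod_eq_iff)
qed

lemma ip_K_lin:
  assumes "u \<in> broken_RT" "v \<in> broken_RT" "w \<in> broken_RT"
  shows "ip_K G k u (v + w) = ip_K G k u v + ip_K G k u w" "ip_K G k u (c *\<^sub>R v) = c * ip_K G k u v"
  unfolding ip_K_Kf using Kf_lin[OF _ assms]
  by (simp_all add: sum_distrib_left flip: sum.distrib cong: sum.cong)

lemma ip_KD_lin:
  assumes "u \<in> broken_RT" "v \<in> broken_RT" "w \<in> broken_RT"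
  shows "ip_KD G M k u (v + w) = ip_KD G M k u v + ip_KD G M k u w"
    "ip_KD G M k u (c *\<^sub>R v) = c * ip_KD G M k u v"
proof -
  have "ip_KD G M k u (v + w) = (\<Sum>P\<in>Sub. \<Sum>T\<in>elems M P. \<Sum>F\<in>{F. F facet_of T}.
      facet_flux u T F * facet_flux v T F * lump P T F + facet_flux u T F * facet_flux w T F * lump P T F)"
    unfolding ip_KD_lump
  proof (intro sum.cong refl)
    fix P T F assume h: "P \<in> Sub" "T \<in> elems M P" "F \<in> {F. F facet_of T}"
    show "facet_flux u T F * facet_flux (v + w) T F * lump P T F
      = facet_flux u T F * facet_flux v T F * lump P T F + facet_flux u T F * facet_flux w T F * lump P T F"
      using facet_flux_add[OF assms(2,3) all_elemsI[OF h(1,2)], of F] h(3) by (simp add: algebra_simps)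
  qed
  then show "ip_KD G M k u (v + w) = ip_KD G M k u v + ip_KD G M k u w"
    unfolding ip_KD_lump by (simp add: sum.distrib)
  have "ip_KD G M k u (c *\<^sub>R v) = (\<Sum>P\<in>Sub. \<Sum>T\<in>elems M P. \<Sum>F\<in>{F. F facet_of T}.
      c * (facet_flux u T F * facet_flux v T F * lump P T F))"
    unfolding ip_KD_lump
  proof (intro sum.cong refl)
    fix P T F assume h: "P \<in> Sub" "T \<in> elems M P" "F \<in> {F. F facet_of T}"
    show "facet_flux u T F * facet_flux (c *\<^sub>R v) T F * lump P T F
      = c * (facet_flux u T F * facet_flux v T F * lump P T F)"
      using facet_flux_scale[OF assms(2) all_elemsI[OF h(1,2)], of F] h(3) by simp
  qed
  then show "ip_KD G M k u (c *\<^sub>R v) = c * ip_KD G M k u v"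
    unfolding ip_KD_lump by (simp add: sum_distrib_left)
qed

lemma W_h_lin:
  assumes f1: "\<And>u v w. u \<in> broken_RT \<Longrightarrow> v \<in> broken_RT \<Longrightarrow> w \<in> broken_RT \<Longrightarrow> f u (v + w) = f u v + f u w"
    and f2: "\<And>u v c. u \<in> broken_RT \<Longrightarrow> v \<in> broken_RT \<Longrightarrow> f u (c *\<^sub>R v) = c * f u v"
    and w: "w \<in> W_h G M"
  shows "lin_on (W_h G M) (\<lambda>r. f (flux G M w) (flux G M r) + mortar_form (snd w) (snd r))"
  unfolding lin_on_def
proof (intro conjI ballI allI)
  fix r s assume rs: "r \<in> W_h G M" "s \<in> W_h G M"
  show "f (flux G M w) (flux G M (r + s)) + mortar_form (snd w) (snd (r + s))
    = f (flux G M w) (flux G M r) + mortar_form (snd w) (snd r) + (f (flux G M w) (flux G M s) + mortar_form (snd w) (snd s))"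
    unfolding flux_lin(1)[OF rs] snd_add f1[OF flux_broken_RT[OF w] flux_broken_RT[OF rs(1)] flux_broken_RT[OF rs(2)]]
      mortar_form_lin(1)[OF W_hD(3)[OF w] W_hD(3)[OF rs(1)] W_hD(3)[OF rs(2)]] by simp
next
  fix r c assume r: "r \<in> W_h G M"
  show "f (flux G M w) (flux G M (c *\<^sub>R r)) + mortar_form (snd w) (snd (c *\<^sub>R r))
    = c * (f (flux G M w) (flux G M r) + mortar_form (snd w) (snd r))"
    unfolding flux_lin(2)[OF r r] snd_scaleR f2[OF flux_broken_RT[OF w] flux_broken_RT[OF r]]
      mortar_form_lin(2)[OF W_hD(3)[OF w] W_hD(3)[OF r] W_hD(3)[OF r]] by (simp add: distrib_left)
qed

lemma spd_a_form: "spd_on (W_h G M) (a_form G M k)"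
  unfolding spd_on_def
proof (intro conjI ballI impI)
  fix w assume w: "w \<in> W_h G M"
  show "lin_on (W_h G M) (a_form G M k w)"
    unfolding a_form_eq[abs_def] by (rule W_h_lin[OF ip_K_lin(1) ip_K_lin(2) w])
  show "a_form G M k w r = a_form G M k r w" if r: "r \<in> W_h G M" for r
  proof -
    have "ip_K G k (flux G M w) (flux G M r) = ip_K G k (flux G M r) (flux G M w)"
      unfolding ip_K_Kf using Kf_sym[OF _ flux_broken_RT[OF w] flux_broken_RT[OF r]] by (intro sum.cong) auto
    then show ?thesis unfolding a_form_eq using mortar_form_sym[of "snd w" "snd r"] by simp
  qed
  show "0 < a_form G M k w w" if "w \<noteq> 0" using a_form_zero[OF w] that by force
qed

lemma a_form_le: assumes w: "w \<in> W_h G M" shows "a_form G M k w w \<le> (real DIM('a) + 1) * aD_form G M k w w"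
proof -
  have "1 * mortar_form (snd w) (snd w) \<le> (real DIM('a) + 1) * mortar_form (snd w) (snd w)"
    using mortar_form_nonneg by (intro mult_right_mono) auto
  then show ?thesis using ip_K_le[OF flux_broken_RT[OF w]] unfolding a_form_eq aD_form_eq distrib_left by simp
qed

lemma aD_form_le: assumes w: "w \<in> W_h G M" shows "aD_form G M k w w \<le> C_lump * a_form G M k w w"
proof -
  have "1 * mortar_form (snd w) (snd w) \<le> C_lump * mortar_form (snd w) (snd w)"
    using mortar_form_nonneg c_lump_ge_1 by (intro mult_right_mono) auto
  then show ?thesis using ip_KD_le[OF flux_broken_RT[OF w]] unfolding a_form_eq aD_form_eq distrib_left by simp
qed

lemma spd_aD_form: "spd_on (W_h G M) (aD_form G M k)"
  unfolding spd_on_def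
proof (intro conjI ballI impI)
  fix w assume w: "w \<in> W_h G M"
  show "lin_on (W_h G M) (aD_form G M k w)"
    unfolding aD_form_eq[abs_def] by (rule W_h_lin[OF ip_KD_lin(1) ip_KD_lin(2) w])
  show "aD_form G M k w r = aD_form G M k r w" for r
    unfolding aD_form_eq ip_KD_lump using mortar_form_sym[of "snd w" "snd r"] by (simp add: mult.commute)
  show "0 < aD_form G M k w w" if "w \<noteq> 0"
  proof -
    have "0 < a_form G M k w w" using a_form_zero[OF w] that by force
    then have "0 < (real DIM('a) + 1) * aD_form G M k w w" using a_form_le[OF w] by linarith
    then show ?thesis by (simp add: zero_less_mult_iff)
  qed
qed

sublocale saddle: saddle_point "W_h G M" "Q_h G M" "a_form G M k" "aD_form G M k" "b_form G M"
  "1 / C_lump" "real DIM('a) + 1"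
proof
  show "1 / C_lump > 0" using c_lump_ge_1 by simp
  show "1 / C_lump * aD_form G M k w w \<le> a_form G M k w w" if "w \<in> W_h G M" for w
    using aD_form_le[OF that] c_lump_ge_1 by (simp add: field_simps)
  show "q = 0" if "q \<in> Q_h G M" "\<And>r. r \<in> W_h G M \<Longrightarrow> b_form G M r q = 0" for q
    by (rule kernel_trivial[OF that])
qed (use subspace_W_h subspace_Q_h separated_W_h separated_Q_h spd_a_form spd_aD_form b_form_lin1 b_form_lin2
    a_form_le in auto)

lemma blocks:
  "A_block G M k = saddle.blockA" "U_block G M k = saddle.blockU" "D_block G M k = saddle.blockD"
  "pairing x' x = saddle.dual_pair x' x"
proof -
  have A: "A_op G M k = saddle.opA" and DA: "DA_op G M k = saddle.opD" and B: "B_op G M = saddle.opB"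
    and BT: "BT_op G M = saddle.opBT"
    by (simp_all add: fun_eq_iff A_op_def saddle.opA_def DA_op_def saddle.opD_def B_op_def saddle.opB_def
        BT_op_def saddle.opBT_def)
  have S: "S_op G M k = saddle.opS" by (simp add: fun_eq_iff S_op_def saddle.opS_def A DA B BT)
  show "A_block G M k = saddle.blockA" by (simp add: fun_eq_iff A_block_def saddle.blockA_def A B BT)
  show "U_block G M k = saddle.blockU" by (simp add: fun_eq_iff U_block_def saddle.blockU_def A BT S)
  show "D_block G M k = saddle.blockD" by (simp add: fun_eq_iff D_block_def saddle.blockD_def A S)
  show "pairing x' x = saddle.dual_pair x' x" by (simp add: pairing_def saddle.dual_pair_def)
qed

end

theorem theorem4p8:
  fixes G :: "'a::euclidean_space medium" and \<sigma> \<kappa> :: real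
  assumes "DIM('a) \<in> {2, 3}" and "fractured_medium G"
  shows "\<exists>\<xi>1>0. \<exists>\<xi>2>0. \<forall>M k. admissible_mesh G \<sigma> M \<longrightarrow> admissible_params G \<kappa> k \<longrightarrow>
    (\<forall>x\<in>X_h G M. x \<noteq> zero_X \<longrightarrow> (\<forall>x'. x' = U_block G M k x \<longrightarrow>
       \<xi>1 \<le> dual_ip (B_D G M k) (A_block G M k (B_U G M k x')) x' / dual_ip (B_D G M k) x' x' \<and>
       dual_norm (B_D G M k) (A_block G M k (B_U G M k x')) / dual_norm (B_D G M k) x' \<le> \<xi>2))"
proof -
  define c where "c = 1 / ((real DIM('a) + 1) *
    (max \<kappa> 1 * (\<sigma>\<^sup>2 / 4 + 1) * 2 ^ DIM('a) * (8 * 2 ^ DIM('a) + 2)))"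
  have "0 < (real DIM('a) + 1) * (max \<kappa> 1 * (\<sigma>\<^sup>2 / 4 + 1) * 2 ^ DIM('a) * (8 * 2 ^ DIM('a) + 2))"
    by (intro mult_pos_pos add_nonneg_pos) auto
  then have cpos: "0 < c" by (simp add: c_def)
  define \<xi>1 where "\<xi>1 = min 1 (1 / (real DIM('a) + 1)) / 2"
  define \<xi>2 where "\<xi>2 = sqrt (1 + 2 / c + 2 / c\<^sup>2)"
  have \<xi>: "0 < \<xi>1" "0 < \<xi>2" using cpos by (auto simp: \<xi>1_def \<xi>2_def intro!: add_pos_pos)
  have main: "\<xi>1 \<le> dual_ip (B_D G M k) (A_block G M k (B_U G M k x')) x' / dual_ip (B_D G M k) x' x' \<and>
      dual_norm (B_D G M k) (A_block G M k (B_U G M k x')) / dual_norm (B_D G M k) x' \<le> \<xi>2"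
    if M: "admissible_mesh G \<sigma> M" and k: "admissible_params G \<kappa> k"
      and x: "x \<in> X_h G M" "x \<noteq> zero_X" and x': "x' = U_block G M k x" for M k x x'
  proof -
    interpret fractured_problem G M \<sigma> k \<kappa>
      by unfold_locales (use assms(2) M k in auto)
    have c: "1 / C_lump = c" by (simp add: C_lump_def c_lump_def c_def)
    have X: "X_h G M = W_h G M \<times> Q_h G M" by (simp add: X_h_def)
    have "(zero_X :: 'a wvec \<times> 'a qvec) = (0, 0)" by (simp add: zero_X_def zero_prod_def zero_fun_def)
    then have nz: "x \<noteq> (0, 0)" using x(2) by simp
    note b = saddle.field_of_values_bounds[OF x(1)[unfolded X] nz
        B_U_def[of G M k, unfolded X blocks] B_D_def[of G M k, unfolded X blocks] x'[unfolded blocks] refl]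
    show ?thesis
      using b unfolding c dual_norm_def dual_ip_def blocks \<xi>1_def \<xi>2_def by simp
  qed
  show ?thesis
    by (rule exI[of _ \<xi>1], rule conjI[OF \<xi>(1)], rule exI[of _ \<xi>2], rule conjI[OF \<xi>(2)],
        intro allI impI ballI, rule main)
qed

end
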